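(* Let $f\in\mathcal P$ satisfy $\alpha\tilde\beta>\kappa_f b$. Then for every $\gamma\in(0,\beta)$ and every $\mu\in\mathcal M_c(\mathbb R^d)$, \[ e^{-(\alpha-\kappa_f b)t}X_t(f)\xrightarrow[t\to\infty]{}\sum_{p\in\mathbb Z_+^d:\,|p|=\kappa_f}\langle f,\phi_p\rangle_{\varphi}\,H^p_\infty\quad\text{in }L^{1+\gamma}(\mathbb P_\mu). \] Moreover, if $f$ is twice differentiable and all its second order partial derivatives belong to $\mathcal P$, the convergence also holds $\mathbb P_\mu$-almost surely.
   Context: Fix $d\in\mathbb N$ and constants $\sigma>0$, $b>0$. Let $\xi=((\xi_t)_{t\ge0};(\Pi_x)_{x\in\mathbb R^d})$ be the Ornstein–Uhlenbeck process on $\mathbb R^d$ with generator $Lf=\frac12\sigma^2\Delta f-bx\cdot\nabla f$, and let $(P_t)_{t\ge0}$ be its transition semigroup, $P_tf(x)=\Pi_x[f(\xi_t)]$; set $P^\alpha_t:=e^{\alpha t}P_t$. Let $\psi(z)=-\alpha z+\rho z^2+\int_{(0,\infty)}(e^{-zy}-1+zy)\,\pi(dy)$, $z\ge0$, where $\alpha>0$, $\rho\ge0$ and $\pi$ is a measure on $(0,\infty)$ with $\int_{(0,\infty)}(y\wedge y^2)\pi(dy)<\infty$. Let $\mathcal M(\mathbb R^d)$ be the space of finite Borel measures on $\mathbb R^d$ (weak topology), $\mu(f)=\int f\,d\mu$, and $\mathcal M_c(\mathbb R^d)$ the finite Borel measures with compact support. The super-OU process $X=((X_t)_{t\ge0};(\mathbb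 P_\mu)_{\mu\in\mathcal M(\mathbb R^d)})$ is the $\mathcal M(\mathbb R^d)$-valued Hunt process with $\mathbb P_\mu[e^{-X_t(f)}]=e^{-\mu(V_tf)}$ for all bounded nonnegative Borel $f$, where $(t,x)\mapsto V_tf(x)$ is the unique locally bounded nonnegative solution of $V_tf(x)+\Pi_x[\int_0^t\psi(V_{t-s}f(\xi_s))ds]=\Pi_x[f(\xi_t)]$. Standing assumptions: (Grey's condition) there is $z'>0$ with $\psi(z)>0$ for all $z>z'$ and $\int_{z'}^\infty\psi(z)^{-1}dz<\infty$; and there exist $\eta>0$, $\beta\in(0,1)$, $\delta>0$ with $\int_{(1,\infty)}y^{1+\beta+\delta}\,\big|\pi(dy)-\frac{\eta\,dy}{\Gamma(-1-\beta)y^{2+\beta}}\big|<\infty$ (here $\Gamma$ is the analytically continued Gamma function and $|\cdot|$ is total variation); $\eta,\beta$ denote these constants. Write $\tilde\beta=\beta/(1+\beta)$. Let $\varphi(x)=(b/(\pi\sigma^2))^{d/2}\exp(-b|x|^2/\sigma^2)$ (here $\pi=3.14\ldots$), $L^2(\varphi)$ the Hilbert space with $\langle f,g\rangle_\varphi=\int fg\varphi\,dx$. For $p\in\mathbb Z_+^d$ let $|p|=\sum p_k$, $p!=\prod p_k!$, $\partial_p=\prod\partial^{p_k}/\partial x_k^{p_k}$, $H_p(x)=(-1)^{|p|}e^{|x|^2}\partial_pe^{-|x|^2}$ and $\phi_p(x)=(p!2^{|p|})^{-1/2}H_p(\sqrt b\,x/\sigma)$; $\{\phi_p\}$ is an orthonormal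 basis of $L^2(\varphi)$ and $P_t\phi_p=e^{-|p|bt}\phi_p$. $\mathcal P$ is the set of Borel $f:\mathbb R^d\to\mathbb R$ with $|f(x)|\le C(1+|x|)^n$ for some $C>0$, $n\in\mathbb Z_+$. For $f\in L^2(\varphi)$, $\kappa_f:=\inf\{k\ge0:\exists p,\ |p|=k,\ \langle f,\phi_p\rangle_\varphi\ne0\}$. For $p\in\mathbb Z_+^d$, $H^p_t:=e^{-(\alpha-|p|b)t}X_t(\phi_p)$, and when $\alpha\tilde\beta>|p|b$, $H^p_\infty:=\lim_{t\to\infty}H^p_t$ (this limit exists $\mathbb P_\mu$-a.s. for $\mu\in\mathcal M_c(\mathbb R^d)$). *)

theory Defs
  imports "HOL-Probability.Probability"
begin

definition polyP :: "(real^'d \<Rightarrow> real) \<Rightarrow> bool" where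
  "polyP f \<longleftrightarrow> f \<in> borel_measurable borel \<and>
     (\<exists>C>0. \<exists>n::nat. \<forall>x. \<bar>f x\<bar> \<le> C * (1 + norm x) ^ n)"

definition gauss_phi :: "real \<Rightarrow> real \<Rightarrow> real^'d \<Rightarrow> real" where
  "gauss_phi \<sigma> b x = (b / (pi * \<sigma>\<^sup>2)) powr (real CARD('d) / 2) * exp (- b * (norm x)\<^sup>2 / \<sigma>\<^sup>2)"

definition inner_phi :: "real \<Rightarrow> real \<Rightarrow> (real^'d \<Rightarrow> real) \<Rightarrow> (real^'d \<Rightarrow> real) \<Rightarrow> real" where
  "inner_phi \<sigma> b f g = (LINT x|lborel. f x * g x * gauss_phi \<sigma> b x)"

text \<open>One-dimensional (physicists') Hermite polynomial H_n(y) = (-1)^n e^(y^2) d^n/dy^n e^(-y^2).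
  The multi-index version H_p(x) = (-1)^|p| e^(|x|^2) partial_p e^(-|x|^2) is the product over
  coordinates since e^(-|x|^2) is the product of e^(-x_k^2).\<close>
definition hermite1 :: "nat \<Rightarrow> real \<Rightarrow> real" where
  "hermite1 n y = (-1) ^ n * exp (y\<^sup>2) * (((deriv ^^ n) (\<lambda>u. exp (- u\<^sup>2))) y)"

definition hermite :: "('d::finite \<Rightarrow> nat) \<Rightarrow> real^'d \<Rightarrow> real" where
  "hermite p x = (\<Prod>k\<in>UNIV. hermite1 (p k) (x $ k))"

definition mi_abs :: "('d::finite \<Rightarrow> nat) \<Rightarrow> nat" where
  "mi_abs p = (\<Sum>k\<in>UNIV. p k)"

definition mi_fact :: "('d::finite \<Rightarrow> nat) \<Rightarrow> nat" where
  "mi_fact p = (\<Prod>k\<in>UNIV. fact (p k))"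

definition phi_p :: "real \<Rightarrow> real \<Rightarrow> ('d::finite \<Rightarrow> nat) \<Rightarrow> real^'d \<Rightarrow> real" where
  "phi_p \<sigma> b p x = (real (mi_fact p) * 2 ^ mi_abs p) powr (-1/2) * hermite p ((sqrt b / \<sigma>) *\<^sub>R x)"

text \<open>kappa_f as an element of enat (inf of the empty set = infinity).\<close>
definition kappa :: "real \<Rightarrow> real \<Rightarrow> (real^'d::finite \<Rightarrow> real) \<Rightarrow> enat" where
  "kappa \<sigma> b f = Inf {enat k | k. \<exists>p::'d \<Rightarrow> nat. mi_abs p = k \<and> inner_phi \<sigma> b f (phi_p \<sigma> b p) \<noteq> 0}"

text \<open>P_t f(x) = Pi_x[f(xi_t)], where under Pi_x, xi_t is Gaussian with mean e^(-bt)x and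
  covariance sigma^2(1-e^(-2bt))/(2b) I.\<close>
definition std_gauss :: "real^'d \<Rightarrow> real" where
  "std_gauss z = (2 * pi) powr (- real CARD('d) / 2) * exp (- (norm z)\<^sup>2 / 2)"

definition ou_sg :: "real \<Rightarrow> real \<Rightarrow> real \<Rightarrow> (real^'d::finite \<Rightarrow> real) \<Rightarrow> real^'d \<Rightarrow> real" where
  "ou_sg \<sigma> b t f x = (LINT z|lborel.
      f (exp (- b * t) *\<^sub>R x + sqrt (\<sigma>\<^sup>2 * (1 - exp (- 2 * b * t)) / (2 * b)) *\<^sub>R z) * std_gauss z)"

definition psi :: "real \<Rightarrow> real \<Rightarrow> real measure \<Rightarrow> real \<Rightarrow> real" where
  "psi \<alpha> \<rho> Lev z = - \<alpha> * z + \<rho> * z\<^sup>2 + (LINT y:{0<..}|Lev. exp (- z * y) - 1 + z * y)"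

text \<open>Weighted total-variation integral  int_A w(y) |M(dy) - N(dy)|, computed via
  Radon-Nikodym densities of M, N (restricted to A) w.r.t. the sum measure.\<close>
definition tv_wint :: "(real \<Rightarrow> real) \<Rightarrow> real measure \<Rightarrow> real measure \<Rightarrow> real set \<Rightarrow> ennreal" where
  "tv_wint w M N A =
    (let MA = density M (indicator A); NA = density N (indicator A);
         S = measure_of UNIV (sets borel) (\<lambda>B. emeasure MA B + emeasure NA B)
     in \<integral>\<^sup>+ y. ennreal (w y) *
          ennreal \<bar>enn2real (RN_deriv S MA y) - enn2real (RN_deriv S NA y)\<bar> \<partial>S)"

text \<open>V is a locally bounded nonnegative solution of the mild equation
  V_t f(x) + int_0^t P_s[psi(V_{t-s} f)](x) ds = P_t f(x)
  (the Pi_x-expectation of the time integral written via Fubini as an integral of P_s).\<close>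
definition is_V :: "real \<Rightarrow> real \<Rightarrow> (real \<Rightarrow> real) \<Rightarrow> (real^'d::finite \<Rightarrow> real)
    \<Rightarrow> (real \<Rightarrow> real^'d \<Rightarrow> real) \<Rightarrow> bool" where
  "is_V \<sigma> b \<Psi> f V \<longleftrightarrow>
     (\<forall>t\<ge>0. \<forall>x. V t x \<ge> 0) \<and>
     (\<forall>T\<ge>0. \<exists>C. \<forall>t\<in>{0..T}. \<forall>x. \<bar>V t x\<bar> \<le> C) \<and>
     (\<forall>t\<ge>0. \<forall>x. V t x + (LBINT s=0..t. ou_sg \<sigma> b s (\<lambda>y. \<Psi> (V (t - s) y)) x) = ou_sg \<sigma> b t f x)"

definition natF :: "'w measure \<Rightarrow> (real \<Rightarrow> 'w \<Rightarrow> (real^'d) measure) \<Rightarrow> real \<Rightarrow> 'w measure" where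
  "natF M X s = sigma (space M)
     {{\<omega> \<in> space M. measure (X r \<omega>) A \<in> B} | r A B. 0 \<le> r \<and> r \<le> s \<and> A \<in> sets borel \<and> B \<in> sets borel}"

definition fin_borel_measure :: "(real^'d) measure \<Rightarrow> bool" where
  "fin_borel_measure \<mu> \<longleftrightarrow> sets \<mu> = sets borel \<and> finite_measure \<mu>"

definition superOU :: "real \<Rightarrow> real \<Rightarrow> real \<Rightarrow> real \<Rightarrow> real measure
    \<Rightarrow> ((real^'d::finite) measure \<Rightarrow> 'w measure) \<Rightarrow> (real \<Rightarrow> 'w \<Rightarrow> (real^'d) measure) \<Rightarrow> bool" where
  "superOU \<sigma> b \<alpha> \<rho> Lev Pm X \<longleftrightarrow>
     (\<forall>t \<omega>. fin_borel_measure (X t \<omega>)) \<and>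
     (\<forall>\<omega> (g::real^'d \<Rightarrow> real). bounded (range g) \<and> continuous_on UNIV g \<longrightarrow>
         (\<forall>t\<ge>0. continuous (at_right t) (\<lambda>s. \<integral>x. g x \<partial>(X s \<omega>)))) \<and>
     (\<forall>\<mu>. fin_borel_measure \<mu> \<longrightarrow>
        prob_space (Pm \<mu>) \<and>
        (\<forall>t A. A \<in> sets borel \<longrightarrow> (\<lambda>\<omega>. measure (X t \<omega>) A) \<in> borel_measurable (Pm \<mu>)) \<and>
        (AE \<omega> in Pm \<mu>. X 0 \<omega> = \<mu>) \<and>
        (\<forall>f V s t. f \<in> borel_measurable borel \<and> bounded (range f) \<and> (\<forall>x. f x \<ge> 0) \<and>
            is_V \<sigma> b (psi \<alpha> \<rho> Lev) f V \<and> s \<ge> 0 \<and> t \<ge> 0 \<longrightarrow>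
            (AE \<omega> in Pm \<mu>.
               real_cond_exp (Pm \<mu>) (natF (Pm \<mu>) X s) (\<lambda>\<omega>. exp (- (\<integral>x. f x \<partial>(X (s + t) \<omega>)))) \<omega>
               = exp (- (\<integral>x. V t x \<partial>(X s \<omega>))))))"

definition Hmart :: "real \<Rightarrow> real \<Rightarrow> real \<Rightarrow> (real \<Rightarrow> 'w \<Rightarrow> (real^'d::finite) measure)
    \<Rightarrow> ('d \<Rightarrow> nat) \<Rightarrow> real \<Rightarrow> 'w \<Rightarrow> real" where
  "Hmart \<sigma> b \<alpha> X p t \<omega> = exp (- (\<alpha> - real (mi_abs p) * b) * t) * (\<integral>x. phi_p \<sigma> b p x \<partial>(X t \<omega>))"

definition Hinf :: "real \<Rightarrow> real \<Rightarrow> real \<Rightarrow> (real \<Rightarrow> 'w \<Rightarrow> (real^'d::finite) measure)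
    \<Rightarrow> ('d \<Rightarrow> nat) \<Rightarrow> 'w \<Rightarrow> real" where
  "Hinf \<sigma> b \<alpha> X p \<omega> = Lim at_top (\<lambda>t. Hmart \<sigma> b \<alpha> X p t \<omega>)"

definition pderiv1 :: "'d::finite \<Rightarrow> (real^'d \<Rightarrow> real) \<Rightarrow> real^'d \<Rightarrow> real" where
  "pderiv1 k g x = frechet_derivative g (at x) (axis k 1)"

definition twice_diff_P :: "(real^'d::finite \<Rightarrow> real) \<Rightarrow> bool" where
  "twice_diff_P f \<longleftrightarrow> (\<forall>x. f differentiable at x) \<and>
     (\<forall>k x. pderiv1 k f differentiable at x) \<and>
     (\<forall>j k. polyP (pderiv1 j (pderiv1 k f)))"

end

theory Submission
 imports Defs
begin

text \<open>Write $W_n(x) = (1+|x|)^n$. The branching mechanism satisfies $\psi(z)+\alpha z \le A(z^q+z^2)$ for every $q<1+\beta$,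
so the Laplace functional of $X_{s+t}(h)$ differs from that of its conditional mean $e^{\alpha t}X_s(P_th)$ by at most
$C(\theta^q+\theta^2)X_s(W_{2n})$ when $h$ is replaced by $\theta h$. This gives a tail of order $r^{-q}$, hence
$E|X_{s+t}(h)-e^{\alpha t}X_s(P_th)|^p \le C e^{\alpha s}$ for $p<q$ and $t\le 1$. Telescoping over unit time steps and using
$|P_tf| \le C e^{-kbt}W_m$ for $f$ orthogonal to all modes of degree below $k$ (integration by parts for the Gaussian kernel), one
finds that the martingales $H^p$ converge exponentially fast in $L^p$ and that the part of $f$ orthogonal to the modes of degree at most $k$ is
negligible after normalisation. For the almost sure statement, maximal inequalities on dyadic times in $[n,n+1]$ and Borel-Cantelli
give convergence along dyadic times; the drift of $e^{-\alpha t}X_t(f)$ is controlled by Dynkin's formula, and right continuity of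
$t\mapsto X_t(f)$ for continuous $f$ of polynomial growth removes the restriction to dyadic times.\<close>

abbreviation wt :: "nat => 'a::real_normed_vector => real" where
 "wt n x == (1 + norm x) ^ n"

subsection \<open>Gaussian integrals and functions of polynomial growth\<close>

text \<open>The standard Gaussian law on R^d as a measure: polynomial growth then implies
  integrability, and semigroup identities become statements about independent Gaussian
  variables.\<close>

definition stdN :: "(real^'d) measure" where
 "stdN = density lborel (%z. ennreal (std_gauss z))"

lemma std_gauss_nonneg [simp]: "0 <= std_gauss z"
 by (simp add: std_gauss_def)

lemma std_gauss_measurable [measurable]: "std_gauss \<in> borel_measurable borel"
 unfolding std_gauss_def by measurable

lemma sets_stdN [simp, measurable_cong]: "sets stdN = sets borel"
 by (simp add: stdN_def)

lemma space_stdN [simp]: "space stdN = UNIV"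
 by (simp add: stdN_def)

lemma nn_integral_stdN:
 fixes f :: "real^'d => ennreal"
 assumes [measurable]: "f \<in> borel_measurable borel"
 shows "nn_integral stdN (%z. f z) = nn_integral lborel (%z. ennreal (std_gauss z) * f z)"
 unfolding stdN_def by (subst nn_integral_density) auto

lemma integral_stdN:
 fixes f :: "real^'d => real"
 assumes [measurable]: "f \<in> borel_measurable borel"
 shows "(LINT z|stdN. f z) = (LINT z|lborel. f z * std_gauss z)"
 unfolding stdN_def by (subst integral_density) (auto simp: mult.commute)

lemma std_gauss_eq_prod:
 "std_gauss (z::real^'d) = (\<Prod>b\<in>Basis. std_normal_density (z \<bullet> b))"
proof -
 have "(norm z)\<^sup>2 = (\<Sum>b\<in>Basis. (z \<bullet> b)\<^sup>2)"
  by (simp add: norm_eq_sqrt_inner euclidean_inner[of z z] power2_eq_square sum_nonneg)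
 then have e: "exp (- (norm z)\<^sup>2 / 2) = (\<Prod>b\<in>Basis. exp (- (z \<bullet> b)\<^sup>2 / 2))"
  by (simp add: exp_sum[symmetric] sum_negf sum_divide_distrib)
 have "(2 * pi) powr (- real CARD('d) / 2) = (\<Prod>b\<in>(Basis::(real^'d) set). 1 / sqrt (2 * pi))"
 proof -
  have "(2 * pi) powr (- real CARD('d) / 2) = ((2 * pi) powr (-1/2)) powr real CARD('d)"
   by (simp add: powr_powr)
  also have "(2 * pi) powr (-1/2) = 1 / sqrt (2*pi)"
   by (simp add: powr_minus powr_half_sqrt divide_inverse[symmetric] inverse_eq_divide)
  finally show ?thesis by (simp add: powr_realpow)
 qed
 then show ?thesis
  unfolding std_gauss_def e std_normal_density_def by (simp only: prod.distrib)
qed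

lemma nn_integral_std_gauss: "nn_integral lborel (%z. ennreal (std_gauss (z::real^'d))) = 1"
proof -
 have "nn_integral lborel (%z. ennreal (std_gauss (z::real^'d))) =
   nn_integral lborel (%z. (\<Prod>b\<in>(Basis::(real^'d) set). ennreal (std_normal_density (z \<bullet> b))))"
  by (simp add: std_gauss_eq_prod prod_ennreal)
 also have "... = (\<Prod>b\<in>(Basis::(real^'d) set). (nn_integral lborel (%x. ennreal (std_normal_density x))))"
  by (rule nn_integral_lborel_prod) auto
 also have "nn_integral lborel (%x. ennreal (std_normal_density x)) = 1"
  using prob_space.emeasure_space_1[OF prob_space_normal_density[of 1 0]]
  by (simp add: emeasure_density)
 finally show ?thesis by simp
qed

lemma prob_space_stdN: "prob_space (stdN :: (real^'d) measure)"
 by (rule prob_spaceI) (simp add: nn_integral_std_gauss emeasure_density stdN_def)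

interpretation SG: prob_space "stdN :: (real^'d) measure"
 by (rule prob_space_stdN)

interpretation SG2: pair_prob_space
 "stdN :: (real^'d) measure" "stdN :: (real^'d) measure" ..

lemma nn_integral_lborel_affine:
 fixes f :: "real^'d => ennreal"
 assumes [measurable]: "f \<in> borel_measurable borel" and "c > 0"
 shows "nn_integral lborel (%w. f w) = ennreal (c ^ CARD('d)) * nn_integral lborel (%z. f (t + c *\<^sub>R z))"
 using assms(2)
 by (subst lborel_affine[of c t])
  (auto simp: nn_integral_density nn_integral_distr nn_integral_cmult)

text \<open>The weight is at most exp(n|z|). The square (|z|/2 - n)^2 >= 0 trades this for the
  factor exp(n^2) and half of the Gaussian exponent; what remains is a rescaled copy of
  \<open>std_gauss\<close>.\<close>

lemma std_gauss_moment:
 "integrable stdN (%z::real^'d. wt n z)"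
proof (rule integrableI_bounded)
 have 1: "wt n z * exp (- (norm z)\<^sup>2 / 2) <= exp (real n ^ 2) * exp (- (norm z)\<^sup>2 / 4)"
  for z :: "real^'d"
 proof -
  have "wt n z <= exp (norm z) ^ n"
   by (intro power_mono) auto
  also have "... = exp (real n * norm z)" by (simp add: exp_of_nat_mult)
  finally have "wt n z * exp (- (norm z)\<^sup>2 / 2) <= exp (real n * norm z) * exp (- (norm z)\<^sup>2 / 2)"
   by (intro mult_right_mono) auto
  also have "... <= exp (real n ^ 2) * exp (- (norm z)\<^sup>2 / 4)"
   unfolding exp_add[symmetric]
  proof (subst exp_le_cancel_iff)
   have "0 <= (norm z / 2 - real n)^2" by simp
   then show "real n * norm z + - (norm z)\<^sup>2 / 2 <= (real n)\<^sup>2 + - (norm z)\<^sup>2 / 4"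
    by (simp add: power2_eq_square algebra_simps)
  qed
  finally show ?thesis .
 qed
 let ?K = "(2 * pi) powr (- real CARD('d) / 2)"
 have sc: "exp (- (norm (sqrt 2 *\<^sub>R z))\<^sup>2 / 4) = exp (- (norm (z::real^'d))\<^sup>2 / 2)" for z
  by (simp add: power_mult_distrib)
 have "(nn_integral (stdN::(real^'d) measure) (%z. ennreal (norm (wt n z))))
  = nn_integral lborel (%z. ennreal (std_gauss (z::real^'d) * wt n z))"
  by (subst nn_integral_stdN) (auto simp: ennreal_mult'')
 also have "... <= nn_integral lborel (%z. ennreal (exp (real n ^ 2)) * ennreal (?K * exp (- (norm (z::real^'d))\<^sup>2 / 4)))"
  unfolding ennreal_mult'[symmetric, OF exp_ge_zero]
  using mult_left_mono[OF 1, of ?K]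
  by (intro nn_integral_mono ennreal_leI) (simp add: std_gauss_def mult_ac)
 also have "... = ennreal (exp (real n ^ 2)) * nn_integral lborel (%z. ennreal (?K * exp (- (norm (z::real^'d))\<^sup>2 / 4)))"
  by (rule nn_integral_cmult) auto
 also have "nn_integral lborel (%z. ennreal (?K * exp (- (norm (z::real^'d))\<^sup>2 / 4)))
  = ennreal (sqrt 2 ^ CARD('d)) * nn_integral lborel (%z. ennreal (std_gauss (z::real^'d)))"
  by (subst nn_integral_lborel_affine[of _ "sqrt 2" 0]) (auto simp: std_gauss_def sc[simplified])
 finally have "(nn_integral (stdN::(real^'d) measure) (%z. ennreal (norm (wt n z)))) \<le>
  ennreal (exp (real n ^ 2)) * (ennreal (sqrt 2 ^ CARD('d)) * 1)"
  unfolding nn_integral_std_gauss .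
 also have "... < \<infinity>" by (simp add: ennreal_mult_less_top)
 finally show "(nn_integral (stdN::(real^'d) measure) (%z. ennreal (norm (wt n z)))) < \<infinity>" .
qed simp

section \<open>Algebra of functions of polynomial growth\<close>

lemma polyPI:
 assumes "f \<in> borel_measurable borel" "!!x. abs (f x) <= C * wt n x"
 shows "polyP f"
proof -
 have "abs (f x) <= (abs C + 1) * wt n x" for x
  by (rule order_trans[OF assms(2)]) (auto intro!: mult_right_mono)
 then show ?thesis unfolding polyP_def using assms(1)
  by (intro conjI exI[of _ "abs C+1"] exI[of _ n]) auto
qed

lemma polyP_measurable: "polyP f ==> f \<in> borel_measurable borel"
 by (simp add: polyP_def)

lemma polyPE:
 assumes "polyP f"
 obtains C n where "C > 0" "!!x. abs (f x) <= C * wt n x"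
 using assms unfolding polyP_def by auto

lemma one_plus_norm_power_mono: "m <= n ==> wt m x <= wt n x"
 by (rule power_increasing) auto

lemma one_le_one_plus_norm_power: "1 <= wt n x"
 by (rule one_le_power) auto

lemma polyP_const [intro, simp]: "polyP (%_. c)"
 by (rule polyPI[of _ "abs c" 0]) auto

lemma polyP_add [intro]:
 assumes "polyP f" "polyP g" shows "polyP (%x. f x + g x)"
proof -
 obtain C m where C: "C > 0" "!!x. abs (f x) <= C * wt m x" using assms(1) by (rule polyPE) blast
 obtain D n where D: "D > 0" "!!x. abs (g x) <= D * wt n x" using assms(2) by (rule polyPE) blast
 note [measurable] = assms[THEN polyP_measurable]
 show ?thesis
 proof (rule polyPI[of _ "C + D" "m + n"])
  fix x
  have "abs (f x + g x) <= C * wt m x + D * wt n x"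
   using C(2)[of x] D(2)[of x] by linarith
  also have "... <= C * (1 + norm x) ^ (m+n) + D * (1 + norm x) ^ (m+n)"
   using C(1) D(1) by (intro add_mono mult_left_mono one_plus_norm_power_mono) auto
  finally show "abs (f x + g x) <= (C + D) * (1 + norm x) ^ (m+n)" by (simp add: algebra_simps)
 qed measurable
qed

lemma polyP_mult [intro]:
 assumes "polyP f" "polyP g" shows "polyP (%x. f x * g x)"
proof -
 obtain C m where C: "C > 0" "!!x. abs (f x) <= C * wt m x" using assms(1) by (rule polyPE) blast
 obtain D n where D: "D > 0" "!!x. abs (g x) <= D * wt n x" using assms(2) by (rule polyPE) blast
 note [measurable] = assms[THEN polyP_measurable]
 show ?thesis
 proof (rule polyPI[of _ "C * D" "m + n"])
  fix x
  have "abs (f x) * abs (g x) <= (C * wt m x) * (D * wt n x)"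
   using C(1) D(1) by (intro mult_mono C(2) D(2)) auto
  then show "abs (f x * g x) <= (C * D) * (1 + norm x) ^ (m+n)"
   by (simp add: abs_mult power_add mult_ac)
 qed measurable
qed

lemma polyP_minus [intro]: "polyP f ==> polyP (%x. - f x)"
 using polyP_mult[OF polyP_const[of "-1"], of f] by simp

lemma polyP_diff [intro]: "polyP f ==> polyP g ==> polyP (%x. f x - g x)"
 using polyP_add[of f "%x. - g x"] by auto

lemma polyP_sum [intro]: "(!!i. i \<in> I ==> polyP (f i)) ==> polyP (%x. \<Sum>i\<in>I. f i x)"
 by (induction I rule: infinite_finite_induct) auto

lemma polyP_prod [intro]: "(!!i. i \<in> I ==> polyP (f i)) ==> polyP (%x. \<Prod>i\<in>I. f i x)"
 by (induction I rule: infinite_finite_induct) auto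

lemma polyP_norm_power [intro]: "polyP (%x. wt n x)"
 by (rule polyPI[of _ 1 n]) auto

lemma polyP_component [intro]: "polyP (%x::real^'d. x $ i)"
 by (rule polyPI[of _ 1 1])
  (auto intro: order_trans[OF component_le_norm_cart] simp: borel_measurable_continuous_onI continuous_intros)

lemma polyP_bound:
 assumes "polyP g" "f \<in> borel_measurable borel" "!!x. abs (f x) <= g x"
 shows "polyP f"
 using assms(1) by (rule polyPE) (rule polyPI[OF assms(2)], rule order_trans[OF assms(3)], fastforce dest: abs_le_D1)

lemma polyP_abs [intro]: "polyP f ==> polyP (%x. abs (f x))"
 unfolding polyP_def by auto

lemma one_plus_norm_affine_le:
 "1 + norm (a + c *\<^sub>R x) <= (1 + norm a + abs c) * (1 + norm x)"
proof -
 have "norm (a + c *\<^sub>R x) <= norm a + abs c * norm x"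
  using norm_triangle_ineq[of a "c *\<^sub>R x"] by simp
 moreover have "0 <= norm a * norm x" by simp
 moreover have "(1 + norm a + abs c) * (1 + norm x)
   = 1 + norm a + abs c * norm x + norm a * norm x + norm x + abs c"
  by (simp add: algebra_simps)
 ultimately show ?thesis using norm_ge_zero[of x] abs_ge_zero[of c] by linarith
qed

lemma polyP_affine:
 assumes "polyP f" shows "polyP (%x. f (a + c *\<^sub>R x))"
proof -
 obtain C m where C: "C > 0" "!!x. abs (f x) <= C * wt m x" using assms(1) by (rule polyPE) blast
 note [measurable] = assms[THEN polyP_measurable]
 show ?thesis
 proof (rule polyPI[of _ "C * (1 + norm a + abs c)^m" m])
  fix x
  have "abs (f (a + c *\<^sub>R x)) <= C * (1 + norm (a + c *\<^sub>R x)) ^ m" by (rule C)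
  also have "... <= C * ((1 + norm a + abs c) * (1 + norm x)) ^ m"
   using C(1) by (intro mult_left_mono power_mono one_plus_norm_affine_le) auto
  finally show "abs (f (a + c *\<^sub>R x)) <= C * (1 + norm a + abs c)^m * wt m x"
   by (simp add: power_mult_distrib mult_ac)
 qed measurable
qed

lemma integrable_polyP:
 assumes "polyP f" shows "integrable stdN f"
proof -
 obtain C m where C: "C > 0" "!!x. abs (f x) <= C * wt m x" using assms(1) by (rule polyPE) blast
 note [measurable] = assms[THEN polyP_measurable]
 show ?thesis
  by (rule Bochner_Integration.integrable_bound[OF integrable_mult_right[OF std_gauss_moment[of m], of C]])
   (auto intro: order_trans[OF C(2)] abs_ge_self)
qed

lemma integrable_pair_poly:
 fixes F :: "(real^'d) \<times> (real^'d) => real"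
 assumes [measurable]: "F \<in> borel_measurable (borel \<Otimes>\<^sub>M borel)"
  and le: "!!x y. abs (F (x, y)) <= C * (wt n x * wt n y)"
 shows "integrable (stdN \<Otimes>\<^sub>M stdN) F"
proof -
 have "integrable (stdN \<Otimes>\<^sub>M stdN)
     (%(x, y). (1 + norm (x::real^'d)) ^ n * (1 + norm (y::real^'d)) ^ n)"
  by (intro SG2.Fubini_integrable) (auto intro!: std_gauss_moment integrable_mult_left integrable_mult_right simp: abs_mult)
 then show ?thesis
  by (intro Bochner_Integration.integrable_bound[of _ "%p. C * (case p of (x,y) => wt n x * wt n y)" F])
   (auto intro!: AE_I2 order_trans[OF le abs_ge_self] split: prod.splits)
qed

section \<open>Gaussian convolution and reversibility\<close>

lemma nn_integral_gauss_affine: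
 fixes f :: "real^'d => ennreal"
 assumes [measurable]: "f \<in> borel_measurable borel" and "c > 0"
 shows "ennreal (c ^ CARD('d)) * nn_integral stdN (%z. f (t + c *\<^sub>R z))
  = nn_integral lborel (%w. ennreal (std_gauss ((1 / c) *\<^sub>R (w - t))) * f w)"
 using assms(2)
 by (subst nn_integral_lborel_affine[of _ c t]) (auto simp: nn_integral_stdN)

text \<open>Up to a common constant both sides are the joint density of (Z, W), where W = aZ + bZ'
  with independent standard Z and Z'. On the left it is the law of Z times that of W given Z; on the
  right the law of W, of variance C^2, times that of Z given W, of mean aW/C^2 and deviation b/C.
  The computation is completing the square in \<open>P\<close>, \<open>Q\<close>,
  \<open>R\<close>.\<close>

lemma gauss_conv_kernel:
 fixes z w :: "real^'d"
 assumes b: "b > 0" and C: "C > 0" "C\<^sup>2 = a\<^sup>2 + b\<^sup>2"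
 shows "std_gauss z * std_gauss ((1 / b) *\<^sub>R (w - a *\<^sub>R z)) =
    std_gauss ((1 / C) *\<^sub>R w) * std_gauss ((1 / (b / C)) *\<^sub>R (z - (a / C\<^sup>2) *\<^sub>R w))"
proof -
 define P Q R where "P = z \<bullet> z" and "Q = z \<bullet> w" and "R = w \<bullet> w"
 have 1: "(norm ((1 / b) *\<^sub>R (w - a *\<^sub>R z)))\<^sup>2 = (R - 2 * a * Q + a\<^sup>2 * P) / b\<^sup>2"
  unfolding power2_norm_eq_inner P_def Q_def R_def
  by (simp add: inner_commute[of w z] algebra_simps inner_simps power2_eq_square add_divide_distrib diff_divide_distrib)
 have 2: "(norm ((1 / (b / C)) *\<^sub>R (z - (a / C\<^sup>2) *\<^sub>R w)))\<^sup>2 = (C\<^sup>2 / b\<^sup>2) * (P - 2 * (a / C\<^sup>2) * Q + (a / C\<^sup>2)\<^sup>2 * R)"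
  unfolding power2_norm_eq_inner P_def Q_def R_def
  by (simp add: inner_commute[of w z] algebra_simps inner_simps power2_eq_square add_divide_distrib diff_divide_distrib)
 have 3: "(norm z)\<^sup>2 = P" "(norm ((1 / C) *\<^sub>R w))\<^sup>2 = R / C\<^sup>2"
  unfolding P_def R_def power2_norm_eq_inner by (simp_all add: power2_eq_square)
 have "P + (R - 2 * a * Q + a\<^sup>2 * P) / b\<^sup>2 =
    R / C\<^sup>2 + (C\<^sup>2 / b\<^sup>2) * (P - 2 * (a / C\<^sup>2) * Q + (a / C\<^sup>2)\<^sup>2 * R)"
 proof -
  have e1: "(C\<^sup>2 / b\<^sup>2) * (P - 2 * (a / C\<^sup>2) * Q + (a / C\<^sup>2)\<^sup>2 * R)
    = (C\<^sup>2 * P - 2 * a * Q + a\<^sup>2 * R / C\<^sup>2) / b\<^sup>2"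
   using C(1) b by (simp add: field_simps power2_eq_square)
  have e2: "R / C\<^sup>2 = (R - a\<^sup>2 * R / C\<^sup>2) / b\<^sup>2"
  proof -
   have "R * C\<^sup>2 - a\<^sup>2 * R = b\<^sup>2 * R" unfolding C(2) by (simp add: algebra_simps)
   then show ?thesis using C(1) b by (simp add: field_simps)
  qed
  have e3: "P + (R - 2 * a * Q + a\<^sup>2 * P) / b\<^sup>2 = (C\<^sup>2 * P + R - 2 * a * Q) / b\<^sup>2"
   unfolding C(2) using b by (simp add: field_simps)
  show ?thesis unfolding e1 e3 using e2 by (simp add: add_divide_distrib diff_divide_distrib)
 qed
 note eq = this
 have e: "std_gauss u * std_gauss v = ((2 * pi) powr (- real CARD('d) / 2))\<^sup>2 * exp (- ((norm u)\<^sup>2 + (norm v)\<^sup>2) / 2)"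
  for u v :: "real^'d"
 proof -
  have "exp (- ((norm u)\<^sup>2 + (norm v)\<^sup>2) / 2) = exp (- (norm u)\<^sup>2 / 2) * exp (- (norm v)\<^sup>2 / 2)"
   unfolding exp_add[symmetric] by (simp add: field_simps)
  then show ?thesis unfolding std_gauss_def by (simp only: power2_eq_square mult_ac)
 qed
 show ?thesis unfolding e 1 2 3 using eq by simp
qed

text \<open>After Tonelli the factorised kernel lets the integral over z1 be evaluated for each w,
  where it contributes (b/C)^d. The Jacobian b^d is carried along on the left and cancelled at the
  end, which avoids division of extended reals.\<close>

lemma nn_integral_gauss_conv:
 fixes f :: "real^'d => ennreal"
 assumes [measurable]: "f \<in> borel_measurable borel" and b: "b > 0"
 shows "nn_integral stdN (%z1. (nn_integral stdN (%z2. f (y + a *\<^sub>R z1 + b *\<^sub>R z2))))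
  = nn_integral stdN (%z. f (y + sqrt (a\<^sup>2 + b\<^sup>2) *\<^sub>R z))"
proof -
 define C where "C = sqrt (a\<^sup>2 + b\<^sup>2)"
 have C: "C > 0" "C\<^sup>2 = a\<^sup>2 + b\<^sup>2" using b by (auto simp: C_def add_nonneg_pos)
 define g where "g = (%w. f (y + w))"
 have [measurable]: "g \<in> borel_measurable borel" unfolding g_def by measurable
 have "ennreal (b ^ CARD('d)) * nn_integral stdN (%z1. (nn_integral stdN (%z2. g (a *\<^sub>R z1 + b *\<^sub>R z2))))
  = nn_integral stdN (%z1. (nn_integral lborel (%w. ennreal (std_gauss ((1 / b) *\<^sub>R (w - a *\<^sub>R z1))) * g w)))"
  by (subst nn_integral_cmult[symmetric]) (auto simp: nn_integral_gauss_affine[OF _ b])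
 also have "... = nn_integral lborel (%z1. (nn_integral lborel (%w. ennreal (std_gauss z1) * (ennreal (std_gauss ((1 / b) *\<^sub>R (w - a *\<^sub>R z1))) * g w))))"
  by (subst nn_integral_stdN) (auto simp: nn_integral_cmult)
 also have "... = nn_integral lborel (%w. (nn_integral lborel (%z1. ennreal (std_gauss z1) * (ennreal (std_gauss ((1 / b) *\<^sub>R (w - a *\<^sub>R z1))) * g w))))"
  by (rule lborel_pair.Fubini') measurable
 also have "... = nn_integral lborel (%w. (ennreal (std_gauss ((1 / C) *\<^sub>R w)) * g w) *
   nn_integral lborel (%z1. ennreal (std_gauss ((1 / (b / C)) *\<^sub>R (z1 - (a / C\<^sup>2) *\<^sub>R w)))))"
  by (subst nn_integral_cmult[symmetric])
   (auto intro!: nn_integral_cong simp: ennreal_mult[symmetric] mult.assoc[symmetric] gauss_conv_kernel[OF b C]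
    simp: mult_ac)
 also have "... = nn_integral lborel (%w. (ennreal (std_gauss ((1 / C) *\<^sub>R (w - 0))) * g w) * ennreal ((b / C) ^ CARD('d)))"
  using nn_integral_gauss_affine[of "%_::real^'d. 1" "b / C"] b C(1)
  by (simp add: SG.emeasure_space_1[simplified])
 also have "... = nn_integral lborel (%w. (ennreal (std_gauss ((1 / C) *\<^sub>R (w - 0))) * g w)) * ennreal ((b / C) ^ CARD('d))"
  by (rule nn_integral_multc) auto
 also have "... = ennreal (C ^ CARD('d)) * nn_integral stdN (%z. g (0 + C *\<^sub>R z)) * ennreal ((b / C) ^ CARD('d))"
  by (subst nn_integral_gauss_affine[OF _ C(1)]) auto
 also have "... = (ennreal (C ^ CARD('d)) * ennreal ((b / C) ^ CARD('d))) * nn_integral stdN (%z. g (C *\<^sub>R z))"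
  by (simp add: mult_ac)
 also have "ennreal (C ^ CARD('d)) * ennreal ((b / C) ^ CARD('d)) = ennreal (b ^ CARD('d))"
  using C b by (simp add: ennreal_mult[symmetric] power_mult_distrib[symmetric])
 finally have "nn_integral stdN (%z1. (nn_integral stdN (%z2. g (a *\<^sub>R z1 + b *\<^sub>R z2))))
  = nn_integral stdN (%z. g (C *\<^sub>R z))"
  using b by (simp add: ennreal_mult_cancel_left)
 then show ?thesis by (simp add: g_def C_def add.assoc)
qed

text \<open>For r^2 + c^2 = 1 the kernel identity with C = 1 says that the joint density of (x, rx +
  cz) is symmetric, so the two coordinates are exchangeable.\<close>

lemma nn_integral_gauss_reversible:
 fixes F :: "real^'d => real^'d => ennreal"
 assumes [measurable]: "case_prod F \<in> borel_measurable (borel \<Otimes>\<^sub>M borel)" and c: "c > 0" "r\<^sup>2 + c\<^sup>2 = 1"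
 shows "nn_integral stdN (%x. (nn_integral stdN (%z. F x (r *\<^sub>R x + c *\<^sub>R z))))
  = nn_integral stdN (%x. (nn_integral stdN (%z. F (r *\<^sub>R x + c *\<^sub>R z) x)))"
proof -
 have F': "case_prod (%x y. F y x) \<in> borel_measurable (borel \<Otimes>\<^sub>M borel)" by measurable
 have *: "ennreal (c ^ CARD('d)) * nn_integral stdN (%x. (nn_integral stdN (%z. F x (r *\<^sub>R x + c *\<^sub>R z))))
  = nn_integral lborel (%x. (nn_integral lborel (%w. ennreal (std_gauss x * std_gauss ((1 / c) *\<^sub>R (w - r *\<^sub>R x))) * F x w)))"
  if [measurable]: "case_prod F \<in> borel_measurable (borel \<Otimes>\<^sub>M borel)" for F :: "real^'d => real^'d => ennreal"
 proof -
  have "ennreal (c ^ CARD('d)) * nn_integral stdN (%x. (nn_integral stdN (%z. F x (r *\<^sub>R x + c *\<^sub>R z))))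
  = nn_integral stdN (%x. (nn_integral lborel (%w. ennreal (std_gauss ((1 / c) *\<^sub>R (w - r *\<^sub>R x))) * F x w)))"
   by (subst nn_integral_cmult[symmetric]) (auto simp: nn_integral_gauss_affine[OF _ c(1)])
  also have "... = nn_integral lborel (%x. (nn_integral lborel (%w. ennreal (std_gauss x) * (ennreal (std_gauss ((1 / c) *\<^sub>R (w - r *\<^sub>R x))) * F x w))))"
   by (subst nn_integral_stdN) (auto simp: nn_integral_cmult)
  finally show ?thesis by (simp add: ennreal_mult mult.assoc)
 qed
 have sym: "std_gauss x * std_gauss ((1 / c) *\<^sub>R (w - r *\<^sub>R x)) = std_gauss w * std_gauss ((1 / c) *\<^sub>R (x - r *\<^sub>R w))"
  for x w :: "real^'d"
  using gauss_conv_kernel[of c 1 r x w] c by simp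
 have "ennreal (c ^ CARD('d)) * nn_integral stdN (%x. (nn_integral stdN (%z. F x (r *\<^sub>R x + c *\<^sub>R z))))
  = ennreal (c ^ CARD('d)) * nn_integral stdN (%x. (nn_integral stdN (%z. F (r *\<^sub>R x + c *\<^sub>R z) x)))"
  unfolding *[OF assms(1)] *[OF F']
  by (subst lborel_pair.Fubini') (auto simp: sym)
 then show ?thesis using c by (simp add: ennreal_mult_cancel_left)
qed

text \<open>A bound and measurability of the derivative replace its continuity: the gauge integral
  supplies the fundamental theorem, and the bound makes the Lebesgue integral exist. The derivatives
  met later are only known to be measurable and of polynomial growth.\<close>

lemma ftc_lborel:
 fixes F f :: "real => real"
 assumes "a <= b" and [measurable]: "f \<in> borel_measurable borel"
  and F: "!!x. a <= x ==> x <= b ==> (F has_real_derivative f x) (at x)"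
  and B: "!!x. a <= x ==> x <= b ==> abs (f x) <= B"
 shows "set_integrable lborel {a..b} f" "(LINT x:{a..b}|lborel. f x) = F b - F a"
proof -
 show i: "set_integrable lborel {a..b} f"
  unfolding set_integrable_def
 proof (rule Bochner_Integration.integrable_bound[of _ "%x. indicator {a..b} x *\<^sub>R B"])
  show "integrable lborel (%x. indicat_real {a..b} x *\<^sub>R B)"
   using assms(1) by (auto intro!: integrable_real_indicator)
 qed (auto intro!: AE_I2 order_trans[OF B abs_ge_self] split: split_indicator)
 have "(f has_integral (F b - F a)) {a..b}"
 proof (rule fundamental_theorem_of_calculus[OF assms(1)])
  fix x assume "x \<in> {a..b}"
  then show "(F has_vector_derivative f x) (at x within {a..b})"
   unfolding has_real_derivative_iff_has_vector_derivative[symmetric]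
   by (intro has_field_derivative_at_within[OF F]) auto
 qed
 then show "(LINT x:{a..b}|lborel. f x) = F b - F a"
  using set_borel_integral_eq_integral(2)[OF i] by (simp add: integral_unique)
qed

section \<open>Gaussian integration by parts\<close>

lemma integrable_polyP_lborel:
 fixes f :: "real^'d => real"
 assumes "polyP f" shows "integrable lborel (%z. f z * std_gauss z)"
 using integrable_polyP[OF assms] polyP_measurable[OF assms]
 unfolding stdN_def by (subst (asm) integrable_density) (auto simp: mult.commute)

lemma integral_lborel_translate:
 fixes f :: "real^'d => real"
 assumes [measurable]: "f \<in> borel_measurable borel"
 shows "(LINT z|lborel. f (z + t)) = (LINT z|lborel. f z)"
 by (subst (2) lborel_affine[of 1 t])
  (auto simp: integral_density integral_distr add.commute density_1 one_ennreal_def[symmetric])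

lemma integrable_lborel_translate:
 fixes f :: "real^'d => real"
 assumes "integrable lborel f" shows "integrable lborel (%z. f (z + t))"
 using integrable_distr[of "(+) t" lborel borel f] assms
 by (simp add: lborel_distr_plus add.commute)

lemma DERIV_direction_shift:
 fixes h :: "real^'d => real"
 assumes "!!z. ((%tau. h (z + tau *\<^sub>R e)) has_real_derivative h' z) (at 0)"
 shows "((%tau. h (z + tau *\<^sub>R e)) has_real_derivative h' (z + tau *\<^sub>R e)) (at tau)"
 using DERIV_shift[of "%tau. h (z + tau *\<^sub>R e)" "h' (z + tau *\<^sub>R e)" 0 tau] assms[of "z + tau *\<^sub>R e"]
 by (simp add: scaleR_add_left add_ac)

lemma std_gauss_DERIV:
 "((%tau. std_gauss (z + tau *\<^sub>R axis i 1)) has_real_derivative - (z $ i) * std_gauss z) (at 0)"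
proof -
 have "(norm (z + tau *\<^sub>R axis i 1))\<^sup>2 = (norm z)\<^sup>2 + 2 * tau * z $ i + tau\<^sup>2" for tau
  unfolding power2_norm_eq_inner
  by (simp add: inner_simps inner_axis inner_axis' inner_axis_axis power2_eq_square algebra_simps)
 then show ?thesis unfolding std_gauss_def
  by (auto intro!: derivative_eq_intros)
qed

text \<open>Translation invariance of Lebesgue measure replaces boundary terms. With
  \<open>Phi\<close> = h times the density, the integral of Phi(z + e) - Phi(z) vanishes; by the
  fundamental theorem along e and Fubini it also equals the integral of the directional derivative
  \<open>Phi'\<close>, which is (h' - h z_i) times the density.\<close>

lemma gauss_ibp:
 fixes h h' :: "real^'d => real"
 assumes h: "polyP h" and h': "polyP h'"
  and d: "!!z. ((%tau. h (z + tau *\<^sub>R axis i 1)) has_real_derivative h' z) (at 0)"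
 shows "(LINT z|stdN. h z * z $ i) = (LINT z|stdN. h' z)"
proof -
 let ?e = "axis i 1 :: real^'d"
 note [measurable] = h[THEN polyP_measurable] h'[THEN polyP_measurable]
 have [measurable]: "(%z::real^'d. z $ i) \<in> borel_measurable borel" by (rule polyP_measurable) auto
 define H where "H = (%z. h' z - h z * z $ i)"
 have H: "polyP H" unfolding H_def by (intro polyP_diff polyP_mult polyP_component h h')
 note [measurable] = polyP_measurable[OF H]
 define Phi where "Phi = (%z. h z * std_gauss z)"
 define Phi' where "Phi' = (%z. H z * std_gauss z)"
 have [measurable]: "Phi \<in> borel_measurable borel" "Phi' \<in> borel_measurable borel"
  unfolding Phi_def Phi'_def by measurable
 have iPhi: "integrable lborel Phi" and iPhi': "integrable lborel Phi'"
  unfolding Phi_def Phi'_def by (auto intro!: integrable_polyP_lborel h H)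
 have d0: "((%tau. Phi (z + tau *\<^sub>R ?e)) has_real_derivative Phi' z) (at 0)" for z
  unfolding Phi_def Phi'_def H_def
  using DERIV_mult[OF d[of z] std_gauss_DERIV[of z i]] by (simp add: algebra_simps)
 obtain C n where C: "C > 0" "!!x. abs (H x) <= C * wt n x" using H by (rule polyPE) blast
 have bnd: "abs (Phi' (z + tau *\<^sub>R ?e)) <= C * (2 + norm z) ^ n * (2 * pi) powr (- real CARD('d) / 2)"
  if "0 <= tau" "tau <= 1" for z tau
 proof -
  have "norm (z + tau *\<^sub>R ?e) <= norm z + 1"
   using norm_triangle_ineq[of z "tau *\<^sub>R ?e"] that by simp
  then have "abs (H (z + tau *\<^sub>R ?e)) <= C * (2 + norm z) ^ n"
   using C(1) by (intro order_trans[OF C(2)] mult_left_mono power_mono) auto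
  moreover have "std_gauss (z + tau *\<^sub>R ?e) <= (2 * pi) powr (- real CARD('d) / 2)"
   unfolding std_gauss_def by (simp add: mult_le_cancel_left1)
  ultimately show ?thesis unfolding Phi'_def abs_mult using C(1) by (intro mult_mono) auto
 qed
 have ftc: "(LINT tau:{0..1}|lborel. Phi' (z + tau *\<^sub>R ?e)) = Phi (z + ?e) - Phi z" for z
  using ftc_lborel(2)[of 0 1 "%tau. Phi' (z + tau *\<^sub>R ?e)" "%tau. Phi (z + tau *\<^sub>R ?e)", OF _ _ _ bnd]
   DERIV_direction_shift[OF d0] by simp
 have tr: "(LINT z|lborel. Phi' (z + tau *\<^sub>R ?e)) = (LINT z|lborel. Phi' z)" for tau
  by (rule integral_lborel_translate) measurable
 have trabs: "(LINT z|lborel. abs (Phi' (z + tau *\<^sub>R ?e))) = (LINT z|lborel. abs (Phi' z))" for tau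
  by (rule integral_lborel_translate) measurable
 have tri: "integrable lborel (%z. Phi (z + t))" "integrable lborel (%z. Phi' (z + t))" for t
  by (rule integrable_lborel_translate[OF iPhi] integrable_lborel_translate[OF iPhi'])+
 \<comment> \<open>All tau-slices have the same L^1 norm by translation (\<open>trabs\<close>), so
   integrability on the product reduces to that of a single slice.\<close>
 have int: "integrable (lborel \<Otimes>\<^sub>M lborel) (%(tau, z). indicator {0..1::real} tau * Phi' (z + tau *\<^sub>R ?e))"
 proof (rule lborel_pair.Fubini_integrable)
  have "integrable lborel (%tau::real. indicator {0..1} tau * (LINT z|lborel. abs (Phi' z)))"
   by (intro integrable_mult_left integrable_real_indicator) auto
  then show "integrable lborel (%tau::real. (LINT z|lborel. norm (case (tau, z) of (tau, z) => indicator {0..1} tau * Phi' (z + tau *\<^sub>R ?e))))"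
   by (simp add: abs_mult trabs)
  show "AE tau in lborel. integrable lborel (%z. case (tau, z) of (tau, z) => indicator {0..1::real} tau * Phi' (z + tau *\<^sub>R ?e))"
   unfolding prod.case by (intro AE_I2 integrable_mult_right tri(2))
 qed measurable
 have "(LINT z|lborel. (LINT tau|lborel. indicator {0..1::real} tau * Phi' (z + tau *\<^sub>R ?e)))
  = (LINT tau|lborel. (LINT z|lborel. indicator {0..1::real} tau * Phi' (z + tau *\<^sub>R ?e)))"
  by (rule lborel_pair.Fubini_integral[OF int])
 moreover have "(LINT tau|lborel. (LINT z|lborel. indicator {0..1::real} tau * Phi' (z + tau *\<^sub>R ?e))) = (LINT z|lborel. Phi' z)"
  by (simp add: tr)
 moreover have "(LINT z|lborel. (LINT tau|lborel. indicator {0..1::real} tau * Phi' (z + tau *\<^sub>R ?e))) = 0"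
 proof -
  have "(LINT tau|lborel. indicator {0..1::real} tau * Phi' (z + tau *\<^sub>R ?e)) = Phi (z + ?e) - Phi z" for z
   using ftc[of z] by (simp add: set_lebesgue_integral_def)
  then show ?thesis
   using integral_lborel_translate[of Phi ?e]
   by (simp only: Bochner_Integration.integral_diff[OF tri(1) iPhi]) simp
 qed
 ultimately have "(LINT z|stdN. H z) = 0"
  by (subst integral_stdN) (auto simp: Phi'_def)
 moreover have "(LINT z|stdN. H z) = (LINT z|stdN. h' z) - (LINT z|stdN. h z * z $ i)"
  unfolding H_def using h h' by (intro Bochner_Integration.integral_diff integrable_polyP) auto
 ultimately show ?thesis by simp
qed

subsection \<open>Hermite polynomials\<close>

text \<open>A nonintegrable f has Bochner integral 0, so a dominating g suffices and integrability
  of f need not be settled first.\<close>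

lemma abs_integral_le:
 fixes f g :: "'a => real"
 assumes "integrable M g" "AE x in M. abs (f x) <= g x"
 shows "abs (LINT x|M. f x) <= (LINT x|M. g x)"
proof (cases "integrable M f")
 case True
 then show ?thesis
  using assms by (intro order_trans[OF integral_abs_bound integral_mono_AE]) auto
next
 case False
 have "AE x in M. 0 <= g x" using assms(2) by eventually_elim linarith
 then show ?thesis using False by (simp add: not_integrable_integral_eq integral_nonneg_AE)
qed

text \<open>The Mehler operator with free parameters: the expectation of f at rx + cZ. The
  Ornstein-Uhlenbeck semigroup at time t has r = exp(-bt) and c = \<open>sd t\<close>; the standard
  Gaussian law is invariant when r^2 + c^2 = 1.\<close>

definition gop :: "real => real => (real^'d => real) => real^'d => real" where
 "gop r c f x = (LINT z|stdN. f (r *\<^sub>R x + c *\<^sub>R z))"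

lemma gop_measurable_pair:
 fixes F :: "'a => real^'d => real"
 assumes [measurable]: "case_prod F \<in> borel_measurable (M \<Otimes>\<^sub>M borel)"
  "r \<in> borel_measurable M" "c \<in> borel_measurable M" "x \<in> measurable M borel"
 shows "(%a. gop (r a) (c a) (F a) (x a)) \<in> borel_measurable M"
 unfolding gop_def by measurable

lemma gop_measurable [measurable]:
 assumes [measurable]: "f \<in> borel_measurable borel"
 shows "gop r c f \<in> borel_measurable borel"
 unfolding gop_def[abs_def] by measurable

lemma one_plus_norm_mult_le:
 assumes "abs r <= 1" "abs c <= S"
 shows "(1 + norm (r *\<^sub>R x + c *\<^sub>R z)) ^ n <= wt n x * ((1 + S) ^ n * wt n z)"
proof -
 have "norm (r *\<^sub>R x + c *\<^sub>R z) <= norm x + S * norm z"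
  using norm_triangle_ineq[of "r *\<^sub>R x" "c *\<^sub>R z"] assms
   mult_right_mono[OF assms(1) norm_ge_zero[of x]] mult_right_mono[OF assms(2) norm_ge_zero[of z]] by simp
 also have "1 + ... <= (1 + norm x) * ((1 + S) * (1 + norm z))"
 proof -
  have "0 <= S" using assms(2) by linarith
  then have "0 <= S * norm z" "0 <= norm x * (S + norm z + S * norm z)" "0 <= norm z" by auto
  then show ?thesis using \<open>0 <= S\<close> by (simp add: algebra_simps)
 qed
 finally have "(1 + norm (r *\<^sub>R x + c *\<^sub>R z)) ^ n <= ((1 + norm x) * ((1 + S) * (1 + norm z))) ^ n"
  by (intro power_mono) auto
 then show ?thesis by (simp add: power_mult_distrib mult_ac)
qed

text \<open>The constant depends on n and S alone, because 1 + |rx + cz| <= (1 + |x|)(1 + S)(1 +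
  |z|). Estimates for the semigroup become uniform in time in this way.\<close>

lemma gop_bound:
 fixes n :: nat and S :: real
 assumes "S >= 0"
 obtains K where "K >= 1" "!!f C r c x. (!!x. abs (f x) <= C * wt n x) ==> 0 <= C ==> abs r <= 1 ==> abs c <= S
   ==> abs (gop r c f (x::real^'d)) <= C * K * wt n x"
proof
 let ?K = "(1 + S) ^ n * (LINT z|(stdN::(real^'d) measure). wt n z)"
 have "1 <= (LINT z|(stdN::(real^'d) measure). wt n z)"
  using integral_mono[OF SG.integrable_const std_gauss_moment[of n], of 1]
  by (simp add: one_le_one_plus_norm_power SG.prob_space[simplified])
 moreover have "1 <= (1 + S) ^ n" using assms by (intro one_le_power) auto
 ultimately show "1 <= ?K" using mult_mono[of 1 "(1+S)^n" 1] assms by fastforce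
 fix f :: "real^'d => real" and C r c :: real and x :: "real^'d"
 assume f: "!!x. abs (f x) <= C * wt n x" and C: "0 <= C" and r: "abs r <= 1" and c: "abs c <= S"
 have "abs (gop r c f x) <= (LINT z|(stdN::(real^'d) measure). C * (wt n x * ((1 + S) ^ n * wt n z)))"
  unfolding gop_def
 proof (rule abs_integral_le)
  show "integrable stdN (%z::real^'d. C * (wt n x * ((1 + S) ^ n * wt n z)))"
   by (intro integrable_mult_right std_gauss_moment)
 qed (intro AE_I2 order_trans[OF f] mult_left_mono one_plus_norm_mult_le r c C)
 then show "abs (gop r c f x) <= C * ?K * wt n x" by (simp add: mult_ac)
qed

lemma polyP_gop [intro]:
 assumes "polyP f" "abs r <= 1" shows "polyP (gop r c f)"
proof -
 obtain C m where C: "C > 0" "!!x. abs (f x) <= C * wt m x" using assms(1) by (rule polyPE) blast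
 obtain K where K: "K >= 1" "!!f C r c' x. (!!x. abs (f x) <= C * wt m x) ==> 0 <= C ==> abs r <= 1 ==> abs c' <= abs c
   ==> abs (gop r c' f (x::real^'a)) <= C * K * wt m x"
  by (rule gop_bound[OF abs_ge_zero[of c], of m]) blast
 show ?thesis
  using polyP_measurable[OF assms(1)]
  by (intro polyPI[of _ "C * K" m] K(2) C(2) assms(2) less_imp_le[OF C(1)] gop_measurable) auto
qed

lemma integrable_gop: "polyP f ==> integrable stdN (%z. f (a + c *\<^sub>R z))"
 by (intro integrable_polyP polyP_affine)

lemma gop_const [simp]: "gop r c (%_. a) x = a"
 by (simp add: gop_def SG.prob_space[simplified])

lemma gop_add: "polyP f ==> polyP g ==> gop r c (%x. f x + g x) x = gop r c f x + gop r c g x"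
 unfolding gop_def by (intro Bochner_Integration.integral_add integrable_gop)

lemma gop_diff: "polyP f ==> polyP g ==> gop r c (%x. f x - g x) x = gop r c f x - gop r c g x"
 unfolding gop_def by (intro Bochner_Integration.integral_diff integrable_gop)

lemma gop_cmult: "gop r c (%x. a * f x) x = a * gop r c f x"
 unfolding gop_def by simp

lemma gop_sum: "(!!i. i \<in> I ==> polyP (f i)) ==> gop r c (%x. \<Sum>i\<in>I. f i x) x = (\<Sum>i\<in>I. gop r c (f i) x)"
 unfolding gop_def by (intro Bochner_Integration.integral_sum integrable_gop)

lemma gop_1_0 [simp]: "gop 1 0 f x = f x"
 by (simp add: gop_def SG.prob_space[simplified])

text \<open>Applied to indicators, the Tonelli identity becomes an equality of laws, through which
  Bochner integrals of signed functions can be transported.\<close>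

lemma gauss_conv_distr:
 assumes "b > 0"
 shows "distr (stdN \<Otimes>\<^sub>M stdN) borel (%(z1, z2). y + a *\<^sub>R z1 + b *\<^sub>R z2)
  = distr (stdN :: (real^'d) measure) borel (%z. y + sqrt (a\<^sup>2 + b\<^sup>2) *\<^sub>R z)" (is "?L = ?R")
proof (rule measure_eqI)
 fix A assume "A \<in> sets ?L"
 then have [measurable]: "A \<in> sets borel" by simp
 have "emeasure ?L A = (nn_integral ?L (%w. indicator A w))" by simp
 also have "... = nn_integral (stdN \<Otimes>\<^sub>M stdN) (%p. indicator A (case p of (z1, z2) => y + a *\<^sub>R z1 + b *\<^sub>R z2))"
  by (rule nn_integral_distr) measurable
 also have "... = nn_integral stdN (%z1. (nn_integral stdN (%z2. indicator A (y + a *\<^sub>R z1 + b *\<^sub>R z2))))"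
  by (subst SG.nn_integral_fst[symmetric]) auto
 also have "... = nn_integral stdN (%z. indicator A (y + sqrt (a\<^sup>2 + b\<^sup>2) *\<^sub>R z))"
  by (rule nn_integral_gauss_conv) (use assms in auto)
 also have "... = (nn_integral ?R (%w. indicator A w))"
  by (rule nn_integral_distr[symmetric]) measurable
 also have "... = emeasure ?R A" by simp
 finally show "emeasure ?L A = emeasure ?R A" .
qed simp

lemma gop_gop:
 assumes f: "polyP f" and "c2 > 0"
 shows "gop r1 c1 (gop r2 c2 f) x = gop (r1 * r2) (sqrt ((r2 * c1)\<^sup>2 + c2\<^sup>2)) f (x::real^'d)"
proof -
 note [measurable] = polyP_measurable[OF f]
 let ?y = "(r1 * r2) *\<^sub>R x"
 let ?g = "%(z1, z2). ?y + (r2 * c1) *\<^sub>R z1 + c2 *\<^sub>R z2 :: real^'d"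
 let ?L = "distr (stdN \<Otimes>\<^sub>M stdN) borel ?g"
 have eq: "?L = distr (stdN :: (real^'d) measure) borel (%z. ?y + sqrt ((r2 * c1)\<^sup>2 + c2\<^sup>2) *\<^sub>R z)"
  by (rule gauss_conv_distr[OF assms(2)])
 have "integrable ?L f"
  unfolding eq by (subst integrable_distr_eq) (auto intro!: integrable_gop f)
 then have int: "integrable (stdN \<Otimes>\<^sub>M stdN) (%p. f (?g p))"
  by (subst (asm) integrable_distr_eq) auto
 have "gop r1 c1 (gop r2 c2 f) x = (LINT z1|stdN. (LINT z2|stdN. f (?g (z1, z2))))"
  unfolding gop_def by (simp add: scaleR_add_right mult_ac)
 also have "... = (LINT p|(stdN \<Otimes>\<^sub>M stdN). f (?g p))"
  by (rule SG2.integral_fst'[OF int])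
 also have "... = (LINT w|?L. f w)"
  by (rule integral_distr[symmetric]) measurable
 also have "... = gop (r1 * r2) (sqrt ((r2 * c1)\<^sup>2 + c2\<^sup>2)) f x"
  unfolding eq gop_def by (rule integral_distr) measurable
 finally show ?thesis .
qed

lemma gauss_reversible_distr:
 assumes "c > 0" "r\<^sup>2 + c\<^sup>2 = 1"
 shows "distr (stdN \<Otimes>\<^sub>M stdN) (borel \<Otimes>\<^sub>M borel) (%(x, z). (x, r *\<^sub>R x + c *\<^sub>R z :: real^'d))
  = distr (stdN \<Otimes>\<^sub>M stdN) (borel \<Otimes>\<^sub>M borel) (%(x, z). (r *\<^sub>R x + c *\<^sub>R z, x))" (is "?L = ?R")
proof (rule measure_eqI)
 fix A assume "A \<in> sets ?L"
 then have [measurable]: "A \<in> sets (borel \<Otimes>\<^sub>M borel)" by simp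
 have "emeasure ?L A = (nn_integral ?L (%w. indicator A w))" by simp
 also have "... = nn_integral (stdN \<Otimes>\<^sub>M stdN) (%p. indicator A (case p of (x, z) => (x, r *\<^sub>R x + c *\<^sub>R z)))"
  by (rule nn_integral_distr) measurable
 also have "... = nn_integral stdN (%x. (nn_integral stdN (%z. indicator A (x, r *\<^sub>R x + c *\<^sub>R z))))"
  by (subst SG.nn_integral_fst[symmetric]) auto
 also have "... = nn_integral stdN (%x. (nn_integral stdN (%z. indicator A (r *\<^sub>R x + c *\<^sub>R z, x))))"
  by (rule nn_integral_gauss_reversible[of "%x y. indicator A (x, y)"]) (use assms in auto)
 also have "... = nn_integral (stdN \<Otimes>\<^sub>M stdN) (%p. indicator A (case p of (x, z) => (r *\<^sub>R x + c *\<^sub>R z, x)))"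
  by (subst SG.nn_integral_fst[symmetric]) auto
 also have "... = (nn_integral ?R (%w. indicator A w))"
  by (rule nn_integral_distr[symmetric]) measurable
 also have "... = emeasure ?R A" by simp
 finally show "emeasure ?L A = emeasure ?R A" .
qed simp

lemma gauss_reversible:
 fixes F :: "real^'d => real^'d => real"
 assumes [measurable]: "case_prod F \<in> borel_measurable (borel \<Otimes>\<^sub>M borel)" and c: "c > 0" "r\<^sup>2 + c\<^sup>2 = 1"
  and F: "!!x y. abs (F x y) <= C * (wt n x * wt n y)" "0 <= C"
 shows "(LINT x|stdN. (LINT z|stdN. F x (r *\<^sub>R x + c *\<^sub>R z)))
  = (LINT x|stdN. (LINT z|stdN. F (r *\<^sub>R x + c *\<^sub>R z) x))"
proof -
 let ?N2 = "stdN \<Otimes>\<^sub>M stdN :: ((real^'d) \<times> (real^'d)) measure"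
 have rc: "abs r <= 1" "abs c <= 1"
  unfolding abs_square_le_1[symmetric] using c(2) zero_le_power2[of r] zero_le_power2[of c] by linarith+
 have b: "C * (wt n x * (1 + norm (r *\<^sub>R x + c *\<^sub>R z)) ^ n)
   <= C * 2 ^ n * ((1 + norm x) ^ (2*n) * (1 + norm z) ^ (2*n))" for x z :: "real^'d"
 proof -
  have "wt n x * (1 + norm (r *\<^sub>R x + c *\<^sub>R z)) ^ n <= wt n x * (wt n x * (2 ^ n * wt n z))"
   using one_plus_norm_mult_le[OF rc, of x z n] by (intro mult_left_mono) auto
  also have "... <= wt n x * (wt n x * (2 ^ n * (1 + norm z) ^ (2*n)))"
   by (intro mult_left_mono one_plus_norm_power_mono) auto
  also have "... = 2 ^ n * ((1 + norm x) ^ (2*n) * (1 + norm z) ^ (2*n))"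
   unfolding mult_2 power_add by (simp only: mult_ac)
  finally show ?thesis using F(2) by (simp add: mult.assoc mult_left_mono)
 qed
 have b': "C * ((1 + norm (r *\<^sub>R x + c *\<^sub>R z)) ^ n * wt n x)
   <= C * 2 ^ n * ((1 + norm x) ^ (2*n) * (1 + norm z) ^ (2*n))" for x z :: "real^'d"
  using b[of x z] by (simp only: mult.commute[of "wt n x"])
 have i1: "integrable ?N2 (%p. case p of (x, z) => F x (r *\<^sub>R x + c *\<^sub>R z))"
  by (rule integrable_pair_poly[where C="C * 2 ^ n" and n="2 * n"])
   (auto intro: order_trans[OF F(1) b])
 have i2: "integrable ?N2 (%p. case p of (x, z) => F (r *\<^sub>R x + c *\<^sub>R z) x)"
  by (rule integrable_pair_poly[where C="C * 2 ^ n" and n="2 * n"])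
   (auto intro: order_trans[OF F(1) b'])
 have "(LINT x|stdN. (LINT z|stdN. F x (r *\<^sub>R x + c *\<^sub>R z))) = (LINT p|?N2. (case p of (x, z) => F x (r *\<^sub>R x + c *\<^sub>R z)))"
  using SG2.integral_fst'[OF i1] by simp
 also have "... = (LINT p|distr ?N2 (borel \<Otimes>\<^sub>M borel) (%(x, z). (x, r *\<^sub>R x + c *\<^sub>R z)). case_prod F p)"
  by (subst integral_distr) (auto intro!: Bochner_Integration.integral_cong)
 also have "... = (LINT p|distr ?N2 (borel \<Otimes>\<^sub>M borel) (%(x, z). (r *\<^sub>R x + c *\<^sub>R z, x)). case_prod F p)"
  by (simp only: gauss_reversible_distr[OF c])
 also have "... = (LINT p|?N2. (case p of (x, z) => F (r *\<^sub>R x + c *\<^sub>R z) x))"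
  by (subst integral_distr) (auto intro!: Bochner_Integration.integral_cong)
 also have "... = (LINT x|stdN. (LINT z|stdN. F (r *\<^sub>R x + c *\<^sub>R z) x))"
  using SG2.integral_fst'[OF i2] by simp
 finally show ?thesis .
qed

text \<open>Exchangeability of (x, rx + cz) applied to f(w)h(x), i.e. self-adjointness in L^2 of the
  Gaussian law.\<close>

lemma gop_symmetric:
 assumes f: "polyP f" and h: "polyP h" and c: "c > 0" "r\<^sup>2 + c\<^sup>2 = 1"
 shows "(LINT x|stdN. gop r c f x * h x) = (LINT x|stdN. f x * gop r c h (x::real^'d))"
proof -
 note [measurable] = polyP_measurable[OF f] polyP_measurable[OF h]
 obtain C m where C: "C > 0" "!!x. abs (f x) <= C * wt m x" using f by (rule polyPE) blast
 obtain D n where D: "D > 0" "!!x. abs (h x) <= D * wt n x" using h by (rule polyPE) blast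
 have "(LINT x|stdN. (LINT z|stdN. f (r *\<^sub>R x + c *\<^sub>R z) * h x))
   = (LINT x|stdN. (LINT z|stdN. f x * h (r *\<^sub>R x + c *\<^sub>R z)))"
 proof (rule gauss_reversible[of "%x w. f w * h x", OF _ c, where C="C * D" and n="m+n"])
  fix x y :: "real^'d"
  have "abs (f y * h x) <= (C * (1 + norm y) ^ (m+n)) * (D * (1 + norm x) ^ (m+n))"
   unfolding abs_mult using C(1) D(1)
   by (intro mult_mono order_trans[OF C(2)] order_trans[OF D(2)] mult_left_mono one_plus_norm_power_mono) auto
  then show "abs (f y * h x) <= C * D * ((1 + norm x) ^ (m+n) * (1 + norm y) ^ (m+n))" by (simp add: mult_ac)
 qed (use C D in auto)
 then show ?thesis by (simp add: gop_def)
qed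

section \<open>Hermite polynomials as eigenfunctions of the Mehler operator\<close>

fun herm :: "nat => real => real" where
 "herm 0 y = 1"
| "herm (Suc 0) y = 2 * y"
| "herm (Suc (Suc n)) y = 2 * y * herm (Suc n) y - 2 * real (Suc n) * herm n y"

text \<open>At n = 0 the truncated index \<open>n - 1\<close> is 0, but its coefficient vanishes.
  One formula thus covers both recursion clauses; the same convention is used for \<open>He\<close>
  at \<open>p i - 1\<close>.\<close>

lemma herm_Suc: "herm (Suc n) y = 2 * y * herm n y - 2 * real n * herm (n - 1) y"
 by (cases n) auto

lemma herm_DERIV: "(herm n has_real_derivative 2 * real n * herm (n - 1) y) (at y)"
proof (induction n rule: induct_nat_012)
 case (ge2 n)
 show ?case
  unfolding herm.simps(3)[abs_def]
  by (rule DERIV_cong, rule DERIV_diff, rule DERIV_mult, rule DERIV_cmult_Id, rule ge2(2), rule DERIV_cmult, rule ge2(1))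
   (simp add: herm_Suc algebra_simps)
qed (auto intro!: derivative_eq_intros simp: fun_eq_iff)

lemma funpow_deriv_exp_minus_square:
 "(deriv ^^ n) (%u. exp (- u\<^sup>2)) = (%y. (-1) ^ n * herm n y * exp (- y\<^sup>2))"
proof (induction n)
 case (Suc n)
 have "deriv (%y. (-1) ^ n * herm n y * exp (- y\<^sup>2)) y = (-1) ^ Suc n * herm (Suc n) y * exp (- y\<^sup>2)" for y
  by (rule DERIV_imp_deriv) (auto intro!: derivative_eq_intros herm_DERIV simp: herm_Suc algebra_simps)
 then show ?case by (simp only: funpow.simps o_apply Suc)
qed simp

lemma hermite1_eq: "hermite1 n y = herm n y"
proof -
 have "(-1) ^ n * exp (y\<^sup>2) * ((-1) ^ n * herm n y * exp (- y\<^sup>2)) = ((-1) ^ n * (-1) ^ n) * (exp (y\<^sup>2) * exp (- y\<^sup>2)) * herm n y"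
  by (simp only: mult_ac)
 also have "... = herm n y" by (simp add: power_mult_distrib[symmetric] exp_minus_inverse)
 finally show ?thesis unfolding hermite1_def funpow_deriv_exp_minus_square .
qed

text \<open>The factor 1/sqrt 2 makes the physicists' polynomials orthogonal for the standard
  Gaussian law instead of the weight exp(-|x|^2); the squared norms are 2^|p| p!.\<close>

definition He :: "('d::finite => nat) => real^'d => real" where
 "He p u = hermite p ((1 / sqrt 2) *\<^sub>R u)"

lemma He_upd: "He (p(i := m)) u = herm m (u $ i / sqrt 2) * (\<Prod>k\<in>UNIV - {i}. herm (p k) (u $ k / sqrt 2))"
 unfolding He_def hermite_def hermite1_eq
 by (subst prod.remove[of UNIV i]) (auto intro!: prod.cong)

lemma He_split: "He p u = herm (p i) (u $ i / sqrt 2) * (\<Prod>k\<in>UNIV - {i}. herm (p k) (u $ k / sqrt 2))"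
 using He_upd[of p i "p i" u] by simp

lemma He_Suc: "He (p(i := Suc (p i))) u = sqrt 2 * (u $ i * He p u) - 2 * real (p i) * He (p(i := p i - 1)) u"
proof -
 have "2 * (u $ i / sqrt 2) = sqrt 2 * u $ i" by (simp add: field_simps)
 then show ?thesis
  unfolding He_upd He_split[of p u i] herm_Suc by (simp add: algebra_simps)
qed

lemma polyP_He [intro, simp]: "polyP (He p)"
proof -
 have "polyP (%u::real^'a. herm n (u $ k / sqrt 2))" for n k
 proof (induction n rule: induct_nat_012)
  case 1
  have "polyP (%u::real^'a. (2 / sqrt 2) * u $ k)" by (intro polyP_mult polyP_component polyP_const)
  then show ?case by (simp add: field_simps)
 next
  case (ge2 n)
  have "polyP (%u::real^'a. (2 / sqrt 2) * u $ k * herm (Suc n) (u $ k / sqrt 2) - 2 * real (Suc n) * herm n (u $ k / sqrt 2))"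
   by (intro polyP_diff polyP_mult polyP_component polyP_const ge2)
  then show ?case by (simp only: herm.simps times_divide_eq_left times_divide_eq_right)
 qed simp
 then have "polyP (%u::real^'a. \<Prod>k\<in>UNIV. herm (p k) (u $ k / sqrt 2))" by (intro polyP_prod)
 then show ?thesis by (simp add: He_def[abs_def] hermite_def hermite1_eq)
qed

lemma He_measurable [measurable]: "He p \<in> borel_measurable borel"
 by (rule polyP_measurable) simp

lemma He_DERIV:
 "((%tau. He p (z + tau *\<^sub>R axis i 1)) has_real_derivative sqrt 2 * real (p i) * He (p(i := p i - 1)) z) (at 0)"
proof -
 have "((%tau. herm (p i) (z $ i / sqrt 2 + tau / sqrt 2)) has_real_derivative
   2 * real (p i) * herm (p i - 1) (z $ i / sqrt 2 + 0 / sqrt 2) * (1 / sqrt 2)) (at 0)"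
  using DERIV_add[OF DERIV_const[of "z $ i / sqrt 2"] DERIV_cdivide[OF DERIV_ident, where c="sqrt 2"]]
  by (intro DERIV_chain2[OF herm_DERIV]) simp
 then have "((%tau. herm (p i) ((z $ i + tau) / sqrt 2)) has_real_derivative
   (2 / sqrt 2) * real (p i) * herm (p i - 1) (z $ i / sqrt 2)) (at 0)"
  by (simp only: add_divide_distrib div_0 add_0_right times_divide_eq_left times_divide_eq_right mult_1_right)
 moreover have "2 / sqrt 2 = sqrt 2" by (rule real_div_sqrt) simp
 ultimately have "((%tau. herm (p i) ((z $ i + tau) / sqrt 2)) has_real_derivative
   sqrt 2 * real (p i) * herm (p i - 1) (z $ i / sqrt 2)) (at 0)" by simp
 note D = DERIV_cmult_right[OF this, of "\<Prod>k\<in>UNIV - {i}. herm (p k) (z $ k / sqrt 2)"]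
 have P: "(\<Prod>k\<in>UNIV - {i}. herm (p k) ((z + tau *\<^sub>R axis i 1) $ k / sqrt 2)) = (\<Prod>k\<in>UNIV - {i}. herm (p k) (z $ k / sqrt 2))" for tau
  by (rule prod.cong) (auto simp: axis_def)
 show ?thesis
  unfolding He_upd He_split[of p _ i] P using D by (simp add: mult_ac)
qed

lemma He_0 [simp]: "He (%_. 0) u = 1"
 by (simp add: He_def hermite_def hermite1_eq)

lemma mi_abs_upd_Suc: "mi_abs (p(i := Suc (p i))) = Suc (mi_abs p)"
 unfolding mi_abs_def by (subst (1 2) sum.remove[of UNIV i]) (auto intro!: sum.cong)

lemma mi_abs_upd_pred: "p i > 0 ==> Suc (mi_abs (p(i := p i - 1))) = mi_abs p"
 using mi_abs_upd_Suc[of "p(i := p i - 1)" i] by simp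

text \<open>The recurrence for \<open>He\<close> also refers to p with one entry lowered, so the
  step offers its hypothesis for all indices of degree at most |p| and not for p alone.\<close>

lemma multi_index_induct [case_names zero Suc]:
 fixes P :: "('d::finite => nat) => bool"
 assumes "P (%_. 0)" and "!!p i. (!!q. mi_abs q <= mi_abs p ==> P q) ==> P (p(i := Suc (p i)))"
 shows "P p"
proof (induction "mi_abs p" arbitrary: p rule: less_induct)
 case less
 show ?case
 proof (cases "p = (%_. 0)")
  case False
  then obtain i where i: "p i > 0" by (auto simp: fun_eq_iff)
  let ?q = "p(i := p i - 1)"
  have "P (?q(i := Suc (?q i)))"
   by (rule assms(2)) (use mi_abs_upd_pred[of p i, OF i] less in auto)
  then show ?thesis using i by simp
 qed (use assms in simp)
qed

text \<open>The coordinate is r x_i + c z_i; Gaussian integration by parts turns z_i into a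
  derivative, and the chain rule supplies the second factor c.\<close>

lemma gop_component_mult:
 fixes h h' :: "real^'d => real"
 assumes h: "polyP h" "polyP h'"
  and d: "!!z. ((%tau. h (z + tau *\<^sub>R axis i 1)) has_real_derivative h' z) (at 0)"
 shows "gop r c (%u. u $ i * h u) x = r * x $ i * gop r c h x + c\<^sup>2 * gop r c h' x"
proof -
 have "((%tau. h (r *\<^sub>R x + c *\<^sub>R (z + tau *\<^sub>R axis i 1))) has_real_derivative c * h' (r *\<^sub>R x + c *\<^sub>R z)) (at 0)" for z
 proof -
  have "((%tau. h ((r *\<^sub>R x + c *\<^sub>R z) + (c * tau) *\<^sub>R axis i 1)) has_real_derivative
    h' ((r *\<^sub>R x + c *\<^sub>R z) + (c * 0) *\<^sub>R axis i 1) * c) (at 0)"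
   by (rule DERIV_chain2[where g="%tau. c * tau", OF DERIV_direction_shift[OF d]]) (auto intro!: derivative_eq_intros)
  then show ?thesis by (simp add: algebra_simps)
 qed
 note ibp = gauss_ibp[OF polyP_affine[OF h(1)] polyP_mult[OF polyP_const polyP_affine[OF h(2)]] this]
 have "gop r c (%u. u $ i * h u) x = (LINT z|stdN. (r * x $ i) * h (r *\<^sub>R x + c *\<^sub>R z) + c * (h (r *\<^sub>R x + c *\<^sub>R z) * z $ i))"
  unfolding gop_def by (simp add: algebra_simps)
 also have "... = (r * x $ i) * gop r c h x + c * (LINT z|stdN. h (r *\<^sub>R x + c *\<^sub>R z) * z $ i)"
 proof -
  have "integrable stdN (%z. c * (h (r *\<^sub>R x + c *\<^sub>R z) * z $ i))"
   by (intro integrable_mult_right integrable_polyP polyP_mult polyP_affine h(1) polyP_component)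
  moreover have "integrable stdN (%z. (r * x $ i) * h (r *\<^sub>R x + c *\<^sub>R z))"
   by (intro integrable_mult_right integrable_polyP polyP_affine h(1))
  ultimately show ?thesis unfolding gop_def by (simp add: Bochner_Integration.integral_add)
 qed
 finally show ?thesis unfolding ibp by (simp add: gop_def power2_eq_square mult_ac)
qed

text \<open>In the recurrence, integration by parts contributes 2 c^2 p_i, which combines with -2
  p_i to -2 r^2 p_i. This is exactly the factor r^2 missing between the degrees |p| - 1 and |p| +
  1.\<close>

lemma gop_He:
 assumes rc: "r\<^sup>2 + c\<^sup>2 = 1"
 shows "gop r c (He p) x = r ^ mi_abs p * He p (x::real^'d::finite)"
proof (induction p rule: multi_index_induct)
 case zero
 have "He (%_. 0) = (%_::real^'d. 1)" by (simp add: fun_eq_iff)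
 then show ?case by (simp add: mi_abs_def)
next
 case (Suc p i)
 let ?q = "p(i := p i - 1)"
 have "mi_abs ?q <= mi_abs p" by (cases "p i") (auto simp: mi_abs_def intro!: sum_mono)
 have "gop r c (He (p(i := Suc (p i)))) x
   = gop r c (%u. sqrt 2 * (u $ i * He p u) - 2 * real (p i) * He ?q u) x"
  by (simp add: He_Suc[abs_def])
 also have "... = sqrt 2 * gop r c (%u. u $ i * He p u) x - 2 * real (p i) * gop r c (He ?q) x"
  by (subst gop_diff) (auto simp: gop_cmult intro!: polyP_mult)
 also have "gop r c (%u. u $ i * He p u) x = r * x $ i * gop r c (He p) x + c\<^sup>2 * (sqrt 2 * real (p i) * gop r c (He ?q) x)"
  by (subst gop_component_mult[OF polyP_He _ He_DERIV]) (auto simp: gop_cmult intro!: polyP_mult)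
 also have "gop r c (He p) x = r ^ mi_abs p * He p x" by (rule Suc) simp
 also have "gop r c (He ?q) x = r ^ mi_abs ?q * He ?q x" by (rule Suc) fact
 also have "sqrt 2 * (r * x $ i * (r ^ mi_abs p * He p x) + c\<^sup>2 * (sqrt 2 * real (p i) * (r ^ mi_abs ?q * He ?q x))) -
   2 * real (p i) * (r ^ mi_abs ?q * He ?q x)
  = r ^ Suc (mi_abs p) * (sqrt 2 * (x $ i * He p x)) - (2 - 2 * c\<^sup>2) * real (p i) * r ^ mi_abs ?q * He ?q x"
  by (simp add: algebra_simps)
 also have "2 - 2 * c\<^sup>2 = 2 * r\<^sup>2" using rc by simp
 also have "2 * r\<^sup>2 * real (p i) * r ^ mi_abs ?q * He ?q x = r ^ Suc (mi_abs p) * (2 * real (p i) * He ?q x)"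
 proof (cases "p i = 0")
  case False
  then have "Suc (mi_abs p) = 2 + mi_abs ?q" using mi_abs_upd_pred[of p i] by simp
  then show ?thesis by (simp only: power_add) (simp add: mult_ac)
 qed simp
 finally show ?case by (simp only: He_Suc mi_abs_upd_Suc right_diff_distrib)
qed

text \<open>Raising p_i means applying sqrt 2 (z_i - d/dz_i) to \<open>He p\<close>, and this
  operator is the adjoint of sqrt 2 d/dz_i in L^2 of the Gaussian law.\<close>

lemma integral_mult_He_Suc:
 fixes h h' :: "real^'d::finite => real"
 assumes h: "polyP h" "polyP h'"
  and d: "!!z. ((%tau. h (z + tau *\<^sub>R axis i 1)) has_real_derivative h' z) (at 0)"
 shows "(LINT z|stdN. h z * He (p(i := Suc (p i))) z) = sqrt 2 * (LINT z|stdN. h' z * He p z)"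
proof -
 let ?q = "p(i := p i - 1)"
 have "((%tau. h (z + tau *\<^sub>R axis i 1) * He p (z + tau *\<^sub>R axis i 1)) has_real_derivative
   h' z * He p z + h z * (sqrt 2 * real (p i) * He ?q z)) (at 0)" for z
  using DERIV_mult[OF d[of z] He_DERIV[of p z i]] by (simp add: algebra_simps)
 from gauss_ibp[OF polyP_mult[OF h(1) polyP_He] polyP_add[OF polyP_mult[OF h(2) polyP_He]
   polyP_mult[OF h(1) polyP_mult[OF polyP_const polyP_He]]] this]
 have "(LINT z|stdN. h z * He p z * z $ i) = (LINT z|stdN. h' z * He p z + h z * (sqrt 2 * real (p i) * He ?q z))" .
 also have "... = (LINT z|stdN. h' z * He p z) + (LINT z|stdN. (sqrt 2 * real (p i)) * (h z * He ?q z))"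
  using h by (subst Bochner_Integration.integral_add) (auto intro!: integrable_polyP polyP_mult simp: mult_ac)
 finally have 1: "(LINT z|stdN. h z * He p z * z $ i)
  = (LINT z|stdN. h' z * He p z) + sqrt 2 * real (p i) * (LINT z|stdN. h z * He ?q z)" by simp
 have "(LINT z|stdN. h z * He (p(i := Suc (p i))) z)
  = (LINT z|stdN. sqrt 2 * (h z * He p z * z $ i) - 2 * real (p i) * (h z * He ?q z))"
  by (simp add: He_Suc algebra_simps)
 also have "... = sqrt 2 * (LINT z|stdN. h z * He p z * z $ i) - 2 * real (p i) * (LINT z|stdN. h z * He ?q z)"
  using h by (subst Bochner_Integration.integral_diff) (auto intro!: integrable_mult_right integrable_polyP polyP_mult)
 moreover have "sqrt 2 * (sqrt 2 * a) = 2 * a" for a :: real by (simp add: mult.assoc[symmetric])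
 ultimately show ?thesis unfolding 1 by (simp add: algebra_simps)
qed

text \<open>Raising operators are moved across one at a time, each lowering the other index. The
  pairing survives only if both indices are exhausted together, and the factors 2 q_i collected on
  the way build 2^|p| p!.\<close>

lemma He_orthogonal:
 "(LINT z|stdN. He q z * He p (z::real^'d::finite)) = (if p = q then 2 ^ mi_abs p * real (mi_fact p) else 0)"
proof (induction p arbitrary: q rule: multi_index_induct)
 case zero
 show ?case
 proof (cases "q = (%_. 0)")
  case True
  then show ?thesis by (simp add: mi_abs_def mi_fact_def SG.prob_space[simplified])
 next
  case False
  then obtain i where i: "q i > 0" by (auto simp: fun_eq_iff)
  have "(LINT z|stdN. 1 * He ((q(i := q i - 1))(i := Suc ((q(i := q i - 1)) i))) z)
    = sqrt 2 * (LINT z|stdN. 0 * He (q(i := q i - 1)) (z::real^'d))"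
   by (rule integral_mult_He_Suc) auto
  then show ?thesis using i False by auto
 qed
next
 case (Suc p i)
 let ?q = "q(i := q i - 1)"
 have "(LINT z|stdN. He q z * He (p(i := Suc (p i))) (z::real^'d))
   = sqrt 2 * (LINT z|stdN. (sqrt 2 * real (q i) * He ?q z) * He p z)"
  by (rule integral_mult_He_Suc[OF _ _ He_DERIV]) (auto intro!: polyP_mult)
 also have "... = 2 * real (q i) * (LINT z|stdN. He ?q z * He p z)"
  by (simp add: mult.assoc)
 also have "... = 2 * real (q i) * (if p = ?q then 2 ^ mi_abs p * real (mi_fact p) else 0)"
  by (subst Suc) auto
 also have "... = (if p(i := Suc (p i)) = q then 2 ^ mi_abs (p(i := Suc (p i))) * real (mi_fact (p(i := Suc (p i)))) else 0)"
 proof (cases "p(i := Suc (p i)) = q")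
  case True
  have "mi_fact (p(i := Suc (p i))) = Suc (p i) * mi_fact p"
  proof -
   have "(\<Prod>k\<in>UNIV - {i}. fact ((p(i := Suc (p i))) k)) = (\<Prod>k\<in>UNIV - {i}. fact (p k) :: nat)"
    by (rule prod.cong) auto
   then show ?thesis unfolding mi_fact_def
    by (simp only: prod.remove[OF finite UNIV_I[of i]] fun_upd_same fact_Suc of_nat_id mult.assoc)
  qed
  moreover have "q i = Suc (p i)" "?q = p" using True by auto
  ultimately show ?thesis unfolding if_P[OF True] by (simp only: mi_abs_upd_Suc) (simp add: algebra_simps)
 next
  case False
  have "q i = 0 \<or> p ~= ?q"
  proof (rule ccontr)
   assume *: "\<not> (q i = 0 \<or> p ~= ?q)"
   then have "?q(i := Suc (?q i)) = q" by (auto simp: fun_eq_iff)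
   then show False using * False by simp
  qed
  then show ?thesis using False by auto
 qed
 finally show ?case .
qed

subsection \<open>Decay of the Mehler semigroup\<close>

interpretation SGL: pair_sigma_finite "stdN :: (real^'d) measure" "lborel :: real measure" ..

lemma std_gauss_DERIV_line:
 "((%tau. std_gauss (v + tau *\<^sub>R w)) has_real_derivative - (w \<bullet> (v + tau *\<^sub>R w)) * std_gauss (v + tau *\<^sub>R w)) (at tau)"
proof -
 have n: "(norm (v + tau *\<^sub>R w))\<^sup>2 = v \<bullet> v + 2 * tau * (w \<bullet> v) + tau\<^sup>2 * (w \<bullet> w)" for tau
  unfolding power2_norm_eq_inner
  by (simp add: inner_simps inner_commute[of v w] power2_eq_square algebra_simps)
 show ?thesis unfolding std_gauss_def n
  by (auto intro!: derivative_eq_intros simp: inner_simps field_simps)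
qed

lemma poly_bound_affine:
 assumes "!!x. abs (f x) <= C * wt n x" "0 <= C" "norm A <= R" "0 <= c"
 shows "abs (f (A + c *\<^sub>R z)) <= C * (1 + R + c) ^ n * wt n z"
proof -
 have "1 + norm (A + c *\<^sub>R z) <= (1 + R + c) * (1 + norm z)"
  using one_plus_norm_affine_le[of A c z] assms(3,4)
  by (elim order_trans) (intro mult_right_mono, auto)
 then have "(1 + norm (A + c *\<^sub>R z)) ^ n <= ((1 + R + c) * (1 + norm z)) ^ n"
  by (intro power_mono) auto
 then show ?thesis using assms(1)[of "A + c *\<^sub>R z"] mult_left_mono[OF _ assms(2)]
  by (fastforce simp: power_mult_distrib mult_ac)
qed

lemma polyP_inner: "polyP (%z. a \<bullet> z)"
proof (rule polyPI[of _ "norm a" 1])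
 show "abs (a \<bullet> x) <= norm a * wt 1 x" for x
  using Cauchy_Schwarz_ineq2[of a x] norm_ge_zero[of a]
  unfolding power_one_right distrib_left mult_1_right by linarith
qed measurable

text \<open>Since f is only measurable, differences are taken on the density: translating z by
  (r/c)x moves x out of f and into the Gaussian factor. Differentiating that factor gives
  \<open>g i\<close>, the i-th partial derivative of the smoothed function; the form integrated
  along a segment avoids any claim of pointwise differentiability.\<close>

lemma gop_gradient:
 fixes f :: "real^'d => real" and r c :: real
 assumes f: "polyP f" and c: "c > 0"
 defines "g \<equiv> (%i x. (r / c) * (LINT z|stdN. f (r *\<^sub>R x + c *\<^sub>R z) * z $ i))"
 shows "gop r c f (y + a) - gop r c f y = (\<Sum>i\<in>UNIV. a $ i * (LINT tau|lborel. indicator {0..1} tau * g i (y + tau *\<^sub>R a)))"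
proof -
 note [measurable] = polyP_measurable[OF f]
 have [measurable]: "(%z::real^'d. z $ i) \<in> borel_measurable borel" for i by (rule polyP_measurable) auto
 define \<rho> where "\<rho> = r / c"
 have c\<rho>: "c * \<rho> = r" using c by (simp add: \<rho>_def)
 have rep: "(LINT z|lborel. f (r *\<^sub>R x + c *\<^sub>R z) * k z * std_gauss z) = (LINT z|lborel. f (c *\<^sub>R z) * k (z - \<rho> *\<^sub>R x) * std_gauss (z - \<rho> *\<^sub>R x))"
  if [measurable]: "k \<in> borel_measurable borel" for k x
  by (subst integral_lborel_translate[of "%z. f (c *\<^sub>R z) * k (z - \<rho> *\<^sub>R x) * std_gauss (z - \<rho> *\<^sub>R x)" "\<rho> *\<^sub>R x", symmetric])
   (auto simp: scaleR_add_right c\<rho> add.commute)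
 \<comment> \<open>The derivative in tau of f(cz) times the density shifted by \<rho>(y + tau a); f
   no longer depends on tau.\<close>
 define Q where "Q = (%tau z. f (c *\<^sub>R z) * (\<rho> * (a \<bullet> (z - \<rho> *\<^sub>R (y + tau *\<^sub>R a)))) * std_gauss (z - \<rho> *\<^sub>R (y + tau *\<^sub>R a)))"
 have [measurable]: "(%p. Q (fst p) (snd p)) \<in> borel_measurable (borel \<Otimes>\<^sub>M borel)"
  unfolding Q_def by measurable
 have ftc: "(LINT tau|lborel. indicator {0..1::real} tau * Q tau z) = f (c *\<^sub>R z) * std_gauss (z - \<rho> *\<^sub>R (y + a)) - f (c *\<^sub>R z) * std_gauss (z - \<rho> *\<^sub>R y)" for z
 proof -
  have "(LINT tau|lborel. indicator {0..1::real} tau *\<^sub>R Q tau z) = f (c *\<^sub>R z) * std_gauss ((z - \<rho> *\<^sub>R y) + 1 *\<^sub>R (- \<rho> *\<^sub>R a)) - f (c *\<^sub>R z) * std_gauss ((z - \<rho> *\<^sub>R y) + 0 *\<^sub>R (- \<rho> *\<^sub>R a))"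
  proof (rule integral_FTC_atLeastAtMost)
   fix tau :: real
   have e: "(z - \<rho> *\<^sub>R y) + tau *\<^sub>R (- \<rho> *\<^sub>R a) = z - \<rho> *\<^sub>R (y + tau *\<^sub>R a)"
    by (simp add: algebra_simps)
   have "((%tau. f (c *\<^sub>R z) * std_gauss ((z - \<rho> *\<^sub>R y) + tau *\<^sub>R (- \<rho> *\<^sub>R a))) has_real_derivative Q tau z) (at tau within {0..1})"
    using DERIV_cmult[OF has_field_derivative_at_within[OF std_gauss_DERIV_line[of "z - \<rho> *\<^sub>R y" "- \<rho> *\<^sub>R a" tau]], of "f (c *\<^sub>R z)" "{0..1}"]
    unfolding e Q_def by (simp add: algebra_simps)
   then show "((%tau. f (c *\<^sub>R z) * std_gauss ((z - \<rho> *\<^sub>R y) + tau *\<^sub>R (- \<rho> *\<^sub>R a))) has_vector_derivative Q tau z) (at tau within {0..1})"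
    by (simp add: has_real_derivative_iff_has_vector_derivative)
  next
   show "continuous_on {0..1} (%tau. Q tau z)" unfolding Q_def std_gauss_def by (intro continuous_intros) auto
  qed simp
  then show ?thesis by (simp add: algebra_simps)
 qed
 obtain C n where C: "C > 0" "!!x. abs (f x) <= C * wt n x" using f by (rule polyPE) blast
 define C' where "C' = C * (1 + abs r * (norm y + norm a) + c) ^ n"
 have C': "C' >= 0" unfolding C'_def using C c by simp
 define B where "B = (LINT z|(stdN::(real^'d) measure). C' * abs \<rho> * norm a * (1 + norm z) ^ Suc n)"
 have bz: "abs (f (r *\<^sub>R (y + tau *\<^sub>R a) + c *\<^sub>R z) * (\<rho> * (a \<bullet> z))) <= C' * abs \<rho> * norm a * (1 + norm z) ^ Suc n"
  if "0 <= tau" "tau <= 1" for tau z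
 proof -
  have "norm (y + tau *\<^sub>R a) <= norm y + norm a"
   using norm_triangle_ineq[of y "tau *\<^sub>R a"] that mult_left_le_one_le[of "norm a" tau] by simp
  then have "norm (r *\<^sub>R (y + tau *\<^sub>R a)) <= abs r * (norm y + norm a)" by (simp add: mult_left_mono)
  from poly_bound_affine[of f, OF C(2) less_imp_le[OF C(1)] this less_imp_le[OF c], of z]
  have "abs (f (r *\<^sub>R (y + tau *\<^sub>R a) + c *\<^sub>R z)) <= C' * wt n z" by (simp add: C'_def)
  moreover have "abs (\<rho> * (a \<bullet> z)) <= abs \<rho> * (norm a * (1 + norm z))"
   unfolding abs_mult
   by (intro mult_left_mono order_trans[OF Cauchy_Schwarz_ineq2]) auto
  ultimately have "abs (f (r *\<^sub>R (y + tau *\<^sub>R a) + c *\<^sub>R z) * (\<rho> * (a \<bullet> z))) <= (C' * wt n z) * (abs \<rho> * (norm a * (1 + norm z)))"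
   unfolding abs_mult[of "f _"] using C' by (intro mult_mono) auto
  then show ?thesis by (simp add: mult_ac)
 qed
 have pz: "polyP (%z. f (r *\<^sub>R x + c *\<^sub>R z) * (\<rho> * (a \<bullet> z)))" for x
  by (rule polyP_mult[OF polyP_affine[OF f] polyP_mult[OF polyP_const polyP_inner]])
 have Qt: "(LINT z|lborel. Q tau z) = (LINT z|stdN. f (r *\<^sub>R (y + tau *\<^sub>R a) + c *\<^sub>R z) * (\<rho> * (a \<bullet> z)))" for tau
  unfolding Q_def
  by (subst integral_stdN, measurable, subst rep) auto
 have sh: "r *\<^sub>R x + c *\<^sub>R (z + (- \<rho>) *\<^sub>R x) = c *\<^sub>R z" for x z :: "real^'d"
  by (simp add: scaleR_diff_right c\<rho>)
 have Qi: "integrable lborel (Q tau)" for tau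
  using integrable_lborel_translate[OF integrable_polyP_lborel[OF pz[of "y + tau *\<^sub>R a"]], of "- \<rho> *\<^sub>R (y + tau *\<^sub>R a)"]
  unfolding Q_def sh by (simp only: scaleR_minus_left add_uminus_conv_diff)
 have Qabs: "(LINT z|lborel. abs (Q tau z)) = (LINT z|stdN. abs (f (r *\<^sub>R (y + tau *\<^sub>R a) + c *\<^sub>R z) * (\<rho> * (a \<bullet> z))))" for tau
  unfolding Q_def
  by (subst integral_lborel_translate[of _ "\<rho> *\<^sub>R (y + tau *\<^sub>R a)", symmetric], measurable,
    subst integral_stdN, measurable)
   (simp add: abs_mult scaleR_add_right[of c] c\<rho> add.commute)
 have int: "integrable (lborel \<Otimes>\<^sub>M lborel) (%(tau, z). indicator {0..1::real} tau * Q tau z)"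
 proof (rule lborel_pair.Fubini_integrable)
  show "integrable lborel (%tau::real. (LINT z|lborel. norm (case (tau, z) of (tau, z) => indicator {0..1} tau * Q tau z)))"
  proof (rule Bochner_Integration.integrable_bound[of _ "%tau::real. indicator {0..1} tau * B"])
   show "integrable lborel (%tau::real. indicator {0..1} tau * B)"
    by (intro integrable_mult_left integrable_real_indicator) auto
   have "(LINT z|lborel. abs (Q tau z)) <= B" if "0 <= tau" "tau <= 1" for tau
    unfolding Qabs B_def using pz bz[OF that]
    by (intro integral_mono integrable_polyP polyP_abs integrable_mult_right std_gauss_moment) auto
   moreover have "0 <= (LINT z|lborel. abs (Q tau z))" for tau by simp
   ultimately show "AE tau in lborel. norm (LINT z|lborel. norm (case (tau, z) of (tau, z) => indicator {0..1} tau * Q tau z))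
     <= norm (indicator {0..1} tau * B)"
    by (intro AE_I2) (auto simp: abs_mult split: split_indicator intro: order_trans[OF _ abs_ge_self])
  qed measurable
  show "AE tau in lborel. integrable lborel (%z. case (tau, z) of (tau, z) => indicator {0..1::real} tau * Q tau z)"
   unfolding prod.case by (intro AE_I2 integrable_mult_right Qi)
 qed measurable
 have i0: "integrable lborel (%z. f (c *\<^sub>R z) * std_gauss (z - \<rho> *\<^sub>R x))" for x
  using integrable_lborel_translate[OF integrable_polyP_lborel[OF polyP_affine[OF f, of "r *\<^sub>R x" c]], of "- \<rho> *\<^sub>R x"]
  unfolding sh by (simp only: scaleR_minus_left add_uminus_conv_diff)
 have g0: "gop r c f x = (LINT z|lborel. f (c *\<^sub>R z) * std_gauss (z - \<rho> *\<^sub>R x))" for x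
  unfolding gop_def using rep[of "%_. 1" x] by (subst integral_stdN) auto
 have gi: "integrable stdN (%z. f (r *\<^sub>R x + c *\<^sub>R z) * z $ i)" for x i
  by (rule integrable_polyP[OF polyP_mult[OF polyP_affine[OF f] polyP_component]])
 have "gop r c f (y + a) - gop r c f y = (LINT z|lborel. (LINT tau|lborel. indicator {0..1::real} tau * Q tau z))"
  unfolding g0 ftc by (rule Bochner_Integration.integral_diff[symmetric, OF i0 i0])
 also have "... = (LINT tau|lborel. (LINT z|lborel. indicator {0..1::real} tau * Q tau z))"
  by (rule lborel_pair.Fubini_integral[OF int])
 also have "... = (LINT tau|lborel. (\<Sum>i\<in>UNIV. a $ i * (indicator {0..1} tau * g i (y + tau *\<^sub>R a))))"
 proof (rule Bochner_Integration.integral_cong)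
  fix tau :: real
  have "(LINT z|lborel. Q tau z) = (LINT z|stdN. (\<Sum>i\<in>UNIV. \<rho> * a $ i * (f (r *\<^sub>R (y + tau *\<^sub>R a) + c *\<^sub>R z) * z $ i)))"
   unfolding Qt inner_vec_def by (simp add: sum_distrib_left sum_distrib_right mult_ac)
  also have "... = (\<Sum>i\<in>UNIV. a $ i * g i (y + tau *\<^sub>R a))"
  proof (subst Bochner_Integration.integral_sum)
   show "(\<Sum>i\<in>UNIV. (LINT z|stdN. \<rho> * a $ i * (f (r *\<^sub>R (y + tau *\<^sub>R a) + c *\<^sub>R z) * z $ i))) = (\<Sum>i\<in>UNIV. a $ i * g i (y + tau *\<^sub>R a))"
    unfolding integral_mult_right_zero g_def \<rho>_def[symmetric] by (simp only: mult_ac)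
  qed (intro integrable_mult_right gi)
  finally show "(LINT z|lborel. indicator {0..1::real} tau * Q tau z) = (\<Sum>i\<in>UNIV. a $ i * (indicator {0..1} tau * g i (y + tau *\<^sub>R a)))"
   by (simp add: sum_distrib_left mult_ac)
 qed simp
 also have "... = (\<Sum>i\<in>UNIV. a $ i * (LINT tau|lborel. indicator {0..1} tau * g i (y + tau *\<^sub>R a)))"
 proof -
  have [measurable]: "g i \<in> borel_measurable borel" for i unfolding g_def by measurable
  have "integrable lborel (%tau::real. indicator {0..1} tau * g i (y + tau *\<^sub>R a))" for i
  proof (rule Bochner_Integration.integrable_bound[of _ "%tau::real. indicator {0..1} tau * (abs (r / c) * (LINT z|(stdN::(real^'d) measure). C' * (1 + norm z) ^ Suc n))"])
   show "integrable lborel (%tau::real. indicator {0..1} tau * (abs (r / c) * (LINT z|(stdN::(real^'d) measure). C' * (1 + norm z) ^ Suc n)))"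
    by (intro integrable_mult_left integrable_real_indicator) auto
   have "abs (LINT z|stdN. f (r *\<^sub>R (y + tau *\<^sub>R a) + c *\<^sub>R z) * z $ i) <= (LINT z|(stdN::(real^'d) measure). C' * (1 + norm z) ^ Suc n)"
    if "0 <= tau" "tau <= 1" for tau
   proof (rule abs_integral_le)
    show "integrable stdN (%z::real^'d. C' * (1 + norm z) ^ Suc n)"
     by (intro integrable_mult_right std_gauss_moment)
    have "norm (y + tau *\<^sub>R a) <= norm y + norm a"
     using norm_triangle_ineq[of y "tau *\<^sub>R a"] that mult_left_le_one_le[of "norm a" tau] by simp
    then have *: "norm (r *\<^sub>R (y + tau *\<^sub>R a)) <= abs r * (norm y + norm a)" by (simp add: mult_left_mono)
    show "AE z in stdN. abs (f (r *\<^sub>R (y + tau *\<^sub>R a) + c *\<^sub>R z) * z $ i) <= C' * (1 + norm z) ^ Suc n"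
    proof (rule AE_I2)
     fix z :: "real^'d"
     have "abs (f (r *\<^sub>R (y + tau *\<^sub>R a) + c *\<^sub>R z) * z $ i) <= (C' * wt n z) * (1 + norm z)"
      unfolding abs_mult using C' component_le_norm_cart[of z i]
      by (intro mult_mono poly_bound_affine[of f, OF C(2) less_imp_le[OF C(1)] * less_imp_le[OF c], of z, folded C'_def]) auto
     then show "abs (f (r *\<^sub>R (y + tau *\<^sub>R a) + c *\<^sub>R z) * z $ i) <= C' * (1 + norm z) ^ Suc n" by (simp add: mult_ac)
    qed
   qed
   then show "AE tau in lborel. norm (indicator {0..1::real} tau * g i (y + tau *\<^sub>R a)) <= norm (indicator {0..1} tau * (abs (r / c) * (LINT z|(stdN::(real^'d) measure). C' * (1 + norm z) ^ Suc n)))"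
    unfolding g_def
    by (intro AE_I2) (auto simp: abs_mult abs_of_nonneg[OF C'] split: split_indicator intro!: mult_left_mono divide_right_mono intro: order_trans[OF _ abs_ge_self])
  qed measurable
  then show ?thesis by (subst Bochner_Integration.integral_sum) auto
 qed
 finally show ?thesis .
qed

text \<open>The operator commutes with the gradient up to one factor r, because moving y by a moves
  the argument of f by ra. This factor is the source of the decay in
  \<open>mehler_decay\<close>.\<close>

lemma gop_line_diff:
 fixes f :: "real^'d => real"
 assumes f: "polyP f" and g: "!!i. polyP (g i)" and c: "c >= 0"
  and grad: "!!x a. f (x + a) - f x = (\<Sum>i\<in>UNIV. a $ i * (LINT tau|lborel. indicator {0..1} tau * g i (x + tau *\<^sub>R a)))"
 shows "gop r c f (y + a) - gop r c f y = r * (\<Sum>i\<in>UNIV. a $ i * (LINT tau|lborel. indicator {0..1} tau * gop r c (g i) (y + tau *\<^sub>R a)))"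
proof -
 note [measurable] = polyP_measurable[OF g]
 have int: "integrable (stdN \<Otimes>\<^sub>M lborel) (%(z, tau). indicator {0..1::real} tau * g i (r *\<^sub>R y + c *\<^sub>R z + tau *\<^sub>R (r *\<^sub>R a)))" for i
 proof -
  obtain C n where C: "C > 0" "!!x. abs (g i x) <= C * wt n x" using g[of i] by (rule polyPE) blast
  define C' where "C' = C * (1 + (norm (r *\<^sub>R y) + norm (r *\<^sub>R a)) + c) ^ n"
  have C': "C' >= 0" unfolding C'_def using C c by simp
  have b: "abs (g i (r *\<^sub>R y + c *\<^sub>R z + tau *\<^sub>R (r *\<^sub>R a))) <= C' * wt n z" if "0 <= tau" "tau <= 1" for z tau
  proof -
   have *: "norm (r *\<^sub>R y + tau *\<^sub>R (r *\<^sub>R a)) <= norm (r *\<^sub>R y) + norm (r *\<^sub>R a)"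
   proof -
    have "norm (tau *\<^sub>R (r *\<^sub>R a)) <= norm (r *\<^sub>R a)"
     using mult_left_le_one_le[of "norm (r *\<^sub>R a)" tau] that
     by (simp only: norm_scaleR[of tau] abs_of_nonneg norm_ge_zero)
    then show ?thesis using norm_triangle_ineq[of "r *\<^sub>R y" "tau *\<^sub>R (r *\<^sub>R a)"] by linarith
   qed
   from poly_bound_affine[of "g i", OF C(2) less_imp_le[OF C(1)] * c, of z]
   show ?thesis by (simp add: C'_def add_ac)
  qed
  have m: "integrable (stdN \<Otimes>\<^sub>M lborel) (%(z::real^'d, tau). C' * wt n z * indicator {0..1::real} tau)"
   using C' by (intro SGL.Fubini_integrable) (auto intro!: integrable_mult_right std_gauss_moment integrable_real_indicator simp: abs_mult)
  show ?thesis
   by (rule Bochner_Integration.integrable_bound[OF m])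
    (auto intro!: AE_I2 simp: abs_mult C' split: split_indicator intro: b[simplified])
 qed
 have i1: "integrable stdN (%z. (LINT tau|lborel. indicator {0..1::real} tau * g i (r *\<^sub>R y + c *\<^sub>R z + tau *\<^sub>R (r *\<^sub>R a))))" for i
  using SGL.integrable_fst'[OF int[of i]] by simp
 have "gop r c f (y + a) - gop r c f y = (LINT z|stdN. f ((r *\<^sub>R y + c *\<^sub>R z) + r *\<^sub>R a) - f (r *\<^sub>R y + c *\<^sub>R z))"
 proof -
  have e: "(r *\<^sub>R y + c *\<^sub>R z) + r *\<^sub>R a = r *\<^sub>R (y + a) + c *\<^sub>R z" for z by (simp add: scaleR_add_right)
  show ?thesis unfolding gop_def e
   using Bochner_Integration.integral_diff[OF integrable_gop[OF f, of "r *\<^sub>R (y + a)" c] integrable_gop[OF f, of "r *\<^sub>R y" c]] by simp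
 qed
 also have "... = (LINT z|stdN. (\<Sum>i\<in>UNIV. (r * a $ i) * (LINT tau|lborel. indicator {0..1::real} tau * g i (r *\<^sub>R y + c *\<^sub>R z + tau *\<^sub>R (r *\<^sub>R a)))))"
  unfolding grad by simp
 also have "... = (\<Sum>i\<in>UNIV. (r * a $ i) * (LINT z|stdN. (LINT tau|lborel. indicator {0..1::real} tau * g i (r *\<^sub>R y + c *\<^sub>R z + tau *\<^sub>R (r *\<^sub>R a)))))"
  using i1 by (subst Bochner_Integration.integral_sum) auto
 also have "... = (\<Sum>i\<in>UNIV. (r * a $ i) * (LINT tau|lborel. (LINT z|stdN. indicator {0..1::real} tau * g i (r *\<^sub>R y + c *\<^sub>R z + tau *\<^sub>R (r *\<^sub>R a)))))"
  using SGL.Fubini_integral[OF int] by simp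
 also have "... = r * (\<Sum>i\<in>UNIV. a $ i * (LINT tau|lborel. indicator {0..1} tau * gop r c (g i) (y + tau *\<^sub>R a)))"
  unfolding gop_def by (simp add: sum_distrib_left algebra_simps)
 finally show ?thesis .
qed

lemma integral_gop:
 assumes f: "polyP f" and c: "c >= 0" and rc: "r\<^sup>2 + c\<^sup>2 = 1" "r >= 0"
 shows "(LINT x|stdN. gop r c f x) = (LINT x|(stdN :: (real^'d) measure). f x)"
proof (cases "c = 0")
 case True
 then have "r = 1" using rc by (simp add: power2_eq_1_iff)
 then show ?thesis using True by simp
next
 case False
 then show ?thesis using gop_symmetric[OF f polyP_const[of 1] _ rc(1)] c by simp
qed

text \<open>With w = rx + cz one has c z_i = w_i - r x_i, and exchanging w and x takes f out of the
  inner integral. What remains there is the operator applied to \<open>He p\<close> and to u_i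
  \<open>He p\<close>, hence a combination of the polynomials with p_i raised or lowered by one, of
  degree at most |p| + 1.\<close>

lemma gradient_orthogonal:
 fixes f :: "real^'d::finite => real"
 assumes f: "polyP f" and c: "c > 0" and rc: "r\<^sup>2 + c\<^sup>2 = 1"
  and orth: "!!q. mi_abs q <= Suc (mi_abs p) ==> (LINT x|stdN. f x * He q x) = 0"
 shows "(LINT x|stdN. (LINT z|stdN. f (r *\<^sub>R x + c *\<^sub>R z) * z $ i) * He p x) = 0"
proof -
 note [measurable] = polyP_measurable[OF f]
 have [measurable]: "(%z::real^'d. z $ i) \<in> borel_measurable borel" for i by (rule polyP_measurable) auto
 let ?pS = "p(i := Suc (p i))" and ?q = "p(i := p i - 1)"
 have u: "u $ i * He p u = (1 / sqrt 2) * He ?pS u + (2 * real (p i) / sqrt 2) * He ?q u" for u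
  unfolding He_Suc by (simp add: field_simps)
 have "mi_abs ?q <= mi_abs p" by (cases "p i") (auto simp: mi_abs_def intro!: sum_mono)
 then have o: "(LINT x|stdN. f x * He ?pS x) = 0" "(LINT x|stdN. f x * He ?q x) = 0"
  using orth[of ?pS] orth[of ?q] by (auto simp: mi_abs_upd_Suc)
 have lin: "(LINT x|stdN. f x * (A * He ?pS x + B * He ?q x)) = 0" for A B
 proof -
  have "(LINT x|stdN. f x * (A * He ?pS x + B * He ?q x)) = (LINT x|stdN. A * (f x * He ?pS x) + B * (f x * He ?q x))"
   by (simp add: algebra_simps)
  also have "... = A * (LINT x|stdN. f x * He ?pS x) + B * (LINT x|stdN. f x * He ?q x)"
   using f by (subst Bochner_Integration.integral_add) (auto intro!: integrable_mult_right integrable_polyP polyP_mult)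
  finally show ?thesis using o by simp
 qed
 obtain C m where C: "C > 0" "!!x. abs (f x) <= C * wt m x" using f by (rule polyPE) blast
 obtain D n where D: "D > 0" "!!x. abs (He p x) <= D * wt n x" using polyP_He[of p] by (rule polyPE) blast
 have r1: "abs r <= 1"
  unfolding abs_square_le_1[symmetric] using rc zero_le_power2[of c] by linarith
 define F where "F = (%x w. f w * (w $ i - r * x $ i) * He p x)"
 have Fb: "abs (F x w) <= C * D * ((1 + norm x) ^ (m+n+1) * (1 + norm w) ^ (m+n+1))" for x w
 proof -
  have "abs (w $ i - r * x $ i) <= norm w + norm x"
   using component_le_norm_cart[of w i] component_le_norm_cart[of x i] mult_left_le_one_le[of "abs (x $ i)" "abs r"] r1
   by (simp add: abs_mult[symmetric])
  also have "... <= (1 + norm x) * (1 + norm w)" by (simp add: algebra_simps)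
  finally have "abs (F x w) <= (C * wt m w) * ((1 + norm x) * (1 + norm w)) * (D * wt n x)"
   unfolding F_def abs_mult using C D by (intro mult_mono) auto
  also have "... = C * D * ((1 + norm x) ^ (n+1) * (1 + norm w) ^ (m+1))" by (simp add: mult_ac)
  also have "... <= C * D * ((1 + norm x) ^ (m+n+1) * (1 + norm w) ^ (m+n+1))"
   using C D by (intro mult_left_mono mult_mono one_plus_norm_power_mono) auto
  finally show ?thesis .
 qed
 have "c * (LINT x|stdN. (LINT z|stdN. f (r *\<^sub>R x + c *\<^sub>R z) * z $ i) * He p x)
  = (LINT x|stdN. (LINT z|stdN. F x (r *\<^sub>R x + c *\<^sub>R z)))"
 proof -
  have "F x (r *\<^sub>R x + c *\<^sub>R z) = (c * He p x) * (f (r *\<^sub>R x + c *\<^sub>R z) * z $ i)" for x z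
   unfolding F_def by simp
  then have "(LINT z|stdN. F x (r *\<^sub>R x + c *\<^sub>R z)) = c * ((LINT z|stdN. f (r *\<^sub>R x + c *\<^sub>R z) * z $ i) * He p x)" for x
   by simp
  then show ?thesis by simp
 qed
 also have "... = (LINT x|stdN. (LINT z|stdN. F (r *\<^sub>R x + c *\<^sub>R z) x))"
  by (rule gauss_reversible[OF _ c rc Fb]) (use C D in \<open>auto simp: F_def\<close>)
 also have "... = (LINT x|stdN. f x * ((r ^ mi_abs p * (1 / sqrt 2) - r * (1 / sqrt 2) * r ^ mi_abs ?pS) * He ?pS x
   + (r ^ mi_abs p * (2 * real (p i) / sqrt 2) - r * (2 * real (p i) / sqrt 2) * r ^ mi_abs ?q) * He ?q x))"
 proof (rule Bochner_Integration.integral_cong[OF refl])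
  fix x :: "real^'d"
  have 1: "gop r c (%u. u $ i * He p u) x = (1 / sqrt 2) * (r ^ mi_abs ?pS * He ?pS x) + (2 * real (p i) / sqrt 2) * (r ^ mi_abs ?q * He ?q x)"
   unfolding u by (subst gop_add) (auto simp only: gop_cmult gop_He[OF rc] intro!: polyP_mult polyP_const polyP_He)
  have 2: "x $ i * gop r c (He p) x = r ^ mi_abs p * ((1 / sqrt 2) * He ?pS x + (2 * real (p i) / sqrt 2) * He ?q x)"
   unfolding gop_He[OF rc] u[of x, symmetric] by (simp add: mult_ac)
  have "(LINT z|stdN. F (r *\<^sub>R x + c *\<^sub>R z) x)
   = (LINT z|stdN. f x * x $ i * He p (r *\<^sub>R x + c *\<^sub>R z) - f x * r * ((r *\<^sub>R x + c *\<^sub>R z) $ i * He p (r *\<^sub>R x + c *\<^sub>R z)))"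
   unfolding F_def by (simp add: algebra_simps)
  also have "... = f x * x $ i * gop r c (He p) x - f x * r * gop r c (%u. u $ i * He p u) x"
   unfolding gop_def
   by (subst Bochner_Integration.integral_diff)
    (intro integrable_mult_right integrable_gop[of "He p"] integrable_gop[of "%u. u $ i * He p u"] polyP_mult polyP_component polyP_He,
     intro integrable_mult_right integrable_gop[of "He p"] integrable_gop[of "%u. u $ i * He p u"] polyP_mult polyP_component polyP_He, simp)
  also have "... = f x * (x $ i * gop r c (He p) x) - f x * r * gop r c (%u. u $ i * He p u) x" by simp
  finally show "(LINT z|stdN. F (r *\<^sub>R x + c *\<^sub>R z) x) = f x * ((r ^ mi_abs p * (1 / sqrt 2) - r * (1 / sqrt 2) * r ^ mi_abs ?pS) * He ?pS x
   + (r ^ mi_abs p * (2 * real (p i) / sqrt 2) - r * (2 * real (p i) / sqrt 2) * r ^ mi_abs ?q) * He ?q x)"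
   unfolding 1 2 by (simp add: algebra_simps)
 qed
 also have "... = 0" by (rule lin)
 finally show ?thesis using c by simp
qed

text \<open>Induction on k: the gradient of a smoothed f loses one order of orthogonality but gains
  a factor r through \<open>gop_line_diff\<close>. The smoothing uses the fixed contraction 1/2, so
  the contraction r <= 1/2 is written as 2r followed by 1/2; this costs 2^(k+1) in the
  constant.\<close>

theorem mehler_decay:
 fixes f :: "real^'d::finite => real"
 assumes "polyP f" and "!!p. mi_abs p < k ==> (LINT x|stdN. f x * He p x) = 0"
 shows "\<exists>C m. 0 <= C & (\<forall>r x. 0 <= r & r <= 1 --> abs (gop r (sqrt (1 - r\<^sup>2)) f x) <= C * r ^ k * wt m x)"
 using assms
proof (induction k arbitrary: f)
 case 0
 obtain C m where C: "C > 0" "!!x. abs (f x) <= C * wt m x" using 0(1) by (rule polyPE) blast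
 obtain K where K: "K >= 1" "!!f C r c x. (!!x. abs (f x) <= C * wt m x) ==> 0 <= C ==> abs r <= 1 ==> abs c <= 1
   ==> abs (gop r c f (x::real^'d)) <= C * K * wt m x"
  by (rule gop_bound[of 1 m]) auto
 show ?case
  by (rule exI[of _ "C * K"], rule exI[of _ m])
   (use C K in \<open>auto intro!: K(2) simp: power_le_one\<close>)
next
 case (Suc k f)
 note f = Suc.prems(1)
 define c0 where "c0 = sqrt (1 - (1/2 :: real)\<^sup>2)"
 have c0: "c0 > 0" "(1/2)\<^sup>2 + c0\<^sup>2 = 1" "c0 <= 1" unfolding c0_def by (auto simp: power2_eq_square)
 define f1 where "f1 = gop (1/2) c0 f"
 define g where "g = (%i x. ((1/2) / c0) * (LINT z|stdN. f ((1/2) *\<^sub>R x + c0 *\<^sub>R z) * z $ i))"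
 have f1: "polyP f1" unfolding f1_def using f by auto
 have g: "polyP (g i)" for i
 proof -
  obtain C m where C: "C > 0" "!!x. abs (f x) <= C * wt m x" using f by (rule polyPE) blast
  note [measurable] = polyP_measurable[OF f]
  have [measurable]: "(%z::real^'d. z $ i) \<in> borel_measurable borel" for i by (rule polyP_measurable) auto
  have mg: "g i \<in> borel_measurable borel" unfolding g_def by measurable
  show ?thesis
  proof (rule polyPI[OF mg, of "(1/2) / c0 * (LINT z|(stdN::(real^'d) measure). C * (2 ^ m * (1 + norm z) ^ Suc m))" m])
   fix x :: "real^'d"
   have "abs (LINT z|stdN. f ((1/2) *\<^sub>R x + c0 *\<^sub>R z) * z $ i)
    <= (LINT z|(stdN::(real^'d) measure). wt m x * (C * (2 ^ m * (1 + norm z) ^ Suc m)))"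
   proof (rule abs_integral_le)
    show "integrable stdN (%z::real^'d. wt m x * (C * (2 ^ m * (1 + norm z) ^ Suc m)))"
     by (intro integrable_mult_right std_gauss_moment)
    show "AE z in stdN. abs (f ((1/2) *\<^sub>R x + c0 *\<^sub>R z) * z $ i) <= wt m x * (C * (2 ^ m * (1 + norm z) ^ Suc m))"
    proof (rule AE_I2)
     fix z :: "real^'d"
     have "abs (f ((1/2) *\<^sub>R x + c0 *\<^sub>R z)) <= C * (wt m x * ((1 + 1) ^ m * wt m z))"
      using c0 C(1) by (intro order_trans[OF C(2)] mult_left_mono one_plus_norm_mult_le) auto
     then have "abs (f ((1/2) *\<^sub>R x + c0 *\<^sub>R z)) * abs (z $ i) <= (C * (wt m x * ((1 + 1) ^ m * wt m z))) * (1 + norm z)"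
      using C(1) component_le_norm_cart[of z i] by (intro mult_mono) auto
     then show "abs (f ((1/2) *\<^sub>R x + c0 *\<^sub>R z) * z $ i) <= wt m x * (C * (2 ^ m * (1 + norm z) ^ Suc m))"
      by (simp add: abs_mult mult_ac)
    qed
   qed
   then have "abs (LINT z|stdN. f ((1/2) *\<^sub>R x + c0 *\<^sub>R z) * z $ i)
    <= wt m x * (LINT z|(stdN::(real^'d) measure). C * (2 ^ m * (1 + norm z) ^ Suc m))" (is "?l <= ?w * ?J")
    by (simp only: integral_mult_right_zero)
   then have "abs ((1/2) / c0) * ?l <= (1/2) / c0 * (?w * ?J)" using c0(1) by (intro mult_mono) auto
   then show "abs (g i x) <= (1/2) / c0 * ?J * ?w"
    unfolding g_def abs_mult by (simp only: mult_ac)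
  qed
 qed
 have gorth: "(LINT x|stdN. g i x * He p x) = 0" if "mi_abs p < k" for i p
  using gradient_orthogonal[OF f c0(1,2), of p i] Suc.prems(2) that by (simp add: g_def mult.assoc)
 have "\<exists>C m. 0 <= C & (\<forall>r x. 0 <= r & r <= 1 --> abs (gop r (sqrt (1 - r\<^sup>2)) (g i) x) <= C * r ^ k * wt m x)" for i
  by (rule Suc.IH[OF g gorth])
 then obtain Cg mg where Cg: "!!i. 0 <= Cg i"
  "!!i r x. 0 <= r ==> r <= 1 ==> abs (gop r (sqrt (1 - r\<^sup>2)) (g i) x) <= Cg i * r ^ k * (1 + norm x) ^ mg i"
  by metis
 define m where "m = Max (range mg)"
 define C where "C = (\<Sum>i\<in>UNIV. Cg i)"
 have mm: "mg i <= m" for i unfolding m_def by (rule Max_ge) auto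
 have C0: "0 <= C" unfolding C_def by (intro sum_nonneg Cg)
 have CC: "Cg i <= C" for i unfolding C_def by (rule member_le_sum) (auto intro: Cg)
 have gb: "abs (gop r (sqrt (1 - r\<^sup>2)) (g i) x) <= C * r ^ k * wt m x" if "0 <= r" "r <= 1" for i r x
  by (rule order_trans[OF Cg(2)[OF that]])
   (use that C0 Cg(1) CC mm in \<open>intro mult_mono one_plus_norm_power_mono, auto\<close>)
 have grad: "f1 (x + a) - f1 x = (\<Sum>i\<in>UNIV. a $ i * (LINT tau|lborel. indicator {0..1} tau * g i (x + tau *\<^sub>R a)))" for x a
  unfolding f1_def g_def by (rule gop_gradient[OF f c0(1)])
 define K where "K = (LINT y|(stdN::(real^'d) measure). (1 + norm y) ^ Suc m)"
 have K0: "0 <= K" unfolding K_def by simp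
 have main: "abs (gop r (sqrt (1 - r\<^sup>2)) f1 x) <= (real CARD('d) * C * K) * r ^ Suc k * (1 + norm x) ^ Suc m" if r: "0 <= r" "r <= 1" for r x
 proof -
  let ?c = "sqrt (1 - r\<^sup>2)"
  have c: "?c >= 0" "r\<^sup>2 + ?c\<^sup>2 = 1" using r by (auto simp: power_le_one)
  have diff: "abs (gop r ?c f1 x - gop r ?c f1 y) <= (real CARD('d) * C) * r ^ Suc k * (1 + norm x) ^ Suc m * (1 + norm y) ^ Suc m" for y
  proof -
   let ?a = "x - y"
   have a: "norm ?a <= (1 + norm x) * (1 + norm y)"
    using norm_triangle_ineq4[of x y] by (simp add: algebra_simps) (smt (verit) mult_nonneg_nonneg norm_ge_zero)
   have ai: "abs (?a $ i) <= (1 + norm x) * (1 + norm y)" for i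
    by (rule order_trans[OF component_le_norm_cart a])
   have it: "abs (LINT tau|lborel. indicator {0..1} tau * gop r ?c (g i) (y + tau *\<^sub>R ?a)) <= C * r ^ k * (wt m x * wt m y)" for i
   proof -
    have "abs (LINT tau|lborel. indicator {0..1} tau * gop r ?c (g i) (y + tau *\<^sub>R ?a))
      <= (LINT tau|lborel. indicator {0..1::real} tau * (C * r ^ k * (wt m x * wt m y)))"
    proof (rule abs_integral_le)
     show "integrable lborel (%tau. indicator {0..1::real} tau * (C * r ^ k * (wt m x * wt m y)))"
      by (intro integrable_mult_left integrable_real_indicator) auto
     have "abs (gop r ?c (g i) (y + tau *\<^sub>R ?a)) <= C * r ^ k * (wt m x * wt m y)" if t: "0 <= tau" "tau <= 1" for tau
     proof -
      have "norm (y + tau *\<^sub>R ?a) = norm ((1 - tau) *\<^sub>R y + tau *\<^sub>R x)" by (simp add: algebra_simps)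
      also have "... <= (1 - tau) * norm y + tau * norm x"
       using norm_triangle_ineq[of "(1 - tau) *\<^sub>R y" "tau *\<^sub>R x"] t by simp
      also have "... <= norm y + norm x"
       using t by (intro add_mono mult_left_le_one_le) auto
      finally have "1 + norm (y + tau *\<^sub>R ?a) <= (1 + norm x) * (1 + norm y)"
       by (simp add: algebra_simps) (smt (verit) mult_nonneg_nonneg norm_ge_zero)
      then have "(1 + norm (y + tau *\<^sub>R ?a)) ^ m <= wt m x * wt m y"
       unfolding power_mult_distrib[symmetric] by (intro power_mono) auto
      then show ?thesis using C0 r by (intro order_trans[OF gb[OF r]] mult_left_mono) auto
     qed
     then show "AE tau in lborel. abs (indicator {0..1} tau * gop r ?c (g i) (y + tau *\<^sub>R ?a)) <= indicator {0..1::real} tau * (C * r ^ k * (wt m x * wt m y))"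
      by (intro AE_I2) (auto simp: abs_mult split: split_indicator)
    qed
    then show ?thesis by simp
   qed
   have "abs (gop r ?c f1 x - gop r ?c f1 y) = abs (r * (\<Sum>i\<in>UNIV. ?a $ i * (LINT tau|lborel. indicator {0..1} tau * gop r ?c (g i) (y + tau *\<^sub>R ?a))))"
    using gop_line_diff[OF f1 g c(1) grad, of r y ?a] by simp
   also have "... <= r * (\<Sum>i\<in>(UNIV::'d set). ((1 + norm x) * (1 + norm y)) * (C * r ^ k * (wt m x * wt m y)))"
    unfolding abs_mult using r
    by (auto intro!: mult_left_mono order_trans[OF sum_abs] sum_mono mult_mono it ai[unfolded vector_minus_component] simp: abs_mult simp del: sum_constant)
   also have "... = (real CARD('d) * C) * r ^ Suc k * (1 + norm x) ^ Suc m * (1 + norm y) ^ Suc m"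
    by (simp add: mult_ac)
   finally show ?thesis .
  qed
  \<comment> \<open>Orthogonality to the constant mode makes the mean zero, so the value at x is the
    average over y of the differences bounded in \<open>diff\<close>. In this way a gradient bound
    becomes a bound on the function itself.\<close>
  have mean0: "(LINT y|stdN. gop r ?c f1 y) = 0"
   using integral_gop[OF f1 c r(1)] integral_gop[OF f less_imp_le[OF c0(1)] c0(2)] Suc.prems(2)[of "%_. 0"]
   by (simp add: f1_def mi_abs_def)
  have ig: "integrable stdN (gop r ?c f1)" using f1 r by (intro integrable_polyP) auto
  have "abs (gop r ?c f1 x) = abs (LINT y|stdN. gop r ?c f1 x - gop r ?c f1 y)"
   using ig mean0 by (simp add: SG.prob_space[simplified])
  also have "... <= (LINT y|(stdN::(real^'d) measure). (real CARD('d) * C) * r ^ Suc k * (1 + norm x) ^ Suc m * (1 + norm y) ^ Suc m)"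
   by (rule abs_integral_le) (intro integrable_mult_right std_gauss_moment AE_I2 diff)+
  also have "... = (real CARD('d) * C * K) * r ^ Suc k * (1 + norm x) ^ Suc m" by (simp add: K_def)
  finally show ?thesis .
 qed
 obtain Cf n where Cf: "Cf > 0" "!!x. abs (f x) <= Cf * wt n x" using f by (rule polyPE) blast
 obtain Kf where Kf: "Kf >= 1" "!!f C r c x. (!!x. abs (f x) <= C * wt n x) ==> 0 <= C ==> abs r <= 1 ==> abs c <= 1
   ==> abs (gop r c f (x::real^'d)) <= C * Kf * wt n x"
  by (rule gop_bound[of 1 n]) auto
 define A where "A = real CARD('d) * C * K + Cf * Kf"
 have A0: "0 <= A" unfolding A_def using C0 K0 Cf Kf by simp
 show ?case
 proof (rule exI[of _ "A * 2 ^ Suc k"], rule exI[of _ "Suc m + n"], intro conjI allI impI)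
  show "0 <= A * 2 ^ Suc k" using A0 by simp
  fix r :: real and x :: "real^'d" assume "0 <= r & r <= 1"
  then have r: "0 <= r" "r <= 1" by auto
  show "abs (gop r (sqrt (1 - r\<^sup>2)) f x) <= A * 2 ^ Suc k * r ^ Suc k * (1 + norm x) ^ (Suc m + n)"
  proof (cases "r <= 1/2")
   case True
   have "abs (gop r (sqrt (1 - r\<^sup>2)) f x) = abs (gop (2 * r) (sqrt (1 - (2 * r)\<^sup>2)) f1 x)"
   proof -
    have "((1/2) * sqrt (1 - (2 * r)\<^sup>2))\<^sup>2 + c0\<^sup>2 = 1 - r\<^sup>2"
     using True r c0(2) abs_square_le_1[of "2 * r"] by (simp add: power_mult_distrib power2_eq_square field_simps)
    then show ?thesis
     unfolding f1_def by (subst gop_gop[OF f c0(1)]) simp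
   qed
   also have "... <= (real CARD('d) * C * K) * (2 * r) ^ Suc k * (1 + norm x) ^ Suc m"
    using True r by (intro main) auto
   also have "... <= A * (2 * r) ^ Suc k * (1 + norm x) ^ (Suc m + n)"
    using r C0 K0 Cf Kf A0 by (intro mult_mono one_plus_norm_power_mono) (auto simp: A_def)
   finally show ?thesis by (simp add: power_mult_distrib mult_ac)
  next
   \<comment> \<open>For r > 1/2 there is nothing to gain: (2r)^(k+1) >= 1, and the uniform bound
     suffices.\<close>
   case False
   then have "1 <= (2 * r) ^ Suc k" by (intro one_le_power) auto
   have "abs (gop r (sqrt (1 - r\<^sup>2)) f x) <= Cf * Kf * wt n x"
    using r Cf by (intro Kf(2)) (auto simp: power_le_one)
   also have "... = (Cf * Kf) * 1 * wt n x" by simp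
   also have "... <= A * (2 * r) ^ Suc k * (1 + norm x) ^ (Suc m + n)"
    using r C0 K0 Cf Kf A0 \<open>1 <= (2 * r) ^ Suc k\<close> by (intro mult_mono one_plus_norm_power_mono) (auto simp: A_def)
   finally show ?thesis by (simp add: power_mult_distrib mult_ac)
  qed
 qed
qed

subsection \<open>The Ornstein-Uhlenbeck semigroup\<close>

definition ou_sd :: "real => real => real => real" where
 "ou_sd \<sigma> b t = sqrt (\<sigma>\<^sup>2 * (1 - exp (- 2 * b * t)) / (2 * b))"

lemma ou_sg_eq_gop:
 assumes [measurable]: "f \<in> borel_measurable borel"
 shows "ou_sg \<sigma> b t f x = gop (exp (- b * t)) (ou_sd \<sigma> b t) f x"
 unfolding ou_sg_def gop_def ou_sd_def by (subst integral_stdN) auto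

lemma ou_sg_eq_gop_fun:
 assumes "f \<in> borel_measurable borel"
 shows "ou_sg \<sigma> b t f = gop (exp (- b * t)) (ou_sd \<sigma> b t) f"
 using ou_sg_eq_gop[OF assms] by (simp add: fun_eq_iff)

lemma std_gauss_uminus: "std_gauss (- z) = std_gauss z"
 by (simp add: std_gauss_def)

lemma integral_gauss_reflect:
 fixes f :: "real^'d => real"
 assumes [measurable]: "f \<in> borel_measurable borel"
 shows "(LINT z|stdN. f (- z)) = (LINT z|stdN. f z)"
proof -
 have "(LINT z|lborel. f z * std_gauss z) = (LINT z|lborel. f (- z) * std_gauss (- z))"
  by (subst (1) lborel_affine[of "-1" 0]) (auto simp: integral_density integral_distr density_1 one_ennreal_def[symmetric])
 then show ?thesis by (simp add: integral_stdN std_gauss_uminus)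
qed

lemma integral_lborel_scale:
 fixes f :: "real^'d => real"
 assumes [measurable]: "f \<in> borel_measurable borel" and c: "c > 0"
 shows "(LINT z|lborel. f z) = c ^ CARD('d) * (LINT z|lborel. f (c *\<^sub>R z))"
proof -
 have "(LINT z|lborel. f z) = (LINT z|density (distr lborel borel (%x. 0 + c *\<^sub>R x)) (%_. ennreal (abs c ^ DIM(real^'d))). f z)"
  using lborel_affine[of c "0 :: real^'d"] c by simp
 also have "... = (LINT z|distr lborel borel (%x. 0 + c *\<^sub>R x). abs c ^ DIM(real^'d) * f z)"
  by (subst integral_density) auto
 also have "... = (LINT z|lborel. abs c ^ DIM(real^'d) * f (0 + c *\<^sub>R z))"
  by (rule integral_distr) auto
 finally show ?thesis using c by simp
qed

lemma has_derivative_compose_vec: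
 fixes g :: "real^'d::finite => real"
 assumes "g differentiable at (y tau)" "(y has_vector_derivative v) (at tau)"
 shows "((%tau. g (y tau)) has_real_derivative (\<Sum>k\<in>UNIV. v $ k * pderiv1 k g (y tau))) (at tau)"
proof -
 let ?D = "frechet_derivative g (at (y tau))"
 have D: "(g has_derivative ?D) (at (y tau))" using assms(1) frechet_derivative_works by blast
 then have lin: "linear ?D" by (rule has_derivative_linear)
 have v: "v = (\<Sum>k\<in>UNIV. (v $ k) *\<^sub>R axis k 1)"
  by (simp add: vec_eq_iff axis_def if_distrib cong: if_cong)
 have "?D v = (\<Sum>k\<in>UNIV. v $ k * pderiv1 k g (y tau))"
  by (subst v) (simp add: linear_sum[OF lin] linear_cmul[OF lin] pderiv1_def)
 moreover have "((%tau. g (y tau)) has_derivative (%h. ?D (h *\<^sub>R v))) (at tau)"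
  using has_derivative_compose[OF assms(2)[unfolded has_vector_derivative_def] D] by simp
 then have "((%tau. g (y tau)) has_vector_derivative ?D v) (at tau)"
  by (simp add: has_vector_derivative_def linear_cmul[OF lin])
 ultimately show ?thesis by (simp add: has_real_derivative_iff_has_vector_derivative)
qed

lemma DERIV_axis_pderiv1:
 fixes g :: "real^'d::finite => real"
 assumes "g differentiable at z"
 shows "((%tau. g (z + tau *\<^sub>R axis i 1)) has_real_derivative pderiv1 i g z) (at 0)"
proof -
 have "((%tau. z + tau *\<^sub>R axis i 1 :: real^'d) has_vector_derivative axis i 1) (at 0)"
  by (auto intro!: derivative_eq_intros)
 from has_derivative_compose_vec[of g "%tau. z + tau *\<^sub>R axis i 1", OF _ this] assms
 show ?thesis by (simp add: axis_def if_distrib if_distribR sum.delta' cong: if_cong)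
qed

lemma differentiable_imp_borel:
 fixes g :: "real^'d::finite => real"
 assumes "!!x. g differentiable at x" shows "g \<in> borel_measurable borel"
 using assms by (intro borel_measurable_continuous_onI continuous_at_imp_continuous_on ballI differentiable_imp_continuous_within)

text \<open>\<open>twice_diff_P\<close> bounds only second derivatives. The mean value theorem along
  the ray from 0 to x passes polynomial growth from the gradient of a function to the function, and
  so to the first derivatives of f.\<close>

lemma polyP_of_gradient:
 fixes g :: "real^'d::finite => real"
 assumes d: "!!x. g differentiable at x" and p: "!!j. polyP (pderiv1 j g)"
 shows "polyP g"
proof -
 have "\<forall>j. \<exists>C n. C > 0 & (\<forall>x. abs (pderiv1 j g x) <= C * wt n x)"
  using p unfolding polyP_def by auto
 then obtain C n where C: "!!j. C j > 0" "!!j x. abs (pderiv1 j g x) <= C j * (1 + norm x) ^ n j" by metis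
 have "polyP (%x. abs (g 0) + (\<Sum>j\<in>UNIV. wt 1 x * (C j * (1 + norm x) ^ n j)))"
  by (intro polyP_add polyP_const polyP_sum polyP_mult polyP_norm_power)
 then show ?thesis
 proof (rule polyP_bound)
  fix x :: "real^'d"
  have vd: "((%tau. tau *\<^sub>R x) has_vector_derivative x) (at tau)" for tau by (auto intro!: derivative_eq_intros)
  have D: "((%tau. g (tau *\<^sub>R x)) has_real_derivative (\<Sum>k\<in>UNIV. x $ k * pderiv1 k g (tau *\<^sub>R x))) (at tau)" for tau
   by (rule has_derivative_compose_vec[OF d vd])
  obtain z where z: "0 < z" "z < 1" "g (1 *\<^sub>R x) - g (0 *\<^sub>R x) = (1 - 0) * (\<Sum>k\<in>UNIV. x $ k * pderiv1 k g (z *\<^sub>R x))"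
   using MVT2[of 0 1 "%tau. g (tau *\<^sub>R x)" "%tau. \<Sum>k\<in>UNIV. x $ k * pderiv1 k g (tau *\<^sub>R x)", OF zero_less_one D] by blast
  have "abs (\<Sum>k\<in>UNIV. x $ k * pderiv1 k g (z *\<^sub>R x)) <= (\<Sum>j\<in>UNIV. wt 1 x * (C j * (1 + norm x) ^ n j))"
  proof (rule order_trans[OF sum_abs sum_mono])
   fix j
   have "norm (z *\<^sub>R x) <= norm x" using z by (simp add: mult_left_le_one_le)
   then have "abs (pderiv1 j g (z *\<^sub>R x)) <= C j * (1 + norm x) ^ n j"
    using C(1)[of j] by (intro order_trans[OF C(2)] mult_left_mono power_mono) auto
   moreover have "abs (x $ j) <= wt 1 x" using component_le_norm_cart[of x j] by simp
   ultimately show "abs (x $ j * pderiv1 j g (z *\<^sub>R x)) <= wt 1 x * (C j * (1 + norm x) ^ n j)"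
    unfolding abs_mult by (intro mult_mono) auto
  qed
  then show "abs (g x) <= abs (g 0) + (\<Sum>j\<in>UNIV. wt 1 x * (C j * (1 + norm x) ^ n j))"
   using z(3) by simp
 qed (rule differentiable_imp_borel[OF d])
qed

definition ou_gen :: "real => real => (real^'d::finite => real) => real^'d => real" where
 "ou_gen \<sigma> b f x = (\<Sum>k\<in>UNIV. \<sigma>\<^sup>2 / 2 * pderiv1 k (pderiv1 k f) x - b * (x $ k * pderiv1 k f x))"

lemma twice_diff_polyP:
 assumes "twice_diff_P f"
 shows "polyP (pderiv1 k f)" "polyP (pderiv1 j (pderiv1 k f))" "polyP (ou_gen \<sigma> b f)"
proof -
 show 1: "polyP (pderiv1 k f)" for k
  using assms unfolding twice_diff_P_def by (rule_tac polyP_of_gradient) auto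
 show 2: "polyP (pderiv1 j (pderiv1 k f))" for j k
  using assms unfolding twice_diff_P_def by auto
 show "polyP (ou_gen \<sigma> b f)"
  unfolding ou_gen_def[abs_def] 
  by (rule polyP_sum) (rule polyP_diff[OF polyP_mult[OF polyP_const 2] polyP_mult[OF polyP_const polyP_mult[OF polyP_component 1]]])
qed

locale ou_params =
 fixes \<sigma> b :: real
 assumes \<sigma>_pos: "\<sigma> > 0" and b_pos: "b > 0"
begin

abbreviation "ou \<equiv> ou_sg \<sigma> b"
abbreviation "sd \<equiv> ou_sd \<sigma> b"

abbreviation "ph == phi_p \<sigma> b"

text \<open>The standard deviation of each coordinate under the invariant law. Rescaling space by it
  turns \<open>inner_phi\<close> into a \<open>stdN\<close> integral, \<open>phi_p\<close> into a
  multiple of \<open>He\<close>, and \<open>ou\<close> into a Mehler operator with r^2 + c^2 =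
  1.\<close>

definition "scl = \<sigma> / sqrt (2 * b)"

lemma scl_pos: "scl > 0" using \<sigma>_pos b_pos by (simp add: scl_def)

lemma sd_eq: "sd t = scl * sqrt (1 - (exp (- b * t))\<^sup>2)"
proof -
 have "(exp (- b * t))\<^sup>2 = exp (- 2 * b * t)" by (simp add: power2_eq_square exp_add[symmetric])
 then show ?thesis using \<sigma>_pos b_pos unfolding ou_sd_def scl_def
  by (simp add: real_sqrt_mult real_sqrt_divide)
qed

lemma exp_bt: "t >= 0 ==> 0 <= exp (- b * t) & exp (- b * t) <= 1"
 using b_pos by simp

lemma sd_bounds: "t >= 0 ==> 0 <= sd t" "t >= 0 ==> sd t <= scl" "t > 0 ==> sd t > 0"
proof -
 assume t: "t >= 0"
 then have e: "(exp (- b * t))\<^sup>2 <= 1" using exp_bt[OF t] by (intro power_le_one) auto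
 show "0 <= sd t" unfolding sd_eq using scl_pos e by simp
 have "sqrt (1 - (exp (- b * t))\<^sup>2) <= 1" by simp
 then show "sd t <= scl" unfolding sd_eq using scl_pos by (simp add: mult_left_le)
next
 assume t: "t > 0"
 have "exp (- 2 * b * t) < 1" using t b_pos by simp
 then show "sd t > 0" unfolding ou_sd_def using \<sigma>_pos b_pos by simp
qed

lemma sd_sq: "t >= 0 ==> (sd t)\<^sup>2 = \<sigma>\<^sup>2 * (1 - exp (- 2 * b * t)) / (2 * b)"
 using b_pos \<sigma>_pos unfolding ou_sd_def by (intro real_sqrt_pow2) (auto intro!: divide_nonneg_nonneg mult_nonneg_nonneg)

lemma sd_0 [simp]: "sd 0 = 0" by (simp add: ou_sd_def)

lemma sd_measurable [measurable]: "sd \<in> borel_measurable borel"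
 unfolding ou_sd_def[abs_def] by measurable

lemma polyP_ou: "polyP f ==> t >= 0 ==> polyP (ou t f)"
 using exp_bt[of t] polyP_gop[of f "exp (- b * t)" "sd t"]
 by (simp add: ou_sg_eq_gop_fun[OF polyP_measurable])

lemma ou_measurable [measurable]:
 assumes [measurable]: "f \<in> borel_measurable borel" shows "ou t f \<in> borel_measurable borel"
 unfolding ou_sg_eq_gop_fun[OF assms] by measurable

lemma ou_measurable_pair:
 fixes F :: "'a => real^'d => real"
 assumes m: "case_prod F \<in> borel_measurable (M \<Otimes>\<^sub>M borel)" and [measurable]: "r \<in> borel_measurable M" "x \<in> measurable M borel"
 shows "(%a. ou (r a) (F a) (x a)) \<in> borel_measurable M"
proof -
 have "(%a. gop (exp (- b * r a)) (sd (r a)) (F a) (x a)) \<in> borel_measurable M"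
  by (rule gop_measurable_pair[OF m]) measurable
 moreover have "ou (r a) (F a) (x a) = gop (exp (- b * r a)) (sd (r a)) (F a) (x a)" if "a \<in> space M" for a
  by (rule ou_sg_eq_gop) (use measurable_Pair2[OF m that] in simp)
 ultimately show ?thesis by (simp cong: measurable_cong)
qed

lemma ou_0 [simp]: "f \<in> borel_measurable borel ==> ou 0 f x = f x"
 by (simp add: ou_sg_eq_gop)

lemma ou_add_time:
 assumes f: "polyP f" and "s >= 0" "t >= 0"
 shows "ou s (ou t f) x = ou (s + t) f x"
proof (cases "t = 0")
 case True
 have "gop 1 0 f = f" by (rule ext) simp
 then show ?thesis using polyP_measurable[OF f] True by (simp add: ou_sg_eq_gop_fun)
next
 case False
 then have t: "t > 0" using assms by simp
 note [measurable] = polyP_measurable[OF f]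
 have "(exp (- b * t) * sd s)\<^sup>2 + (sd t)\<^sup>2 = (sd (s + t))\<^sup>2"
 proof -
  have e: "exp (- 2 * b * (s + t)) = (exp (- b * t))\<^sup>2 * exp (- 2 * b * s)" "exp (- 2 * b * t) = (exp (- b * t))\<^sup>2"
   by (simp_all add: power2_eq_square exp_add[symmetric] algebra_simps)
  have "0 <= s + t" using assms by simp
  then show ?thesis unfolding power_mult_distrib sd_sq[OF assms(2)] sd_sq[OF assms(3)] sd_sq[OF \<open>0 <= s + t\<close>] e
   by (simp add: diff_divide_distrib add_divide_distrib algebra_simps)
 qed
 then have "sqrt ((exp (- b * t) * sd s)\<^sup>2 + (sd t)\<^sup>2) = sd (s + t)" using assms sd_bounds(1)[of "s+t"] by simp
 moreover have "exp (- b * s) * exp (- b * t) = exp (- b * (s + t))"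
  by (simp add: exp_add[symmetric] algebra_simps)
 ultimately show ?thesis
  using gop_gop[OF f sd_bounds(3)[OF t], where ?r1.0="exp (- b * s)" and ?c1.0="sd s" and ?r2.0="exp (- b * t)" and x=x] by (simp add: ou_sg_eq_gop_fun)
qed

lemma ou_bound:
 fixes n :: nat
 obtains K where "K >= 1" "!!f C t x. f \<in> borel_measurable borel ==> (!!x. abs (f x) <= C * wt n x) ==> 0 <= C ==> t >= 0
   ==> abs (ou t f (x::real^'d)) <= C * K * wt n x"
proof -
 obtain K where K: "K >= 1" "!!f C r c x. (!!x. abs (f x) <= C * wt n x) ==> 0 <= C ==> abs r <= 1 ==> abs c <= scl
   ==> abs (gop r c f (x::real^'d)) <= C * K * wt n x"
  by (rule gop_bound[OF less_imp_le[OF scl_pos], of n]) blast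
 show ?thesis
  by (rule that[OF K(1)], subst ou_sg_eq_gop, assumption, rule K(2))
   (use exp_bt sd_bounds in auto)
qed

text \<open>For every z, one of u + v and u - v has norm at least |u|, so the values at z and -z
  together dominate the right side; symmetry of the Gaussian law accounts for the 1/2. The bound
  serves to recover X_s(W) from the martingale built on P_{T-s}W.\<close>

lemma ou_lower:
 assumes "t >= 0"
 shows "ou t (%x. wt n x) x >= (1/2) * exp (- b * t) ^ n * (1 + norm (x::real^'d)) ^ n"
proof -
 let ?r = "exp (- b * t)" and ?c = "sd t"
 let ?h = "%z. (1 + norm (?r *\<^sub>R x + ?c *\<^sub>R z)) ^ n"
 have r: "0 <= ?r" "?r <= 1" using exp_bt[OF assms] by auto
 have i: "integrable stdN ?h" "integrable stdN (%z. ?h (- z))"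
  using integrable_gop[OF polyP_norm_power[of n], of "?r *\<^sub>R x" "?c"] integrable_gop[OF polyP_norm_power[of n], of "?r *\<^sub>R x" "- ?c"] by auto
 have "?r ^ n * wt n x <= ?h z + ?h (- z)" for z
 proof -
  let ?u = "?r *\<^sub>R x" and ?v = "?c *\<^sub>R z"
  have "2 * norm ?u <= norm (?u + ?v) + norm (?u - ?v)"
  proof -
   have "(u + v) + (u - v) = 2 *\<^sub>R u" for u v :: "real^'d" by (simp add: scaleR_2)
   then have "norm ((?u + ?v) + (?u - ?v)) = abs 2 * norm ?u" by (simp only: norm_scaleR)
   then show ?thesis using norm_triangle_ineq[of "?u + ?v" "?u - ?v"] by linarith
  qed
  then have "norm ?u <= norm (?u + ?v) \<or> norm ?u <= norm (?u - ?v)" by linarith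
  moreover have "?r * (1 + norm x) <= 1 + norm ?u" using r by (simp add: algebra_simps)
  ultimately have "(?r * (1 + norm x)) ^ n <= (1 + norm (?u + ?v)) ^ n \<or> (?r * (1 + norm x)) ^ n <= (1 + norm (?u - ?v)) ^ n"
   using r by (auto intro!: power_mono)
  moreover have "0 <= (1 + norm (?u + ?v)) ^ n" "0 <= (1 + norm (?u - ?v)) ^ n" by auto
  ultimately have "(?r * (1 + norm x)) ^ n <= (1 + norm (?u + ?v)) ^ n + (1 + norm (?u - ?v)) ^ n" by linarith
  then show ?thesis by (simp add: power_mult_distrib)
 qed
 then have "(LINT z|(stdN::(real^'d) measure). ?r ^ n * wt n x) <= (LINT z|stdN. ?h z + ?h (- z))"
  using i by (intro integral_mono SG.integrable_const Bochner_Integration.integrable_add) auto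
 also have "... = 2 * (LINT z|stdN. ?h z)"
  using i integral_gauss_reflect[of ?h] by simp
 also have "(LINT z|stdN. ?h z) = ou t (%x. wt n x) x"
  by (simp add: ou_sg_eq_gop gop_def)
 finally show ?thesis by (simp add: SG.prob_space[simplified])
qed

lemma inner_phi_eq:
 fixes f g :: "real^'d => real"
 assumes [measurable]: "f \<in> borel_measurable borel" "g \<in> borel_measurable borel"
 shows "inner_phi \<sigma> b f g = (LINT z|stdN. f (scl *\<^sub>R z) * g (scl *\<^sub>R z))"
proof -
 have "abs scl ^ CARD('d) * gauss_phi \<sigma> b (scl *\<^sub>R z) = std_gauss (z::real^'d)" for z
 proof -
  have s2: "scl\<^sup>2 = \<sigma>\<^sup>2 / (2 * b)" using b_pos by (simp add: scl_def power_divide)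
  have "scl ^ CARD('d) * (b / (pi * \<sigma>\<^sup>2)) powr (real CARD('d) / 2) = (2 * pi) powr (- real CARD('d) / 2)"
  proof -
   have "scl ^ CARD('d) = (scl\<^sup>2) powr (real CARD('d) / 2)"
    using powr_realpow[OF scl_pos, of "CARD('d)"] powr_realpow[OF scl_pos, of 2] powr_powr[of scl 2 "real CARD('d) / 2"] by simp
   also have "... * (b / (pi * \<sigma>\<^sup>2)) powr (real CARD('d) / 2) = (scl\<^sup>2 * (b / (pi * \<sigma>\<^sup>2))) powr (real CARD('d) / 2)"
    by (intro powr_mult[symmetric])
   also have "scl\<^sup>2 * (b / (pi * \<sigma>\<^sup>2)) = inverse (2 * pi)"
    unfolding s2 using b_pos \<sigma>_pos by (simp add: field_simps)
   also have "inverse (2 * pi) powr (real CARD('d) / 2) = (2 * pi) powr (- real CARD('d) / 2)"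
    unfolding minus_divide_left[symmetric] powr_minus by (rule inverse_powr)
   finally show ?thesis .
  qed
  moreover have "- b * (norm (scl *\<^sub>R z))\<^sup>2 / \<sigma>\<^sup>2 = - (norm z)\<^sup>2 / 2"
   using b_pos \<sigma>_pos by (simp add: power_mult_distrib s2)
  ultimately show ?thesis using scl_pos unfolding gauss_phi_def std_gauss_def
   by (simp add: mult.assoc[symmetric])
 qed
 note K = this
 have [measurable]: "gauss_phi \<sigma> b \<in> borel_measurable (borel :: (real^'d) measure)"
  unfolding gauss_phi_def[abs_def] by measurable
 have "inner_phi \<sigma> b f g = (LINT z|lborel. abs scl ^ CARD('d) * (f (scl *\<^sub>R z) * g (scl *\<^sub>R z) * gauss_phi \<sigma> b (scl *\<^sub>R z)))"
  unfolding inner_phi_def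
  using integral_lborel_scale[OF _ scl_pos, of "%x. f x * g x * gauss_phi \<sigma> b x"] scl_pos by simp
 also have "... = (LINT z|lborel. f (scl *\<^sub>R z) * g (scl *\<^sub>R z) * std_gauss z)"
  unfolding K[symmetric] by (simp only: mult_ac)
 finally show ?thesis by (simp add: integral_stdN)
qed

definition nrm :: "('d::finite => nat) => real" where
 "nrm p = (real (mi_fact p) * 2 ^ mi_abs p) powr (-1/2)"

lemma mi_fact_pos: "mi_fact p > 0" by (simp add: mi_fact_def)

lemma nrm_pos: "nrm p > 0" using mi_fact_pos[of p] by (simp add: nrm_def)

lemma nrm_sq: "nrm p * nrm p * (2 ^ mi_abs p * real (mi_fact p)) = 1"
proof -
 define A where "A = real (mi_fact p) * 2 ^ mi_abs p"
 have A: "A > 0" using mi_fact_pos[of p] by (simp add: A_def)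
 have "A powr (-1/2) * A powr (-1/2) = A powr (-1)" by (simp only: powr_add[symmetric]) simp
 also have "... = 1 / A" using A by (simp add: powr_minus_divide)
 finally show ?thesis using A by (simp add: nrm_def A_def[symmetric] mult.commute)
qed

lemma phi_p_eq_He: "ph p (scl *\<^sub>R u) = nrm p * He p u"
proof -
 have "(sqrt b / \<sigma>) *\<^sub>R (scl *\<^sub>R u) = (1 / sqrt 2) *\<^sub>R u"
  using b_pos \<sigma>_pos by (simp add: scl_def real_sqrt_mult)
 then show ?thesis unfolding phi_p_def nrm_def He_def by (simp only:)
qed

lemma phi_p_eq_He': "ph p x = nrm p * He p (0 + (1 / scl) *\<^sub>R x)"
 using phi_p_eq_He[of p "(1 / scl) *\<^sub>R x"] scl_pos by simp

lemma polyP_phi_p: "polyP (ph p)"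
 unfolding phi_p_eq_He'[abs_def] by (rule polyP_mult[OF polyP_const polyP_affine[OF polyP_He]])

lemma ou_scl:
 assumes [measurable]: "f \<in> borel_measurable borel"
 shows "ou t f (scl *\<^sub>R u) = gop (exp (- b * t)) (sqrt (1 - (exp (- b * t))\<^sup>2)) (%v. f (scl *\<^sub>R v)) u"
 by (simp add: ou_sg_eq_gop gop_def sd_eq scaleR_add_right mult_ac)

lemma ou_phi_p:
 assumes "t >= 0"
 shows "ou t (ph p) x = exp (- (real (mi_abs p) * b * t)) * ph p x"
proof -
 define u where "u = (1 / scl) *\<^sub>R x"
 have x: "x = scl *\<^sub>R u" using scl_pos by (simp add: u_def)
 have "(exp (- b * t))\<^sup>2 + (sqrt (1 - (exp (- b * t))\<^sup>2))\<^sup>2 = 1"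
  using exp_bt[OF assms] by (simp add: power_le_one)
 from gop_He[OF this, of p u]
 have "ou t (ph p) (scl *\<^sub>R u) = nrm p * (exp (- b * t) ^ mi_abs p * He p u)"
  by (simp only: ou_scl[OF polyP_measurable[OF polyP_phi_p]] phi_p_eq_He gop_cmult)
 then show ?thesis
  unfolding x by (simp add: phi_p_eq_He exp_of_nat_mult[symmetric] mult_ac)
qed

lemma inner_phi_orthonormal:
 "inner_phi \<sigma> b (ph p) (ph q) = (if p = q then 1 else 0)"
proof -
 have "inner_phi \<sigma> b (ph p) (ph q) = (LINT z|stdN. nrm p * nrm q * (He p z * He q z))"
  by (subst inner_phi_eq) (auto simp: polyP_measurable[OF polyP_phi_p] phi_p_eq_He mult_ac)
 then show ?thesis using nrm_sq[of p] by (cases "p = q") (auto simp: He_orthogonal)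
qed

lemma inner_phi_He:
 assumes "polyP f"
 shows "inner_phi \<sigma> b f (ph p) = nrm p * (LINT z|stdN. f (scl *\<^sub>R z) * He p z)"
 by (subst inner_phi_eq) (auto simp: polyP_measurable[OF assms] polyP_measurable[OF polyP_phi_p] phi_p_eq_He mult_ac)

lemma inner_phi_diff:
 assumes "polyP f" "polyP g"
 shows "inner_phi \<sigma> b (%x. f x - g x) (ph p) = inner_phi \<sigma> b f (ph p) - inner_phi \<sigma> b g (ph p)"
proof -
 have i: "integrable stdN (%z. f (scl *\<^sub>R z) * He p z)" if "polyP f" for f
  using integrable_polyP[OF polyP_mult[OF polyP_affine[OF that, of 0 scl] polyP_He]] by simp
 show ?thesis
  using assms by (simp add: inner_phi_He polyP_diff left_diff_distrib right_diff_distrib Bochner_Integration.integral_diff[OF i i])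
qed

lemma inner_phi_sum:
 assumes "!!i. i \<in> I ==> polyP (f i)"
 shows "inner_phi \<sigma> b (%x. \<Sum>i\<in>I. c i * f i x) (ph p) = (\<Sum>i\<in>I. c i * inner_phi \<sigma> b (f i) (ph p))"
proof -
 have i: "integrable stdN (%z. c i * (f i (scl *\<^sub>R z) * He p z))" if "i \<in> I" for i
  using integrable_polyP[OF polyP_mult[OF polyP_affine[OF assms[OF that], of 0 scl] polyP_He]] by simp
 have "inner_phi \<sigma> b (%x. \<Sum>i\<in>I. c i * f i x) (ph p) = nrm p * (LINT z|stdN. (\<Sum>i\<in>I. c i * (f i (scl *\<^sub>R z) * He p z)))"
  using assms by (subst inner_phi_He) (auto intro!: polyP_sum polyP_mult simp: sum_distrib_right mult.assoc)
 also have "... = (\<Sum>i\<in>I. c i * inner_phi \<sigma> b (f i) (ph p))"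
  using i assms by (subst Bochner_Integration.integral_sum) (auto simp: inner_phi_He sum_distrib_left mult_ac)
 finally show ?thesis .
qed

text \<open>\<open>mehler_decay\<close> with r = exp(-bt) in rescaled coordinates; the factor (1 +
  1/scl)^m is the cost of returning to the original weight.\<close>

theorem ou_decay:
 fixes f :: "real^'d::finite => real"
 assumes f: "polyP f" and orth: "!!p. mi_abs p < k ==> inner_phi \<sigma> b f (ph p) = 0"
 obtains C m where "0 <= C" "!!t x. t >= 0 ==> abs (ou t f x) <= C * exp (- (real k * b * t)) * wt m x"
proof -
 have fs: "polyP (%u. f (scl *\<^sub>R u))" using polyP_affine[OF f, of 0 scl] by simp
 have "(LINT x|stdN. f (scl *\<^sub>R x) * He p x) = 0" if "mi_abs p < k" for p
  using orth[OF that] nrm_pos[of p] by (simp add: inner_phi_He[OF f])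
 from mehler_decay[of _ k, OF fs this] obtain C m where C: "0 <= C"
  "!!r x. 0 <= r ==> r <= 1 ==> abs (gop r (sqrt (1 - r\<^sup>2)) (%u. f (scl *\<^sub>R u)) x) <= C * r ^ k * wt m x"
  by auto
 show ?thesis
 proof (rule that[of "C * (1 + 1 / scl) ^ m" m])
  show "0 <= C * (1 + 1 / scl) ^ m" using C(1) scl_pos by simp
  fix t :: real and x :: "real^'d" assume t: "t >= 0"
  define u where "u = (1 / scl) *\<^sub>R x"
  have x: "x = scl *\<^sub>R u" using scl_pos by (simp add: u_def)
  have "1 + norm u <= (1 + 1 / scl) * (1 + norm x)"
   using one_plus_norm_affine_le[of 0 "1 / scl" x] scl_pos by (simp add: u_def)
  then have u: "wt m u <= (1 + 1 / scl) ^ m * wt m x"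
   unfolding power_mult_distrib[symmetric] by (intro power_mono) auto
  have "abs (ou t f x) <= C * exp (- b * t) ^ k * wt m u"
   unfolding x ou_scl[OF polyP_measurable[OF f]] using exp_bt[OF t] by (intro C(2)) auto
  also have "... <= C * exp (- b * t) ^ k * ((1 + 1 / scl) ^ m * wt m x)"
   using C(1) by (intro mult_left_mono u) auto
  finally show "abs (ou t f x) <= C * (1 + 1 / scl) ^ m * exp (- (real k * b * t)) * wt m x"
   by (simp add: exp_of_nat_mult[symmetric] mult_ac)
 qed
qed

end

subsection \<open>Dynkin formula\<close>

context ou_params
begin

lemma sd_DERIV:
 assumes "t > 0"
 shows "(sd has_real_derivative \<sigma>\<^sup>2 * exp (- 2 * b * t) / (2 * sd t)) (at t)"
proof -
 have pos: "0 < \<sigma>\<^sup>2 * (1 - exp (- 2 * b * t)) / (2 * b)" using assms b_pos \<sigma>_pos by simp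
 have "((%t. \<sigma>\<^sup>2 * (1 - exp (- 2 * b * t)) / (2 * b)) has_real_derivative \<sigma>\<^sup>2 * exp (- 2 * b * t)) (at t)"
  using b_pos by (auto intro!: derivative_eq_intros simp: field_simps)
 from DERIV_chain2[OF DERIV_real_sqrt[OF pos] this]
 show ?thesis unfolding ou_sd_def[abs_def] by (simp add: field_simps)
qed

text \<open>The time derivative of f along the deterministic curve exp(-bs)x + sd(s)z for frozen
  noise z. Dynkin's formula is then obtained from calculus under the Gaussian integral.\<close>

definition vel :: "(real^'d::finite => real) => real^'d => real => real^'d => real" where
 "vel f x s z = (\<Sum>k\<in>UNIV. (- b * exp (- b * s) * x $ k + \<sigma>\<^sup>2 * exp (- 2 * b * s) / (2 * sd s) * z $ k) *
   pderiv1 k f (exp (- b * s) *\<^sub>R x + sd s *\<^sub>R z))"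

lemma vel_DERIV:
 assumes f: "twice_diff_P f" and "s > 0"
 shows "((%s. f (exp (- b * s) *\<^sub>R x + sd s *\<^sub>R z)) has_real_derivative vel f x s z) (at s)"
proof -
 have "((%s. exp (- b * s) *\<^sub>R x + sd s *\<^sub>R z) has_vector_derivative
   (- b * exp (- b * s)) *\<^sub>R x + (\<sigma>\<^sup>2 * exp (- 2 * b * s) / (2 * sd s)) *\<^sub>R z) (at s)"
 proof (rule has_vector_derivative_add)
  have "((%s. exp (- b * s)) has_real_derivative - b * exp (- b * s)) (at s)"
   by (auto intro!: derivative_eq_intros)
  then show "((%s. exp (- b * s) *\<^sub>R x) has_vector_derivative (- b * exp (- b * s)) *\<^sub>R x) (at s)"
   using has_vector_derivative_scaleR[OF _ has_vector_derivative_const[of x]] by fastforce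
  show "((%s. sd s *\<^sub>R z) has_vector_derivative (\<sigma>\<^sup>2 * exp (- 2 * b * s) / (2 * sd s)) *\<^sub>R z) (at s)"
   using has_vector_derivative_scaleR[OF sd_DERIV[OF assms(2)] has_vector_derivative_const[of z]] by fastforce
 qed
 from has_derivative_compose_vec[of f "%s. exp (- b * s) *\<^sub>R x + sd s *\<^sub>R z", OF _ this] f
 show ?thesis unfolding vel_def twice_diff_P_def by simp
qed

lemma pderiv1_borel:
 assumes "twice_diff_P f" shows "pderiv1 k f \<in> borel_measurable borel"
 using twice_diff_polyP(1)[OF assms] by (rule polyP_measurable)

lemma vel_measurable:
 assumes f: "twice_diff_P f"
 shows "(%p. vel f x (fst p) (snd p)) \<in> borel_measurable (borel \<Otimes>\<^sub>M borel)"
proof -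
 note [measurable] = pderiv1_borel[OF f]
 have [measurable]: "(%z::real^'a. z $ i) \<in> borel_measurable borel" for i by (rule polyP_measurable) auto
 show ?thesis unfolding vel_def by measurable
qed

text \<open>Gaussian integration by parts turns the noise term z_k d_k f into a second derivative,
  and it does the same with the drift term of the generator. The coefficients agree because sd' sd +
  b sd^2 = \<sigma>^2/2.\<close>

lemma integral_vel:
 assumes f: "twice_diff_P f" and s: "s > 0"
 shows "(LINT z|stdN. vel f x s z) = ou s (ou_gen \<sigma> b f) x"
proof -
 let ?r = "exp (- b * s)" and ?c = "sd s"
 let ?c' = "\<sigma>\<^sup>2 * exp (- 2 * b * s) / (2 * sd s)"
 let ?y = "%z. ?r *\<^sub>R x + ?c *\<^sub>R z"
 note P = twice_diff_polyP[OF f]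
 have c: "?c > 0" using sd_bounds(3)[OF s] .
 have d: "((%tau. pderiv1 k f (z + tau *\<^sub>R axis k 1)) has_real_derivative pderiv1 k (pderiv1 k f) z) (at 0)" for k z
  using f unfolding twice_diff_P_def by (intro DERIV_axis_pderiv1) auto
 have i1: "integrable stdN (%z. pderiv1 k f (?y z))" for k by (rule integrable_gop[OF P(1)])
 have i2: "integrable stdN (%z. pderiv1 k f (?y z) * z $ k)" for k
  by (rule integrable_polyP[OF polyP_mult[OF polyP_affine[OF P(1)] polyP_component]])
 have ibp: "(LINT z|stdN. pderiv1 k f (?y z) * z $ k) = ?c * gop ?r ?c (pderiv1 k (pderiv1 k f)) x" for k
 proof -
  have "((%tau. pderiv1 k f (?r *\<^sub>R x + ?c *\<^sub>R (z + tau *\<^sub>R axis k 1))) has_real_derivative ?c * pderiv1 k (pderiv1 k f) (?y z)) (at 0)" for z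
  proof -
   have "((%tau. pderiv1 k f (?y z + (?c * tau) *\<^sub>R axis k 1)) has_real_derivative
     pderiv1 k (pderiv1 k f) (?y z + (?c * 0) *\<^sub>R axis k 1) * ?c) (at 0)"
    by (rule DERIV_chain2[where g="%tau. ?c * tau", OF DERIV_direction_shift[OF d]]) (auto intro!: derivative_eq_intros)
   then show ?thesis by (simp add: algebra_simps)
  qed
  from gauss_ibp[OF polyP_affine[OF P(1)] polyP_mult[OF polyP_const polyP_affine[OF P(2)]] this]
  show ?thesis by (simp add: gop_def)
 qed
 have "(LINT z|stdN. vel f x s z) = (LINT z|stdN. (\<Sum>k\<in>UNIV. (- b * ?r * x $ k) * pderiv1 k f (?y z) + ?c' * (pderiv1 k f (?y z) * z $ k)))"
  unfolding vel_def by (intro Bochner_Integration.integral_cong sum.cong refl) (simp add: algebra_simps)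
 also have "... = (\<Sum>k\<in>UNIV. (LINT z|stdN. (- b * ?r * x $ k) * pderiv1 k f (?y z) + ?c' * (pderiv1 k f (?y z) * z $ k)))"
  by (intro Bochner_Integration.integral_sum Bochner_Integration.integrable_add integrable_mult_right i1 i2)
 also have "... = (\<Sum>k\<in>UNIV. (- b * ?r * x $ k) * gop ?r ?c (pderiv1 k f) x + ?c' * (?c * gop ?r ?c (pderiv1 k (pderiv1 k f)) x))"
  unfolding gop_def
  by (subst Bochner_Integration.integral_add[OF integrable_mult_right[OF i1] integrable_mult_right[OF i2]])
   (simp only: integral_mult_right_zero ibp[unfolded gop_def])
 also have "... = (\<Sum>k\<in>UNIV. gop ?r ?c (%u. \<sigma>\<^sup>2 / 2 * pderiv1 k (pderiv1 k f) u - b * (u $ k * pderiv1 k f u)) x)"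
 proof (rule sum.cong[OF refl])
  fix k :: 'a
  have "gop ?r ?c (%u. \<sigma>\<^sup>2 / 2 * pderiv1 k (pderiv1 k f) u - b * (u $ k * pderiv1 k f u)) x
   = \<sigma>\<^sup>2 / 2 * gop ?r ?c (pderiv1 k (pderiv1 k f)) x - b * gop ?r ?c (%u. u $ k * pderiv1 k f u) x"
   by (subst gop_diff[OF polyP_mult[OF polyP_const P(2)] polyP_mult[OF polyP_const polyP_mult[OF polyP_component P(1)]]])
    (simp only: gop_cmult)
  also have "gop ?r ?c (%u. u $ k * pderiv1 k f u) x = ?r * x $ k * gop ?r ?c (pderiv1 k f) x + ?c\<^sup>2 * gop ?r ?c (pderiv1 k (pderiv1 k f)) x"
   by (rule gop_component_mult[OF P(1) P(2) d])
  finally have 1: "gop ?r ?c (%u. \<sigma>\<^sup>2 / 2 * pderiv1 k (pderiv1 k f) u - b * (u $ k * pderiv1 k f u)) x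
   = (- b * ?r * x $ k) * gop ?r ?c (pderiv1 k f) x + (\<sigma>\<^sup>2 / 2 - b * ?c\<^sup>2) * gop ?r ?c (pderiv1 k (pderiv1 k f)) x"
   by (simp add: algebra_simps)
  have "\<sigma>\<^sup>2 / 2 - b * ?c\<^sup>2 = ?c' * ?c" using c b_pos s by (simp add: sd_sq field_simps)
  then show "(- b * ?r * x $ k) * gop ?r ?c (pderiv1 k f) x + ?c' * (?c * gop ?r ?c (pderiv1 k (pderiv1 k f)) x)
   = gop ?r ?c (%u. \<sigma>\<^sup>2 / 2 * pderiv1 k (pderiv1 k f) u - b * (u $ k * pderiv1 k f u)) x"
   unfolding 1 by (simp only: mult.assoc)
 qed
 also have "... = gop ?r ?c (ou_gen \<sigma> b f) x"
  unfolding ou_gen_def[abs_def]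
  by (subst gop_sum) (rule polyP_diff[OF polyP_mult[OF polyP_const P(2)] polyP_mult[OF polyP_const polyP_mult[OF polyP_component P(1)]]], rule refl)
 finally show ?thesis by (simp only: ou_sg_eq_gop[OF polyP_measurable[OF P(3)]])
qed

text \<open>The derivative of \<open>sd\<close> blows up like s^(-1/2) at 0, so a bound uniform in
  time starts at t1 > 0. For this reason Dynkin's formula is first proved away from time 0.\<close>

lemma vel_bound:
 fixes f :: "real^'d::finite => real"
 assumes f: "twice_diff_P f" and t: "0 < t1"
 obtains C n where "C >= 0" "!!s z. t1 <= s ==> abs (vel f x s z) <= C * wt n z"
proof -
 have "\<forall>j. \<exists>C n. C > 0 & (\<forall>x. abs (pderiv1 j f x) <= C * wt n x)"
  using twice_diff_polyP(1)[OF f] unfolding polyP_def by auto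
 then obtain C n where C: "!!j. C j > 0" "!!j x. abs (pderiv1 j f x) <= C j * (1 + norm x) ^ n j" by metis
 define c1 where "c1 = \<sigma>\<^sup>2 / (2 * sd t1)"
 have sd1: "sd t1 > 0" by (rule sd_bounds(3)[OF t])
 have c1: "c1 >= 0" unfolding c1_def using sd1 by simp
 define A where "A = b * norm x + c1"
 have A: "A >= 0" unfolding A_def using b_pos c1 by simp
 define B where "B = (%k. A * (C k * ((1 + norm x) ^ n k * (1 + scl) ^ n k)))"
 have B: "B k >= 0" for k unfolding B_def using A C(1)[of k] scl_pos by simp
 define m where "m = Suc (Max (range n))"
 have m: "Suc (n k) <= m" for k unfolding m_def by (auto intro!: Max_ge)
 show ?thesis
 proof (rule that[of "\<Sum>k\<in>UNIV. B k" m])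
  show "0 <= (\<Sum>k\<in>UNIV. B k)" by (intro sum_nonneg B)
  fix s z assume s: "t1 <= s"
  then have s0: "s >= 0" using t by simp
  have "sd t1 <= sd s"
   using s b_pos \<sigma>_pos unfolding ou_sd_def by (auto intro!: divide_right_mono mult_left_mono)
  then have c's: "\<sigma>\<^sup>2 * exp (- 2 * b * s) / (2 * sd s) <= c1"
   unfolding c1_def using sd1 s0 b_pos by (intro frac_le) (auto intro!: mult_left_le)
  have "abs (vel f x s z) <= (\<Sum>k\<in>UNIV. B k * wt m z)"
   unfolding vel_def
  proof (rule order_trans[OF sum_abs sum_mono])
   fix k :: 'd
   have "abs (- b * exp (- b * s) * x $ k + \<sigma>\<^sup>2 * exp (- 2 * b * s) / (2 * sd s) * z $ k) <= A * (1 + norm z)"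
   proof -
    have 1: "abs (b * exp (- b * s) * x $ k) <= b * norm x"
     using b_pos exp_bt[OF s0] component_le_norm_cart[of x k]
     by (simp add: abs_mult mult.assoc mult_left_le_one_le mult_mono order_trans[OF mult_left_le_one_le])
    have 2: "abs (\<sigma>\<^sup>2 * exp (- 2 * b * s) / (2 * sd s) * z $ k) <= c1 * norm z"
     unfolding abs_mult[of _ "z $ k"] using c's sd_bounds(1)[OF s0] component_le_norm_cart[of z k] c1
     by (intro mult_mono) auto
    have 3: "A * (1 + norm z) = b * norm x + c1 + b * norm x * norm z + c1 * norm z"
     by (simp add: A_def algebra_simps)
    have "0 <= b * norm x * norm z" using b_pos by simp
    then show ?thesis unfolding 3 using 1 2 c1 by linarith
   qed
   moreover have "abs (pderiv1 k f (exp (- b * s) *\<^sub>R x + sd s *\<^sub>R z)) <= C k * ((1 + norm x) ^ n k * ((1 + scl) ^ n k * (1 + norm z) ^ n k))"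
    using C(1)[of k] exp_bt[OF s0] sd_bounds(1,2)[OF s0]
    by (intro order_trans[OF C(2)] mult_left_mono one_plus_norm_mult_le) auto
   ultimately have "abs ((- b * exp (- b * s) * x $ k + \<sigma>\<^sup>2 * exp (- 2 * b * s) / (2 * sd s) * z $ k) *
    pderiv1 k f (exp (- b * s) *\<^sub>R x + sd s *\<^sub>R z)) <= (A * (1 + norm z)) * (C k * ((1 + norm x) ^ n k * ((1 + scl) ^ n k * (1 + norm z) ^ n k)))"
    unfolding abs_mult[of _ "pderiv1 _ _ _"] using A by (intro mult_mono) auto
   also have "... = B k * (1 + norm z) ^ Suc (n k)" unfolding B_def by (simp add: mult_ac)
   also have "... <= B k * wt m z" using B m by (intro mult_left_mono one_plus_norm_power_mono)
   finally show "abs ((- b * exp (- b * s) * x $ k + \<sigma>\<^sup>2 * exp (- 2 * b * s) / (2 * sd s) * z $ k) *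
    pderiv1 k f (exp (- b * s) *\<^sub>R x + sd s *\<^sub>R z)) <= B k * wt m z" .
  qed
  then show "abs (vel f x s z) <= (\<Sum>k\<in>UNIV. B k) * wt m z" by (simp add: sum_distrib_right)
 qed
qed

lemma dynkin_pos:
 fixes f :: "real^'d::finite => real"
 assumes f: "twice_diff_P f" "polyP f" and t: "0 < t1" "t1 <= t2"
 shows "ou t2 f x - ou t1 f x = (LINT s|lborel. indicator {t1..t2} s * ou s (ou_gen \<sigma> b f) x)"
proof -
 note [measurable] = vel_measurable[OF f(1)] polyP_measurable[OF f(2)]
 have vm [measurable]: "(%p. vel f x (g p) (h p)) \<in> borel_measurable M" if "g \<in> borel_measurable M" "h \<in> borel_measurable M" for M g h
  using measurable_compose[OF measurable_Pair[OF that] vel_measurable[OF f(1), of x]] by simp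
 obtain C n where C: "C >= 0" "!!s z. t1 <= s ==> abs (vel f x s z) <= C * wt n z"
  using vel_bound[OF f(1) t(1)] by blast
 have ftc: "(LINT s|lborel. indicator {t1..t2} s * vel f x s z) = f (exp (- b * t2) *\<^sub>R x + sd t2 *\<^sub>R z) - f (exp (- b * t1) *\<^sub>R x + sd t1 *\<^sub>R z)" for z
 proof -
  have "(LINT s:{t1..t2}|lborel. vel f x s z) = f (exp (- b * t2) *\<^sub>R x + sd t2 *\<^sub>R z) - f (exp (- b * t1) *\<^sub>R x + sd t1 *\<^sub>R z)"
   by (rule ftc_lborel(2)[OF t(2), where B="C * wt n z" and F="%s. f (exp (- b * s) *\<^sub>R x + sd s *\<^sub>R z)"])
    (use t vel_DERIV[OF f(1)] C(2) in auto)
  then show ?thesis by (simp add: set_lebesgue_integral_def)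
 qed
 have m: "integrable (stdN \<Otimes>\<^sub>M lborel) (%(z::real^'d, s). C * wt n z * indicator {t1..t2} s)"
  using C t by (intro SGL.Fubini_integrable) (auto intro!: integrable_mult_right std_gauss_moment integrable_real_indicator simp: abs_mult)
 have int: "integrable (stdN \<Otimes>\<^sub>M lborel) (%(z, s). indicator {t1..t2} s * vel f x s z)"
  by (rule Bochner_Integration.integrable_bound[OF m])
   (auto intro!: AE_I2 simp: abs_mult C split: split_indicator)
 have "ou t2 f x - ou t1 f x = (LINT z|stdN. (LINT s|lborel. indicator {t1..t2} s * vel f x s z))"
  unfolding ftc ou_sg_eq_gop[OF polyP_measurable[OF f(2)]] gop_def
  by (rule Bochner_Integration.integral_diff[symmetric, OF integrable_gop[OF f(2)] integrable_gop[OF f(2)]])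
 also have "... = (LINT s|lborel. (LINT z|stdN. indicator {t1..t2} s * vel f x s z))"
  by (rule SGL.Fubini_integral[OF int, symmetric])
 also have "... = (LINT s|lborel. indicator {t1..t2} s * ou s (ou_gen \<sigma> b f) x)"
  using t by (intro Bochner_Integration.integral_cong refl) (auto simp: integral_vel[OF f(1)] split: split_indicator)
 finally show ?thesis .
qed

text \<open>The starting time t/(n+1) tends to 0. Continuity of f handles the left side; on the
  right the singularity of \<open>vel\<close> has disappeared with the integration over z, and the
  integrand is bounded.\<close>

theorem dynkin:
 fixes f :: "real^'d::finite => real"
 assumes f: "twice_diff_P f" "polyP f" and t: "0 <= t"
 shows "ou t f x - f x = (LINT s|lborel. indicator {0..t} s * ou s (ou_gen \<sigma> b f) x)"
proof (cases "t = 0")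
 case True
 then have "(LINT s|lborel. indicator {0..t} s * ou s (ou_gen \<sigma> b f) x) = (LINT s|(lborel::real measure). 0)"
 proof (intro integral_cong_AE)
  show "AE s in lborel. indicator {0..t} s * ou s (ou_gen \<sigma> b f) x = 0"
   using AE_lborel_singleton[of 0] by eventually_elim (auto simp: True)
  show "(%s. indicator {0..t} s * ou s (ou_gen \<sigma> b f) x) \<in> borel_measurable lborel"
   using polyP_measurable[OF twice_diff_polyP(3)[OF f(1)]] by (intro borel_measurable_times ou_measurable_pair) (auto simp: case_prod_beta')
 qed simp
 then show ?thesis using True polyP_measurable[OF f(2)] by simp
next
 case False
 note G = twice_diff_polyP(3)[OF f(1), of \<sigma> b]
 note [measurable] = polyP_measurable[OF f(2)] polyP_measurable[OF G]
 have [measurable]: "(%s. ou s (ou_gen \<sigma> b f) x) \<in> borel_measurable borel"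
  by (intro ou_measurable_pair) (auto simp: case_prod_beta')
 have t0: "t > 0" using False t by simp
 define e where "e = (%n::nat. t / real (Suc n))"
 have e: "0 < e n" "e n <= t" for n using t0 by (auto simp: e_def field_simps)
 have e0: "e \<longlonglongrightarrow> 0" unfolding e_def by (rule lim_const_over_n[THEN LIMSEQ_Suc])
 obtain C n where C: "C > 0" "!!x. abs (f x) <= C * wt n x" using f(2) by (rule polyPE) blast
 have cont: "continuous_on UNIV f"
  using f(1) unfolding twice_diff_P_def by (intro continuous_at_imp_continuous_on ballI differentiable_imp_continuous_within) auto
 have l1: "(%k. ou (e k) f x) \<longlonglongrightarrow> f x"
 proof -
  have "(%k. (LINT z|stdN. f (exp (- b * e k) *\<^sub>R x + sd (e k) *\<^sub>R z))) \<longlonglongrightarrow> (LINT z|(stdN::(real^'d) measure). f x)"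
  proof (rule integral_dominated_convergence)
   show "integrable stdN (%z::real^'d. C * (wt n x * ((1 + scl) ^ n * wt n z)))"
    by (intro integrable_mult_right std_gauss_moment)
   show "AE z in stdN. (%k. f (exp (- b * e k) *\<^sub>R x + sd (e k) *\<^sub>R z)) \<longlonglongrightarrow> f x"
   proof (rule AE_I2)
    fix z :: "real^'d"
    have "isCont sd 0" unfolding ou_sd_def[abs_def] using b_pos by (intro continuous_intros) auto
    then have "(%k. sd (e k)) \<longlonglongrightarrow> sd 0" using e0 by (rule isCont_tendsto_compose)
    moreover have "(%k. exp (- b * e k)) \<longlonglongrightarrow> exp (- b * 0)" by (intro tendsto_intros e0)
    ultimately have "(%k. exp (- b * e k) *\<^sub>R x + sd (e k) *\<^sub>R z) \<longlonglongrightarrow> exp (- b * 0) *\<^sub>R x + sd 0 *\<^sub>R z"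
     by (intro tendsto_add tendsto_scaleR tendsto_const)
    then have "(%k. exp (- b * e k) *\<^sub>R x + sd (e k) *\<^sub>R z) \<longlonglongrightarrow> x" by simp
    moreover have "isCont f x" using cont by (simp add: continuous_on_eq_continuous_at)
    ultimately show "(%k. f (exp (- b * e k) *\<^sub>R x + sd (e k) *\<^sub>R z)) \<longlonglongrightarrow> f x"
     by (rule isCont_tendsto_compose[rotated])
   qed
   show "AE z in stdN. norm (f (exp (- b * e k) *\<^sub>R x + sd (e k) *\<^sub>R z)) <= C * (wt n x * ((1 + scl) ^ n * wt n z))" for k
    using C(1) exp_bt[of "e k"] sd_bounds(1,2)[of "e k"] e(1)[of k]
    unfolding real_norm_def
    by (intro AE_I2 order_trans[OF C(2)] mult_left_mono one_plus_norm_mult_le) auto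
  qed measurable
  then show ?thesis by (simp add: ou_sg_eq_gop gop_def SG.prob_space[simplified])
 qed
 obtain D m where D: "D > 0" "!!x. abs (ou_gen \<sigma> b f x) <= D * wt m x" using G by (rule polyPE) blast
 obtain K where K: "K >= 1" "!!f C t x. f \<in> borel_measurable borel ==> (!!x. abs (f x) <= C * wt m x) ==> 0 <= C ==> t >= 0
   ==> abs (ou t f (x::real^'d)) <= C * K * wt m x"
  using ou_bound[of m] by blast
 have l2: "(%k. (LINT s|lborel. indicator {e k..t} s * ou s (ou_gen \<sigma> b f) x)) \<longlonglongrightarrow> (LINT s|lborel. indicator {0..t} s * ou s (ou_gen \<sigma> b f) x)"
 proof (rule integral_dominated_convergence)
  show "integrable lborel (%s. indicator {0..t} s * (D * K * wt m x))"
   using t0 by (intro integrable_mult_left integrable_real_indicator) auto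
  show "AE s in lborel. (%k. indicator {e k..t} s * ou s (ou_gen \<sigma> b f) x) \<longlonglongrightarrow> indicator {0..t} s * ou s (ou_gen \<sigma> b f) x"
   using AE_lborel_singleton[of 0]
  proof eventually_elim
   fix s :: real assume s: "s ~= 0"
   have "\<forall>\<^sub>F k in sequentially. indicator {e k..t} s = (indicator {0..t} s :: real)"
   proof (cases "s > 0")
    case True
    then show ?thesis by (intro eventually_mono[OF order_tendstoD(2)[OF e0 True]]) (auto split: split_indicator)
   next
    case False
    have "s \<notin> {e k..t}" "s \<notin> {0..t}" for k using e(1)[of k] s False by auto
    then show ?thesis by simp
   qed
   then have "(%k. indicator {e k..t} s) \<longlonglongrightarrow> (indicator {0..t} s :: real)" by (rule tendsto_eventually)
   then show "(%k. indicator {e k..t} s * ou s (ou_gen \<sigma> b f) x) \<longlonglongrightarrow> indicator {0..t} s * ou s (ou_gen \<sigma> b f) x"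
    by (intro tendsto_intros)
  qed
  have "abs (ou s (ou_gen \<sigma> b f) x) <= D * K * wt m x" if "s >= 0" for s
   using that D by (intro K(2)) auto
  then show "AE s in lborel. norm (indicator {e k..t} s * ou s (ou_gen \<sigma> b f) x) <= indicator {0..t} s * (D * K * wt m x)" for k
   using e[of k] D(1) K(1) by (intro AE_I2) (auto simp: abs_mult split: split_indicator)
 qed measurable
 have "(%k. ou t f x - ou (e k) f x) \<longlonglongrightarrow> ou t f x - f x" by (intro tendsto_intros l1)
 moreover have "(%k. ou t f x - ou (e k) f x) \<longlonglongrightarrow> (LINT s|lborel. indicator {0..t} s * ou s (ou_gen \<sigma> b f) x)"
  using l2 dynkin_pos[OF f e] by simp
 ultimately show ?thesis by (rule LIMSEQ_unique)
qed

lemma inner_phi_symmetric_ou: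
 assumes f: "polyP f" and t: "t > 0"
 shows "inner_phi \<sigma> b (ou t f) (ph p) = exp (- (real (mi_abs p) * b * t)) * inner_phi \<sigma> b f (ph p)"
proof -
 let ?r = "exp (- b * t)" and ?c = "sqrt (1 - (exp (- b * t))\<^sup>2)"
 have "?r < 1" using t b_pos by simp
 then have r1: "?r\<^sup>2 < 1" by (simp add: abs_square_less_1)
 then have c: "?c > 0" "?r\<^sup>2 + ?c\<^sup>2 = 1" by auto
 have fs: "polyP (%u. f (scl *\<^sub>R u))" using polyP_affine[OF f, of 0 scl] by simp
 have "inner_phi \<sigma> b (ou t f) (ph p) = nrm p * (LINT z|stdN. gop ?r ?c (%v. f (scl *\<^sub>R v)) z * He p z)"
  using t by (simp only: inner_phi_He[OF polyP_ou[OF f less_imp_le[OF t]]] ou_scl[OF polyP_measurable[OF f]])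
 also have "... = nrm p * (LINT z|stdN. f (scl *\<^sub>R z) * gop ?r ?c (He p) z)"
  by (simp only: gop_symmetric[OF fs polyP_He c])
 also have "... = nrm p * (LINT z|stdN. ?r ^ mi_abs p * (f (scl *\<^sub>R z) * He p z))"
  unfolding gop_He[OF c(2)] by (simp only: mult_ac)
 also have "... = ?r ^ mi_abs p * inner_phi \<sigma> b f (ph p)" by (simp add: inner_phi_He[OF f])
 finally show ?thesis by (simp add: exp_of_nat_mult[symmetric] mult_ac)
qed

end

subsection \<open>The branching mechanism\<close>

text \<open>On y > 1 the densities satisfy m <= n + |m - n|, and y^q <= y^(1+\<beta>+dl). The first
  term is a q-th moment of the stable reference, finite because q < 1+\<beta>; the second is the
  given total variation integral.\<close>

lemma tv_wint_imp_moment: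
 fixes Lev :: "real measure" and q \<beta> dl c :: real
 assumes sets [measurable_cong]: "sets Lev = sets borel"
  and fin: "emeasure Lev {1<..} < \<infinity>"
  and q: "0 <= q" "q < 1 + \<beta>" and \<beta>dl: "0 < \<beta>" "0 < dl"
  and tv: "tv_wint (%y. y powr (1 + \<beta> + dl)) Lev (density lborel (%y. ennreal (\<eta> / (c * y powr (2 + \<beta>))))) {1<..} < \<infinity>"
 shows "nn_integral Lev (%y. ennreal (y powr q) * indicator {1<..} y) < \<infinity>"
proof -
 have dm: "(%y. ennreal (\<eta> / (c * y powr (2 + \<beta>)))) \<in> borel_measurable borel" by simp
 define w where "w = (%y::real. y powr (1 + \<beta> + dl))"
 define N where "N = density lborel (%y. ennreal (\<eta> / (c * y powr (2 + \<beta>))))"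
 define MA where "MA = density Lev (indicator {1<..})"
 define NA where "NA = density N (indicator {1<..})"
 \<comment> \<open>\<open>measure_of\<close> returns the sum of the two measures only after
   countable additivity has been checked; this happens in \<open>S_em\<close>.\<close>
 define S where "S = measure_of UNIV (sets borel) (%B. emeasure MA B + emeasure NA B)"
 have [measurable_cong]: "sets N = sets borel" by (simp add: N_def)
 have MA_sets [measurable_cong, simp]: "sets MA = sets borel" by (simp add: MA_def sets)
 have NA_sets [measurable_cong, simp]: "sets NA = sets borel" by (simp add: NA_def N_def)
 have S_sets [measurable_cong, simp]: "sets S = sets borel"
  unfolding S_def using sets.sigma_sets_eq[of "borel :: real measure"] by (subst sets_measure_of) auto
 have S_em: "emeasure S B = emeasure MA B + emeasure NA B" if "B \<in> sets borel" for B
 proof (rule emeasure_measure_of[OF S_def])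
  show "countably_additive (sets S) (%B. emeasure MA B + emeasure NA B)"
  proof (rule countably_additiveI)
   fix A :: "nat => real set" assume A: "range A \<subseteq> sets S" "disjoint_family A"
   then have "(\<Sum>i. emeasure MA (A i)) = emeasure MA (\<Union>i. A i)" "(\<Sum>i. emeasure NA (A i)) = emeasure NA (\<Union>i. A i)"
    by (auto intro!: suminf_emeasure)
   then show "(\<Sum>i. emeasure MA (A i) + emeasure NA (A i)) = emeasure MA (\<Union>i. A i) + emeasure NA (\<Union>i. A i)"
    by (subst suminf_add[symmetric]) (auto intro: summableI)
  qed
 qed (use that in \<open>auto simp: positive_def\<close>)
 have NI: "nn_integral NA (%y. ennreal (y powr p)) < \<infinity>" if p: "p < 1 + \<beta>" for p
 proof -
  have "nn_integral NA (%y. ennreal (y powr p)) = nn_integral lborel (%y. ennreal (\<eta> / (c * y powr (2 + \<beta>))) * (indicator {1<..} y * ennreal (y powr p)))"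
  proof -
   have "nn_integral NA (%y. ennreal (y powr p)) = nn_integral N (%y. indicator {1<..} y * ennreal (y powr p))"
    unfolding NA_def by (rule nn_integral_density) measurable
   also have "... = nn_integral lborel (%y. ennreal (\<eta> / (c * y powr (2 + \<beta>))) * (indicator {1<..} y * ennreal (y powr p)))"
    unfolding N_def
   proof (rule nn_integral_density)
    show "(%y. ennreal (\<eta> / (c * y powr (2 + \<beta>)))) \<in> borel_measurable lborel" using dm by simp
   qed simp
   finally show ?thesis .
  qed
  \<comment> \<open>The sign of c is not fixed here, hence |\<eta>/c|. The remaining power is
    integrable on y >= 1 since p - 2 - \<beta> < -1.\<close>
  also have "... <= nn_integral lborel (%y. ennreal (abs (\<eta> / c)) * (ennreal (y powr (p - 2 - \<beta>)) * indicator {1..} y))"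
  proof (rule nn_integral_mono)
   fix y :: real
   show "ennreal (\<eta> / (c * y powr (2 + \<beta>))) * (indicator {1<..} y * ennreal (y powr p)) <= ennreal (abs (\<eta> / c)) * (ennreal (y powr (p - 2 - \<beta>)) * indicator {1..} y)"
   proof (cases "y > 1")
    case True
    have "ennreal (\<eta> / (c * y powr (2 + \<beta>))) * ennreal (y powr p) <= ennreal (abs (\<eta> / c) / y powr (2 + \<beta>)) * ennreal (y powr p)"
    proof (intro mult_right_mono ennreal_leI)
     have "(\<eta> / c) / y powr (2 + \<beta>) <= abs (\<eta> / c) / y powr (2 + \<beta>)" by (intro divide_right_mono abs_ge_self) simp
     then show "\<eta> / (c * y powr (2 + \<beta>)) <= abs (\<eta> / c) / y powr (2 + \<beta>)" by (simp only: divide_divide_eq_left)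
    qed simp
    also have "... = ennreal (abs (\<eta> / c) * (y powr p / y powr (2 + \<beta>)))"
     by (simp add: ennreal_mult[symmetric])
    also have "y powr p / y powr (2 + \<beta>) = y powr (p - 2 - \<beta>)" by (simp add: powr_diff[symmetric] algebra_simps)
    also have "ennreal (abs (\<eta> / c) * y powr (p - 2 - \<beta>)) = ennreal (abs (\<eta> / c)) * ennreal (y powr (p - 2 - \<beta>))"
     by (rule ennreal_mult) auto
    finally show ?thesis using True by simp
   qed (simp add: indicator_def)
  qed
  also have "... = ennreal (abs (\<eta> / c)) * nn_integral lborel (%y. ennreal (y powr (p - 2 - \<beta>)) * indicator {1..} y)"
   by (rule nn_integral_cmult) measurable
  also have "nn_integral lborel (%y. ennreal (y powr (p - 2 - \<beta>)) * indicator {1..} y) = ennreal (0 - 1 powr (p - 1 - \<beta>) / (p - 1 - \<beta>))"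
  proof (rule nn_integral_FTC_atLeast[where F="%y. y powr (p - 1 - \<beta>) / (p - 1 - \<beta>)" and T=0])
   show "((%y. y powr (p - 1 - \<beta>) / (p - 1 - \<beta>)) has_real_derivative x powr (p - 2 - \<beta>)) (at x)" if "1 <= x" for x
   proof -
    have e: "p - 2 - \<beta> = p - \<beta> - 2" by simp
    show ?thesis unfolding e
     using DERIV_cdivide[OF has_real_derivative_powr[of x "p - 1 - \<beta>"], of "p - 1 - \<beta>"] that p by simp
   qed
   have "((%y. y powr (p - 1 - \<beta>)) \<longlongrightarrow> 0) at_top" using p by (intro tendsto_neg_powr filterlim_ident) auto
   then show "((%y. y powr (p - 1 - \<beta>) / (p - 1 - \<beta>)) \<longlongrightarrow> 0) at_top" by (auto intro: tendsto_divide_zero)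
  qed auto
  also have "ennreal (abs (\<eta> / c)) * ennreal (0 - 1 powr (p - 1 - \<beta>) / (p - 1 - \<beta>)) < \<infinity>"
   by (simp add: ennreal_mult_less_top)
  finally show ?thesis .
 qed
 have MA_fin: "emeasure MA UNIV < \<infinity>"
  unfolding MA_def using fin by (subst emeasure_density) (auto simp: sets)
 have AENA: "AE y in NA. y > 1" unfolding NA_def by (subst AE_density) (auto split: split_indicator)
 have AEMA: "AE y in MA. y > 1" unfolding MA_def by (subst AE_density) (auto split: split_indicator simp: sets)
 have NA_fin: "emeasure NA UNIV < \<infinity>"
 proof -
  have sp: "space NA = UNIV" using sets_eq_imp_space_eq[OF NA_sets] by simp
  have "emeasure NA UNIV = nn_integral NA (%y. 1)" using sp by simp
  also have "... <= nn_integral NA (%y. ennreal (y powr 0))"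
   by (intro nn_integral_mono_AE) (use AENA in \<open>eventually_elim, simp\<close>)
  also have "... < \<infinity>" using \<beta>dl by (intro NI) auto
  finally show ?thesis .
 qed
 have spS: "space S = UNIV" "space MA = UNIV" "space NA = UNIV"
  using sets_eq_imp_space_eq[OF S_sets] sets_eq_imp_space_eq[OF MA_sets] sets_eq_imp_space_eq[OF NA_sets] by auto
 \<comment> \<open>Finite total masses are what makes the Radon-Nikodym densities reproduce
   \<open>MA\<close> and \<open>NA\<close> and be finite almost everywhere.\<close>
 interpret S: finite_measure S
  by (rule finite_measureI) (use MA_fin NA_fin in \<open>auto simp: spS S_em top_unique less_top\<close>)
 interpret M: finite_measure MA by (rule finite_measureI) (use MA_fin in \<open>auto simp: spS\<close>)
 interpret NN: finite_measure NA by (rule finite_measureI) (use NA_fin in \<open>auto simp: spS\<close>)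
 have acM: "absolutely_continuous S MA" and acN: "absolutely_continuous S NA"
  by (auto simp: absolutely_continuous_def null_sets_def S_em)
 define m where "m = RN_deriv S MA"
 define n where "n = RN_deriv S NA"
 have [measurable]: "m \<in> borel_measurable S" "n \<in> borel_measurable S" unfolding m_def n_def by auto
 have dM: "density S m = MA" unfolding m_def by (rule S.density_RN_deriv[OF acM]) simp
 have dN: "density S n = NA" unfolding n_def by (rule S.density_RN_deriv[OF acN]) simp
 have mf: "AE y in S. m y ~= \<infinity>" unfolding m_def by (rule S.RN_deriv_finite[OF M.sigma_finite_measure_axioms acM]) simp
 have nf: "AE y in S. n y ~= \<infinity>" unfolding n_def by (rule S.RN_deriv_finite[OF NN.sigma_finite_measure_axioms acN]) simp
 have AES: "AE y in S. y > 1"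
 proof -
  have "emeasure MA {..1} = 0" using AEMA by (subst (asm) AE_iff_measurable[of "{..1}"]) (auto simp: spS not_less)
  moreover have "emeasure NA {..1} = 0" using AENA by (subst (asm) AE_iff_measurable[of "{..1}"]) (auto simp: spS not_less)
  ultimately have "emeasure S {..1} = 0" by (simp add: S_em)
  then show ?thesis by (subst AE_iff_measurable[of "{..1}"]) (auto simp: spS not_less)
 qed
 have tv': "nn_integral S (%y. ennreal (w y) * ennreal (abs (enn2real (m y) - enn2real (n y)))) < \<infinity>"
  using tv unfolding tv_wint_def Let_def m_def n_def S_def MA_def NA_def N_def w_def .
 have "nn_integral Lev (%y. ennreal (y powr q) * indicator {1<..} y) = nn_integral MA (%y. ennreal (y powr q))"
  unfolding MA_def by (subst nn_integral_density) (auto simp: sets mult.commute)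
 also have "... = nn_integral S (%y. m y * ennreal (y powr q))"
  unfolding dM[symmetric] by (rule nn_integral_density) auto
 also have "... <= nn_integral S (%y. n y * ennreal (y powr q) + ennreal (w y) * ennreal (abs (enn2real (m y) - enn2real (n y))))"
 proof (rule nn_integral_mono_AE, use AES mf nf in eventually_elim)
  fix y assume y: "y > 1" "m y ~= \<infinity>" "n y ~= \<infinity>"
  define m' n' where "m' = enn2real (m y)" and "n' = enn2real (n y)"
  have e: "m y = ennreal m'" "n y = ennreal n'" "0 <= m'" "0 <= n'"
   using y by (auto simp: m'_def n'_def less_top)
  have "y powr q <= w y" unfolding w_def using y q \<beta>dl by (intro powr_mono) auto
  then have "m' * y powr q <= n' * y powr q + w y * abs (m' - n')"
   using mult_right_mono[of "y powr q" "w y" "abs (m' - n')"] mult_right_mono[OF abs_ge_self[of "m' - n'"], of "y powr q"]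
   by (simp add: algebra_simps)
  moreover have "0 <= w y" by (simp add: w_def)
  ultimately show "m y * ennreal (y powr q) <= n y * ennreal (y powr q) + ennreal (w y) * ennreal (abs (enn2real (m y) - enn2real (n y)))"
   unfolding m'_def[symmetric] n'_def[symmetric] e using e(3,4)
   by (simp add: ennreal_mult[symmetric] ennreal_plus[symmetric] del: ennreal_plus)
 qed
 also have "... = nn_integral S (%y. n y * ennreal (y powr q)) + nn_integral S (%y. ennreal (w y) * ennreal (abs (enn2real (m y) - enn2real (n y))))"
  unfolding w_def by (rule nn_integral_add) auto
 also have "nn_integral S (%y. n y * ennreal (y powr q)) = nn_integral NA (%y. ennreal (y powr q))"
  unfolding dN[symmetric] by (rule nn_integral_density[symmetric]) auto
 also have "... + nn_integral S (%y. ennreal (w y) * ennreal (abs (enn2real (m y) - enn2real (n y)))) < \<infinity>"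
  using NI[OF q(2)] tv' by simp
 finally show ?thesis .
qed

section \<open>Elementary bounds for the compensated exponential\<close>

lemma exp_minus_remainder_bounds:
 assumes "0 <= (u::real)"
 shows "0 <= exp (- u) - 1 + u" "exp (- u) - 1 + u <= u" "exp (- u) - 1 + u <= u\<^sup>2"
proof -
 show "0 <= exp (- u) - 1 + u" using exp_ge_add_one_self[of "- u"] by simp
 show "exp (- u) - 1 + u <= u" using assms by simp
 show "exp (- u) - 1 + u <= u\<^sup>2"
 proof -
  have "1 + u <= exp u" by (rule exp_ge_add_one_self)
  then have "exp (- u) <= 1 / (1 + u)" using assms by (simp add: exp_minus divide_simps)
  also have "... <= 1 - u + u\<^sup>2"
  proof -
   \<comment> \<open>The product equals 1 + u^3.\<close>
   have "1 <= (1 - u + u\<^sup>2) * (1 + u)" using assms by (simp add: algebra_simps power2_eq_square)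
   then show ?thesis using assms by (simp add: divide_simps)
  qed
  finally show ?thesis by simp
 qed
qed

text \<open>The derivative in z is y(1 - exp(-zy)), which lies between 0 and min(y, M y^2). The
  factor max 1 M reduces this to min(y, y^2), the function that the Levy measure integrates.\<close>

lemma exp_minus_remainder_diff:
 assumes "0 <= (x::real)" "x <= z" "z <= M" "0 < y"
 shows "0 <= (exp (- z * y) - 1 + z * y) - (exp (- x * y) - 1 + x * y)"
  "(exp (- z * y) - 1 + z * y) - (exp (- x * y) - 1 + x * y) <= (z - x) * (max 1 M * min y (y\<^sup>2))"
proof -
 have "0 <= D & D <= (z - x) * (max 1 M * min y (y\<^sup>2))" if D: "D = (exp (- z * y) - 1 + z * y) - (exp (- x * y) - 1 + x * y)" for D
 proof (cases "x = z")
  case False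
  then have "x < z" using assms by simp
  have der: "((%v. exp (- v * y) - 1 + v * y) has_real_derivative y * (1 - exp (- v * y))) (at v)" for v
   by (auto intro!: derivative_eq_intros simp: algebra_simps)
  obtain v where v: "x < v" "v < z" "D = (z - x) * (y * (1 - exp (- v * y)))"
   using MVT2[OF \<open>x < z\<close> der] unfolding D by auto
  have vy: "0 <= v * y" using v assms by simp
  then have 1: "0 <= 1 - exp (- v * y)" "1 - exp (- v * y) <= 1" by auto
  have 2: "1 - exp (- v * y) <= v * y" using exp_ge_add_one_self[of "- v * y"] by simp
  also have "... <= max 1 M * y" using v assms by (intro mult_right_mono) auto
  finally have "y * (1 - exp (- v * y)) <= y * (max 1 M * y)" using assms by (intro mult_left_mono) auto
  moreover have "y * (1 - exp (- v * y)) <= y * max 1 M"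
   using assms by (intro mult_left_mono order_trans[OF 1(2)] max.cobounded1) auto
  ultimately have "y * (1 - exp (- v * y)) <= max 1 M * min y (y\<^sup>2)"
   by (simp add: min_def power2_eq_square mult_ac)
  then show ?thesis unfolding v(3) using assms 1 by (auto intro!: mult_left_mono mult_nonneg_nonneg)
 qed (use assms that in simp)
 from this[OF refl] show "0 <= (exp (- z * y) - 1 + z * y) - (exp (- x * y) - 1 + x * y)"
  "(exp (- z * y) - 1 + z * y) - (exp (- x * y) - 1 + x * y) <= (z - x) * (max 1 M * min y (y\<^sup>2))" by auto
qed

locale branching = ou_params +
 fixes \<alpha> \<rho> :: real and Lev :: "real measure"
 assumes \<alpha>_pos: "\<alpha> > 0" and \<rho>_nonneg: "\<rho> >= 0"
  and Lev_sets [measurable_cong]: "sets Lev = sets borel"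
  and Lev_int: "nn_integral Lev (%y. ennreal (min y (y\<^sup>2)) * indicator {0<..} y) < \<infinity>"
begin

abbreviation "\<psi> \<equiv> psi \<alpha> \<rho> Lev"

text \<open>The nonnegative increasing part of the mechanism. The linear part -\<alpha>z is moved
  into the semigroup as exp(\<alpha>t), so that V is compared with the mean exp(\<alpha>t)P_t
  f.\<close>

definition \<psi>0 :: "real => real" where "\<psi>0 z = \<psi> z + \<alpha> * z"

definition ker :: "real => real => real" where
 "ker z y = indicator {0<..} y * (exp (- z * y) - 1 + z * y)"

lemma ker_measurable [measurable]: "ker z \<in> borel_measurable borel"
 unfolding ker_def[abs_def] by measurable

lemma \<psi>0_eq: "\<psi>0 z = \<rho> * z\<^sup>2 + (LINT y|Lev. ker z y)"
 by (simp add: \<psi>0_def psi_def ker_def set_lebesgue_integral_def)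

lemma min_integrable: "integrable Lev (%y. indicator {0<..} y * min y (y\<^sup>2))"
proof (rule integrableI_bounded)
 have "nn_integral Lev (%y. ennreal (norm (indicator {0<..} y * min y (y\<^sup>2)))) = nn_integral Lev (%y. ennreal (min y (y\<^sup>2)) * indicator {0<..} y)"
  by (intro nn_integral_cong) (auto split: split_indicator)
 then show "nn_integral Lev (%y. ennreal (norm (indicator {0<..} y * min y (y\<^sup>2)))) < \<infinity>" using Lev_int by simp
qed measurable

lemma ker_bounds:
 assumes "0 <= z"
 shows "0 <= ker z y" "ker z y <= max z (z\<^sup>2) * (indicator {0<..} y * min y (y\<^sup>2))"
proof -
 show "0 <= ker z y" using assms exp_minus_remainder_bounds(1)[of "z * y"] by (auto simp: ker_def split: split_indicator)
 show "ker z y <= max z (z\<^sup>2) * (indicator {0<..} y * min y (y\<^sup>2))"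
 proof (cases "y > 0")
  case True
  then have zy: "0 <= z * y" using assms by simp
  have "exp (- z * y) - 1 + z * y <= z * y" "exp (- z * y) - 1 + z * y <= z\<^sup>2 * y\<^sup>2"
   using exp_minus_remainder_bounds(2,3)[OF zy] by (auto simp: power_mult_distrib)
  moreover have "z * y <= max z (z\<^sup>2) * y" "z\<^sup>2 * y\<^sup>2 <= max z (z\<^sup>2) * y\<^sup>2" using True by (auto intro!: mult_right_mono)
  ultimately have "exp (- z * y) - 1 + z * y <= max z (z\<^sup>2) * y" "exp (- z * y) - 1 + z * y <= max z (z\<^sup>2) * y\<^sup>2"
   by linarith+
  then show ?thesis using True by (auto simp: ker_def min_def)
 qed (simp add: ker_def)
qed

lemma ker_integrable:
 assumes "0 <= z" shows "integrable Lev (ker z)"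
 by (rule Bochner_Integration.integrable_bound[OF integrable_mult_right[OF min_integrable, of "max z (z\<^sup>2)"]])
  (use ker_bounds[OF assms] in \<open>auto intro!: AE_I2 intro: order_trans[OF _ abs_ge_self]\<close>)

lemma \<psi>0_nonneg: "0 <= z ==> 0 <= \<psi>0 z"
 unfolding \<psi>0_eq using \<rho>_nonneg ker_bounds(1) by (intro add_nonneg_nonneg mult_nonneg_nonneg integral_nonneg_AE AE_I2) auto

text \<open>The explicit Lipschitz constant on [0, M] determines the killing rate \<open>ka\<close>
  in \<open>mild_solution\<close>.\<close>

lemma \<psi>0_diff:
 assumes "0 <= x" "x <= z" "z <= M"
 shows "0 <= \<psi>0 z - \<psi>0 x"
  "\<psi>0 z - \<psi>0 x <= (z - x) * (2 * \<rho> * M + max 1 M * (LINT y|Lev. indicator {0<..} y * min y (y\<^sup>2)))"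
proof -
 have e: "(LINT y|Lev. ker z y) - (LINT y|Lev. ker x y) = (LINT y|Lev. ker z y - ker x y)"
  using assms by (intro Bochner_Integration.integral_diff[symmetric] ker_integrable) auto
 have d: "0 <= ker z y - ker x y" "ker z y - ker x y <= (z - x) * (max 1 M * (indicator {0<..} y * min y (y\<^sup>2)))" for y
  using exp_minus_remainder_diff[OF assms, of y] by (auto simp: ker_def split: split_indicator)
 have "0 <= (LINT y|Lev. ker z y) - (LINT y|Lev. ker x y)"
  unfolding e using d(1) by (intro integral_nonneg_AE AE_I2)
 moreover have "x\<^sup>2 <= z\<^sup>2" using assms by (intro power_mono) auto
 ultimately show "0 <= \<psi>0 z - \<psi>0 x" unfolding \<psi>0_eq using mult_left_mono[of "x\<^sup>2" "z\<^sup>2" \<rho>] \<rho>_nonneg by simp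
 have "(LINT y|Lev. ker z y - ker x y) <= (LINT y|Lev. (z - x) * (max 1 M * (indicator {0<..} y * min y (y\<^sup>2))))"
  using assms d(2) by (intro integral_mono Bochner_Integration.integrable_diff ker_integrable integrable_mult_right min_integrable) auto
 moreover have "\<rho> * z\<^sup>2 - \<rho> * x\<^sup>2 <= (z - x) * (2 * \<rho> * M)"
 proof -
  have "\<rho> * z\<^sup>2 - \<rho> * x\<^sup>2 = \<rho> * ((z - x) * (z + x))" by (simp add: algebra_simps power2_eq_square)
  also have "... <= \<rho> * ((z - x) * (2 * M))" using assms \<rho>_nonneg by (intro mult_left_mono) auto
  finally show ?thesis by (simp add: mult_ac)
 qed
 ultimately show "\<psi>0 z - \<psi>0 x <= (z - x) * (2 * \<rho> * M + max 1 M * (LINT y|Lev. indicator {0<..} y * min y (y\<^sup>2)))"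
  unfolding \<psi>0_eq using e by (simp add: distrib_left)
qed

lemma \<psi>0_mono: "0 <= x ==> x <= z ==> \<psi>0 x <= \<psi>0 z"
 using \<psi>0_diff(1)[of x z z] by simp

lemma \<psi>0_0 [simp]: "\<psi>0 0 = 0"
 by (simp add: \<psi>0_eq ker_def)

lemma Lev_gt1_finite: "emeasure Lev {1<..} < \<infinity>"
proof -
 have "emeasure Lev {1<..} = nn_integral Lev (%y. indicator {1<..} y)" by (simp add: Lev_sets)
 also have "... <= nn_integral Lev (%y. ennreal (min y (y\<^sup>2)) * indicator {0<..} y)"
 proof (rule nn_integral_mono)
  fix y :: real
  show "indicator {1<..} y <= ennreal (min y (y\<^sup>2)) * indicator {0<..} y"
  proof (cases "y > 1")
   case True
   then have "1 <= min y (y\<^sup>2)" by (simp add: one_le_power)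
   then show ?thesis using True by (simp add: ennreal_leI[of 1, simplified])
  qed simp
 qed
 finally show ?thesis using Lev_int by simp
qed

text \<open>For jumps y > 1 and u = zy, the remainder is at most u^2 if u <= 1 and at most u if u >=
  1, hence at most u^q in both cases because 1 <= q <= 2. For y <= 1 the quadratic bound is
  integrable.\<close>

lemma \<psi>0_upper:
 assumes q: "1 <= q" "q <= 2" and fin: "nn_integral Lev (%y. ennreal (y powr q) * indicator {1<..} y) < \<infinity>"
 obtains A where "A >= 0" "!!z. 0 <= z ==> \<psi>0 z <= A * (z powr q + z\<^sup>2)"
proof -
 have iq: "integrable Lev (%y. indicator {1<..} y * y powr q)"
 proof (rule integrableI_bounded)
  have "nn_integral Lev (%y. ennreal (norm (indicator {1<..} y * y powr q))) = nn_integral Lev (%y. ennreal (y powr q) * indicator {1<..} y)"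
   by (intro nn_integral_cong) (auto split: split_indicator)
  then show "nn_integral Lev (%y. ennreal (norm (indicator {1<..} y * y powr q))) < \<infinity>" using fin by simp
 qed measurable
 define B C where "B = (LINT y|Lev. indicator {1<..} y * y powr q)" and "C = (LINT y|Lev. indicator {0<..} y * min y (y\<^sup>2))"
 have B: "0 <= B" unfolding B_def by (intro integral_nonneg_AE AE_I2) auto
 have C: "0 <= C" unfolding C_def by (intro integral_nonneg_AE AE_I2) (auto split: split_indicator)
 show ?thesis
 proof (rule that[of "\<rho> + B + C"])
  show "0 <= \<rho> + B + C" using B C \<rho>_nonneg by simp
  fix z :: real assume z: "0 <= z"
  have "ker z y <= z powr q * (indicator {1<..} y * y powr q) + z\<^sup>2 * (indicator {0<..} y * min y (y\<^sup>2))" for y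
  proof (cases "y > 1")
   case True
   then have zy: "0 <= z * y" using z by simp
   have "exp (- (z * y)) - 1 + z * y <= (z * y) powr q"
   proof (cases "z * y <= 1")
    case True
    show ?thesis
    proof (cases "z * y = 0")
     case False
     then have "(z * y)\<^sup>2 = (z * y) powr 2" using zy by (simp add: powr_numeral)
     also have "... <= (z * y) powr q" using True False zy q by (intro powr_mono') auto
     finally show ?thesis using exp_minus_remainder_bounds(3)[OF zy] by simp
    qed auto
   next
    case False
    then have "z * y <= (z * y) powr q" using powr_mono[of 1 q "z * y"] q by simp
    then show ?thesis using exp_minus_remainder_bounds(2)[OF zy] by linarith
   qed
   also have "... = z powr q * y powr q" using z True by (simp add: powr_mult)
   finally show ?thesis using True by (simp add: ker_def add_increasing2)
  next
   case False
   show ?thesis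
   proof (cases "y > 0")
    case True
    then have "0 <= z * y" using z by simp
    moreover have "min y (y\<^sup>2) = y\<^sup>2" using True False by (simp add: min_def power2_eq_square mult_left_le)
    ultimately show ?thesis using True False exp_minus_remainder_bounds(3)[of "z * y"] by (simp add: ker_def power_mult_distrib)
   qed (use False in \<open>simp add: ker_def\<close>)
  qed
  then have "(LINT y|Lev. ker z y) <= (LINT y|Lev. z powr q * (indicator {1<..} y * y powr q) + z\<^sup>2 * (indicator {0<..} y * min y (y\<^sup>2)))"
   using z by (intro integral_mono ker_integrable Bochner_Integration.integrable_add integrable_mult_right iq min_integrable) auto
  also have "... = z powr q * B + z\<^sup>2 * C"
   unfolding B_def C_def by (subst Bochner_Integration.integral_add) (auto intro!: integrable_mult_right iq min_integrable)
  finally have "\<psi>0 z <= z powr q * B + z\<^sup>2 * (\<rho> + C)" unfolding \<psi>0_eq by (simp add: algebra_simps)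
  also have "... <= (\<rho> + B + C) * (z powr q + z\<^sup>2)"
  proof -
   have "0 <= z powr q * (\<rho> + C)" "0 <= z\<^sup>2 * B" using B C \<rho>_nonneg by auto
   then show ?thesis by (simp add: algebra_simps)
  qed
  finally show "\<psi>0 z <= (\<rho> + B + C) * (z powr q + z\<^sup>2)" .
 qed
qed

end

subsection \<open>The mild equation\<close>

context ou_params
begin

text \<open>The semigroup on extended nonnegative functions. Tonelli and the semigroup law hold
  there without integrability conditions, which frees the fixed point argument from them.\<close>

definition nP :: "real => (real^'d => ennreal) => real^'d => ennreal" where
 "nP t h x = nn_integral stdN (%z. h (exp (- b * t) *\<^sub>R x + sd t *\<^sub>R z))"

text \<open>The Duhamel term with killing at rate \<open>ka\<close>. The rate is a parameter because
  the solution is built at a large rate and read off at the rates 0 and -\<alpha>.\<close>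

definition nI :: "real => (real => real^'d => ennreal) => real => real^'d => ennreal" where
 "nI ka H t x = nn_integral lborel (%s. indicator {0..t} s * (ennreal (exp (- ka * s)) * nP s (H (t - s)) x))"

lemma nP_measurable_pair [measurable (raw)]:
 fixes F :: "'a => real^'d => ennreal"
 assumes [measurable]: "case_prod F \<in> borel_measurable (M \<Otimes>\<^sub>M borel)" "r \<in> borel_measurable M" "x \<in> measurable M borel"
 shows "(%a. nP (r a) (F a) (x a)) \<in> borel_measurable M"
 unfolding nP_def by measurable

lemma nI_measurable_pair:
 fixes H :: "real => real^'d => ennreal"
 assumes [measurable]: "case_prod H \<in> borel_measurable (borel \<Otimes>\<^sub>M borel)"
 shows "case_prod (nI ka H) \<in> borel_measurable (borel \<Otimes>\<^sub>M borel)"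
proof -
 have [measurable]: "(%a. H (f a) (g a)) \<in> borel_measurable M" if "f \<in> borel_measurable M" "g \<in> borel_measurable M" for f g and M :: "'b measure"
  using measurable_compose[OF measurable_Pair[OF that] assms] by simp
 \<comment> \<open>The indicator of the moving interval becomes a condition on (s, t), which makes
   joint measurability visible.\<close>
 have eq: "case_prod (nI ka H) = (%p. nn_integral lborel (%s. (if 0 <= s & s <= fst p then 1 else 0) * (ennreal (exp (- ka * s)) * nn_integral stdN (%z. H (fst p - s) (exp (- b * s) *\<^sub>R snd p + sd s *\<^sub>R z)))))"
  by (auto simp: nI_def nP_def fun_eq_iff indicator_def of_bool_def)
 show ?thesis unfolding eq by measurable
qed

lemma nP_nP:
 fixes h :: "real^'d => ennreal"
 assumes [measurable]: "h \<in> borel_measurable borel" and "s >= 0" "t >= 0"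
 shows "nP s (nP t h) x = nP (s + t) h x"
proof (cases "t = 0")
 case True
 have "nP 0 h = h" by (simp add: nP_def fun_eq_iff SG.emeasure_space_1[simplified])
 then show ?thesis using True by simp
next
 case False
 then have t: "t > 0" using assms by simp
 have e: "exp (- 2 * b * (s + t)) = (exp (- b * t))\<^sup>2 * exp (- 2 * b * s)" "exp (- 2 * b * t) = (exp (- b * t))\<^sup>2"
  by (simp_all add: power2_eq_square exp_add[symmetric] algebra_simps)
 have st: "0 <= s + t" using assms by simp
 have "(exp (- b * t) * sd s)\<^sup>2 + (sd t)\<^sup>2 = (sd (s + t))\<^sup>2"
  unfolding power_mult_distrib sd_sq[OF assms(2)] sd_sq[OF assms(3)] sd_sq[OF st] e
  by (simp add: diff_divide_distrib add_divide_distrib algebra_simps)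
 then have sq: "sqrt ((exp (- b * t) * sd s)\<^sup>2 + (sd t)\<^sup>2) = sd (s + t)" using sd_bounds(1)[OF st] by simp
 have ee: "exp (- b * t) * exp (- b * s) = exp (- b * (s + t))" by (simp add: exp_add[symmetric] algebra_simps)
 have "nP s (nP t h) x = nn_integral stdN (%z1. (nn_integral stdN (%z2. h ((exp (- b * t) * exp (- b * s)) *\<^sub>R x + (exp (- b * t) * sd s) *\<^sub>R z1 + sd t *\<^sub>R z2))))"
  unfolding nP_def by (simp only: scaleR_add_right scaleR_scaleR)
 also have "... = nP (s + t) h x"
  unfolding nP_def by (subst nn_integral_gauss_conv[OF _ sd_bounds(3)[OF t]]) (simp_all only: assms sq ee)
 finally show ?thesis .
qed

lemma nP_cmult:
 assumes [measurable]: "h \<in> borel_measurable borel" shows "nP t (%x. c * h x) x = c * nP t h x"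
 unfolding nP_def by (rule nn_integral_cmult) measurable

lemma nP_add:
 assumes [measurable]: "h \<in> borel_measurable borel" "g \<in> borel_measurable borel"
 shows "nP t (%x. h x + g x) x = nP t h x + nP t g x"
 unfolding nP_def by (rule nn_integral_add) measurable

lemma nP_mono: "(!!x. h x <= g x) ==> nP t h x <= nP t g x"
 unfolding nP_def by (intro nn_integral_mono)

lemma nP_const [simp]: "nP t (%_. c) x = c"
 unfolding nP_def by (simp add: SG.emeasure_space_1[simplified])

lemma nP_eq_ou:
 assumes f: "polyP f" "!!x. 0 <= f x"
 shows "nP t (%x. ennreal (f x)) x = ennreal (ou t f x)"
 unfolding nP_def ou_sg_eq_gop[OF polyP_measurable[OF f(1)]] gop_def
 by (rule nn_integral_eq_integral[OF integrable_gop[OF f(1)]]) (use f in auto)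

lemma ou_nonneg: "f \<in> borel_measurable borel ==> (!!x. 0 <= f x) ==> 0 <= ou t f x"
 unfolding ou_sg_eq_gop gop_def by (intro integral_nonneg_AE AE_I2)

lemma nn_integral_exp_mix:
 assumes "nu < ka" "0 <= v"
 shows "ennreal (ka - nu) * nn_integral lborel (%s. indicator {0..v} s * ennreal (exp (- nu * s - ka * (v - s)))) = ennreal (exp (- nu * v) - exp (- ka * v))"
proof -
 have "nn_integral lborel (%s. ennreal (exp (- nu * s - ka * (v - s))) * indicator {0..v} s)
  = exp (- nu * v - ka * (v - v)) / (ka - nu) - exp (- nu * 0 - ka * (v - 0)) / (ka - nu)"
 proof (rule nn_integral_FTC_Icc[where F="%s. exp (- nu * s - ka * (v - s)) / (ka - nu)"])
  fix s :: real
  have "((%s. - nu * s - ka * (v - s)) has_real_derivative (ka - nu)) (at s)"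
   by (auto intro!: derivative_eq_intros)
  from DERIV_cdivide[OF DERIV_fun_exp[OF this], of "ka - nu"]
  show "((%s. exp (- nu * s - ka * (v - s)) / (ka - nu)) has_real_derivative exp (- nu * s - ka * (v - s))) (at s)"
   using assms by simp
 qed (use assms in auto)
 then have "nn_integral lborel (%s. indicator {0..v} s * ennreal (exp (- nu * s - ka * (v - s)))) = ennreal ((exp (- nu * v) - exp (- ka * v)) / (ka - nu))"
  by (simp add: mult.commute diff_divide_distrib)
 moreover have "exp (- ka * v) <= exp (- nu * v)" using assms by (simp add: mult_right_mono)
 ultimately show ?thesis using assms by (simp add: ennreal_mult[symmetric])
qed

lemma nn_integral_lborel_shift:
 fixes f :: "real => ennreal"
 assumes [measurable]: "f \<in> borel_measurable borel"
 shows "nn_integral lborel (%u. f (s + u)) = nn_integral lborel (%u. f u)"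
 using nn_integral_real_affine[of f 1 s] by simp

text \<open>The resolvent equation for two killing rates: exchanging the order of the two time
  integrals leaves \<open>nn_integral_exp_mix\<close>. Sums on the left replace the usual
  difference, since subtraction is delicate in \<open>ennreal\<close>.\<close>

lemma nI_resolvent:
 fixes H :: "real => real^'d => ennreal"
 assumes H [measurable]: "case_prod H \<in> borel_measurable (borel \<Otimes>\<^sub>M borel)" and nuka: "nu < ka"
 shows "ennreal (ka - nu) * nI nu (nI ka H) t x + nI ka H t x = nI nu H t x"
proof -
 have Hm [measurable]: "(%a. H (f a) (g a)) \<in> borel_measurable M" if "f \<in> borel_measurable M" "g \<in> borel_measurable M" for f g and M :: "'b measure"
  using measurable_compose[OF measurable_Pair[OF that] H] by simp
 define K where "K = (%v. nP v (H (t - v)) x)"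
 have Kv: "nP v (H (t - v)) x = K v" for v by (simp add: K_def)
 have Km [measurable]: "K \<in> borel_measurable borel" unfolding K_def by measurable
 have 1: "nP s (nI ka H (t - s)) x = nn_integral lborel (%v. indicator {s..t} v * (ennreal (exp (- ka * (v - s))) * K v))" if s: "0 <= s" "s <= t" for s
 proof -
  have "nP s (nI ka H (t - s)) x = nn_integral stdN (%z. (nn_integral lborel (%u. indicator {0..t - s} u * (ennreal (exp (- ka * u)) * nP u (H (t - s - u)) (exp (- b * s) *\<^sub>R x + sd s *\<^sub>R z)))))"
   by (simp add: nP_def[of s] nI_def)
  also have "... = nn_integral lborel (%u. (nn_integral stdN (%z. indicator {0..t - s} u * (ennreal (exp (- ka * u)) * nP u (H (t - s - u)) (exp (- b * s) *\<^sub>R x + sd s *\<^sub>R z)))))"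
   by (rule SGL.Fubini'[symmetric]) measurable
  also have "... = nn_integral lborel (%u. indicator {0..t - s} u * (ennreal (exp (- ka * u)) * nP s (nP u (H (t - s - u))) x))"
  proof (rule nn_integral_cong)
   fix u :: real
   show "nn_integral stdN (%z. indicator {0..t - s} u * (ennreal (exp (- ka * u)) * nP u (H (t - s - u)) (exp (- b * s) *\<^sub>R x + sd s *\<^sub>R z)))
    = indicator {0..t - s} u * (ennreal (exp (- ka * u)) * nP s (nP u (H (t - s - u))) x)"
    unfolding nP_def[of s] by (subst nn_integral_cmult, measurable, subst nn_integral_cmult, measurable)
  qed
  also have "... = nn_integral lborel (%u. indicator {s..t} (s + u) * (ennreal (exp (- ka * ((s + u) - s))) * K (s + u)))"
  proof (rule nn_integral_cong)
   fix u :: real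
   show "indicator {0..t - s} u * (ennreal (exp (- ka * u)) * nP s (nP u (H (t - s - u))) x) = indicator {s..t} (s + u) * (ennreal (exp (- ka * ((s + u) - s))) * K (s + u))"
   proof (cases "0 <= u & u <= t - s")
    case True
    then have "nP s (nP u (H (t - s - u))) x = nP (s + u) (H (t - s - u)) x" using s by (intro nP_nP) auto
    then show ?thesis using True by (simp add: K_def diff_diff_eq)
   qed (auto simp: indicator_def)
  qed
  also have "... = nn_integral lborel (%v. indicator {s..t} v * (ennreal (exp (- ka * (v - s))) * K v))"
   by (rule nn_integral_lborel_shift) measurable
  finally show ?thesis .
 qed
 have "nI nu (nI ka H) t x = nn_integral lborel (%s. (nn_integral lborel (%v. (if 0 <= s & s <= v & v <= t then 1 else 0) * (ennreal (exp (- nu * s - ka * (v - s))) * K v))))"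
  unfolding nI_def[of nu]
 proof (rule nn_integral_cong)
  fix s :: real
  show "indicator {0..t} s * (ennreal (exp (- nu * s)) * nP s (nI ka H (t - s)) x) = nn_integral lborel (%v. (if 0 <= s & s <= v & v <= t then 1 else 0) * (ennreal (exp (- nu * s - ka * (v - s))) * K v))"
  proof (cases "0 <= s & s <= t")
   case True
   have "ennreal (exp (- nu * s)) * nn_integral lborel (%v. indicator {s..t} v * (ennreal (exp (- ka * (v - s))) * K v))
     = nn_integral lborel (%v. ennreal (exp (- nu * s)) * (indicator {s..t} v * (ennreal (exp (- ka * (v - s))) * K v)))"
    by (rule nn_integral_cmult[symmetric]) measurable
   also have "... = nn_integral lborel (%v. (if 0 <= s & s <= v & v <= t then 1 else 0) * (ennreal (exp (- nu * s - ka * (v - s))) * K v))"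
   proof (rule nn_integral_cong)
    fix v
    have "ennreal (exp (- nu * s - ka * (v - s))) = ennreal (exp (- nu * s)) * ennreal (exp (- ka * (v - s)))"
     by (simp add: ennreal_mult[symmetric] exp_add[symmetric])
    then show "ennreal (exp (- nu * s)) * (indicator {s..t} v * (ennreal (exp (- ka * (v - s))) * K v)) = (if 0 <= s & s <= v & v <= t then 1 else 0) * (ennreal (exp (- nu * s - ka * (v - s))) * K v)"
     using True by (auto simp: indicator_def mult.assoc)
   qed
   finally show ?thesis using True 1 by simp
  next
   case False
   then have "(if 0 <= s & s <= v & v <= t then 1 else 0) = (0::ennreal)" for v by auto
   then show ?thesis using False by (auto simp: indicator_def)
  qed
 qed
 also have "... = nn_integral lborel (%v. (nn_integral lborel (%s. (if 0 <= s & s <= v & v <= t then 1 else 0) * (ennreal (exp (- nu * s - ka * (v - s))) * K v))))"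
  by (rule lborel_pair.Fubini') measurable
 finally have 2: "nI nu (nI ka H) t x = ..." .
 have "ennreal (ka - nu) * nI nu (nI ka H) t x = nn_integral lborel (%v. ennreal (ka - nu) * nn_integral lborel (%s. (if 0 <= s & s <= v & v <= t then 1 else 0) * (ennreal (exp (- nu * s - ka * (v - s))) * K v)))"
  unfolding 2 by (rule nn_integral_cmult[symmetric]) measurable
 also have "... = nn_integral lborel (%v. indicator {0..t} v * (ennreal (exp (- nu * v) - exp (- ka * v)) * K v))"
 proof (rule nn_integral_cong)
  fix v :: real
  show "ennreal (ka - nu) * nn_integral lborel (%s. (if 0 <= s & s <= v & v <= t then 1 else 0) * (ennreal (exp (- nu * s - ka * (v - s))) * K v))
   = indicator {0..t} v * (ennreal (exp (- nu * v) - exp (- ka * v)) * K v)"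
  proof (cases "0 <= v & v <= t")
   case True
   have "nn_integral lborel (%s. (if 0 <= s & s <= v & v <= t then 1 else 0) * (ennreal (exp (- nu * s - ka * (v - s))) * K v))
     = nn_integral lborel (%s. (indicator {0..v} s * ennreal (exp (- nu * s - ka * (v - s)))) * K v)"
    using True by (intro nn_integral_cong) (auto simp: indicator_def)
   also have "... = nn_integral lborel (%s. indicator {0..v} s * ennreal (exp (- nu * s - ka * (v - s)))) * K v"
    by (rule nn_integral_multc) measurable
   finally show ?thesis using True nn_integral_exp_mix[OF nuka, of v] by (simp add: mult.assoc[symmetric])
  next
   case False
   then have "(if 0 <= s & s <= v & v <= t then 1 else 0) = (0::ennreal)" for s by auto
   then show ?thesis using False by (auto simp: indicator_def)
  qed
 qed
 finally have 3: "ennreal (ka - nu) * nI nu (nI ka H) t x = ..." .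
 have "ennreal (ka - nu) * nI nu (nI ka H) t x + nI ka H t x
  = nn_integral lborel (%v. indicator {0..t} v * (ennreal (exp (- nu * v) - exp (- ka * v)) * K v) + indicator {0..t} v * (ennreal (exp (- ka * v)) * K v))"
  unfolding 3 unfolding nI_def[of ka] Kv by (rule nn_integral_add[symmetric]) measurable
 also have "... = nn_integral lborel (%v. indicator {0..t} v * (ennreal (exp (- nu * v)) * K v))"
 proof (rule nn_integral_cong)
  fix v :: real
  show "indicator {0..t} v * (ennreal (exp (- nu * v) - exp (- ka * v)) * K v) + indicator {0..t} v * (ennreal (exp (- ka * v)) * K v) = indicator {0..t} v * (ennreal (exp (- nu * v)) * K v)"
  proof (cases "v \<in> {0..t}")
   case True
   have "exp (- ka * v) <= exp (- nu * v)" using nuka True by (simp add: mult_right_mono)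
   then have "ennreal (exp (- nu * v) - exp (- ka * v)) + ennreal (exp (- ka * v)) = ennreal (exp (- nu * v))"
    by (simp add: ennreal_plus[symmetric] del: ennreal_plus)
   then show ?thesis using True by (simp add: distrib_right[symmetric])
  qed simp
 qed
 also have "... = nI nu H t x" unfolding nI_def K_def ..
 finally show ?thesis .
qed

lemma nI_cmult:
 assumes "case_prod H \<in> borel_measurable (borel \<Otimes>\<^sub>M borel)"
 shows "nI ka (%t x. c * H t x) t x = c * nI ka H t x"
proof -
 have Hm [measurable]: "(%a. H (f a) (g a)) \<in> borel_measurable M" if "f \<in> borel_measurable M" "g \<in> borel_measurable M" for f g and M :: "'b measure"
  using measurable_compose[OF measurable_Pair[OF that] assms] by simp
 have "nI ka (%t x. c * H t x) t x = nn_integral lborel (%s. c * (indicator {0..t} s * (ennreal (exp (- ka * s)) * nP s (H (t - s)) x)))"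
  unfolding nI_def by (subst nP_cmult) (auto simp: mult_ac)
 also have "... = c * nI ka H t x" unfolding nI_def by (rule nn_integral_cmult) measurable
 finally show ?thesis .
qed

lemma nI_add:
 assumes "case_prod H \<in> borel_measurable (borel \<Otimes>\<^sub>M borel)" "case_prod G \<in> borel_measurable (borel \<Otimes>\<^sub>M borel)"
 shows "nI ka (%t x. H t x + G t x) t x = nI ka H t x + nI ka G t x"
proof -
 have Hm [measurable]: "(%a. H (f a) (g a)) \<in> borel_measurable M" if "f \<in> borel_measurable M" "g \<in> borel_measurable M" for f g and M :: "'b measure"
  using measurable_compose[OF measurable_Pair[OF that] assms(1)] by simp
 have Gm [measurable]: "(%a. G (f a) (g a)) \<in> borel_measurable M" if "f \<in> borel_measurable M" "g \<in> borel_measurable M" for f g and M :: "'b measure"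
  using measurable_compose[OF measurable_Pair[OF that] assms(2)] by simp
 have "nI ka (%t x. H t x + G t x) t x = nn_integral lborel (%s. indicator {0..t} s * (ennreal (exp (- ka * s)) * nP s (H (t - s)) x) + indicator {0..t} s * (ennreal (exp (- ka * s)) * nP s (G (t - s)) x))"
  unfolding nI_def by (subst nP_add) (auto simp: distrib_left)
 also have "... = nI ka H t x + nI ka G t x" unfolding nI_def by (rule nn_integral_add) measurable
 finally show ?thesis .
qed

lemma nI_cong: "(!!s x. 0 <= s ==> s <= t ==> H s x = G s x) ==> nI ka H t x = nI ka G t x"
 unfolding nI_def nP_def by (intro nn_integral_cong) (auto simp: indicator_def)

lemma nI_mono: "(!!s x. 0 <= s ==> s <= t ==> H s x <= G s x) ==> nI ka H t x <= nI ka G t x"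
 unfolding nI_def nP_def
proof (rule nn_integral_mono)
 fix s :: real
 assume le: "!!s x. 0 <= s ==> s <= t ==> H s x <= G s x"
 show "indicator {0..t} s * (ennreal (exp (- ka * s)) * nn_integral stdN (%z. H (t - s) (exp (- b * s) *\<^sub>R x + sd s *\<^sub>R z)))
  <= indicator {0..t} s * (ennreal (exp (- ka * s)) * nn_integral stdN (%z. G (t - s) (exp (- b * s) *\<^sub>R x + sd s *\<^sub>R z)))"
  by (cases "s \<in> {0..t}") (auto intro!: mult_left_mono nn_integral_mono le)
qed

lemma nI_semigroup:
 fixes f :: "real^'d => ennreal"
 assumes [measurable]: "f \<in> borel_measurable borel" and nuka: "nu < ka" and t: "0 <= t"
 shows "ennreal (ka - nu) * nI nu (%t x. ennreal (exp (- ka * t)) * nP t f x) t x + ennreal (exp (- ka * t)) * nP t f x = ennreal (exp (- nu * t)) * nP t f x"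
proof -
 have "nI nu (%t x. ennreal (exp (- ka * t)) * nP t f x) t x = nn_integral lborel (%s. (indicator {0..t} s * ennreal (exp (- nu * s - ka * (t - s)))) * nP t f x)"
  unfolding nI_def
 proof (rule nn_integral_cong)
  fix s :: real
  show "indicator {0..t} s * (ennreal (exp (- nu * s)) * nP s (%x. ennreal (exp (- ka * (t - s))) * nP (t - s) f x) x) = (indicator {0..t} s * ennreal (exp (- nu * s - ka * (t - s)))) * nP t f x"
  proof (cases "s \<in> {0..t}")
   case True
   have "nP s (%x. ennreal (exp (- ka * (t - s))) * nP (t - s) f x) x = ennreal (exp (- ka * (t - s))) * nP s (nP (t - s) f) x"
    by (rule nP_cmult) measurable
   also have "nP s (nP (t - s) f) x = nP t f x" using True by (subst nP_nP) auto
   finally show ?thesis using True by (simp add: mult.assoc[symmetric] ennreal_mult[symmetric] exp_add[symmetric])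
  qed simp
 qed
 also have "... = nn_integral lborel (%s. indicator {0..t} s * ennreal (exp (- nu * s - ka * (t - s)))) * nP t f x"
  by (rule nn_integral_multc) measurable
 finally have "ennreal (ka - nu) * nI nu (%t x. ennreal (exp (- ka * t)) * nP t f x) t x = ennreal (exp (- nu * t) - exp (- ka * t)) * nP t f x"
  using nn_integral_exp_mix[OF nuka t] by (simp add: mult.assoc[symmetric])
 moreover have "ennreal (exp (- nu * t) - exp (- ka * t)) + ennreal (exp (- ka * t)) = ennreal (exp (- nu * t))"
  using nuka t by (subst ennreal_plus[symmetric]) (auto simp: mult_right_mono)
 ultimately show ?thesis by (simp add: distrib_right[symmetric])
qed

text \<open>Lowering the killing rate from ka to nu puts the linear term (ka - nu)V on the left: a
  solution at one rate satisfies the corresponding equation at every smaller rate, by the resolvent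
  identity for H and its analogue for the semigroup term.\<close>

lemma mild_change_rate:
 fixes f :: "real^'d => ennreal"
 assumes f [measurable]: "f \<in> borel_measurable borel" and H: "case_prod H \<in> borel_measurable (borel \<Otimes>\<^sub>M borel)"
  and nuka: "nu < ka" and t: "0 <= t"
  and V: "!!s x. 0 <= s ==> V s x = ennreal (exp (- ka * s)) * nP s f x + nI ka H s x"
 shows "ennreal (ka - nu) * nI nu V t x + V t x = ennreal (exp (- nu * t)) * nP t f x + nI nu H t x"
proof -
 have "nI nu V t x = nI nu (%s x. ennreal (exp (- ka * s)) * nP s f x + nI ka H s x) t x"
  by (rule nI_cong) (rule V)
 also have "... = nI nu (%s x. ennreal (exp (- ka * s)) * nP s f x) t x + nI nu (nI ka H) t x"
  by (rule nI_add) (use nI_measurable_pair[OF H] in \<open>auto simp: case_prod_beta'\<close>)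
 finally show ?thesis
  unfolding V[OF t] nI_semigroup[OF f nuka t, symmetric] nI_resolvent[OF H nuka, symmetric]
  by (simp add: distrib_left add_ac)
qed

end

section \<open>Construction of the mild solution\<close>

context branching
begin

lemma polyP_bounded:
 assumes "f \<in> borel_measurable borel" "!!x. abs (f x) <= M" shows "polyP f"
 by (rule polyPI[OF assms(1), of M 0]) (use assms in simp)

lemma ou_le_const:
 assumes [measurable]: "f \<in> borel_measurable borel" and "!!x. 0 <= f x" "!!x. f x <= M"
 shows "ou t f x <= M"
proof -
 have p: "polyP f" using assms by (intro polyP_bounded[of _ M]) (auto simp: abs_le_iff intro: order_trans)
 have "ou t f x <= (LINT z|(stdN::(real^'a) measure). M)"
  unfolding ou_sg_eq_gop[OF assms(1)] gop_def using assms by (intro integral_mono integrable_gop[OF p]) auto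
 then show ?thesis by (simp add: SG.prob_space[simplified])
qed

lemma nI_eq_integral:
 fixes F :: "real => real^'d => real"
 assumes F: "case_prod F \<in> borel_measurable (borel \<Otimes>\<^sub>M borel)" and b: "!!s x. 0 <= s ==> 0 <= F s x & F s x <= M" and t: "0 <= t"
 shows "nI ka (%s x. ennreal (F s x)) t x = ennreal (LINT s|lborel. indicator {0..t} s * (exp (- ka * s) * ou s (F (t - s)) x))"
  "integrable lborel (%s. indicator {0..t} s * (exp (- ka * s) * ou s (F (t - s)) x))"
proof -
 have Fm [measurable]: "(%a. F (f a) (g a)) \<in> borel_measurable M" if "f \<in> borel_measurable M" "g \<in> borel_measurable M" for f g and M :: "'b measure"
  using measurable_compose[OF measurable_Pair[OF that] F] by simp
 have [measurable]: "(%s. ou s (F (t - s)) x) \<in> borel_measurable borel"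
  by (rule ou_measurable_pair) (auto simp: case_prod_beta')
 have o: "0 <= ou s (F (t - s)) x" "ou s (F (t - s)) x <= M" if "0 <= s" "s <= t" for s
  using that b by (auto intro!: ou_nonneg ou_le_const)
 define B where "B = exp (abs ka * t) * M"
 have bd: "abs (exp (- ka * s) * ou s (F (t - s)) x) <= B" if "0 <= s" "s <= t" for s
 proof -
  have "- ka * s <= abs ka * s" using that by (intro mult_right_mono) auto
  also have "... <= abs ka * t" using that by (intro mult_left_mono) auto
  finally show ?thesis unfolding B_def abs_mult using o[OF that] by (intro mult_mono) auto
 qed
 show int: "integrable lborel (%s. indicator {0..t} s * (exp (- ka * s) * ou s (F (t - s)) x))"
 proof (rule Bochner_Integration.integrable_bound[of _ "%s. indicator {0..t} s * B"])
  show "integrable lborel (%s. indicator {0..t} s * B)" using t by (intro integrable_mult_left integrable_real_indicator) auto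
  show "AE s in lborel. norm (indicator {0..t} s * (exp (- ka * s) * ou s (F (t - s)) x)) <= norm (indicator {0..t} s * B)"
   by (intro AE_I2) (auto split: split_indicator intro!: order_trans[OF bd[simplified] abs_ge_self])
 qed measurable
 have "nI ka (%s x. ennreal (F s x)) t x = nn_integral lborel (%s. ennreal (indicator {0..t} s * (exp (- ka * s) * ou s (F (t - s)) x)))"
  unfolding nI_def
 proof (rule nn_integral_cong)
  fix s :: real
  show "indicator {0..t} s * (ennreal (exp (- ka * s)) * nP s (%x. ennreal (F (t - s) x)) x) = ennreal (indicator {0..t} s * (exp (- ka * s) * ou s (F (t - s)) x))"
  proof (cases "s \<in> {0..t}")
   case True
   have "polyP (F (t - s))" using True b[of "t - s"] by (intro polyP_bounded[of _ M]) (auto simp: abs_le_iff intro: order_trans)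
   then have "nP s (%x. ennreal (F (t - s) x)) x = ennreal (ou s (F (t - s)) x)"
    using True b[of "t - s"] by (intro nP_eq_ou) auto
   then show ?thesis using True o[of s] by (simp add: ennreal_mult[symmetric])
  qed simp
 qed
 also have "... = ennreal (LINT s|lborel. indicator {0..t} s * (exp (- ka * s) * ou s (F (t - s)) x))"
  using o by (intro nn_integral_eq_integral[OF int] AE_I2) (auto split: split_indicator)
 finally show "nI ka (%s x. ennreal (F s x)) t x = ennreal (LINT s|lborel. indicator {0..t} s * (exp (- ka * s) * ou s (F (t - s)) x))" .
qed

text \<open>Since psi(M) >= 0, the constant M is a supersolution. For a rate \<open>ka\<close> so
  large that g(z) = ka z - psi(z) is increasing on [0, M], the map \<open>F\<close> is monotone in u
  and stays below M; iterating it from 0 gives an increasing sequence whose limit solves the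
  equation at rate \<open>ka\<close>. \<open>mild_change_rate\<close> then yields the rate 0, which
  is \<open>is_V\<close>, and the rate -\<alpha>, which is the comparison with the mean.\<close>

lemma mild_solution:
 fixes f :: "real^'d::finite => real"
 assumes f [measurable]: "f \<in> borel_measurable borel" and fM: "!!x. 0 <= f x" "!!x. f x <= M" and M: "\<psi> M >= 0"
 obtains V where "case_prod V \<in> borel_measurable (borel \<Otimes>\<^sub>M borel)" "is_V \<sigma> b \<psi> f V"
  "!!t x. 0 <= t ==> 0 <= V t x & V t x <= M"
  "!!t x. 0 <= t ==> ennreal (V t x) + nI (- \<alpha>) (%s x. ennreal (\<psi>0 (V s x))) t x = ennreal (exp (\<alpha> * t) * ou t f x)"
proof -
 have M0: "0 <= M" using fM[of 0] by simp
 \<comment> \<open>The bracket is the Lipschitz constant of \<open>\<psi>0\<close> on [0, M] given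
   by \<open>\<psi>0_diff\<close>; the summand 1 makes the rate positive.\<close>
 define ka where "ka = 1 + (2 * \<rho> * M + max 1 M * (LINT y|Lev. indicator {0<..} y * min y (y\<^sup>2)))"
 have "0 <= (LINT y|Lev. indicator {0<..} y * min y (y\<^sup>2))" by (intro integral_nonneg_AE AE_I2) (auto split: split_indicator)
 then have ka: "ka > 0" unfolding ka_def using M0 \<rho>_nonneg by (intro add_pos_nonneg add_nonneg_nonneg mult_nonneg_nonneg) auto
 \<comment> \<open>Clipping to [0, M] makes \<open>g\<close> monotone and bounded on the whole line:
   the iteration then needs no range conditions, and Borel measurability of \<open>g\<close> follows
   from monotonicity.\<close>
 define cl where "cl = (%z::real. max 0 (min z M))"
 have cl: "0 <= cl z" "cl z <= M" for z using M0 by (auto simp: cl_def)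
 have cl_id: "0 <= z ==> z <= M ==> cl z = z" for z by (simp add: cl_def)
 define g where "g = (%z. ka * cl z - \<psi> (cl z))"
 have g_alt: "g z = (ka + \<alpha>) * cl z - \<psi>0 (cl z)" for z by (simp add: g_def \<psi>0_def algebra_simps)
 have \<psi>_lip: "\<psi>0 z - \<psi>0 x <= (z - x) * ka" if "0 <= x" "x <= z" "z <= M" for x z
  by (rule order_trans[OF \<psi>0_diff(2)[OF that]]) (use that in \<open>auto simp: ka_def intro!: mult_left_mono\<close>)
 have g_mono: "mono g"
 proof (rule monoI)
  fix x z :: real assume "x <= z"
  then have c: "cl x <= cl z" by (auto simp: cl_def)
  have "g z - g x = (cl z - cl x) * ka + \<alpha> * (cl z - cl x) - (\<psi>0 (cl z) - \<psi>0 (cl x))"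
   unfolding g_alt by (simp add: algebra_simps)
  moreover have "\<psi>0 (cl z) - \<psi>0 (cl x) <= (cl z - cl x) * ka" using c cl by (intro \<psi>_lip) auto
  moreover have "0 <= \<alpha> * (cl z - cl x)" using c \<alpha>_pos by simp
  ultimately show "g x <= g z" by linarith
 qed
 have g0: "g z >= 0" for z
 proof -
  have "\<psi>0 (cl z) - \<psi>0 0 <= (cl z - 0) * ka" using cl by (intro \<psi>_lip) auto
  moreover have "0 <= \<alpha> * cl z" using cl[of z] \<alpha>_pos by simp
  moreover have "(ka + \<alpha>) * cl z = (cl z - 0) * ka + \<alpha> * cl z" by (simp add: algebra_simps)
  ultimately show ?thesis unfolding g_alt \<psi>0_0 by linarith
 qed
 \<comment> \<open>The supersolution property: the largest value of \<open>g\<close> is ka M -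
   psi(M), at most ka M.\<close>
 have gM: "g z <= ka * M" for z
 proof -
  have "g z <= g (max z M)" by (rule monoD[OF g_mono]) simp
  also have "... = ka * M - \<psi> M" using M0 by (simp add: g_def cl_def)
  finally show ?thesis using M by simp
 qed
 have g_lip: "abs (g z - g x) <= (2 * ka + \<alpha>) * abs (z - x)" for x z
 proof -
  have *: "abs (g z - g x) <= (2 * ka + \<alpha>) * abs (z - x)" if xz: "x <= z" for x z
  proof -
   have c: "cl x <= cl z" "cl z - cl x <= z - x" using xz M0 by (auto simp: cl_def)
   have "0 <= \<psi>0 (cl z) - \<psi>0 (cl x)" using c cl by (intro \<psi>0_diff(1)[of _ _ M]) auto
   moreover have "g z - g x = (ka + \<alpha>) * (cl z - cl x) - (\<psi>0 (cl z) - \<psi>0 (cl x))"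
    unfolding g_alt by (simp add: algebra_simps)
   ultimately have "g z - g x <= (ka + \<alpha>) * (cl z - cl x)" by linarith
   also have "... <= (2 * ka + \<alpha>) * (z - x)" using c ka \<alpha>_pos by (intro mult_mono) auto
   finally show ?thesis using monoD[OF g_mono xz] xz by simp
  qed
  show ?thesis using *[of x z] *[of z x] by (cases "x <= z") (auto simp: abs_minus_commute)
 qed
 have g_cont: "continuous_on UNIV g"
 proof (rule continuous_on_iff[THEN iffD2], intro ballI allI impI)
  fix x e :: real assume e: "0 < e"
  have L: "2 * ka + \<alpha> > 0" using ka \<alpha>_pos by simp
  show "\<exists>d>0. \<forall>x'\<in>UNIV. dist x' x < d --> dist (g x') (g x) < e"
  proof (intro exI[of _ "e / (2 * ka + \<alpha>)"] conjI ballI impI)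
   fix x' assume "dist x' x < e / (2 * ka + \<alpha>)"
   then have "(2 * ka + \<alpha>) * abs (x' - x) < e" using L by (simp add: dist_real_def field_simps)
   then show "dist (g x') (g x) < e" using g_lip[of x' x] by (simp add: dist_real_def)
  qed (use e L in simp)
 qed
 have [measurable]: "g \<in> borel_measurable borel" by (rule borel_measurable_mono[OF g_mono])
 define F where "F = (%u::real => real^'d => real. %t x. ennreal (exp (- ka * t)) * nP t (%x. ennreal (f x)) x + nI ka (%s x. ennreal (g (u s x))) t x)"
 have F_meas: "case_prod (F u) \<in> borel_measurable (borel \<Otimes>\<^sub>M borel)" if [measurable]: "case_prod u \<in> borel_measurable (borel \<Otimes>\<^sub>M borel)" for u
 proof -
  have [measurable]: "case_prod (nI ka (%s x. ennreal (g (u s x)))) \<in> borel_measurable (borel \<Otimes>\<^sub>M borel)"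
   by (rule nI_measurable_pair) (simp add: case_prod_beta')
  have "(%p. nI ka (%s x. ennreal (g (u s x))) (fst p) (snd p)) \<in> borel_measurable (borel \<Otimes>\<^sub>M borel)"
   using nI_measurable_pair[of "%s x. ennreal (g (u s x))" ka] that by (simp add: case_prod_beta')
  then show ?thesis unfolding F_def case_prod_beta' by measurable
 qed
 \<comment> \<open>Mass balance: the Duhamel term contributes at most M(1 - exp(-ka t)) and the
   initial term at most M exp(-ka t).\<close>
 have F_le: "F u t x <= ennreal M" if t: "0 <= t" for u t x
 proof -
  have "nI ka (%s x. ennreal (g (u s x))) t x <= nn_integral lborel (%s. ennreal M * (ennreal (ka * exp (- ka * s)) * indicator {0..t} s))"
   unfolding nI_def
  proof (rule nn_integral_mono)
   fix s :: real
   have "nP s (%x. ennreal (g (u (t - s) x))) x <= nP s (%x. ennreal (ka * M)) x" by (intro nP_mono ennreal_leI gM)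
   then have "ennreal (exp (- ka * s)) * nP s (%x. ennreal (g (u (t - s) x))) x <= ennreal (exp (- ka * s)) * ennreal (ka * M)"
    by (intro mult_left_mono) auto
   also have "... = ennreal M * ennreal (ka * exp (- ka * s))" using ka M0 by (simp add: ennreal_mult[symmetric] mult_ac)
   finally show "indicator {0..t} s * (ennreal (exp (- ka * s)) * nP s (%x. ennreal (g (u (t - s) x))) x) <= ennreal M * (ennreal (ka * exp (- ka * s)) * indicator {0..t} s)"
    by (auto split: split_indicator)
  qed
  also have "... = ennreal M * nn_integral lborel (%s. ennreal (ka * exp (- ka * s)) * indicator {0..t} s)"
   by (rule nn_integral_cmult) measurable
  also have "nn_integral lborel (%s. ennreal (ka * exp (- ka * s)) * indicator {0..t} s) = ennreal (- exp (- ka * t) - - exp (- ka * 0))"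
   by (rule nn_integral_FTC_Icc[where F="%s. - exp (- ka * s)"]) (use t ka in \<open>auto intro!: derivative_eq_intros\<close>)
  finally have 1: "nI ka (%s x. ennreal (g (u s x))) t x <= ennreal (M * (1 - exp (- ka * t)))"
   using M0 ka t by (simp add: ennreal_mult[symmetric])
  have "nP t (%x. ennreal (f x)) x <= nP t (%x. ennreal M) x" by (intro nP_mono ennreal_leI fM)
  then have "ennreal (exp (- ka * t)) * nP t (%x. ennreal (f x)) x <= ennreal (exp (- ka * t)) * ennreal M"
   by (intro mult_left_mono) auto
  then have "F u t x <= ennreal (exp (- ka * t) * M) + ennreal (M * (1 - exp (- ka * t)))"
   unfolding F_def using 1 by (intro add_mono) (simp_all add: ennreal_mult')
  also have "... = ennreal (exp (- ka * t) * M + M * (1 - exp (- ka * t)))"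
   using M0 ka t by (intro ennreal_plus[symmetric] mult_nonneg_nonneg) auto
  also have "exp (- ka * t) * M + M * (1 - exp (- ka * t)) = M" by (simp add: algebra_simps)
  finally show ?thesis .
 qed
 \<comment> \<open>For t >= 0 the values of \<open>F\<close> are finite by \<open>F_le\<close>, so
   \<open>enn2real\<close> loses nothing there (\<open>U_F\<close>).\<close>
 define U where "U = rec_nat (%t x. 0) (%_ u t x. enn2real (F u t x))"
 have U0: "U 0 = (%t x. 0)" and US: "U (Suc n) = (%t x. enn2real (F (U n) t x))" for n by (simp_all add: U_def)
 have U_meas: "case_prod (U n) \<in> borel_measurable (borel \<Otimes>\<^sub>M borel)" for n
 proof (induction n)
  case (Suc n)
  have "(%p. enn2real (case_prod (F (U n)) p)) \<in> borel_measurable (borel \<Otimes>\<^sub>M borel)"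
   using F_meas[OF Suc] by measurable
  then show ?case by (simp add: US case_prod_beta')
 qed (simp add: U0 case_prod_beta')
 have U_F: "ennreal (U (Suc n) t x) = F (U n) t x" if "0 <= t" for n t x
  unfolding US by (intro ennreal_enn2real le_less_trans[OF F_le[OF that] ennreal_less_top])
 have U_b: "0 <= U n t x" "U n t x <= M" if "0 <= t" for n t x
 proof -
  show "0 <= U n t x" by (cases n) (auto simp: U0 US)
  show "U n t x <= M"
  proof (cases n)
   case (Suc m)
   have "ennreal (U n t x) <= ennreal M" unfolding Suc U_F[OF that] by (rule F_le[OF that])
   then show ?thesis using M0 by (simp add: ennreal_le_iff)
  qed (simp add: U0 M0)
 qed
 have F_mono: "F u t x <= F v t x" if "!!s y. 0 <= s ==> u s y <= v s y" "0 <= t" for u v t x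
  unfolding F_def using that by (intro add_left_mono nI_mono ennreal_leI monoD[OF g_mono]) auto
 have U_inc: "U n t x <= U (Suc n) t x" if "0 <= t" for n t x
  using that
 proof (induction n arbitrary: t x)
  case 0
  show ?case using U_b(1)[OF 0, of "Suc 0"] by (simp add: U0)
 next
  case (Suc n)
  have "ennreal (U (Suc n) t x) <= ennreal (U (Suc (Suc n)) t x)"
   unfolding U_F[OF Suc.prems] by (rule F_mono[OF Suc.IH Suc.prems])
  then show ?case using U_b(1)[OF Suc.prems] by (simp add: ennreal_le_iff)
 qed
 define V where "V = (%t x. lim (%n. U n t x))"
 have V_lim: "(%n. U n t x) \<longlonglongrightarrow> V t x" if "0 <= t" for t x
 proof -
  have "incseq (%n. U n t x)" by (rule incseq_SucI) (rule U_inc[OF that])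
  moreover have "bdd_above (range (%n. U n t x))" using U_b(2)[OF that] by (intro bdd_aboveI[of _ M]) auto
  ultimately have "convergent (%n. U n t x)" using LIMSEQ_incseq_SUP by (auto simp: convergent_def)
  then show ?thesis unfolding V_def by (simp add: convergent_LIMSEQ_iff)
 qed
 have V_meas: "case_prod V \<in> borel_measurable (borel \<Otimes>\<^sub>M borel)"
 proof -
  have "(%p. lim (%n. case_prod (U n) p)) \<in> borel_measurable (borel \<Otimes>\<^sub>M borel)"
   using U_meas by (intro borel_measurable_lim_metric) auto
  then show ?thesis by (simp add: V_def case_prod_beta')
 qed
 have V_b: "0 <= V t x & V t x <= M" if "0 <= t" for t x
  using LIMSEQ_le_const[OF V_lim[OF that, of x], of 0] LIMSEQ_le_const2[OF V_lim[OF that, of x], of M] U_b[OF that] by auto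
 have V_eq: "ennreal (V t x) = F V t x" if t: "0 <= t" for t x
 proof -
  have Um [measurable]: "(%a. U n (f a) (h a)) \<in> borel_measurable M" if "f \<in> borel_measurable M" "h \<in> borel_measurable M" for n f h and M :: "'b measure"
   using measurable_compose[OF measurable_Pair[OF that] U_meas] by simp
  have gl: "(%n. ennreal (g (U n s y))) \<longlonglongrightarrow> ennreal (g (V s y))" if "0 <= s" for s y
   using V_lim[OF that, of y] g_cont by (intro tendsto_ennrealI isCont_tendsto_compose[of _ g]) (auto simp: continuous_on_eq_continuous_at)
  have gi: "incseq (%n. ennreal (g (U n s y)))" if "0 <= s" for s y
   using U_inc[OF that] by (intro incseq_SucI ennreal_leI monoD[OF g_mono])
  have nPl: "(%n. nP s (%x. ennreal (g (U n (t - s) x))) x) \<longlonglongrightarrow> nP s (%x. ennreal (g (V (t - s) x))) x" if "s <= t" for s x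
   unfolding nP_def
  proof (rule nn_integral_LIMSEQ)
   show "incseq (%n z. ennreal (g (U n (t - s) (exp (- b * s) *\<^sub>R x + sd s *\<^sub>R z))))"
    using gi[of "t - s"] that by (auto simp: incseq_def le_fun_def)
  qed (use that gl in auto)
  have nPi: "incseq (%n. nP s (%x. ennreal (g (U n (t - s) x))) x)" if "s <= t" for s x
   using gi[of "t - s"] that by (auto simp: incseq_def intro!: nP_mono)
  have "(%n. nI ka (%s x. ennreal (g (U n s x))) t x) \<longlonglongrightarrow> nI ka (%s x. ennreal (g (V s x))) t x"
   unfolding nI_def
  proof (rule nn_integral_LIMSEQ)
   show "incseq (%n s. indicator {0..t} s * (ennreal (exp (- ka * s)) * nP s (%x. ennreal (g (U n (t - s) x))) x))"
    unfolding incseq_def le_fun_def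
   proof (intro allI impI)
    fix m n :: nat and s assume "m <= n"
    then show "indicator {0..t} s * (ennreal (exp (- ka * s)) * nP s (%x. ennreal (g (U m (t - s) x))) x) <= indicator {0..t} s * (ennreal (exp (- ka * s)) * nP s (%x. ennreal (g (U n (t - s) x))) x)"
     using nPi[of s x] by (cases "s \<in> {0..t}") (auto simp: incseq_def intro!: mult_left_mono)
   qed
   fix s :: real
   show "(%n. indicator {0..t} s * (ennreal (exp (- ka * s)) * nP s (%x. ennreal (g (U n (t - s) x))) x)) \<longlonglongrightarrow> indicator {0..t} s * (ennreal (exp (- ka * s)) * nP s (%x. ennreal (g (V (t - s) x))) x)"
    using nPl[of s x] by (cases "s \<in> {0..t}") (auto intro!: ennreal_tendsto_cmult)
  qed measurable
  then have "(%n. F (U n) t x) \<longlonglongrightarrow> F V t x" unfolding F_def by (intro tendsto_add tendsto_const)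
  moreover have "(%n. F (U n) t x) \<longlonglongrightarrow> ennreal (V t x)"
   unfolding U_F[OF t, symmetric] using V_lim[OF t, THEN LIMSEQ_Suc] by (intro tendsto_ennrealI)
  ultimately show ?thesis by (intro LIMSEQ_unique)
 qed
 have Vm [measurable]: "(%a. V (f a) (h a)) \<in> borel_measurable M" if "f \<in> borel_measurable M" "h \<in> borel_measurable M" for f h and M :: "'b measure"
  using measurable_compose[OF measurable_Pair[OF that] V_meas] by simp
 \<comment> \<open>A version of \<open>\<psi>0\<close> after clipping, written through
   \<open>g\<close> so that it inherits measurability; it agrees with \<open>\<psi>0\<close> on the
   range of V.\<close>
 define \<psi>c where "\<psi>c = (%z. (ka + \<alpha>) * cl z - g z)"
 have \<psi>c_meas [measurable]: "\<psi>c \<in> borel_measurable borel" unfolding \<psi>c_def cl_def by measurable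
 have \<psi>c: "\<psi>c z = \<psi>0 z" if "0 <= z" "z <= M" for z using cl_id[OF that] by (simp add: \<psi>c_def g_alt)
 have \<psi>c0: "0 <= \<psi>c z" for z unfolding \<psi>c_def g_alt using \<psi>0_nonneg[OF cl(1)] by simp
 have gm: "case_prod (%s x. ennreal (g (V s x))) \<in> borel_measurable (borel \<Otimes>\<^sub>M borel)"
  and vm: "case_prod (%s x. ennreal (V s x)) \<in> borel_measurable (borel \<Otimes>\<^sub>M borel)"
  and pm: "case_prod (%s x. ennreal (\<psi>c (V s x))) \<in> borel_measurable (borel \<Otimes>\<^sub>M borel)"
  by (simp_all add: case_prod_beta')
 have fe: "(%x. ennreal (f x)) \<in> borel_measurable borel" by simp
 have f_poly: "polyP f" using fM by (intro polyP_bounded[of _ M]) (auto simp: abs_le_iff intro: order_trans)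
 have nPf: "nP t (%x. ennreal (f x)) x = ennreal (ou t f x)" for t x by (rule nP_eq_ou[OF f_poly fM(1)])
 have ouf: "0 <= ou t f x" for t x by (rule ou_nonneg[OF f fM(1)])
 have rate: "ennreal (ka - nu) * nI nu (%s x. ennreal (V s x)) t x + ennreal (V t x) = ennreal (exp (- nu * t)) * ennreal (ou t f x) + nI nu (%s x. ennreal (g (V s x))) t x"
  if "0 <= t" "nu < ka" for nu t x
  using mild_change_rate[OF fe gm that(2,1), of "%s x. ennreal (V s x)" x] V_eq by (simp add: F_def nPf)
 show ?thesis
 proof (rule that[OF V_meas _ V_b])
  fix t :: real and x :: "real^'d" assume t: "0 <= t"
  \<comment> \<open>At rate -\<alpha> one has (ka + \<alpha>)V = g(V) + \<psi>0(V). The integral of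
    g(V) is finite and cancels, which leaves the integral of \<psi>0(V) as the exact deficit from
    the mean.\<close>
  have I: "ennreal (ka + \<alpha>) * nI (- \<alpha>) (%s x. ennreal (V s x)) t x = nI (- \<alpha>) (%s x. ennreal (g (V s x))) t x + nI (- \<alpha>) (%s x. ennreal (\<psi>c (V s x))) t x"
   unfolding nI_add[OF gm pm, symmetric] nI_cmult[OF vm, symmetric]
  proof (rule nI_cong)
   fix s x assume s: "(0::real) <= s"
   have "(ka + \<alpha>) * V s x = g (V s x) + \<psi>c (V s x)" using cl_id[of "V s x"] V_b[OF s, of x] by (simp add: \<psi>c_def)
   then show "ennreal (ka + \<alpha>) * ennreal (V s x) = ennreal (g (V s x)) + ennreal (\<psi>c (V s x))"
    using g0 \<psi>c0 V_b[OF s, of x] ka \<alpha>_pos by (simp add: ennreal_mult[symmetric] ennreal_plus[symmetric] del: ennreal_plus)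
  qed
  have gfin: "nI (- \<alpha>) (%s x. ennreal (g (V s x))) t x ~= \<top>"
   using nI_eq_integral(1)[of "%s x. g (V s x)" "ka * M" t "- \<alpha>" x] g0 gM t by (simp add: case_prod_beta')
  have "nI (- \<alpha>) (%s x. ennreal (g (V s x))) t x + (nI (- \<alpha>) (%s x. ennreal (\<psi>c (V s x))) t x + ennreal (V t x))
   = nI (- \<alpha>) (%s x. ennreal (g (V s x))) t x + ennreal (exp (\<alpha> * t)) * ennreal (ou t f x)"
   using rate[OF t, of "- \<alpha>" x] ka \<alpha>_pos unfolding diff_minus_eq_add I by (simp add: add_ac)
  then have "nI (- \<alpha>) (%s x. ennreal (\<psi>c (V s x))) t x + ennreal (V t x) = ennreal (exp (\<alpha> * t)) * ennreal (ou t f x)"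
   using gfin by (simp add: ennreal_add_left_cancel)
  moreover have "nI (- \<alpha>) (%s x. ennreal (\<psi>c (V s x))) t x = nI (- \<alpha>) (%s x. ennreal (\<psi>0 (V s x))) t x"
   by (rule nI_cong) (use V_b \<psi>c in auto)
  ultimately show "ennreal (V t x) + nI (- \<alpha>) (%s x. ennreal (\<psi>0 (V s x))) t x = ennreal (exp (\<alpha> * t) * ou t f x)"
   using ouf by (simp add: ennreal_mult add.commute)
 next
  show "is_V \<sigma> b \<psi> f V"
   unfolding is_V_def
  proof (intro conjI allI impI)
   show "0 <= V t x" if "0 <= t" for t x using V_b[OF that] by simp
   show "\<exists>C. \<forall>t\<in>{0..T}. \<forall>x. abs (V t x) <= C" if "0 <= T" for T
    by (rule exI[of _ M]) (use V_b in \<open>auto simp: abs_le_iff intro: order_trans[of _ 0]\<close>)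
   fix t :: real and x :: "real^'d" assume t: "0 <= t"
   \<comment> \<open>The factor \<open>exp (- 0 * s)\<close> is kept so that the terms match
     \<open>nI_eq_integral\<close> at rate 0.\<close>
   let ?v = "%s. indicator {0..t} s * (exp (- 0 * s) * ou s (V (t - s)) x)"
   let ?g = "%s. indicator {0..t} s * (exp (- 0 * s) * ou s (%x. g (V (t - s) x)) x)"
   have Vi: "nI 0 (%s x. ennreal (V s x)) t x = ennreal (LINT s|lborel. ?v s)" "integrable lborel ?v"
    by (rule nI_eq_integral[OF V_meas _ t, of M], rule V_b, assumption)+
   have gmr: "case_prod (%s x. g (V s x)) \<in> borel_measurable (borel \<Otimes>\<^sub>M borel)" by (simp add: case_prod_beta')
   have gb: "0 <= g (V s x) & g (V s x) <= ka * M" for s x using g0 gM by simp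
   note Gi = nI_eq_integral[OF gmr gb t, of 0 x]
   have nn: "0 <= (LINT s|lborel. ?v s)" "0 <= (LINT s|lborel. ?g s)"
    by (intro integral_nonneg_AE AE_I2; use V_b g0 in \<open>auto split: split_indicator intro!: ou_nonneg\<close>)+
   have "ka * (LINT s|lborel. ?v s) + V t x = ou t f x + (LINT s|lborel. ?g s)"
    using rate[OF t, of 0 x] ka nn V_b[OF t, of x] ouf[of t x] unfolding Vi(1) Gi(1)
    by (simp add: ennreal_mult[symmetric] ennreal_plus[symmetric] del: ennreal_plus)
   moreover have "(LBINT s=0..t. ou s (%y. \<psi> (V (t - s) y)) x) = ka * (LINT s|lborel. ?v s) - (LINT s|lborel. ?g s)"
   proof -
    have "(LBINT s=0..t. ou s (%y. \<psi> (V (t - s) y)) x) = (LINT s|lborel. indicator {0..t} s * ou s (%y. \<psi> (V (t - s) y)) x)"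
     using t by (simp add: interval_integral_Icc set_lebesgue_integral_def zero_ereal_def)
    also have "... = (LINT s|lborel. ka * ?v s - ?g s)"
    proof (rule Bochner_Integration.integral_cong[OF refl])
     fix s :: real
     show "indicator {0..t} s * ou s (%y. \<psi> (V (t - s) y)) x = ka * ?v s - ?g s"
     proof (cases "s \<in> {0..t}")
      case True
      then have ts: "0 <= t - s" by simp
      have "\<psi> (V (t - s) y) = ka * V (t - s) y - g (V (t - s) y)" for y
       using cl_id[of "V (t - s) y"] V_b[OF ts, of y] by (simp add: g_def)
      then have e: "(%y. \<psi> (V (t - s) y)) = (%y. ka * V (t - s) y - g (V (t - s) y))" by auto
      have p1: "polyP (%y. ka * V (t - s) y)"
       using V_b[OF ts] by (intro polyP_mult polyP_const polyP_bounded[of _ M]) (auto simp: abs_le_iff intro: order_trans[of _ 0])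
      have p2: "polyP (%y. g (V (t - s) y))"
       using g0 gM by (intro polyP_bounded[of _ "ka * M"]) (auto simp: abs_le_iff intro: order_trans[of _ 0])
      have m3: "(%y. ka * V (t - s) y - g (V (t - s) y)) \<in> borel_measurable borel" "V (t - s) \<in> borel_measurable borel" by measurable
      show ?thesis unfolding e using True
       by (simp add: ou_sg_eq_gop[OF m3(1)] ou_sg_eq_gop[OF m3(2)] ou_sg_eq_gop[OF polyP_measurable[OF p2]] gop_diff[OF p1 p2] gop_cmult)
     qed simp
    qed
    also have "... = (LINT s|lborel. ka * ?v s) - (LINT s|lborel. ?g s)"
     by (rule Bochner_Integration.integral_diff[OF integrable_mult_right[OF Vi(2)] Gi(2)])
    finally show ?thesis by simp
   qed
   ultimately show "V t x + (LBINT s=0..t. ou s (%y. \<psi> (V (t - s) y)) x) = ou t f x" by simp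
  qed
 qed
qed

end

text \<open>\<open>q\<close> is the usable moment order with the constant \<open>cpsi\<close> from
  \<open>\<psi>0_upper\<close>; \<open>\<psi>_large\<close> provides constants M with psi(M) >=
  0.\<close>

locale branching_q = branching +
 fixes q cpsi :: real
 assumes q: "1 < q" "q <= 2" and A_nonneg: "0 <= cpsi" and \<psi>0_le: "!!z. 0 <= z ==> \<psi>0 z <= cpsi * (z powr q + z\<^sup>2)"
  and \<psi>_large: "\<exists>z'. \<forall>z>z'. 0 <= \<psi> z"
begin

text \<open>The bound M on f serves existence, whereas C depends on n and T alone. Since V <=
  exp(\<alpha>t)P_t f is at most th times a constant multiple of W_n, the deficit is a Duhamel
  integral of \<psi>0(V), itself at most a multiple of (th^q + th^2)W_{2n}.\<close>

lemma V_exists: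
 fixes n :: nat and T :: real
 assumes T: "0 <= T"
 obtains C where "0 <= C" "!!f th M. f \<in> borel_measurable borel ==> 0 < th ==> (!!x. 0 <= f x) ==> (!!x. f x <= M) ==>
  (!!x. f x <= th * wt n x) ==> \<exists>V. is_V \<sigma> b \<psi> f V & (\<forall>t. V t \<in> borel_measurable borel) &
   (\<forall>t\<in>{0..T}. \<forall>x::real^'d::finite. 0 <= V t x & V t x <= exp (\<alpha> * t) * ou t f x &
     exp (\<alpha> * t) * ou t f x - V t x <= C * (th powr q + th\<^sup>2) * wt (2 * n) x)"
proof -
 obtain K where K: "K >= 1" "!!f C t x. f \<in> borel_measurable borel ==> (!!x. abs (f x) <= C * wt n x) ==> 0 <= C ==> t >= 0
   ==> abs (ou t f (x::real^'d)) <= C * K * wt n x"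
  by (rule ou_bound[of n]) blast
 obtain K2 where K2: "K2 >= 1" "!!f C t x. f \<in> borel_measurable borel ==> (!!x. abs (f x) <= C * wt (2 * n) x) ==> 0 <= C ==> t >= 0
   ==> abs (ou t f (x::real^'d)) <= C * K2 * wt (2 * n) x"
  by (rule ou_bound[of "2 * n"]) blast
 define K1 where "K1 = exp (\<alpha> * T) * K"
 have eT: "1 <= exp (\<alpha> * T)" using T \<alpha>_pos by simp
 have K1: "1 <= K1" unfolding K1_def using eT K(1) mult_mono[of 1 "exp (\<alpha> * T)" 1 K] by simp
 define C where "C = T * (exp (\<alpha> * T) * (cpsi * K1\<^sup>2 * K2))"
 have C0: "0 <= C" unfolding C_def using T A_nonneg K2(1) by simp
 show ?thesis
 proof (rule that[OF C0])
  fix f :: "real^'d => real" and th M :: real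
  assume f [measurable]: "f \<in> borel_measurable borel" and th: "0 < th" and f0: "!!x. 0 <= f x" and fM: "!!x. f x <= M"
   and fW: "!!x. f x <= th * wt n x"
  obtain z' where z': "!!z. z > z' ==> 0 <= \<psi> z" using \<psi>_large by auto
  \<comment> \<open>The bound is raised beyond the point from which psi is nonnegative, so that M'
    is a supersolution.\<close>
  define M' where "M' = max M (z' + 1)"
  have M': "\<psi> M' >= 0" "!!x. f x <= M'"
   using z'[of M'] order_trans[OF fM max.cobounded1, of _ "z' + 1"] by (auto simp: M'_def)
  obtain V where V: "case_prod V \<in> borel_measurable (borel \<Otimes>\<^sub>M borel)" "is_V \<sigma> b \<psi> f V"
   "!!t x. 0 <= t ==> 0 <= V t x & V t x <= M'"
   "!!t x. 0 <= t ==> ennreal (V t x) + nI (- \<alpha>) (%s x. ennreal (\<psi>0 (V s x))) t x = ennreal (exp (\<alpha> * t) * ou t f x)"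
   by (rule mild_solution[OF f f0 M'(2) M'(1)]) blast
  have Vm: "V t \<in> borel_measurable borel" for t
   using measurable_Pair2[OF V(1), of t] by simp
  have ouf: "0 <= ou t f x" for t x by (rule ou_nonneg[OF f f0])
  have V_le: "V t x <= exp (\<alpha> * t) * ou t f x" if "0 <= t" for t x
  proof -
   have "ennreal (V t x) <= ennreal (exp (\<alpha> * t) * ou t f x)" unfolding V(4)[OF that, symmetric] by simp
   then show ?thesis using ouf[of t x] by (simp add: ennreal_le_iff)
  qed
  define L where "L = cpsi * (th powr q + th\<^sup>2) * K1\<^sup>2"
  have L0: "0 <= L" unfolding L_def using A_nonneg by simp
  have \<psi>V: "\<psi>0 (V s y) <= L * wt (2 * n) y" if s: "0 <= s" "s <= T" for s y
  proof -
   have "ou s f y <= th * K * wt n y"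
    using K(2)[OF f, of th s y] f0 fW th s by (simp add: abs_of_nonneg ouf)
   then have "V s y <= exp (\<alpha> * T) * (th * K * wt n y)"
    using s \<alpha>_pos ouf by (intro order_trans[OF V_le[OF s(1)]] mult_mono) auto
   then have vz: "V s y <= th * (K1 * wt n y)" by (simp add: K1_def mult_ac)
   define w where "w = K1 * wt n y"
   have w: "1 <= w" unfolding w_def using K1 one_le_one_plus_norm_power[of y n] mult_mono[of 1 K1 1] by simp
   have "\<psi>0 (V s y) <= \<psi>0 (th * w)" using vz V(3)[OF s(1)] unfolding w_def by (intro \<psi>0_mono) auto
   also have "... <= cpsi * ((th * w) powr q + (th * w)\<^sup>2)" using th w by (intro \<psi>0_le) auto
   also have "... <= cpsi * (th powr q * w\<^sup>2 + th\<^sup>2 * w\<^sup>2)"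
   proof (intro mult_left_mono add_mono A_nonneg)
    \<comment> \<open>As w >= 1 and q <= 2, the power q of the weight is absorbed by its square;
      this is where the weight W_{2n} comes from.\<close>
    have "w powr q <= w powr 2" using w q by (intro powr_mono) auto
    then show "(th * w) powr q <= th powr q * w\<^sup>2" using w th by (simp add: powr_mult powr_numeral mult_left_mono)
   qed (simp add: power_mult_distrib)
   also have "... = L * wt (2 * n) y"
    unfolding L_def w_def by (simp add: power_mult_distrib power_mult[symmetric] algebra_simps)
   finally show ?thesis .
  qed
  have "0 <= V t x & V t x <= exp (\<alpha> * t) * ou t f x &
     exp (\<alpha> * t) * ou t f x - V t x <= C * (th powr q + th\<^sup>2) * wt (2 * n) x" if t: "t \<in> {0..T}" for t x
  proof (intro conjI)
   have t0: "0 <= t" using t by simp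
   show "0 <= V t x" using V(3)[OF t0] by simp
   show "V t x <= exp (\<alpha> * t) * ou t f x" by (rule V_le[OF t0])
   define B where "B = C * (th powr q + th\<^sup>2) * wt (2 * n) x"
   have B0: "0 <= B" unfolding B_def using C0 by simp
   have "nI (- \<alpha>) (%s x. ennreal (\<psi>0 (V s x))) t x <= nI (- \<alpha>) (%s x. ennreal (L * wt (2 * n) x)) t x"
    using t by (intro nI_mono ennreal_leI \<psi>V) auto
   also have "... <= nn_integral lborel (%s. ennreal (exp (\<alpha> * T) * (L * K2 * wt (2 * n) x)) * indicator {0..T} s)"
    unfolding nI_def
   proof (rule nn_integral_mono)
    fix s :: real
    show "indicator {0..t} s * (ennreal (exp (- (- \<alpha>) * s)) * nP s (%x. ennreal (L * wt (2 * n) x)) x)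
     <= ennreal (exp (\<alpha> * T) * (L * K2 * wt (2 * n) x)) * indicator {0..T} s"
    proof (cases "s \<in> {0..t}")
     case True
     have p: "polyP (%x::real^'d. L * wt (2 * n) x)" by (rule polyP_mult[OF polyP_const polyP_norm_power])
     have "nP s (%x. ennreal (L * wt (2 * n) x)) x = ennreal (ou s (%x. L * wt (2 * n) x) x)"
      using L0 by (intro nP_eq_ou p) auto
     moreover have "ou s (%x. L * wt (2 * n) x) x <= L * K2 * wt (2 * n) x"
      using K2(2)[OF polyP_measurable[OF p], of L s x] L0 True by simp
     ultimately have "ennreal (exp (\<alpha> * s)) * nP s (%x. ennreal (L * wt (2 * n) x)) x <= ennreal (exp (\<alpha> * T)) * ennreal (L * K2 * wt (2 * n) x)"
      using True t \<alpha>_pos by (intro mult_mono ennreal_leI) (auto intro!: ennreal_leI)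
     then show ?thesis using True t L0 K2(1) by (simp add: ennreal_mult)
    qed simp
   qed
   also have "... = ennreal (exp (\<alpha> * T) * (L * K2 * wt (2 * n) x)) * ennreal T"
    using T by (simp add: nn_integral_cmult_indicator)
   also have "... = ennreal B"
    unfolding B_def C_def L_def using T A_nonneg K2(1) by (subst ennreal_mult[symmetric]) (auto simp: mult_ac)
   finally have "ennreal (exp (\<alpha> * t) * ou t f x) <= ennreal (V t x) + ennreal B"
    unfolding V(4)[OF t0, symmetric] by (intro add_left_mono)
   also have "... = ennreal (V t x + B)" using V(3)[OF t0] B0 by simp
   finally have "exp (\<alpha> * t) * ou t f x <= V t x + B"
    using V(3)[OF t0, of x] B0 by (subst (asm) ennreal_le_iff) auto
   then show "exp (\<alpha> * t) * ou t f x - V t x <= C * (th powr q + th\<^sup>2) * wt (2 * n) x" by (simp add: B_def)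
  qed
  then show "\<exists>V. is_V \<sigma> b \<psi> f V & (\<forall>t. V t \<in> borel_measurable borel) &
   (\<forall>t\<in>{0..T}. \<forall>x. 0 <= V t x & V t x <= exp (\<alpha> * t) * ou t f x &
     exp (\<alpha> * t) * ou t f x - V t x <= C * (th powr q + th\<^sup>2) * wt (2 * n) x)"
   using V(2) Vm by blast
 qed
qed

end

text \<open>For X only the masses of sets are known to be measurable in the sample point; induction
  over nonnegative measurable functions extends this to integrals.\<close>

lemma nn_integral_kernel_measurable:
 fixes h :: "'b => ennreal"
 assumes h: "h \<in> borel_measurable B"
  and s: "!!w. sets (ka w) = sets B" and m: "!!A. A \<in> sets B ==> (%w. emeasure (ka w) A) \<in> borel_measurable N"
 shows "(%w. nn_integral (ka w) (%x. h x)) \<in> borel_measurable N"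
 using h
proof (induction rule: borel_measurable_induct)
 case (cong f g)
 have "nn_integral (ka w) (%x. f x) = nn_integral (ka w) (%x. g x)" for w
  using cong(3) sets_eq_imp_space_eq[OF s[of w]] by (intro nn_integral_cong) auto
 then show ?case using cong(4) by simp
next
 case (set A)
 then show ?case using m[OF set] s by (simp add: nn_integral_indicator)
next
 case (mult u c)
 have "nn_integral (ka w) (%x. c * u x) = c * nn_integral (ka w) (%x. u x)" for w
  by (rule nn_integral_cmult) (use mult(2) in \<open>simp add: measurable_cong_sets[OF s refl]\<close>)
 then show ?case using mult by simp
next
 case (add u v)
 have "nn_integral (ka w) (%x. v x + u x) = nn_integral (ka w) (%x. v x) + nn_integral (ka w) (%x. u x)" for w
  by (rule nn_integral_add) (use add in \<open>simp_all add: measurable_cong_sets[OF s refl]\<close>)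
 then show ?case using add by simp
next
 case (seq U)
 have "nn_integral (ka w) (%x. (SUP i. U i) x) = (SUP i. nn_integral (ka w) (%x. U i x))" for w
  unfolding SUP_apply
  by (rule nn_integral_monotone_convergence_SUP) (use seq in \<open>auto simp: measurable_cong_sets[OF s refl]\<close>)
 then show ?case using seq by simp
qed

text \<open>Where h is not integrable the integral is 0 by convention, so the difference of the two
  nonnegative integrals is used only on the measurable set where |h| has a finite integral.\<close>

lemma integral_kernel_measurable:
 fixes h :: "'b => real"
 assumes h [measurable]: "h \<in> borel_measurable B"
  and s: "!!w. sets (ka w) = sets B" and m: "!!A. A \<in> sets B ==> (%w. emeasure (ka w) A) \<in> borel_measurable N"
 shows "(%w. (LINT x|ka w. h x)) \<in> borel_measurable N"
proof -
 have hm: "h \<in> borel_measurable (ka w)" for w using h by (simp add: measurable_cong_sets[OF s refl])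
 have [measurable]: "(%w. nn_integral (ka w) (%x. ennreal (abs (h x)))) \<in> borel_measurable N"
  "(%w. nn_integral (ka w) (%x. ennreal (h x))) \<in> borel_measurable N"
  "(%w. nn_integral (ka w) (%x. ennreal (- h x))) \<in> borel_measurable N"
  by (rule nn_integral_kernel_measurable[OF _ s m]; simp)+
 have "(LINT x|ka w. h x) = (if (nn_integral (ka w) (%x. ennreal (abs (h x)))) < \<infinity> then
   enn2real (nn_integral (ka w) (%x. ennreal (h x))) - enn2real (nn_integral (ka w) (%x. ennreal (- h x))) else 0)" for w
  using hm[of w] by (auto simp: integrable_iff_bounded real_lebesgue_integral_def intro!: not_integrable_integral_eq)
 then show ?thesis by simp
qed

subsection \<open>Means and moments of the superprocess\<close>

text \<open>Compact support of \<mu> enters as finiteness of all its polynomial moments, which X_t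
  inherits in mean (\<open>mean_W\<close>).\<close>

locale super = branching_q +
 fixes Pm :: "(real^'d::finite) measure => 'w measure" and X :: "real => 'w => (real^'d) measure" and \<mu> :: "(real^'d) measure"
 assumes superX: "superOU \<sigma> b \<alpha> \<rho> Lev Pm X" and \<mu>_fin: "fin_borel_measure \<mu>"
  and \<mu>_mom: "!!n. (nn_integral \<mu> (%x. ennreal (wt n x))) < \<infinity>"
begin

abbreviation "MM \<equiv> Pm \<mu>"
abbreviation "FF \<equiv> natF MM X"

lemma X_fin: "fin_borel_measure (X t w)"
 using superX unfolding superOU_def by blast

lemma X_sets [simp, measurable_cong]: "sets (X t w) = sets borel"
 using X_fin by (simp add: fin_borel_measure_def)

lemma X_space [simp]: "space (X t w) = UNIV"
 using sets_eq_imp_space_eq[OF X_sets] by simp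

lemma X_finite: "finite_measure (X t w)"
 using X_fin by (simp add: fin_borel_measure_def)

lemma prob: "prob_space MM"
 using superX \<mu>_fin unfolding superOU_def by blast

sublocale prob_space MM by (rule prob)

lemma X_measurable: "A \<in> sets borel ==> (%w. measure (X t w) A) \<in> borel_measurable MM"
 using superX \<mu>_fin unfolding superOU_def by blast

lemma X_0: "AE w in MM. X 0 w = \<mu>"
 using superX \<mu>_fin unfolding superOU_def by blast

lemma X_right_cont:
 fixes g :: "real^'d => real"
 assumes "bounded (range g)" "continuous_on UNIV g" "0 <= t"
 shows "continuous (at_right t) (%s. (LINT x|X s w. g x))"
 using superX assms unfolding superOU_def by blast

lemma X_laplace_AE:
 assumes "f \<in> borel_measurable borel" "bounded (range f)" "!!x. 0 <= f x" "is_V \<sigma> b \<psi> f V" "0 <= s" "0 <= t"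
 shows "AE w in MM. real_cond_exp MM (FF s) (%w. exp (- (LINT x|X (s + t) w. f x))) w = exp (- (LINT x|X s w. V t x))"
 using superX \<mu>_fin assms unfolding superOU_def by blast

abbreviation "gens s \<equiv> {{w \<in> space MM. measure (X r w) A \<in> B} | r A B. 0 <= r & r <= s & A \<in> sets borel & B \<in> sets (borel :: real measure)}"

lemma sets_FF: "sets (FF s) = sigma_sets (space MM) (gens s)"
 unfolding natF_def by (rule sets_measure_of) auto

lemma space_FF [simp]: "space (FF s) = space MM"
 unfolding natF_def by (rule space_measure_of) auto

lemma FF_subalgebra: "subalgebra MM (FF s)"
proof -
 have "sets (FF s) \<subseteq> sets MM"
  unfolding sets_FF
 proof (rule sets.sigma_sets_subset, safe)
  fix r A and B :: "real set" assume "A \<in> sets (borel :: (real^'d) measure)" "B \<in> sets borel"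
  then show "{w \<in> space MM. measure (X r w) A \<in> B} \<in> sets MM"
   using measurable_sets[OF X_measurable[of A r], of B] by (simp add: vimage_def Int_def conj_commute)
 qed
 then show ?thesis by (simp add: subalgebra_def)
qed

lemma FF_sub: "A \<in> sets (FF s) ==> A \<in> sets MM"
 using FF_subalgebra by (auto simp: subalgebra_def)

lemma FF_mono: "s <= t ==> sets (FF s) \<subseteq> sets (FF t)"
 unfolding sets_FF by (rule sigma_sets_mono') force

lemma FF_measurable_mono: "f \<in> borel_measurable (FF s) ==> s <= t ==> f \<in> borel_measurable (FF t)"
 using FF_mono[of s t] by (auto simp: measurable_def)

lemma FF_measurable_MM: "f \<in> borel_measurable (FF s) ==> f \<in> borel_measurable MM"
 using FF_subalgebra measurable_from_subalg by blast

lemma emeasure_X_measurable: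
 assumes A: "A \<in> sets borel" and r: "0 <= r" "r <= s"
 shows "(%w. emeasure (X r w) A) \<in> borel_measurable (FF s)"
proof -
 have "(%w. measure (X r w) A) \<in> borel_measurable (FF s)"
 proof (rule measurableI)
  fix B :: "real set" assume "B \<in> sets borel"
  then have "{w \<in> space MM. measure (X r w) A \<in> B} \<in> gens s" using A r by blast
  then show "(%w. measure (X r w) A) -` B \<inter> space (FF s) \<in> sets (FF s)"
   unfolding sets_FF by (auto simp: vimage_def Int_def conj_commute intro: sigma_sets.Basic)
 qed simp
 then show ?thesis by (simp add: finite_measure.emeasure_eq_measure[OF X_finite])
qed

lemma nn_X_adapted:
 assumes "h \<in> borel_measurable borel" "0 <= r" "r <= s"
 shows "(%w. nn_integral (X r w) (%x. h x)) \<in> borel_measurable (FF s)"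
 by (rule nn_integral_kernel_measurable[OF assms(1) X_sets emeasure_X_measurable]) (use assms in auto)

lemma X_adapted:
 fixes h :: "real^'d => real"
 assumes "h \<in> borel_measurable borel" "0 <= r" "r <= s"
 shows "(%w. (LINT x|X r w. h x)) \<in> borel_measurable (FF s)"
 by (rule integral_kernel_measurable[OF assms(1) X_sets emeasure_X_measurable]) (use assms in auto)

lemma nn_X_measurable:
 "h \<in> borel_measurable borel ==> 0 <= t ==> (%w. nn_integral (X t w) (%x. h x)) \<in> borel_measurable MM"
 by (rule FF_measurable_MM[OF nn_X_adapted[of h t t]]) auto

lemma X_int_measurable:
 fixes h :: "real^'d => real"
 shows "h \<in> borel_measurable borel ==> 0 <= t ==> (%w. (LINT x|X t w. h x)) \<in> borel_measurable MM"
 by (rule FF_measurable_MM[OF X_adapted[of h t t]]) auto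

lemma FF_sigma_finite: "sigma_finite_subalgebra MM (FF s)"
 by (rule finite_measure_subalgebra_is_sigma_finite) (unfold_locales, use FF_subalgebra in \<open>auto simp: finite_measure_subalgebra_def finite_measure_subalgebra_axioms_def\<close>)

text \<open>The conditional identity tested against bounded \<open>FF s\<close>-measurable Y.
  Indicators of sets of \<open>FF s\<close> give the mean formula, and Y = indicator times exp(th m)
  gives the centred Laplace transform in \<open>tail_bound\<close>.\<close>

lemma X_laplace:
 assumes f: "f \<in> borel_measurable borel" "bounded (range f)" "!!x. 0 <= f x" "is_V \<sigma> b \<psi> f V" "V t \<in> borel_measurable borel" "0 <= s" "0 <= t"
  and Y: "Y \<in> borel_measurable (FF s)" "!!w. abs (Y w) <= B"
 shows "(LINT w|MM. Y w * exp (- (LINT x|X (s + t) w. f x))) = (LINT w|MM. Y w * exp (- (LINT x|X s w. V t x)))"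
proof -
 interpret sf: sigma_finite_subalgebra MM "FF s" by (rule FF_sigma_finite)
 have Ym [measurable]: "Y \<in> borel_measurable MM" by (rule FF_measurable_MM[OF Y(1)])
 have [measurable]: "(%w. (LINT x|X (s + t) w. f x)) \<in> borel_measurable MM" "(%w. (LINT x|X s w. V t x)) \<in> borel_measurable MM"
  using f by (auto intro!: X_int_measurable)
 have "integrable MM (%w. Y w * exp (- (LINT x|X (s + t) w. f x)))"
 proof (rule integrable_const_bound[of _ "B"])
  show "AE w in MM. norm (Y w * exp (- (LINT x|X (s + t) w. f x))) <= B"
  proof (rule AE_I2)
   fix w
   have "0 <= (LINT x|X (s + t) w. f x)" using f(3) by (intro integral_nonneg_AE AE_I2)
   then have "exp (- (LINT x|X (s + t) w. f x)) <= 1" by simp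
   then show "norm (Y w * exp (- (LINT x|X (s + t) w. f x))) <= B"
    using Y(2)[of w] mult_mono[of "abs (Y w)" B "exp (- (LINT x|X (s + t) w. f x))" 1] by (simp add: abs_mult)
  qed
 qed measurable
 from sf.real_cond_exp_intg(2)[OF this Y(1)]
 have "(LINT w|MM. Y w * exp (- (LINT x|X (s + t) w. f x))) = (LINT w|MM. Y w * real_cond_exp MM (FF s) (%w. exp (- (LINT x|X (s + t) w. f x))) w)"
  by simp
 also have "... = (LINT w|MM. Y w * exp (- (LINT x|X s w. V t x)))"
 proof (rule integral_cong_AE)
  show "(%w. Y w * real_cond_exp MM (FF s) (%w. exp (- (LINT x|X (s + t) w. f x))) w) \<in> borel_measurable MM"
   by (intro borel_measurable_times Ym borel_measurable_cond_exp2)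
  show "AE w in MM. Y w * real_cond_exp MM (FF s) (%w. exp (- (LINT x|X (s + t) w. f x))) w = Y w * exp (- (LINT x|X s w. V t x))"
   using X_laplace_AE[OF f(1-4,6,7)] by eventually_elim simp
 qed measurable
 finally show ?thesis .
qed

lemma X_integrable_bounded:
 fixes f :: "real^'d => real"
 assumes "f \<in> borel_measurable borel" "!!x. abs (f x) <= B" shows "integrable (X t w) f"
proof -
 interpret finite_measure "X t w" by (rule X_finite)
 show ?thesis by (rule integrable_const_bound[of _ B]) (use assms in \<open>auto simp: measurable_cong_sets[OF X_sets refl]\<close>)
qed

lemma exp_remainder_sq: "0 <= (x::real) ==> x - x\<^sup>2 <= 1 - exp (- x)"
 using exp_minus_remainder_bounds(3)[of x] by simp

text \<open>The derivative of the Laplace functional at 0. With th = 1/(n+1), (1 - exp(-th Z))/th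
  tends to Z and (1 - exp(-v))/th tends to m, the errors being of order th^(q-1) and th; here q > 1
  is used. Both sequences lie below their limits, so Fatou's lemma applied in each direction gives
  equality.\<close>

lemma mean_bounded:
 fixes f :: "real^'d => real"
 assumes f [measurable]: "f \<in> borel_measurable borel" and f0: "!!x. 0 <= f x" and fB: "!!x. f x <= B"
  and s: "0 <= s" and t: "0 <= t" and A: "A \<in> sets (FF s)"
 shows "nn_integral MM (%y. indicator A y * ennreal (LINT x|X (s + t) y. f x)) = nn_integral MM (%y. indicator A y * ennreal (exp (\<alpha> * t) * (LINT x|X s y. ou t f x)))"
proof -
 obtain C where C: "0 <= C" "!!f th M. f \<in> borel_measurable borel ==> 0 < th ==> (!!x. 0 <= f x) ==> (!!x. f x <= M) ==>
  (!!x. f x <= th * wt 0 x) ==> \<exists>V. is_V \<sigma> b \<psi> f V & (\<forall>t. V t \<in> borel_measurable borel) &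
   (\<forall>t\<in>{0..t}. \<forall>x::real^'d. 0 <= V t x & V t x <= exp (\<alpha> * t) * ou t f x &
     exp (\<alpha> * t) * ou t f x - V t x <= C * (th powr q + th\<^sup>2) * wt (2 * 0) x)"
  by (rule V_exists[OF t, of 0]) blast
 define B' where "B' = abs B + 1"
 have B': "B' > 0" "f x <= B'" for x using fB[of x] by (auto simp: B'_def)
 define th where "th = (%n::nat. inverse (real (Suc n)))"
 have th: "th n > 0" for n by (simp add: th_def)
 have th0: "th \<longlonglongrightarrow> 0" unfolding th_def by (rule LIMSEQ_inverse_real_of_nat)
 have "\<forall>n. \<exists>V. is_V \<sigma> b \<psi> (%x. th n * f x) V & (\<forall>t. V t \<in> borel_measurable borel) &
   (\<forall>x. 0 <= V t x & V t x <= exp (\<alpha> * t) * ou t (%x. th n * f x) x &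
     exp (\<alpha> * t) * ou t (%x. th n * f x) x - V t x <= C * ((th n * B') powr q + (th n * B')\<^sup>2))"
 proof
  fix n
  have "\<exists>V. is_V \<sigma> b \<psi> (%x. th n * f x) V & (\<forall>t. V t \<in> borel_measurable borel) &
   (\<forall>t\<in>{0..t}. \<forall>x. 0 <= V t x & V t x <= exp (\<alpha> * t) * ou t (%x. th n * f x) x &
     exp (\<alpha> * t) * ou t (%x. th n * f x) x - V t x <= C * ((th n * B') powr q + (th n * B')\<^sup>2) * wt (2 * 0) x)"
   using th[of n] f0 B' by (intro C(2)[of _ "th n * B'" "th n * B'"]) auto
  then show "\<exists>V. is_V \<sigma> b \<psi> (%x. th n * f x) V & (\<forall>t. V t \<in> borel_measurable borel) &
   (\<forall>x. 0 <= V t x & V t x <= exp (\<alpha> * t) * ou t (%x. th n * f x) x &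
     exp (\<alpha> * t) * ou t (%x. th n * f x) x - V t x <= C * ((th n * B') powr q + (th n * B')\<^sup>2))"
   using t by auto
 qed
 then obtain V where V: "!!n. is_V \<sigma> b \<psi> (%x. th n * f x) (V n)" "!!n. V n t \<in> borel_measurable borel"
  "!!n x. 0 <= V n t x" "!!n x. V n t x <= exp (\<alpha> * t) * ou t (%x. th n * f x) x"
  "!!n x. exp (\<alpha> * t) * ou t (%x. th n * f x) x - V n t x <= C * ((th n * B') powr q + (th n * B')\<^sup>2)"
  by metis
 have ouc: "ou t (%x. c * f x) x = c * ou t f x" for c x by (simp add: ou_sg_eq_gop gop_cmult)
 have oub: "0 <= ou t f x" "ou t f x <= B'" for x using f0 B' by (auto intro!: ou_nonneg ou_le_const)
 define Z where "Z = (%y. (LINT x|X (s + t) y. f x))"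
 define m where "m = (%y. exp (\<alpha> * t) * (LINT x|X s y. ou t f x))"
 define v where "v = (%n y. (LINT x|X s y. V n t x))"
 have [measurable]: "Z \<in> borel_measurable MM" "m \<in> borel_measurable MM" "!!n. v n \<in> borel_measurable MM"
  unfolding Z_def m_def v_def using s t V(2) by (auto intro!: X_int_measurable borel_measurable_times)
 have [measurable]: "A \<in> sets MM" by (rule FF_sub[OF A])
 have Z0: "0 <= Z y" for y unfolding Z_def using f0 by (intro integral_nonneg_AE AE_I2)
 have m0: "0 <= m y" for y unfolding m_def using oub by (intro mult_nonneg_nonneg integral_nonneg_AE AE_I2) auto
 have v0: "0 <= v n y" for n y unfolding v_def using V(3) by (intro integral_nonneg_AE AE_I2) auto
 have iou: "integrable (X s y) (%x. exp (\<alpha> * t) * (c * ou t f x))" for y c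
  by (intro integrable_mult_right X_integrable_bounded[of _ B']) (use oub in auto)
 have iV: "integrable (X s y) (V n t)" for n y
 proof (rule X_integrable_bounded[OF V(2), of _ "exp (\<alpha> * t) * (th n * B')"])
  show "abs (V n t x) <= exp (\<alpha> * t) * (th n * B')" for x
   using V(3,4)[of n x] oub(2)[of x] th[of n] unfolding ouc
   by (auto intro!: order_trans[OF V(4)[unfolded ouc]] mult_left_mono)
 qed
 have vle: "v n y <= th n * m y" for n y
 proof -
  have "v n y <= (LINT x|X s y. exp (\<alpha> * t) * (th n * ou t f x))"
   unfolding v_def using V(4) by (intro integral_mono iV iou) (simp add: ouc)
  then show ?thesis by (simp add: m_def mult_ac)
 qed
 have vge: "th n * m y - v n y <= C * ((th n * B') powr q + (th n * B')\<^sup>2) * measure (X s y) UNIV" for n y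
 proof -
  interpret X: finite_measure "X s y" by (rule X_finite)
  have "(LINT x|X s y. exp (\<alpha> * t) * (th n * ou t f x) - V n t x) <= (LINT x|X s y. C * ((th n * B') powr q + (th n * B')\<^sup>2))"
   using V(5) by (intro integral_mono Bochner_Integration.integrable_diff iV iou X.integrable_const) (simp add: ouc)
  then show ?thesis by (subst (asm) Bochner_Integration.integral_diff[OF iou iV]) (simp add: m_def v_def mult_ac)
 qed
 define a where "a = (%n y. (1 - exp (- (th n * Z y))) / th n)"
 define c where "c = (%n y. (1 - exp (- v n y)) / th n)"
 have [measurable]: "a n \<in> borel_measurable MM" "c n \<in> borel_measurable MM" for n unfolding a_def c_def by auto
 have a0: "0 <= a n y" and c0: "0 <= c n y" for n y
  unfolding a_def c_def using th[of n] Z0[of y] v0[of n y] by auto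
 have ac: "nn_integral MM (%y. indicator A y * ennreal (a n y)) = nn_integral MM (%y. indicator A y * ennreal (c n y))" for n
 proof -
  have ia: "integrable MM (%y. indicator A y * a n y)" "integrable MM (%y. indicator A y * c n y)"
   by (rule integrable_const_bound[of _ "1 / th n"];
     use th[of n] Z0 v0 in \<open>auto simp: a_def c_def abs_mult split: split_indicator intro!: AE_I2 divide_right_mono\<close>)+
  have ii: "integrable MM (%y. indicator A y * exp (- (th n * Z y)))" "integrable MM (%y. indicator A y * exp (- v n y))" "integrable MM (indicator A :: _ => real)"
   by (rule integrable_const_bound[of _ 1]; use th[of n] Z0 v0 in \<open>auto simp: abs_mult split: split_indicator intro!: AE_I2\<close>)+
  have "(LINT y|MM. indicator A y * exp (- (LINT x|X (s + t) y. th n * f x))) = (LINT y|MM. indicator A y * exp (- (LINT x|X s y. V n t x)))"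
  proof (rule X_laplace[OF _ _ _ V(1,2) s t])
   show "bounded (range (%x. th n * f x))"
    using f0 B' th[of n] by (intro boundedI[of _ "th n * B'"]) (auto simp: abs_mult)
   show "(indicator A :: _ => real) \<in> borel_measurable (FF s)" using A by simp
   show "abs (indicator A y) <= (1::real)" for y by (auto split: split_indicator)
  qed (use f0 th[of n] in auto)
  then have "(LINT y|MM. indicator A y * exp (- (th n * Z y))) = (LINT y|MM. indicator A y * exp (- v n y))"
   by (simp add: Z_def v_def)
  then have "(LINT y|MM. indicator A y * a n y) = (LINT y|MM. indicator A y * c n y)"
   unfolding a_def c_def using ii by (simp add: right_diff_distrib)
  moreover have "nn_integral MM (%y. ennreal (indicator A y * a n y)) = ennreal (LINT y|MM. indicator A y * a n y)"
   "nn_integral MM (%y. ennreal (indicator A y * c n y)) = ennreal (LINT y|MM. indicator A y * c n y)"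
   using ia a0 c0 by (auto intro!: nn_integral_eq_integral AE_I2)
  moreover have "indicator A y * ennreal (a n y) = ennreal (indicator A y * a n y)" "indicator A y * ennreal (c n y) = ennreal (indicator A y * c n y)" for y
   by (auto split: split_indicator)
  ultimately show ?thesis by simp
 qed
 have a_le: "a n y <= Z y" for n y
 proof -
  have "1 - exp (- (th n * Z y)) <= Z y * th n" using exp_ge_add_one_self[of "- (th n * Z y)"] by (simp add: mult.commute)
  then show ?thesis by (simp add: a_def pos_divide_le_eq[OF th])
 qed
 have a_lim: "(%n. a n y) \<longlonglongrightarrow> Z y" for y
 proof (rule tendsto_sandwich[OF always_eventually always_eventually])
  show "\<forall>n. Z y - th n * (Z y)\<^sup>2 <= a n y"
  proof
   fix n
   have "0 <= th n * Z y" using th[of n] Z0[of y] by simp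
   from exp_remainder_sq[OF this] show "Z y - th n * (Z y)\<^sup>2 <= a n y"
    by (simp add: a_def pos_le_divide_eq[OF th] algebra_simps power2_eq_square)
  qed
  show "\<forall>n. a n y <= Z y"
   using a_le by simp
  have "(%n. Z y - th n * (Z y)\<^sup>2) \<longlonglongrightarrow> Z y - 0 * (Z y)\<^sup>2" by (intro tendsto_intros th0)
  then show "(%n. Z y - th n * (Z y)\<^sup>2) \<longlonglongrightarrow> Z y" by simp
 qed simp
 have c_le: "c n y <= m y" for n y
 proof -
  have "1 - exp (- v n y) <= m y * th n" using exp_ge_add_one_self[of "- v n y"] vle[of n y] by (simp add: mult.commute)
  then show ?thesis by (simp add: c_def pos_divide_le_eq[OF th])
 qed
 have c_lim: "(%n. c n y) \<longlonglongrightarrow> m y" for y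
 proof (rule tendsto_sandwich[OF always_eventually always_eventually])
  define R where "R = measure (X s y) UNIV"
  have R0: "0 <= R" by (simp add: R_def)
  show "\<forall>n. m y - C * (th n powr (q - 1) * B' powr q + th n * B'\<^sup>2) * R - th n * (m y)\<^sup>2 <= c n y"
  proof
   fix n
   have "v n y - (v n y)\<^sup>2 <= 1 - exp (- v n y)" by (rule exp_remainder_sq[OF v0])
   moreover have "(v n y)\<^sup>2 <= (th n * m y)\<^sup>2" using v0 vle by (intro power_mono) auto
   moreover have "th n * m y - v n y <= C * ((th n * B') powr q + (th n * B')\<^sup>2) * R" using vge by (simp add: R_def)
   ultimately have 1: "th n * m y - C * ((th n * B') powr q + (th n * B')\<^sup>2) * R - (th n * m y)\<^sup>2 <= 1 - exp (- v n y)" by linarith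
   have "th n powr q = th n * th n powr (q - 1)" using th[of n] by (simp add: powr_diff)
   then have "(th n * B') powr q = th n * (th n powr (q - 1) * B' powr q)" using th[of n] B'(1) by (simp add: powr_mult)
   then have "(m y - C * (th n powr (q - 1) * B' powr q + th n * B'\<^sup>2) * R - th n * (m y)\<^sup>2) * th n = th n * m y - C * ((th n * B') powr q + (th n * B')\<^sup>2) * R - (th n * m y)\<^sup>2"
    by (simp add: algebra_simps power2_eq_square)
   then show "m y - C * (th n powr (q - 1) * B' powr q + th n * B'\<^sup>2) * R - th n * (m y)\<^sup>2 <= c n y"
    unfolding c_def pos_le_divide_eq[OF th] using 1 by simp
  qed
  show "\<forall>n. c n y <= m y" using c_le by simp
  have "(%n. th n powr (q - 1)) \<longlonglongrightarrow> 0" using th0 q(1) th by (intro tendsto_zero_powrI[OF _ tendsto_const]) (auto intro: always_eventually less_imp_le)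
  then have "(%n. m y - C * (th n powr (q - 1) * B' powr q + th n * B'\<^sup>2) * R - th n * (m y)\<^sup>2) \<longlonglongrightarrow> m y - C * (0 * B' powr q + 0 * B'\<^sup>2) * R - 0 * (m y)\<^sup>2"
   by (intro tendsto_intros th0)
  then show "(%n. m y - C * (th n powr (q - 1) * B' powr q + th n * B'\<^sup>2) * R - th n * (m y)\<^sup>2) \<longlonglongrightarrow> m y" by simp
 qed simp
 have fatou: "nn_integral MM (%y. indicator A y * ennreal (u y)) <= nn_integral MM (%y. indicator A y * ennreal (w y))"
  if um: "!!n. un n \<in> borel_measurable MM" and ul: "!!y. (%n. un n y) \<longlonglongrightarrow> u y"
   and le: "!!n. (nn_integral MM (%y. indicator A y * ennreal (un n y))) <= nn_integral MM (%y. indicator A y * ennreal (w y))" for un u w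
 proof -
  have "nn_integral MM (%y. indicator A y * ennreal (u y)) = nn_integral MM (%y. liminf (%n. indicator A y * ennreal (un n y)))"
  proof (rule nn_integral_cong)
   fix y
   have "(%n. indicator A y * ennreal (un n y)) \<longlonglongrightarrow> indicator A y * ennreal (u y)"
    by (intro ennreal_tendsto_cmult tendsto_ennrealI ul) (auto split: split_indicator)
   then show "indicator A y * ennreal (u y) = liminf (%n. indicator A y * ennreal (un n y))"
    by (intro lim_imp_Liminf[symmetric]) auto
  qed
  also have "... <= liminf (%n. nn_integral MM (%y. indicator A y * ennreal (un n y)))"
   using um by (intro nn_integral_liminf) measurable
  also have "... <= liminf (%n::nat. nn_integral MM (%y. indicator A y * ennreal (w y)))"
   by (intro Liminf_mono always_eventually allI le)
  finally show ?thesis by (simp add: Liminf_const)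
 qed
 have "nn_integral MM (%y. indicator A y * ennreal (Z y)) = nn_integral MM (%y. indicator A y * ennreal (m y))"
 proof (rule antisym)
  show "nn_integral MM (%y. indicator A y * ennreal (Z y)) <= nn_integral MM (%y. indicator A y * ennreal (m y))"
   by (rule fatou[OF _ a_lim]) (auto simp: ac intro!: nn_integral_mono mult_left_mono ennreal_leI c_le)
  show "nn_integral MM (%y. indicator A y * ennreal (m y)) <= nn_integral MM (%y. indicator A y * ennreal (Z y))"
   by (rule fatou[OF _ c_lim]) (auto simp: ac[symmetric] intro!: nn_integral_mono mult_left_mono ennreal_leI a_le)
 qed
 then show ?thesis by (simp add: Z_def m_def)
qed

end

text \<open>The Chebyshev function of \<open>tail_bound\<close>: it detects |u| >= 1, while its
  expectation is computed by a Laplace functional and a mean. Its smallest value there is 1/e, taken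
  at u = 1.\<close>

lemma exp_remainder_ge_third:
 fixes u :: real
 assumes "1 <= abs u" shows "1 / 3 <= exp (- u) - 1 + u"
proof (cases "u >= 0")
 case True
 then have u: "1 <= u" using assms by simp
 have e: "1 / 3 <= exp (- 1 :: real)" using exp_le by (simp add: exp_minus field_simps)
 have "1 + - (u - 1) <= exp (- (u - 1))" by (rule exp_ge_add_one_self)
 then have "exp (- 1) * (1 + - (u - 1)) <= exp (- 1) * exp (- (u - 1))" by (intro mult_left_mono) auto
 also have "... = exp (- u)" by (simp add: exp_add[symmetric])
 finally have "exp (- u) >= exp (- 1) - exp (- 1) * (u - 1)" by (simp add: algebra_simps)
 moreover have "exp (- 1) * (u - 1) <= 1 * (u - 1)" using u by (intro mult_right_mono) auto
 moreover define Y where "Y = exp (- 1) * (u - 1)"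
 ultimately have "exp (- 1) - Y <= exp (- u)" "Y <= u - 1" by auto
 then show ?thesis using e by linarith
next
 case False
 then have v: "1 <= - u" using assms by simp
 have "1 + (- u) + (- u)\<^sup>2 / 2 <= exp (- u)" using v by (intro exp_lower_Taylor_quadratic) auto
 moreover have "1 <= (- u)\<^sup>2" using v by (intro one_le_power) auto
 ultimately show ?thesis by linarith
qed

text \<open>Only the level with 2^j <= w < 2^(j+1) is needed; keeping all lower levels makes the
  bound a series of tail events, so that tail estimates at r = 2^j give moments.\<close>

lemma powr_le_dyadic:
 fixes w p :: real
 assumes "0 <= w" "0 <= p"
 shows "ennreal (w powr p) <= 1 + (\<Sum>j. ennreal (2 powr (p * real (Suc j))) * indicator {v. 2 ^ j <= v} w)"
proof (cases "w < 1")
 case True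
 then have "w powr p <= 1" using assms by (simp add: powr_le1)
 then have "ennreal (w powr p) <= 1" by simp
 then show ?thesis by (rule order_trans) simp
next
 case False
 define j where "j = nat \<lfloor>log 2 w\<rfloor>"
 have w: "1 <= w" using False by simp
 have l: "0 <= log 2 w" using w by simp
 then have j: "real j <= log 2 w" "log 2 w <= real (Suc j)" unfolding j_def by linarith+
 have "2 ^ j = 2 powr real j" by (simp add: powr_realpow)
 also have "... <= 2 powr log 2 w" using j by (intro powr_mono) auto
 finally have j1: "2 ^ j <= w" using w by simp
 have "w = 2 powr log 2 w" using w by simp
 also have "... <= 2 powr real (Suc j)" using j by (intro powr_mono) auto
 finally have "w powr p <= (2 powr real (Suc j)) powr p" using assms by (intro powr_mono2) auto
 also have "... = 2 powr (p * real (Suc j))" by (simp add: powr_powr mult.commute)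
 finally have "ennreal (w powr p) <= ennreal (2 powr (p * real (Suc j))) * indicator {v. 2 ^ j <= v} w" using j1 by (simp add: ennreal_leI)
 also have "... = (\<Sum>j\<in>{j}. ennreal (2 powr (p * real (Suc j))) * indicator {v. 2 ^ j <= v} w)"
  by (subst sum.insert) simp_all
 also have "... <= (\<Sum>j. ennreal (2 powr (p * real (Suc j))) * indicator {v. 2 ^ j <= v} w)"
  by (rule sum_le_suminf) (auto intro: summableI)
 finally show ?thesis by (simp add: add_increasing)
qed

context super
begin

lemma integral_indicator_le_top: "indicator A w * ennreal x = ennreal (indicator A w * x)"
 by (auto split: split_indicator)

lemma mean_nn:
 fixes h :: "real^'d => real"
 assumes h [measurable]: "h \<in> borel_measurable borel" and h0: "!!x. 0 <= h x"
  and s: "0 <= s" and t: "0 <= t" and A: "A \<in> sets (FF s)"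
 shows "nn_integral MM (%w. indicator A w * (nn_integral (X (s + t) w) (%x. ennreal (h x))))
  = ennreal (exp (\<alpha> * t)) * nn_integral MM (%w. indicator A w * nn_integral (X s w) (%x. nP t (%x. ennreal (h x)) x))"
proof -
 define hk where "hk = (%k::nat. %x. min (h x) (real k))"
 have [measurable]: "hk k \<in> borel_measurable borel" for k unfolding hk_def by measurable
 have [measurable]: "A \<in> sets MM" by (rule FF_sub[OF A])
 have hk: "0 <= hk k x" "hk k x <= real k" for k x using h0 by (auto simp: hk_def)
 have nPm [measurable]: "nP t (%x. ennreal (g x)) \<in> borel_measurable borel" if [measurable]: "g \<in> borel_measurable borel" for g :: "real^'d => real"
  by measurable
 have nm [measurable]: "(%w. nn_integral (X r w) (%x. g x)) \<in> borel_measurable MM" if "g \<in> borel_measurable borel" "0 <= r" for g r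
  by (rule nn_X_measurable[OF that])
 have st: "0 <= s + t" using s t by simp
 have eqk: "nn_integral MM (%w. indicator A w * (nn_integral (X (s + t) w) (%x. ennreal (hk k x))))
  = ennreal (exp (\<alpha> * t)) * nn_integral MM (%w. indicator A w * nn_integral (X s w) (%x. nP t (%x. ennreal (hk k x)) x))" for k
 proof -
  have p: "polyP (hk k)" using hk by (intro polyP_bounded[of _ "real k"]) auto
  have o: "0 <= ou t (hk k) x" "ou t (hk k) x <= real k" for x using hk by (auto intro!: ou_nonneg ou_le_const)
  have 1: "nn_integral (X r w) (%x. ennreal (hk k x)) = ennreal (LINT x|X r w. hk k x)" for r w
   using hk by (intro nn_integral_eq_integral X_integrable_bounded[of _ "real k"]) auto
  have 2: "nn_integral (X r w) (%x. nP t (%x. ennreal (hk k x)) x) = ennreal (LINT x|X r w. ou t (hk k) x)" for r w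
   unfolding nP_eq_ou[OF p hk(1)] using o by (intro nn_integral_eq_integral X_integrable_bounded[of _ "real k"]) auto
  have "nn_integral MM (%w. indicator A w * ennreal (exp (\<alpha> * t) * (LINT x|X s w. ou t (hk k) x))) = nn_integral MM (%w. ennreal (exp (\<alpha> * t)) * (indicator A w * ennreal (LINT x|X s w. ou t (hk k) x)))"
   using o by (intro nn_integral_cong) (auto simp: ennreal_mult mult_ac)
  also have "... = ennreal (exp (\<alpha> * t)) * nn_integral MM (%w. indicator A w * ennreal (LINT x|X s w. ou t (hk k) x))"
   using X_int_measurable[of "ou t (hk k)" s] s by (intro nn_integral_cmult) auto
  finally show ?thesis unfolding 1 2 using mean_bounded[OF _ hk s t A, of k] by simp
 qed
 have inc: "incseq (%k x. ennreal (hk k x))"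
  by (auto simp: incseq_def le_fun_def hk_def intro!: ennreal_leI min.mono)
 have lim: "(%k. ennreal (hk k x)) \<longlonglongrightarrow> ennreal (h x)" for x
 proof (rule tendsto_ennrealI, rule tendsto_eventually)
  show "\<forall>\<^sub>F k in sequentially. hk k x = h x"
   using eventually_ge_at_top[of "nat \<lceil>h x\<rceil>"]
  proof eventually_elim
   fix k :: nat assume "nat \<lceil>h x\<rceil> <= k"
   then have "real (nat \<lceil>h x\<rceil>) <= real k" by simp
   then have "h x <= real k" using real_nat_ceiling_ge[of "h x"] by linarith
   then show "hk k x = h x" by (simp add: hk_def)
  qed
 qed
 have i1: "incseq (%k w. indicator A w * (nn_integral (X (s + t) w) (%x. ennreal (hk k x))))"
  using inc by (auto simp: incseq_def le_fun_def intro!: mult_left_mono nn_integral_mono)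
 have l1: "(%k. nn_integral (X r w) (%x. ennreal (hk k x))) \<longlonglongrightarrow> (nn_integral (X r w) (%x. ennreal (h x)))" for r w
  by (rule nn_integral_LIMSEQ[OF inc _ lim]) simp
 have inp: "incseq (%k. nP t (%x. ennreal (hk k x)))"
  using inc by (auto simp: incseq_def le_fun_def intro!: nP_mono)
 have lnp: "(%k. nP t (%x. ennreal (hk k x)) x) \<longlonglongrightarrow> nP t (%x. ennreal (h x)) x" for x
  unfolding nP_def using inc by (intro nn_integral_LIMSEQ lim) (auto simp: incseq_def le_fun_def)
 have i2: "incseq (%k w. indicator A w * nn_integral (X s w) (%x. nP t (%x. ennreal (hk k x)) x))"
  using inp by (auto simp: incseq_def le_fun_def intro!: mult_left_mono nn_integral_mono)
 have l2: "(%k. nn_integral (X s w) (%x. nP t (%x. ennreal (hk k x)) x)) \<longlonglongrightarrow> (nn_integral (X s w) (%x. nP t (%x. ennreal (h x)) x))" for w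
  by (rule nn_integral_LIMSEQ[OF inp _ lnp]) simp
 have "(%k. nn_integral MM (%w. indicator A w * (nn_integral (X (s + t) w) (%x. ennreal (hk k x))))) \<longlonglongrightarrow> (nn_integral MM (%w. indicator A w * (nn_integral (X (s + t) w) (%x. ennreal (h x)))))"
 proof (rule nn_integral_LIMSEQ[OF i1])
  show "(%w. indicator A w * (nn_integral (X (s + t) w) (%x. ennreal (hk k x)))) \<in> borel_measurable MM" for k
   using st by (intro borel_measurable_times_ennreal nm) auto
  show "(%k. indicator A w * (nn_integral (X (s + t) w) (%x. ennreal (hk k x)))) \<longlonglongrightarrow> indicator A w * (nn_integral (X (s + t) w) (%x. ennreal (h x)))" for w
   by (intro ennreal_tendsto_cmult l1) (auto split: split_indicator)
 qed
 moreover have "(%k. ennreal (exp (\<alpha> * t)) * nn_integral MM (%w. indicator A w * nn_integral (X s w) (%x. nP t (%x. ennreal (hk k x)) x))) \<longlonglongrightarrow> ennreal (exp (\<alpha> * t)) * nn_integral MM (%w. indicator A w * nn_integral (X s w) (%x. nP t (%x. ennreal (h x)) x))"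
 proof (rule ennreal_tendsto_cmult, simp, rule nn_integral_LIMSEQ[OF i2])
  show "(%w. indicator A w * nn_integral (X s w) (%x. nP t (%x. ennreal (hk k x)) x)) \<in> borel_measurable MM" for k
   using s by (intro borel_measurable_times_ennreal nm nPm) auto
  show "(%k. indicator A w * nn_integral (X s w) (%x. nP t (%x. ennreal (hk k x)) x)) \<longlonglongrightarrow> indicator A w * nn_integral (X s w) (%x. nP t (%x. ennreal (h x)) x)" for w
   by (intro ennreal_tendsto_cmult l2) (auto split: split_indicator)
 qed
 ultimately show ?thesis unfolding eqk by (rule LIMSEQ_unique)
qed

lemma mean_W:
 fixes n :: nat
 obtains K where "1 <= K" "!!t. 0 <= t ==> (nn_integral MM (%w. (nn_integral (X t w) (%x. ennreal (wt n x))))) <= ennreal (K * exp (\<alpha> * t))"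
proof -
 obtain K where K: "K >= 1" "!!f C t x. f \<in> borel_measurable borel ==> (!!x. abs (f x) <= C * wt n x) ==> 0 <= C ==> t >= 0
   ==> abs (ou t f (x::real^'d)) <= C * K * wt n x"
  by (rule ou_bound[of n]) blast
 define m where "m = enn2real (nn_integral \<mu> (%x. ennreal (wt n x)))"
 have m: "(nn_integral \<mu> (%x. ennreal (wt n x))) = ennreal m" "0 <= m"
  unfolding m_def using \<mu>_mom[of n] by auto
 have \<mu>s: "sets \<mu> = sets borel" using \<mu>_fin by (simp add: fin_borel_measure_def)
 show ?thesis
 proof (rule that[of "1 + K * m"])
  show "1 <= 1 + K * m" using K m by simp
  fix t :: real assume t: "0 <= t"
  let ?W = "%x::real^'d. wt n x"
  have np: "nP t (%x. ennreal (?W x)) x <= ennreal K * ennreal (?W x)" for x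
  proof -
   have "nP t (%x. ennreal (?W x)) x = ennreal (ou t ?W x)" by (rule nP_eq_ou) auto
   moreover have "ou t ?W x <= K * ?W x" using K(2)[of ?W 1 t x] t by simp
   ultimately show ?thesis using K by (simp add: ennreal_mult[symmetric] ennreal_leI)
  qed
  have sp: "space MM \<in> sets (FF 0)" using sets.top[of "FF 0"] by simp
  have "nn_integral MM (%w. (nn_integral (X t w) (%x. ennreal (?W x)))) = nn_integral MM (%w. indicator (space MM) w * (nn_integral (X (0 + t) w) (%x. ennreal (?W x))))"
   by (intro nn_integral_cong) simp
  also have "... = ennreal (exp (\<alpha> * t)) * nn_integral MM (%w. indicator (space MM) w * nn_integral (X 0 w) (%x. nP t (%x. ennreal (?W x)) x))"
   by (rule mean_nn[OF _ _ _ t sp]) auto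
  also have "nn_integral MM (%w. indicator (space MM) w * nn_integral (X 0 w) (%x. nP t (%x. ennreal (?W x)) x)) = nn_integral MM (%w. (nn_integral \<mu> (%x. nP t (%x. ennreal (?W x)) x)))"
   by (intro nn_integral_cong_AE) (use X_0 AE_space in eventually_elim, simp)
  also have "... = (nn_integral \<mu> (%x. nP t (%x. ennreal (?W x)) x))" by (simp add: emeasure_space_1)
  also have "... <= (nn_integral \<mu> (%x. ennreal K * ennreal (?W x)))" by (intro nn_integral_mono np)
  also have "... = ennreal K * ennreal m" unfolding m(1)[symmetric] by (intro nn_integral_cmult) (simp add: measurable_cong_sets[OF \<mu>s refl])
  finally have "nn_integral MM (%w. (nn_integral (X t w) (%x. ennreal (?W x)))) <= ennreal (exp (\<alpha> * t)) * (ennreal K * ennreal m)"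
   by (simp add: mult_left_mono)
  also have "... <= ennreal ((1 + K * m) * exp (\<alpha> * t))"
   using K(1) m(2) by (simp add: ennreal_mult[symmetric] algebra_simps ennreal_leI)
  finally show "nn_integral MM (%w. (nn_integral (X t w) (%x. ennreal (?W x)))) <= ennreal ((1 + K * m) * exp (\<alpha> * t))" .
 qed
qed

lemma X_W_AE:
 assumes "0 <= t" shows "AE w in MM. (nn_integral (X t w) (%x. ennreal (wt n x))) < \<infinity>"
proof -
 obtain K where "nn_integral MM (%w. (nn_integral (X t w) (%x. ennreal (wt n x)))) <= ennreal (K * exp (\<alpha> * t))"
  using mean_W[of n] assms by metis
 then have "nn_integral MM (%w. (nn_integral (X t w) (%x. ennreal (wt n x)))) ~= \<infinity>"
  by (auto simp: top_unique)
 from nn_integral_PInf_AE[OF _ this] show ?thesis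
  using nn_X_measurable[OF _ assms] by (auto simp: less_top)
qed

text \<open>The first bound holds for every path, also where h is not integrable and its integral is
  0; almost sure integrability can therefore be treated separately.\<close>

lemma X_int_le:
 fixes h :: "real^'d => real"
 assumes [measurable]: "h \<in> borel_measurable borel" and "!!x. abs (h x) <= C * wt n x" "0 <= C"
 shows "ennreal (abs (LINT x|X t w. h x)) <= ennreal C * nn_integral (X t w) (%x. ennreal (wt n x))"
  "nn_integral (X t w) (%x. ennreal (wt n x)) < \<infinity> ==> integrable (X t w) h"
proof -
 have b: "nn_integral (X t w) (%x. ennreal (abs (h x))) <= ennreal C * nn_integral (X t w) (%x. ennreal (wt n x))"
 proof -
  have "nn_integral (X t w) (%x. ennreal (abs (h x))) <= nn_integral (X t w) (%x. ennreal C * ennreal (wt n x))"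
   using assms by (intro nn_integral_mono) (auto simp: ennreal_mult[symmetric] intro!: ennreal_leI)
  also have "... = ennreal C * nn_integral (X t w) (%x. ennreal (wt n x))" by (rule nn_integral_cmult) measurable
  finally show ?thesis .
 qed
 show "ennreal (abs (LINT x|X t w. h x)) <= ennreal C * nn_integral (X t w) (%x. ennreal (wt n x))"
 proof (cases "integrable (X t w) h")
  case True
  from integral_norm_bound_ennreal[OF True] show ?thesis using b by simp
 qed (simp add: not_integrable_integral_eq)
 assume "nn_integral (X t w) (%x. ennreal (wt n x)) < \<infinity>"
 then have "nn_integral (X t w) (%x. ennreal (abs (h x))) < \<infinity>" by (intro le_less_trans[OF b]) (simp add: ennreal_mult_less_top)
 then show "integrable (X t w) h" by (intro integrableI_bounded) auto
qed

lemma X_polyP_AE: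
 assumes "polyP h" "0 <= t" shows "AE w in MM. integrable (X t w) h"
proof -
 obtain C n where C: "C > 0" "!!x. abs (h x) <= C * wt n x" using assms(1) by (rule polyPE) blast
 show ?thesis using X_W_AE[OF assms(2), of n]
  by eventually_elim (rule X_int_le(2)[OF polyP_measurable[OF assms(1)] C(2) less_imp_le[OF C(1)]])
qed

lemma X_integrable:
 assumes "polyP h" "0 <= t" shows "integrable MM (%w. (LINT x|X t w. h x))"
proof (rule integrableI_bounded)
 obtain C n where C: "C > 0" "!!x. abs (h x) <= C * wt n x" using assms(1) by (rule polyPE) blast
 obtain K where K: "nn_integral MM (%w. (nn_integral (X t w) (%x. ennreal (wt n x)))) <= ennreal (K * exp (\<alpha> * t))"
  using mean_W[of n] assms(2) by metis
 have "nn_integral MM (%w. ennreal (norm (LINT x|X t w. h x))) <= nn_integral MM (%w. ennreal C * nn_integral (X t w) (%x. ennreal (wt n x)))"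
  unfolding real_norm_def
  by (intro nn_integral_mono X_int_le(1)[OF polyP_measurable[OF assms(1)] C(2) less_imp_le[OF C(1)]])
 also have "... = ennreal C * nn_integral MM (%w. (nn_integral (X t w) (%x. ennreal (wt n x))))"
  by (rule nn_integral_cmult) (intro nn_X_measurable assms(2), measurable)
 also have "... < \<infinity>" using K by (simp add: ennreal_mult_less_top le_less_trans)
 finally show "nn_integral MM (%w. ennreal (norm (LINT x|X t w. h x))) < \<infinity>" .
qed (rule X_int_measurable[OF polyP_measurable[OF assms(1)] assms(2)])

lemma mean_nonneg:
 assumes h: "polyP h" "!!x. 0 <= h x" and s: "0 <= s" and t: "0 <= t" and A: "A \<in> sets (FF s)"
 shows "(LINT w|MM. indicator A w * (LINT x|X (s + t) w. h x)) = exp (\<alpha> * t) * (LINT w|MM. indicator A w * (LINT x|X s w. ou t h x))"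
proof -
 have [measurable]: "A \<in> sets MM" by (rule FF_sub[OF A])
 have conv: "nn_integral MM (%w. indicator A w * nn_integral (X r w) (%x. ennreal (g x))) = ennreal (LINT w|MM. indicator A w * (LINT x|X r w. g x))"
  if g: "polyP g" "!!x. 0 <= g x" "0 <= r" for g r
 proof -
  have "nn_integral MM (%w. indicator A w * nn_integral (X r w) (%x. ennreal (g x))) = nn_integral MM (%w. ennreal (indicator A w * (LINT x|X r w. g x)))"
  proof (intro nn_integral_cong_AE, use X_polyP_AE[OF g(1,3)] in eventually_elim)
   fix w assume "integrable (X r w) g"
   then have "nn_integral (X r w) (%x. ennreal (g x)) = ennreal (LINT x|X r w. g x)" using g(2) by (intro nn_integral_eq_integral) auto
   then show "indicator A w * nn_integral (X r w) (%x. ennreal (g x)) = ennreal (indicator A w * (LINT x|X r w. g x))"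
    by (simp add: integral_indicator_le_top)
  qed
  also have "... = ennreal (LINT w|MM. indicator A w * (LINT x|X r w. g x))"
  proof (rule nn_integral_eq_integral)
   show "integrable MM (%w. indicator A w * (LINT x|X r w. g x))"
    using integrable_mult_indicator[OF _ X_integrable[OF g(1,3)], of A] by simp
   show "AE w in MM. 0 <= indicator A w * (LINT x|X r w. g x)" using g(2) by (intro AE_I2 mult_nonneg_nonneg integral_nonneg_AE) auto
  qed
  finally show ?thesis .
 qed
 have st: "0 <= s + t" using s t by simp
 have o: "polyP (ou t h)" "0 <= ou t h x" for x using h t by (auto intro!: polyP_ou ou_nonneg polyP_measurable)
 have nn: "0 <= (LINT w|MM. indicator A w * (LINT x|X r w. g x))" if "!!x. 0 <= g x" for g :: "real^'d => real" and r
  by (rule integral_nonneg_AE, rule AE_I2, rule mult_nonneg_nonneg) (auto intro!: integral_nonneg_AE simp: that)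
 have "ennreal (LINT w|MM. indicator A w * (LINT x|X (s + t) w. h x)) = ennreal (exp (\<alpha> * t)) * ennreal (LINT w|MM. indicator A w * (LINT x|X s w. ou t h x))"
  unfolding conv[OF h st, symmetric] conv[OF o s, symmetric] nP_eq_ou[OF h, symmetric]
  by (rule mean_nn[OF polyP_measurable[OF h(1)] h(2) s t A])
 also have "... = ennreal (exp (\<alpha> * t) * (LINT w|MM. indicator A w * (LINT x|X s w. ou t h x)))"
  by (rule ennreal_mult[symmetric]) (auto intro!: nn o)
 finally show ?thesis using nn[OF h(2)] nn[OF o(2)] by (subst (asm) ennreal_inj) auto
qed

lemma polyP_pos_neg:
 assumes "polyP h"
 shows "polyP (%x. max (h x) 0)" "polyP (%x. max (- h x) 0)"
 by (rule polyP_bound[OF polyP_abs[OF assms]]; use polyP_measurable[OF assms] in auto)+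

lemma mean_signed:
 assumes h: "polyP h" and s: "0 <= s" and t: "0 <= t" and A: "A \<in> sets (FF s)"
 shows "(LINT w|MM. indicator A w * (LINT x|X (s + t) w. h x)) = exp (\<alpha> * t) * (LINT w|MM. indicator A w * (LINT x|X s w. ou t h x))"
proof -
 have [measurable]: "A \<in> sets MM" by (rule FF_sub[OF A])
 define hp hm where "hp = (%x. max (h x) 0)" and "hm = (%x. max (- h x) 0)"
 have p: "polyP hp" "polyP hm" unfolding hp_def hm_def using polyP_pos_neg[OF h] by auto
 have nn: "0 <= hp x" "0 <= hm x" for x by (auto simp: hp_def hm_def)
 have hd: "h = (%x. hp x - hm x)" by (auto simp: hp_def hm_def fun_eq_iff max_def)
 have oud: "ou t h = (%x. ou t hp x - ou t hm x)"
 proof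
  fix x
  have "gop (exp (- b * t)) (sd t) h x = gop (exp (- b * t)) (sd t) hp x - gop (exp (- b * t)) (sd t) hm x"
   unfolding hd by (rule gop_diff[OF p])
  then show "ou t h x = ou t hp x - ou t hm x" using polyP_measurable[OF p(1)] polyP_measurable[OF p(2)] polyP_measurable[OF h] by (simp add: ou_sg_eq_gop)
 qed
 have split: "(LINT w|MM. indicator A w * (LINT x|X r w. g1 x - g2 x)) = (LINT w|MM. indicator A w * (LINT x|X r w. g1 x)) - (LINT w|MM. indicator A w * (LINT x|X r w. g2 x))"
  if g: "polyP g1" "polyP g2" "0 <= r" for g1 g2 r
 proof -
  have i: "integrable MM (%w. indicator A w * (LINT x|X r w. g x))" if "polyP g" for g
   using integrable_mult_indicator[OF _ X_integrable[OF that g(3)], of A] by simp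
  have "(LINT w|MM. indicator A w * (LINT x|X r w. g1 x - g2 x)) = (LINT w|MM. indicator A w * (LINT x|X r w. g1 x) - indicator A w * (LINT x|X r w. g2 x))"
  proof (rule integral_cong_AE)
   show "AE w in MM. indicator A w * (LINT x|X r w. g1 x - g2 x) = indicator A w * (LINT x|X r w. g1 x) - indicator A w * (LINT x|X r w. g2 x)"
    using X_polyP_AE[OF g(1,3)] X_polyP_AE[OF g(2,3)] by eventually_elim (simp add: right_diff_distrib)
  qed (use i[OF g(1)] i[OF g(2)] i[OF polyP_diff[OF g(1,2)]] in auto)
  then show ?thesis using i[OF g(1)] i[OF g(2)] by simp
 qed
 have st: "0 <= s + t" using s t by simp
 show ?thesis
  unfolding oud
  by (subst (1) hd) (simp only: split[OF p st] split[OF polyP_ou[OF p(1) t] polyP_ou[OF p(2) t] s] mean_nonneg[OF p(1) nn(1) s t A] mean_nonneg[OF p(2) nn(2) s t A] right_diff_distrib)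
qed

text \<open>Given \<open>FF s\<close>, the variable Y = th(Z - m) has mean 0, and exp(-Y) has mean
  exp(K), where K = th m - v is the integral of the deficit from \<open>V_exists\<close>. Thus
  exp(-Y) - 1 + Y has conditional mean exp(K) - 1, and with th = 1/r Chebyshev's inequality bounds
  the tail at r by a multiple of the expectation of K, which is of order th^q.\<close>

lemma tail_bound:
 fixes n :: nat
 obtains C where "0 <= C" "!!s t h B r. 0 <= s ==> 0 <= t ==> t <= 1 ==> h \<in> borel_measurable borel ==> (!!x. 0 <= h x) ==>
  (!!x. h x <= B) ==> (!!x. h x <= wt n x) ==> 1 <= r ==>
  emeasure MM {w \<in> space MM. r <= abs ((LINT x|X (s + t) w. h x) - exp (\<alpha> * t) * (LINT x|X s w. ou t h x))}
   <= ennreal (C * r powr (- q)) * nn_integral MM (%w. (nn_integral (X s w) (%x. ennreal (wt (2 * n) x))))"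
proof -
 obtain C where C: "0 <= C" "!!f th M. f \<in> borel_measurable borel ==> 0 < th ==> (!!x. 0 <= f x) ==> (!!x. f x <= M) ==>
  (!!x. f x <= th * wt n x) ==> \<exists>V. is_V \<sigma> b \<psi> f V & (\<forall>t. V t \<in> borel_measurable borel) &
   (\<forall>t\<in>{0..1}. \<forall>x::real^'d. 0 <= V t x & V t x <= exp (\<alpha> * t) * ou t f x &
     exp (\<alpha> * t) * ou t f x - V t x <= C * (th powr q + th\<^sup>2) * wt (2 * n) x)"
  by (rule V_exists[of 1 n]) (simp, blast)
 show ?thesis
 proof (rule that[of "14 * C"])
  show "0 <= 14 * C" using C by simp
  fix s t B r :: real and h :: "real^'d => real"
  assume s: "0 <= s" and t: "0 <= t" "t <= 1" and h [measurable]: "h \<in> borel_measurable borel" and h0: "!!x. 0 <= h x"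
   and hB: "!!x. h x <= B" and hW: "!!x. h x <= wt n x" and r: "1 <= r"
  define th where "th = 1 / r"
  have th: "0 < th" "th <= 1" using r by (auto simp: th_def)
  have B0: "0 <= B" using order_trans[OF h0 hB] .
  obtain V where V: "is_V \<sigma> b \<psi> (%x. th * h x) V" "V t \<in> borel_measurable borel"
   "!!x. 0 <= V t x" "!!x. V t x <= exp (\<alpha> * t) * ou t (%x. th * h x) x"
   "!!x. exp (\<alpha> * t) * ou t (%x. th * h x) x - V t x <= C * (th powr q + th\<^sup>2) * wt (2 * n) x"
  proof -
   have "\<exists>V. is_V \<sigma> b \<psi> (%x. th * h x) V & (\<forall>t. V t \<in> borel_measurable borel) &
   (\<forall>t\<in>{0..1}. \<forall>x. 0 <= V t x & V t x <= exp (\<alpha> * t) * ou t (%x. th * h x) x &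
     exp (\<alpha> * t) * ou t (%x. th * h x) x - V t x <= C * (th powr q + th\<^sup>2) * wt (2 * n) x)"
    using th h0 hB hW by (intro C(2)[of _ th "th * B"]) auto
   then show ?thesis using that t by auto
  qed
  have ouc: "ou t (%x. th * h x) x = th * ou t h x" for x by (simp add: ou_sg_eq_gop gop_cmult)
  note V4 = V(4)[unfolded ouc] and V5 = V(5)[unfolded ouc]
  have oub: "0 <= ou t h x" "ou t h x <= B" for x using h0 hB by (auto intro!: ou_nonneg ou_le_const)
  define Z where "Z = (%w. (LINT x|X (s + t) w. h x))"
  define m where "m = (%w. exp (\<alpha> * t) * (LINT x|X s w. ou t h x))"
  define v where "v = (%w. (LINT x|X s w. V t x))"
  define K where "K = (%w. th * m w - v w)"
  define W where "W = (%w. nn_integral (X s w) (%x. ennreal (wt (2 * n) x)))"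
  have mF [measurable]: "m \<in> borel_measurable (FF s)" unfolding m_def using s by (intro borel_measurable_times borel_measurable_const X_adapted) auto
  have vF [measurable]: "v \<in> borel_measurable (FF s)" unfolding v_def using s V(2) by (intro X_adapted) auto
  have KF [measurable]: "K \<in> borel_measurable (FF s)" unfolding K_def by measurable
  note [measurable] = FF_measurable_MM[OF mF] FF_measurable_MM[OF vF] FF_measurable_MM[OF KF]
  have [measurable]: "Z \<in> borel_measurable MM" unfolding Z_def using s t by (intro X_int_measurable) auto
  have [measurable]: "W \<in> borel_measurable MM" unfolding W_def by (rule nn_X_measurable[OF _ s]) measurable
  have Z0: "0 <= Z w" for w unfolding Z_def using h0 by (intro integral_nonneg_AE AE_I2)
  have m0: "0 <= m w" for w unfolding m_def using oub by (intro mult_nonneg_nonneg integral_nonneg_AE AE_I2) auto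
  have v0: "0 <= v w" for w unfolding v_def using V(3) by (intro integral_nonneg_AE AE_I2) auto
  have iou: "integrable (X s w) (%x. exp (\<alpha> * t) * (th * ou t h x))" for w
   by (intro integrable_mult_right X_integrable_bounded[of _ B]) (use oub in auto)
  have iV: "integrable (X s w) (V t)" for w
  proof (rule X_integrable_bounded[OF V(2), of "exp (\<alpha> * t) * (th * B)"])
   show "abs (V t x) <= exp (\<alpha> * t) * (th * B)" for x
    using V(3)[of x] oub(2)[of x] th by (auto intro!: order_trans[OF V4] mult_left_mono)
  qed
  have Kd: "K w = (LINT x|X s w. exp (\<alpha> * t) * (th * ou t h x) - V t x)" for w
   unfolding K_def m_def v_def by (subst Bochner_Integration.integral_diff[OF iou iV]) (simp add: mult_ac)
  have K0: "0 <= K w" for w unfolding Kd using V4 by (intro integral_nonneg_AE AE_I2) simp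
  define c where "c = C * (th powr q + th\<^sup>2)"
  have c0: "0 <= c" unfolding c_def using C(1) by simp
  have KW: "ennreal (K w) <= ennreal c * W w" for w
  proof -
   have "ennreal (K w) = nn_integral (X s w) (%x. ennreal (exp (\<alpha> * t) * (th * ou t h x) - V t x))"
    unfolding Kd using V4 by (intro nn_integral_eq_integral[symmetric] Bochner_Integration.integrable_diff iou iV) simp
   also have "... <= nn_integral (X s w) (%x. ennreal c * ennreal (wt (2 * n) x))"
    using V5 c0 by (intro nn_integral_mono) (auto simp: c_def ennreal_mult[symmetric] intro!: ennreal_leI)
   also have "... = ennreal c * W w" unfolding W_def by (rule nn_integral_cmult) measurable
   finally show ?thesis .
  qed
  define E where "E = nn_integral MM (%w. W w)"
  have EK: "nn_integral MM (%w. ennreal (K w)) <= ennreal c * E"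
  proof -
   have "nn_integral MM (%w. ennreal (K w)) <= nn_integral MM (%w. ennreal c * W w)" by (intro nn_integral_mono KW)
   also have "... = ennreal c * E" unfolding E_def by (rule nn_integral_cmult) measurable
   finally show ?thesis .
  qed
  define Y where "Y = (%w. th * (Z w - m w))"
  have [measurable]: "Y \<in> borel_measurable MM" unfolding Y_def by measurable
  \<comment> \<open>On \<open>D k\<close> the test function exp(th m) is bounded and exp(K) - 1 <=
    2K. Afterwards k tends to infinity, and the event K >= 1 is covered by Markov's inequality in
    \<open>p2\<close>.\<close>
  define D where "D = (%k::nat. {w \<in> space MM. K w <= 1 & m w <= real k})"
  have DF: "D k \<in> sets (FF s)" for k
  proof -
   have "{w \<in> space (FF s). K w <= 1 & m w <= real k} \<in> sets (FF s)" by measurable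
   then show ?thesis by (simp add: D_def)
  qed
  have Dm [measurable]: "D k \<in> sets MM" for k by (rule FF_sub[OF DF])
  \<comment> \<open>The 6 is 3, from the lower bound 1/3 on the test function, times 2, from exp(K)
    - 1 <= 2K.\<close>
  have main: "emeasure MM ({w \<in> space MM. 1 <= abs (Y w)} \<inter> D k) <= 6 * (ennreal c * E)" for k
  proof -
   let ?I = "indicator (D k) :: _ => real"
   have im: "integrable MM (%w. ?I w * m w)"
    by (rule integrable_const_bound[of _ "real k"]) (use m0 in \<open>auto simp: D_def split: split_indicator intro!: AE_I2\<close>)
   have eq: "nn_integral MM (%w. ennreal (?I w * Z w)) = nn_integral MM (%w. ennreal (?I w * m w))"
    using mean_bounded[OF h h0 hB s t(1) DF[of k]] unfolding Z_def m_def integral_indicator_le_top .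
   also have "... = ennreal (LINT w|MM. ?I w * m w)" using m0 by (intro nn_integral_eq_integral im AE_I2) auto
   finally have eqm: "nn_integral MM (%w. ennreal (?I w * Z w)) = ennreal (LINT w|MM. ?I w * m w)" .
   have iZ: "integrable MM (%w. ?I w * Z w)"
    by (rule integrableI_bounded) (use Z0 eqm in \<open>auto simp: abs_mult\<close>)
   have "ennreal (LINT w|MM. ?I w * Z w) = ennreal (LINT w|MM. ?I w * m w)"
    unfolding eqm[symmetric] using Z0 by (intro nn_integral_eq_integral[symmetric] iZ AE_I2) auto
   then have EZm: "(LINT w|MM. ?I w * Z w) = (LINT w|MM. ?I w * m w)"
    by (subst (asm) ennreal_inj) (use Z0 m0 in \<open>auto intro!: integral_nonneg_AE AE_I2\<close>)
   have bexp: "?I w * exp (th * m w) <= exp (th * real k)" for w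
    using th by (auto simp: D_def split: split_indicator intro!: mult_left_mono)
   have "(LINT w|MM. (?I w * exp (th * m w)) * exp (- (LINT x|X (s + t) w. th * h x))) = (LINT w|MM. (?I w * exp (th * m w)) * exp (- (LINT x|X s w. V t x)))"
   proof (rule X_laplace[OF _ _ _ V(1,2) s t(1)])
    show "bounded (range (%x. th * h x))"
     using h0 hB th by (intro boundedI[of _ "th * B"]) (auto simp: abs_mult)
    show "(%w. ?I w * exp (th * m w)) \<in> borel_measurable (FF s)" using DF[of k] by measurable
    show "abs (?I w * exp (th * m w)) <= exp (th * real k)" for w using bexp by (simp add: abs_mult)
   qed (use h0 th in auto)
   then have lap: "(LINT w|MM. ?I w * exp (- Y w)) = (LINT w|MM. ?I w * exp (K w))"
   proof -
    assume *: "(LINT w|MM. (?I w * exp (th * m w)) * exp (- (LINT x|X (s + t) w. th * h x))) = (LINT w|MM. (?I w * exp (th * m w)) * exp (- (LINT x|X s w. V t x)))"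
    have e1: "(?I w * exp (th * m w)) * exp (- (LINT x|X (s + t) w. th * h x)) = ?I w * exp (- Y w)" for w
     by (simp add: Y_def Z_def mult.assoc exp_add[symmetric] algebra_simps)
    have e2: "(?I w * exp (th * m w)) * exp (- (LINT x|X s w. V t x)) = ?I w * exp (K w)" for w
     by (simp add: K_def v_def mult.assoc exp_add[symmetric])
    show ?thesis using * unfolding e1 e2 .
   qed
   have iexpY: "integrable MM (%w. ?I w * exp (- Y w))"
   proof (rule integrable_const_bound[of _ "exp (th * real k)"])
    have "?I w * exp (- Y w) <= exp (th * real k)" for w
    proof -
     have "exp (- Y w) <= exp (th * m w)" using th Z0[of w] by (simp add: Y_def algebra_simps)
     then have "?I w * exp (- Y w) <= ?I w * exp (th * m w)" by (intro mult_left_mono) auto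
     then show ?thesis using bexp[of w] by linarith
    qed
    then show "AE w in MM. norm (?I w * exp (- Y w)) <= exp (th * real k)" by (simp add: abs_mult)
   qed measurable
   have iexpK: "integrable MM (%w. ?I w * exp (K w))"
    by (rule integrable_const_bound[of _ "exp 1"]) (auto simp: D_def abs_mult split: split_indicator intro!: AE_I2)
   have iI: "integrable MM ?I" by (rule integrable_const_bound[of _ 1]) (auto split: split_indicator intro!: AE_I2)
   have iY: "integrable MM (%w. ?I w * Y w)"
    using integrable_mult_right[OF Bochner_Integration.integrable_diff[OF iZ im], of th] by (simp add: Y_def algebra_simps)
   have EY: "(LINT w|MM. ?I w * Y w) = 0"
   proof -
    have "(LINT w|MM. ?I w * Y w) = (LINT w|MM. th * (?I w * Z w - ?I w * m w))" by (simp add: Y_def algebra_simps)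
    also have "... = th * ((LINT w|MM. ?I w * Z w) - (LINT w|MM. ?I w * m w))" using iZ im by simp
    finally show ?thesis using EZm by simp
   qed
   have iphi: "integrable MM (%w. ?I w * exp (- Y w) - ?I w + ?I w * Y w)"
    by (intro Bochner_Integration.integrable_add Bochner_Integration.integrable_diff iexpY iI iY)
   have "(LINT w|MM. ?I w * exp (- Y w) - ?I w + ?I w * Y w) = (LINT w|MM. ?I w * exp (K w) - ?I w)"
    using iexpY iI iY iexpK lap EY by simp
   moreover have "(LINT w|MM. ?I w * exp (K w) - ?I w) = (LINT w|MM. ?I w * (exp (K w) - 1))" by (simp add: algebra_simps)
   moreover have phi: "?I w * exp (- Y w) - ?I w + ?I w * Y w = ?I w * (exp (- Y w) - 1 + Y w)" for w by (simp add: algebra_simps)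
   ultimately have ephi: "(LINT w|MM. ?I w * (exp (- Y w) - 1 + Y w)) = (LINT w|MM. ?I w * (exp (K w) - 1))" by simp
   have phi0: "0 <= exp (- y) - 1 + y" for y :: real using exp_ge_add_one_self[of "- y"] by simp
   have iK1: "integrable MM (%w. ?I w * (exp (K w) - 1))"
    using Bochner_Integration.integrable_diff[OF iexpK iI] by (simp add: algebra_simps)
   have "emeasure MM ({w \<in> space MM. 1 <= abs (Y w)} \<inter> D k) = nn_integral MM (%w. indicator ({w \<in> space MM. 1 <= abs (Y w)} \<inter> D k) w)"
    by (rule nn_integral_indicator[symmetric]) measurable
   also have "... <= nn_integral MM (%w. ennreal 3 * ennreal (?I w * (exp (- Y w) - 1 + Y w)))"
   proof (rule nn_integral_mono)
    fix w
    show "indicator ({w \<in> space MM. 1 <= abs (Y w)} \<inter> D k) w <= ennreal 3 * ennreal (?I w * (exp (- Y w) - 1 + Y w))"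
    proof (cases "w \<in> {w \<in> space MM. 1 <= abs (Y w)} \<inter> D k")
     case True
     then have "1 <= 3 * (?I w * (exp (- Y w) - 1 + Y w))" using exp_remainder_ge_third[of "Y w"] by simp
     then have "ennreal 1 <= ennreal (3 * (?I w * (exp (- Y w) - 1 + Y w)))" by (rule ennreal_leI)
     then show ?thesis using True phi0[of "Y w"] by (subst (asm) ennreal_mult) auto
    qed simp
   qed
   also have "... = ennreal 3 * nn_integral MM (%w. ennreal (?I w * (exp (- Y w) - 1 + Y w)))" by (rule nn_integral_cmult) measurable
   also have "nn_integral MM (%w. ennreal (?I w * (exp (- Y w) - 1 + Y w))) = ennreal (LINT w|MM. ?I w * (exp (- Y w) - 1 + Y w))"
    using iphi phi0 unfolding phi by (intro nn_integral_eq_integral AE_I2 mult_nonneg_nonneg) auto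
   also have "... = nn_integral MM (%w. ennreal (?I w * (exp (K w) - 1)))"
    unfolding ephi using iK1 K0 by (intro nn_integral_eq_integral[symmetric] AE_I2 mult_nonneg_nonneg) auto
   also have "... <= nn_integral MM (%w. ennreal 2 * ennreal (K w))"
   proof (rule nn_integral_mono)
    fix w
    have "?I w * (exp (K w) - 1) <= 2 * K w"
    proof (cases "w \<in> D k")
     case True
     then have K1: "K w <= 1" by (simp add: D_def)
     have "exp (K w) <= 1 + K w + (K w)\<^sup>2" using K0 K1 by (intro exp_bound)
     moreover have "(K w)\<^sup>2 <= K w" using K0[of w] K1 by (simp add: power2_eq_square mult_left_le)
     ultimately show ?thesis using True by simp
    qed (use K0 in simp)
    then show "ennreal (?I w * (exp (K w) - 1)) <= ennreal 2 * ennreal (K w)"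
     using K0[of w] by (subst ennreal_mult[symmetric]) (auto intro!: ennreal_leI)
   qed
   also have "... = ennreal 2 * nn_integral MM (%w. ennreal (K w))" by (rule nn_integral_cmult) measurable
   also have "ennreal 3 * (ennreal 2 * nn_integral MM (%w. ennreal (K w))) <= ennreal 3 * (ennreal 2 * (ennreal c * E))"
    by (intro mult_left_mono EK) auto
   also have "... = 6 * (ennreal c * E)" by (simp add: mult.assoc[symmetric])
   finally show ?thesis by (simp add: mult_left_mono)
  qed
  have "(%k. emeasure MM ({w \<in> space MM. 1 <= abs (Y w)} \<inter> D k)) \<longlonglongrightarrow> emeasure MM (\<Union>k. {w \<in> space MM. 1 <= abs (Y w)} \<inter> D k)"
   by (rule Lim_emeasure_incseq) (auto simp: incseq_def D_def)
  from LIMSEQ_le_const2[OF this] have "emeasure MM (\<Union>k. {w \<in> space MM. 1 <= abs (Y w)} \<inter> D k) <= 6 * (ennreal c * E)"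
   using main by auto
  moreover have "(\<Union>k. {w \<in> space MM. 1 <= abs (Y w)} \<inter> D k) = {w \<in> space MM. 1 <= abs (Y w) & K w <= 1}"
   using real_arch_simple by (auto simp: D_def)
  ultimately have p1: "emeasure MM {w \<in> space MM. 1 <= abs (Y w) & K w <= 1} <= 6 * (ennreal c * E)" by simp
  have p2: "emeasure MM {w \<in> space MM. 1 <= K w} <= ennreal c * E"
  proof -
   have "emeasure MM {w \<in> space MM. 1 <= K w} = nn_integral MM (%w. indicator {w \<in> space MM. 1 <= K w} w)" by (rule nn_integral_indicator[symmetric]) measurable
   also have "... <= nn_integral MM (%w. ennreal (K w))"
    by (intro nn_integral_mono) (auto split: split_indicator simp: ennreal_leI[of 1, simplified])
   finally show ?thesis using EK by simp
  qed
  have "{w \<in> space MM. r <= abs (Z w - m w)} \<subseteq> {w \<in> space MM. 1 <= abs (Y w) & K w <= 1} \<union> {w \<in> space MM. 1 <= K w}"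
   using r by (auto simp: Y_def th_def abs_mult field_simps)
  then have "emeasure MM {w \<in> space MM. r <= abs (Z w - m w)} <= emeasure MM ({w \<in> space MM. 1 <= abs (Y w) & K w <= 1} \<union> {w \<in> space MM. 1 <= K w})"
   by (intro emeasure_mono) auto
  also have "... <= emeasure MM {w \<in> space MM. 1 <= abs (Y w) & K w <= 1} + emeasure MM {w \<in> space MM. 1 <= K w}"
   by (rule emeasure_subadditive) measurable
  also have "... <= 6 * (ennreal c * E) + ennreal c * E" by (intro add_mono p1 p2)
  also have "... = ennreal (7 * c) * E"
   using c0 by (simp add: ennreal_mult mult.assoc distrib_right[symmetric]) (metis (no_types, lifting) add.commute distrib_right mult_1 numeral_plus_one one_plus_numeral semiring_norm(5) semiring_norm(2) semiring_norm(8) semiring_norm(3))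
  \<comment> \<open>Since th <= 1 and q <= 2, th^2 <= th^q and so c <= 2 C th^q; together with the 7
    this gives 14.\<close>
  also have "... <= ennreal (14 * C * r powr (- q)) * E"
  proof (intro mult_right_mono ennreal_leI)
   have "th\<^sup>2 = th powr 2" using th by (simp add: powr_numeral)
   also have "... <= th powr q" using th q by (intro powr_mono') auto
   finally have "c <= C * (2 * th powr q)" unfolding c_def using C(1) by (intro mult_left_mono) auto
   moreover have "th powr q = r powr (- q)" using r by (simp add: th_def powr_minus inverse_powr divide_inverse)
   ultimately show "7 * c <= 14 * C * r powr (- q)" by simp
  qed simp
  finally show "emeasure MM {w \<in> space MM. r <= abs ((LINT x|X (s + t) w. h x) - exp (\<alpha> * t) * (LINT x|X s w. ou t h x))}
   <= ennreal (14 * C * r powr (- q)) * nn_integral MM (%w. (nn_integral (X s w) (%x. ennreal (wt (2 * n) x))))"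
   by (simp add: Z_def m_def E_def W_def)
 qed
qed

end

lemma powr_sum_le:
 fixes d w :: "'i => real" and p :: real
 assumes "finite J" "!!j. j \<in> J ==> 0 < w j" "0 < p"
 shows "abs (\<Sum>j\<in>J. d j) powr p <= (\<Sum>j\<in>J. w j) powr p * (\<Sum>j\<in>J. (abs (d j) / w j) powr p)"
proof (cases "J = {}")
 case False
 define M where "M = Max ((%j. abs (d j) / w j) ` J)"
 have "M \<in> (%j. abs (d j) / w j) ` J" unfolding M_def using assms False by (intro Max_in) auto
 then obtain i where i: "i \<in> J" "M = abs (d i) / w i" by auto
 have le: "abs (d j) <= w j * M" if "j \<in> J" for j
 proof -
  have "abs (d j) / w j <= M" unfolding M_def using assms that by (intro Max_ge) auto
  then show ?thesis using assms(2)[OF that] by (simp add: field_simps)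
 qed
 have M0: "0 <= M" using i assms(2)[OF i(1)] by simp
 have S0: "0 <= (\<Sum>j\<in>J. w j)" using assms(2) by (intro sum_nonneg) (simp add: less_imp_le)
 have "abs (\<Sum>j\<in>J. d j) <= (\<Sum>j\<in>J. w j * M)" by (intro order_trans[OF sum_abs sum_mono] le)
 also have "... = (\<Sum>j\<in>J. w j) * M" by (simp add: sum_distrib_right)
 finally have "abs (\<Sum>j\<in>J. d j) powr p <= ((\<Sum>j\<in>J. w j) * M) powr p" using assms by (intro powr_mono2) auto
 also have "... = (\<Sum>j\<in>J. w j) powr p * M powr p" using S0 M0 by (simp add: powr_mult)
 also have "M powr p <= (\<Sum>j\<in>J. (abs (d j) / w j) powr p)"
  unfolding i(2) using i(1) assms(1) by (intro member_le_sum[of i J "%j. (abs (d j) / w j) powr p"]) auto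
 finally show ?thesis by (simp add: mult_left_mono)
qed simp

section \<open>Moments of martingale increments below order q\<close>

context super
begin

text \<open>X_{s+t}(h) minus its conditional expectation given the past up to s.\<close>

definition Dm :: "real => real => (real^'d => real) => 'w => real" where
 "Dm s t h w = (LINT x|X (s + t) w. h x) - exp (\<alpha> * t) * (LINT x|X s w. ou t h x)"

lemma Dm_measurable:
 assumes "h \<in> borel_measurable borel" "0 <= s" "0 <= t" shows "Dm s t h \<in> borel_measurable MM"
 unfolding Dm_def[abs_def] using assms
 by (intro borel_measurable_diff borel_measurable_times borel_measurable_const X_int_measurable) auto

text \<open>Summing the tail r^(-q) over dyadic r with weights 2^(p(j+1)) gives a geometric series
  of ratio 2^(p-q) < 1. The bound is linear in the expected mass, of order exp(\<alpha>s), and not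
  in its p-th power; this is what makes normalised increments small.\<close>

lemma moment_bounded:
 fixes n :: nat and p :: real
 assumes p: "0 < p" "p < q"
 obtains C where "0 <= C" "!!s t h B. 0 <= s ==> 0 <= t ==> t <= 1 ==> h \<in> borel_measurable borel ==> (!!x. 0 <= h x) ==>
  (!!x. h x <= B) ==> (!!x. h x <= wt n x) ==>
  (nn_integral MM (%w. ennreal (abs (Dm s t h w) powr p))) <= ennreal (C * exp (\<alpha> * s))"
proof -
 obtain C where C: "0 <= C" "!!s t h B r. 0 <= s ==> 0 <= t ==> t <= 1 ==> h \<in> borel_measurable borel ==> (!!x. 0 <= h x) ==>
  (!!x. h x <= B) ==> (!!x. h x <= wt n x) ==> 1 <= r ==>
  emeasure MM {w \<in> space MM. r <= abs ((LINT x|X (s + t) w. h x) - exp (\<alpha> * t) * (LINT x|X s w. ou t h x))}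
   <= ennreal (C * r powr (- q)) * nn_integral MM (%w. (nn_integral (X s w) (%x. ennreal (wt (2 * n) x))))"
  by (rule tail_bound[of n]) blast
 obtain K where K: "1 <= K" "!!t. 0 <= t ==> (nn_integral MM (%w. (nn_integral (X t w) (%x. ennreal (wt (2 * n) x))))) <= ennreal (K * exp (\<alpha> * t))"
  by (rule mean_W[of "2 * n"]) blast
 define \<rho>' where "\<rho>' = 2 powr (p - q)"
 have \<rho>': "0 < \<rho>'" "\<rho>' < 1" unfolding \<rho>'_def using p powr_less_mono[of "p - q" 0 2] by auto
 define G where "G = C * 2 powr p * (1 / (1 - \<rho>'))"
 have G0: "0 <= G" unfolding G_def using C(1) \<rho>' by simp
 show ?thesis
 proof (rule that[of "1 + G * K"])
  show "0 <= 1 + G * K" using G0 K by simp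
  fix s t B :: real and h :: "real^'d => real"
  assume s: "0 <= s" and t: "0 <= t" "t <= 1" and h: "h \<in> borel_measurable borel" and h0: "!!x. 0 <= h x"
   and hB: "!!x. h x <= B" and hW: "!!x. h x <= wt n x"
  note [measurable] = Dm_measurable[OF h s t(1)]
  define E where "E = nn_integral MM (%w. (nn_integral (X s w) (%x. ennreal (wt (2 * n) x))))"
  have "nn_integral MM (%w. ennreal (abs (Dm s t h w) powr p)) <= nn_integral MM (%w. 1 + (\<Sum>j. ennreal (2 powr (p * real (Suc j))) * indicator {v. 2 ^ j <= v} (abs (Dm s t h w))))"
   using p by (intro nn_integral_mono powr_le_dyadic) auto
  also have "... = 1 + (\<Sum>j. nn_integral MM (%w. ennreal (2 powr (p * real (Suc j))) * indicator {v. 2 ^ j <= v} (abs (Dm s t h w))))"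
   by (subst nn_integral_add) (auto simp: emeasure_space_1 nn_integral_suminf)
  also have "... <= 1 + (\<Sum>j. ennreal (C * 2 powr p * \<rho>' ^ j) * E)"
  proof (intro add_left_mono suminf_le summableI)
   fix j :: nat
   have "nn_integral MM (%w. ennreal (2 powr (p * real (Suc j))) * indicator {v. 2 ^ j <= v} (abs (Dm s t h w)))
    = nn_integral MM (%w. ennreal (2 powr (p * real (Suc j))) * indicator {w \<in> space MM. 2 ^ j <= abs (Dm s t h w)} w)"
    by (intro nn_integral_cong) (auto simp: indicator_def)
   also have "... = ennreal (2 powr (p * real (Suc j))) * emeasure MM {w \<in> space MM. 2 ^ j <= abs (Dm s t h w)}"
    by (rule nn_integral_cmult_indicator) measurable
   also have "... <= ennreal (2 powr (p * real (Suc j))) * (ennreal (C * (2 ^ j) powr (- q)) * E)"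
    unfolding E_def Dm_def using C(2)[OF s t h h0 hB hW, of "2 ^ j"] by (intro mult_left_mono) auto
   also have "... = ennreal (2 powr (p * real (Suc j)) * (C * (2 ^ j) powr (- q))) * E"
    using C(1) by (simp add: ennreal_mult mult.assoc)
   also have "2 powr (p * real (Suc j)) * (C * (2 ^ j) powr (- q)) = C * 2 powr p * \<rho>' ^ j"
   proof -
    have a: "(2 ^ j :: real) powr (- q) = 2 powr (- q * real j)"
     by (simp add: powr_realpow[symmetric] powr_powr mult.commute)
    have b: "\<rho>' ^ j = 2 powr ((p - q) * real j)" unfolding \<rho>'_def by (simp add: powr_powr powr_realpow[symmetric])
    show ?thesis unfolding a b by (simp add: powr_add[symmetric] algebra_simps)
   qed
   finally show "nn_integral MM (%w. ennreal (2 powr (p * real (Suc j))) * indicator {v. 2 ^ j <= v} (abs (Dm s t h w))) <= ennreal (C * 2 powr p * \<rho>' ^ j) * E" .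
  qed
  also have "(\<Sum>j. ennreal (C * 2 powr p * \<rho>' ^ j) * E) = (\<Sum>j. ennreal (C * 2 powr p * \<rho>' ^ j)) * E"
   by (rule ennreal_suminf_multc)
  also have "(\<Sum>j. ennreal (C * 2 powr p * \<rho>' ^ j)) = ennreal G"
   unfolding G_def using C(1) \<rho>' geometric_sums[of \<rho>'] by (intro suminf_ennreal_eq sums_mult) auto
  also have "1 + ennreal G * E <= 1 + ennreal G * ennreal (K * exp (\<alpha> * s))"
   unfolding E_def by (intro add_left_mono mult_left_mono K(2) s) simp
  also have "... = ennreal (1 + G * (K * exp (\<alpha> * s)))" using G0 K(1) by (simp add: ennreal_mult[symmetric])
  also have "... <= ennreal ((1 + G * K) * exp (\<alpha> * s))"
   using s \<alpha>_pos by (intro ennreal_leI) (simp add: distrib_right)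
  finally show "nn_integral MM (%w. ennreal (abs (Dm s t h w) powr p)) <= ennreal ((1 + G * K) * exp (\<alpha> * s))" .
 qed
qed

lemma nn_integral_Fatou_powr:
 assumes m: "!!k. f k \<in> borel_measurable MM" and l: "AE w in MM. (%k. f k w) \<longlonglongrightarrow> g w" and p: "0 < (p::real)"
  and b: "!!k. (nn_integral MM (%w. ennreal (abs (f k w) powr p))) <= C"
 shows "nn_integral MM (%w. ennreal (abs (g w) powr p)) <= C"
proof -
 have "nn_integral MM (%w. ennreal (abs (g w) powr p)) <= nn_integral MM (%w. liminf (%k. ennreal (abs (f k w) powr p)))"
 proof (rule nn_integral_mono_AE, use l in eventually_elim)
  fix w assume "(%k. f k w) \<longlonglongrightarrow> g w"
  then have "(%k. abs (f k w) powr p) \<longlonglongrightarrow> (abs (g w)) powr p"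
   using p by (intro tendsto_powr' tendsto_rabs tendsto_const) auto
  then have "liminf (%k. ennreal (abs (f k w) powr p)) = ennreal (abs (g w) powr p)"
   by (intro lim_imp_Liminf tendsto_ennrealI) auto
  then show "ennreal (abs (g w) powr p) <= liminf (%k. ennreal (abs (f k w) powr p))" by simp
 qed
 also have "... <= liminf (%k. nn_integral MM (%w. ennreal (abs (f k w) powr p)))"
  using m by (intro nn_integral_liminf) measurable
 also have "... <= liminf (%k::nat. C)" by (intro Liminf_mono always_eventually allI b)
 finally show ?thesis by (simp add: Liminf_const)
qed

text \<open>The constant of \<open>moment_bounded\<close> does not depend on the bound B, so
  truncating h at level k and applying Fatou's lemma removes boundedness without loss.\<close>

lemma moment_nonneg:
 fixes n :: nat and p :: real
 assumes p: "0 < p" "p < q"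
 obtains C where "0 <= C" "!!s t h. 0 <= s ==> 0 <= t ==> t <= 1 ==> h \<in> borel_measurable borel ==> (!!x. 0 <= h x) ==>
  (!!x. h x <= wt n x) ==>
  (nn_integral MM (%w. ennreal (abs (Dm s t h w) powr p))) <= ennreal (C * exp (\<alpha> * s))"
proof -
 obtain C where C: "0 <= C" "!!s t h B. 0 <= s ==> 0 <= t ==> t <= 1 ==> h \<in> borel_measurable borel ==> (!!x. 0 <= h x) ==>
  (!!x. h x <= B) ==> (!!x. h x <= wt n x) ==>
  (nn_integral MM (%w. ennreal (abs (Dm s t h w) powr p))) <= ennreal (C * exp (\<alpha> * s))"
  by (rule moment_bounded[OF p, of n]) blast
 show ?thesis
 proof (rule that[OF C(1)])
  fix s t :: real and h :: "real^'d => real"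
  assume s: "0 <= s" and t: "0 <= t" "t <= 1" and h [measurable]: "h \<in> borel_measurable borel" and h0: "!!x. 0 <= h x"
   and hW: "!!x. h x <= wt n x"
  define hk where "hk = (%k::nat. %x. min (h x) (real k))"
  have hkm [measurable]: "hk k \<in> borel_measurable borel" for k unfolding hk_def by measurable
  have hk: "0 <= hk k x" "hk k x <= real k" "hk k x <= h x" for k x using h0 by (auto simp: hk_def)
  have lim: "(%k. hk k x) \<longlonglongrightarrow> h x" for x
  proof (rule tendsto_eventually)
   show "\<forall>\<^sub>F k in sequentially. hk k x = h x"
    using eventually_ge_at_top[of "nat \<lceil>h x\<rceil>"]
   proof eventually_elim
    fix k :: nat assume "nat \<lceil>h x\<rceil> <= k"
    then have "real (nat \<lceil>h x\<rceil>) <= real k" by simp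
    then have "h x <= real k" using real_nat_ceiling_ge[of "h x"] by linarith
    then show "hk k x = h x" by (simp add: hk_def)
   qed
  qed
  have ph: "polyP h" using h0 hW by (intro polyPI[OF h, of 1 n]) auto
  have pk: "polyP (hk k)" for k using hk by (intro polyP_bounded[of _ "real k"]) auto
  have ol: "(%k. ou t (hk k) x) \<longlonglongrightarrow> ou t h x" for x
   unfolding ou_sg_eq_gop[OF h] ou_sg_eq_gop[OF hkm] gop_def
   by (rule integral_dominated_convergence[OF _ _ integrable_gop[OF ph, of "exp (- b * t) *\<^sub>R x" "sd t"]])
    (use hk lim in auto)
  have ob: "0 <= ou t (hk k) x" "ou t (hk k) x <= ou t h x" for k x
  proof -
   show "0 <= ou t (hk k) x" using hk by (intro ou_nonneg) auto
   show "ou t (hk k) x <= ou t h x"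
    unfolding ou_sg_eq_gop[OF h] ou_sg_eq_gop[OF hkm] gop_def
    by (intro integral_mono integrable_gop ph pk hk(3))
  qed
  have st: "0 <= s + t" using s t by simp
  show "nn_integral MM (%w. ennreal (abs (Dm s t h w) powr p)) <= ennreal (C * exp (\<alpha> * s))"
  proof (rule nn_integral_Fatou_powr[OF _ _ p(1)])
   show "Dm s t (hk k) \<in> borel_measurable MM" for k by (rule Dm_measurable[OF hkm s t(1)])
   show "nn_integral MM (%w. ennreal (abs (Dm s t (hk k) w) powr p)) <= ennreal (C * exp (\<alpha> * s))" for k
    by (rule C(2)[OF s t hkm hk(1) hk(2)]) (rule order_trans[OF hk(3) hW])
   show "AE w in MM. (%k. Dm s t (hk k) w) \<longlonglongrightarrow> Dm s t h w"
    using X_polyP_AE[OF ph st] X_polyP_AE[OF polyP_ou[OF ph t(1)] s]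
   proof eventually_elim
    fix w assume 1: "integrable (X (s + t) w) h" and 2: "integrable (X s w) (ou t h)"
    have "(%k. (LINT x|X (s + t) w. hk k x)) \<longlonglongrightarrow> (LINT x|X (s + t) w. h x)"
     by (rule integral_dominated_convergence[OF _ _ 1]) (use hk lim in auto)
    moreover have "(%k. (LINT x|X s w. ou t (hk k) x)) \<longlonglongrightarrow> (LINT x|X s w. ou t h x)"
     by (rule integral_dominated_convergence[OF _ _ 2]) (use ob ol in auto)
    ultimately show "(%k. Dm s t (hk k) w) \<longlonglongrightarrow> Dm s t h w"
     unfolding Dm_def by (intro tendsto_intros)
   qed
  qed
 qed
qed

lemma Dm_cmult:
 assumes "h \<in> borel_measurable borel" shows "Dm s t (%x. c * h x) w = c * Dm s t h w"
proof -
 have "(%x. c * h x) \<in> borel_measurable borel" using assms by simp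
 then have "ou t (%x. c * h x) x = c * ou t h x" for x using assms by (simp add: ou_sg_eq_gop gop_cmult)
 then show ?thesis by (simp add: Dm_def algebra_simps)
qed

lemma Dm_diff_AE:
 assumes g: "polyP g1" "polyP g2" and "0 <= s" "0 <= t"
 shows "AE w in MM. Dm s t (%x. g1 x - g2 x) w = Dm s t g1 w - Dm s t g2 w"
proof -
 have oud: "ou t (%x. g1 x - g2 x) x = ou t g1 x - ou t g2 x" for x
  using gop_diff[OF g] polyP_measurable[OF g(1)] polyP_measurable[OF g(2)] polyP_measurable[OF polyP_diff[OF g]]
  by (simp add: ou_sg_eq_gop)
 have st: "0 <= s + t" using assms by simp
 show ?thesis
  using X_polyP_AE[OF g(1) st] X_polyP_AE[OF g(2) st] X_polyP_AE[OF polyP_ou[OF g(1) assms(4)] assms(3)] X_polyP_AE[OF polyP_ou[OF g(2) assms(4)] assms(3)]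
  by eventually_elim (simp add: Dm_def oud algebra_simps)
qed

text \<open>Rescaling by c and splitting into positive and negative parts reduces to the previous
  case. The factor c^p matters: in \<open>moment_decay\<close> it carries the decay of the
  semigroup.\<close>

lemma moment_poly:
 fixes n :: nat and p :: real
 assumes p: "0 < p" "p < q"
 obtains C where "0 <= C" "!!s t h c. 0 <= s ==> 0 <= t ==> t <= 1 ==> h \<in> borel_measurable borel ==> 0 < c ==>
  (!!x. abs (h x) <= c * wt n x) ==>
  (nn_integral MM (%w. ennreal (abs (Dm s t h w) powr p))) <= ennreal (C * c powr p * exp (\<alpha> * s))"
proof -
 obtain C where C: "0 <= C" "!!s t h. 0 <= s ==> 0 <= t ==> t <= 1 ==> h \<in> borel_measurable borel ==> (!!x. 0 <= h x) ==>
  (!!x. h x <= wt n x) ==>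
  (nn_integral MM (%w. ennreal (abs (Dm s t h w) powr p))) <= ennreal (C * exp (\<alpha> * s))"
  by (rule moment_nonneg[OF p, of n]) blast
 show ?thesis
 proof (rule that[of "2 powr p * 2 * C"])
  show "0 <= 2 powr p * 2 * C" using C by simp
  fix s t c :: real and h :: "real^'d => real"
  assume s: "0 <= s" and t: "0 <= t" "t <= 1" and h [measurable]: "h \<in> borel_measurable borel" and c: "0 < c"
   and hW: "!!x. abs (h x) <= c * wt n x"
  have ph: "polyP h" by (rule polyPI[OF h hW])
  define hp hm where "hp = (%x. max (h x / c) 0)" and "hm = (%x. max (- (h x / c)) 0)"
  have [measurable]: "hp \<in> borel_measurable borel" "hm \<in> borel_measurable borel" unfolding hp_def hm_def by measurable
  have hpm: "0 <= hp x" "0 <= hm x" "hp x <= wt n x" "hm x <= wt n x" for x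
   using hW[of x] c by (auto simp: hp_def hm_def field_simps abs_le_iff)
  have p12: "polyP hp" "polyP hm" by (rule polyPI[of _ 1 n]; use hpm in auto)+
  have hd: "h = (%x. c * (hp x - hm x))" using c by (auto simp: hp_def hm_def fun_eq_iff max_def)
  have "nn_integral MM (%w. ennreal (abs (Dm s t h w) powr p)) <= nn_integral MM (%w. ennreal (2 powr p * c powr p) * (ennreal (abs (Dm s t hp w) powr p) + ennreal (abs (Dm s t hm w) powr p)))"
  proof (rule nn_integral_mono_AE, use Dm_diff_AE[OF p12 s t(1)] in eventually_elim)
   fix w assume "Dm s t (%x. hp x - hm x) w = Dm s t hp w - Dm s t hm w"
   then have e: "Dm s t h w = c * (Dm s t hp w - Dm s t hm w)"
    by (subst hd) (simp add: Dm_cmult)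
   let ?a = "abs (Dm s t hp w)" and ?b = "abs (Dm s t hm w)"
   have "abs (Dm s t hp w - Dm s t hm w) <= 2 * max ?a ?b" by (simp add: max_def abs_if)
   then have "abs (Dm s t hp w - Dm s t hm w) powr p <= (2 * max ?a ?b) powr p" using p by (intro powr_mono2) auto
   also have "... = 2 powr p * (max ?a ?b) powr p" by (simp add: powr_mult)
   also have "(max ?a ?b) powr p <= ?a powr p + ?b powr p" by (auto simp: max_def)
   finally have "abs (Dm s t h w) powr p <= (2 powr p * c powr p) * (?a powr p + ?b powr p)"
    unfolding e abs_mult using c by (simp add: powr_mult mult_left_mono mult_ac)
   then show "ennreal (abs (Dm s t h w) powr p) <= ennreal (2 powr p * c powr p) * (ennreal (?a powr p) + ennreal (?b powr p))"
    by (simp add: ennreal_mult[symmetric] ennreal_plus[symmetric] ennreal_leI del: ennreal_plus)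
  qed
  also have "... = ennreal (2 powr p * c powr p) * (nn_integral MM (%w. ennreal (abs (Dm s t hp w) powr p)) + nn_integral MM (%w. ennreal (abs (Dm s t hm w) powr p)))"
   using Dm_measurable[of hp s t] Dm_measurable[of hm s t] s t
   by (subst nn_integral_cmult, measurable, subst nn_integral_add) auto
  also have "... <= ennreal (2 powr p * c powr p) * (ennreal (C * exp (\<alpha> * s)) + ennreal (C * exp (\<alpha> * s)))"
   using s t hpm by (intro mult_left_mono add_mono C(2)) auto
  also have "... = ennreal (2 powr p * 2 * C * c powr p * exp (\<alpha> * s))"
   using C(1) by (simp add: ennreal_mult[symmetric] ennreal_plus[symmetric] mult_ac del: ennreal_plus)
  finally show "nn_integral MM (%w. ennreal (abs (Dm s t h w) powr p)) <= ennreal (2 powr p * 2 * C * c powr p * exp (\<alpha> * s))" .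
 qed
qed

end

subsection \<open>Maximal inequality and path regularity\<close>

context super
begin

text \<open>X_t(h) is telescoped along its conditional expectations \<open>a j\<close> at the times
  j dl. A step with remaining time r_j has p-th moment of order exp(p(\<alpha> - l)r_j + \<alpha> j
  dl), so the worst rate is max(\<alpha>/p, \<alpha> - l). The number of steps costs a power of t,
  which the strict inequalities for G absorb.\<close>

lemma moment_decay:
 fixes p l C G :: real and m :: nat
 assumes p: "0 < p" "p < q" and C: "0 <= C" and G: "\<alpha> / p < G" "\<alpha> - l < G"
 obtains K where "0 < K" "!!h t. polyP h ==> (!!t x. 0 <= t ==> abs (ou t h x) <= C * exp (- (l * t)) * wt m x) ==> 0 <= t ==>
  (nn_integral MM (%w. ennreal (abs (LINT x|X t w. h x) powr p))) <= ennreal ((K * exp (G * t)) powr p)"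
proof -
 obtain C1 where C1: "0 <= C1" "!!s t h c. 0 <= s ==> 0 <= t ==> t <= 1 ==> h \<in> borel_measurable borel ==> 0 < c ==>
  (!!x. abs (h x) <= c * wt m x) ==>
  (nn_integral MM (%w. ennreal (abs (Dm s t h w) powr p))) <= ennreal (C1 * c powr p * exp (\<alpha> * s))"
  by (rule moment_poly[OF p, of m]) blast
 define g where "g = max (\<alpha> / p) (\<alpha> - l)"
 have g: "\<alpha> / p <= g" "\<alpha> - l <= g" by (auto simp: g_def)
 have pg: "\<alpha> <= p * g" using g(1) p by (simp add: field_simps)
 define c where "c = C + 1"
 have c: "0 < c" using C by (simp add: c_def)
 define m0 where "m0 = enn2real (nn_integral \<mu> (%x. ennreal (wt m x)))"
 have m0: "(nn_integral \<mu> (%x. ennreal (wt m x))) = ennreal m0" "0 <= m0"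
  unfolding m0_def using \<mu>_mom[of m] by auto
 define B where "B = C1 * c powr p + (c * m0) powr p"
 have B0: "0 <= B" unfolding B_def using C1 by simp
 \<comment> \<open>Chosen so that (t+2)^(p+1) is at most a constant times exp(\<eta>(p+1)t) =
   exp((G-g)pt), the spare exponential factor.\<close>
 define \<eta> where "\<eta> = (G - g) * p / (p + 1)"
 have e: "0 < \<eta>" "\<eta> * (p + 1) = (G - g) * p" using G p by (auto simp: \<eta>_def g_def)
 define K where "K = (B * (2 + 1 / \<eta>) powr (p + 1) + 1) powr (1 / p)"
 have K0: "0 < B * (2 + 1 / \<eta>) powr (p + 1) + 1" using B0 by (intro add_nonneg_pos) auto
 show ?thesis
 proof (rule that[of K])
  show "0 < K" unfolding K_def using K0 by simp
  fix h :: "real^'d => real" and t :: real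
  assume h: "polyP h" and dec: "!!t x. 0 <= t ==> abs (ou t h x) <= C * exp (- (l * t)) * wt m x" and t: "0 <= t"
  have dec': "abs (ou t h x) <= (c * exp (- (l * t))) * wt m x" if "0 <= t" for t x
   by (rule order_trans[OF dec[OF that]]) (auto intro!: mult_right_mono simp: c_def)
  \<comment> \<open>One more than the floor keeps N positive and the step t/N at most 1, as
    \<open>moment_poly\<close> demands.\<close>
  define N where "N = nat \<lfloor>t\<rfloor> + 1"
  have N: "0 < N" "t <= real N" "real N + 1 <= t + 2" using t unfolding N_def by linarith+
  define dl where "dl = t / real N"
  have dl: "0 <= dl" "dl <= 1" "real N * dl = t" using t N by (auto simp: dl_def)
  have jt: "real j * dl <= t" if "j <= N" for j using mult_right_mono[of "real j" "real N" dl] that dl by simp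
  define a where "a = (%j w. exp (\<alpha> * (t - real j * dl)) * (LINT x|X (real j * dl) w. ou (t - real j * dl) h x))"
  define r where "r = (%j. t - real (Suc j) * dl)"
  have r0: "0 <= r j" if "j < N" for j unfolding r_def using jt[of "Suc j"] that by simp
  have step: "a (Suc j) w - a j w = exp (\<alpha> * r j) * Dm (real j * dl) dl (ou (r j) h) w" if j: "j < N" for j w
  proof -
   have e1: "ou dl (ou (r j) h) = ou (t - real j * dl) h"
   proof
    fix x
    show "ou dl (ou (r j) h) x = ou (t - real j * dl) h x"
     using ou_add_time[OF h dl(1) r0[OF j], of x] by (simp add: r_def algebra_simps)
   qed
   have e2: "exp (\<alpha> * r j) * exp (\<alpha> * dl) = exp (\<alpha> * (t - real j * dl))"
    by (simp add: exp_add[symmetric] r_def algebra_simps)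
   have e3: "real j * dl + dl = real (Suc j) * dl" by (simp add: algebra_simps)
   show ?thesis by (simp only: Dm_def e1 e3 right_diff_distrib mult.assoc[symmetric] e2) (simp only: a_def r_def right_diff_distrib mult.assoc[symmetric])
  qed
  have aN: "a N w = (LINT x|X t w. h x)" for w
  proof -
   have "ou 0 h = h" using polyP_measurable[OF h] by (intro ext) simp
   then show ?thesis by (simp add: a_def dl(3))
  qed
  \<comment> \<open>The index N stands for the initial value \<open>a 0\<close>, so that increments
    and initial value form one sum for \<open>powr_sum_le\<close>.\<close>
  define e where "e = (%j w. if j < N then a (Suc j) w - a j w else a 0 w)"
  have tele: "(LINT x|X t w. h x) = (\<Sum>j\<in>{..N}. e j w)" for w
  proof -
   have "(\<Sum>j\<in>{..N}. e j w) = (\<Sum>j<N. e j w) + e N w" by (simp add: lessThan_Suc_atMost[symmetric])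
   also have "(\<Sum>j<N. e j w) = (\<Sum>j<N. a (Suc j) w - a j w)" by (intro sum.cong) (auto simp: e_def)
   also have "... = a N w - a 0 w" by (rule sum_lessThan_telescope)
   finally show ?thesis by (simp add: e_def aN)
  qed
  have am: "a j \<in> borel_measurable MM" if "j <= N" for j
   unfolding a_def using dl polyP_measurable[OF h]
   by (intro borel_measurable_times borel_measurable_const X_int_measurable) auto
  have em: "e j \<in> borel_measurable MM" if "j <= N" for j
    using am[of "Suc j"] am[of j] am[of 0] that unfolding e_def by (cases "j < N") (auto simp: Suc_le_eq)
  have eb: "nn_integral MM (%w. ennreal (abs (e j w) powr p)) <= ennreal (B * exp (p * g * t))" if j: "j <= N" for j
  proof (cases "j < N")
   case True
   have jd: "0 <= real j * dl" using dl by simp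
   have "nn_integral MM (%w. ennreal (abs (e j w) powr p)) = nn_integral MM (%w. ennreal (exp (\<alpha> * r j) powr p) * ennreal (abs (Dm (real j * dl) dl (ou (r j) h) w) powr p))"
    using True by (intro nn_integral_cong) (simp add: e_def step abs_mult powr_mult ennreal_mult[symmetric])
   also have "... = ennreal (exp (\<alpha> * r j) powr p) * nn_integral MM (%w. ennreal (abs (Dm (real j * dl) dl (ou (r j) h) w) powr p))"
    using Dm_measurable[OF ou_measurable[OF polyP_measurable[OF h]] jd dl(1)] by (intro nn_integral_cmult) measurable
   also have "... <= ennreal (exp (\<alpha> * r j) powr p) * ennreal (C1 * (c * exp (- (l * r j))) powr p * exp (\<alpha> * (real j * dl)))"
    using c by (intro mult_left_mono C1(2) jd dl ou_measurable polyP_measurable[OF h] dec' r0 True) auto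
   also have "... = ennreal (exp (\<alpha> * r j) powr p * (C1 * (c * exp (- (l * r j))) powr p * exp (\<alpha> * (real j * dl))))"
    using C1(1) by (intro ennreal_mult[symmetric]) auto
   also have "... <= ennreal (B * exp (p * g * t))"
   proof (rule ennreal_leI)
    have "exp (\<alpha> * r j) powr p * (C1 * (c * exp (- (l * r j))) powr p * exp (\<alpha> * (real j * dl))) = C1 * c powr p * exp (p * (\<alpha> - l) * r j + \<alpha> * (real j * dl))"
     using c by (simp add: powr_mult exp_powr_real exp_add[symmetric] mult_ac) (simp add: exp_add[symmetric] algebra_simps)
    also have "p * (\<alpha> - l) * r j + \<alpha> * (real j * dl) <= p * g * t"
    proof -
     have "p * (\<alpha> - l) * r j <= p * g * r j" using p g r0[OF True] by (intro mult_right_mono mult_left_mono) auto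
     moreover have "\<alpha> * (real j * dl) <= p * g * (real j * dl)" using pg jd by (intro mult_right_mono)
     moreover have "p * g * (real j * dl) <= p * g * (t - r j)"
      using pg \<alpha>_pos dl by (intro mult_left_mono) (auto simp: r_def algebra_simps)
     moreover have "p * g * r j + p * g * (t - r j) = p * g * t" by (simp add: algebra_simps)
     ultimately show ?thesis by linarith
    qed
    finally have "exp (\<alpha> * r j) powr p * (C1 * (c * exp (- (l * r j))) powr p * exp (\<alpha> * (real j * dl))) <= C1 * c powr p * exp (p * g * t)"
     using C1(1) by (simp add: mult_left_mono)
    also have "... <= B * exp (p * g * t)" unfolding B_def by (intro mult_right_mono) auto
    finally show "exp (\<alpha> * r j) powr p * (C1 * (c * exp (- (l * r j))) powr p * exp (\<alpha> * (real j * dl))) <= B * exp (p * g * t)" .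
   qed
   finally show ?thesis .
  next
   case False
   have "nn_integral MM (%w. ennreal (abs (e j w) powr p)) <= nn_integral MM (%w. ennreal (B * exp (p * g * t)))"
   proof (rule nn_integral_mono_AE, use X_0 in eventually_elim)
    fix w assume X0: "X 0 w = \<mu>"
    have "ennreal (abs (LINT x|X 0 w. ou t h x)) <= ennreal (c * exp (- (l * t))) * nn_integral (X 0 w) (%x. ennreal (wt m x))"
     using c by (intro X_int_le(1) ou_measurable polyP_measurable[OF h] dec' t) auto
    also have "... = ennreal (c * exp (- (l * t)) * m0)" unfolding X0 m0(1) using c m0(2) by (simp add: ennreal_mult)
    finally have le: "abs (LINT x|X 0 w. ou t h x) <= c * exp (- (l * t)) * m0"
     using c m0(2) by (subst (asm) ennreal_le_iff) auto
    have "abs (e j w) = exp (\<alpha> * t) * abs (LINT x|X 0 w. ou t h x)" using False by (simp add: e_def a_def abs_mult)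
    also have "... <= exp (\<alpha> * t) * (c * exp (- (l * t)) * m0)" using le by (intro mult_left_mono) auto
    also have "... = c * m0 * exp ((\<alpha> - l) * t)" by (simp add: exp_add[symmetric] exp_diff algebra_simps exp_minus divide_inverse)
    also have "... <= c * m0 * exp (g * t)" using c m0(2) g t by (intro mult_left_mono) (auto intro!: mult_right_mono)
    finally have "abs (e j w) powr p <= (c * m0 * exp (g * t)) powr p" using p by (intro powr_mono2) auto
    also have "... = (c * m0) powr p * exp (p * g * t)" using c m0(2) by (simp add: powr_mult exp_powr_real mult_ac)
    also have "... <= B * exp (p * g * t)" unfolding B_def using C1(1) by (intro mult_right_mono) auto
    finally show "ennreal (abs (e j w) powr p) <= ennreal (B * exp (p * g * t))" by (rule ennreal_leI)
   qed
   then show ?thesis by (simp add: emeasure_space_1)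
  qed
  have "nn_integral MM (%w. ennreal (abs (LINT x|X t w. h x) powr p)) <= nn_integral MM (%w. ennreal ((real N + 1) powr p) * (\<Sum>j\<in>{..N}. ennreal (abs (e j w) powr p)))"
  proof (rule nn_integral_mono)
   fix w
   have "abs (\<Sum>j\<in>{..N}. e j w) powr p <= (\<Sum>j\<in>{..N}. 1) powr p * (\<Sum>j\<in>{..N}. (abs (e j w) / 1) powr p)"
    using p by (intro powr_sum_le) auto
   then have "ennreal (abs (\<Sum>j\<in>{..N}. e j w) powr p) <= ennreal ((real N + 1) powr p * (\<Sum>j\<in>{..N}. abs (e j w) powr p))"
    by (intro ennreal_leI) (simp add: add.commute)
   then show "ennreal (abs (LINT x|X t w. h x) powr p) <= ennreal ((real N + 1) powr p) * (\<Sum>j\<in>{..N}. ennreal (abs (e j w) powr p))"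
    unfolding tele by (simp add: ennreal_mult sum_nonneg sum_ennreal)
  qed
  also have "... = ennreal ((real N + 1) powr p) * (\<Sum>j\<in>{..N}. nn_integral MM (%w. ennreal (abs (e j w) powr p)))"
  proof -
   have m: "(%w. ennreal (abs (e j w) powr p)) \<in> borel_measurable MM" if "j \<in> {..N}" for j using em[of j] that by simp
   show ?thesis by (subst nn_integral_cmult[OF borel_measurable_sum[OF m]], assumption) (simp only: nn_integral_sum[OF m])
  qed
  also have "... <= ennreal ((real N + 1) powr p) * (\<Sum>j\<in>{..N}. ennreal (B * exp (p * g * t)))"
   by (intro mult_left_mono sum_mono eb) auto
  also have "... = ennreal ((real N + 1) powr p * ((real N + 1) * (B * exp (p * g * t))))"
   using B0 by (subst sum_ennreal) (auto simp: ennreal_mult[symmetric] add.commute)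
  also have "... <= ennreal ((K * exp (G * t)) powr p)"
  proof (rule ennreal_leI)
   have "(real N + 1) powr p * (real N + 1) = (real N + 1) powr (p + 1)" by (simp add: powr_add)
   also have "... <= (t + 2) powr (p + 1)" using N p by (intro powr_mono2) auto
   finally have "((real N + 1) powr p * (real N + 1)) * (B * exp (p * g * t)) <= (t + 2) powr (p + 1) * (B * exp (p * g * t))"
    using B0 by (intro mult_right_mono) auto
   also have "... <= ((2 + 1 / \<eta>) * exp (\<eta> * t)) powr (p + 1) * (B * exp (p * g * t))"
   proof -
   have "t + 2 <= (2 + 1 / \<eta>) * exp (\<eta> * t)"
   proof -
    have "1 + \<eta> * t <= exp (\<eta> * t)" by (rule exp_ge_add_one_self)
    moreover have "0 <= \<eta> * t" using e(1) t by simp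
    ultimately have "1 <= exp (\<eta> * t)" "\<eta> * t <= exp (\<eta> * t)" by linarith+
    then have "1 <= exp (\<eta> * t)" "t <= 1 / \<eta> * exp (\<eta> * t)" using e(1) by (auto simp: field_simps)
    then show ?thesis unfolding distrib_right by linarith
   qed
   then show ?thesis using B0 t p by (intro mult_right_mono powr_mono2) auto
   qed
   also have "((2 + 1 / \<eta>) * exp (\<eta> * t)) powr (p + 1) = (2 + 1 / \<eta>) powr (p + 1) * exp ((G - g) * p * t)"
   proof -
    have "\<eta> * t * (p + 1) = (G - g) * p * t" unfolding e(2)[symmetric] by (simp add: mult_ac)
    then show ?thesis using e(1) by (simp add: powr_mult exp_powr_real)
   qed
   also have "(2 + 1 / \<eta>) powr (p + 1) * exp ((G - g) * p * t) * (B * exp (p * g * t)) = B * (2 + 1 / \<eta>) powr (p + 1) * exp (G * t * p)"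
   proof -
    have "exp ((G - g) * p * t) * exp (p * g * t) = exp (G * t * p)" unfolding exp_add[symmetric] by (simp add: algebra_simps)
    then show ?thesis by (metis mult.assoc mult.commute)
   qed
   also have "... <= (B * (2 + 1 / \<eta>) powr (p + 1) + 1) * exp (G * t * p)" by (intro mult_right_mono) auto
   also have "... = (K * exp (G * t)) powr p" unfolding K_def using K0 p by (simp add: powr_mult powr_powr exp_powr_real)
   finally show "(real N + 1) powr p * ((real N + 1) * (B * exp (p * g * t))) <= (K * exp (G * t)) powr p" by (simp only: mult.assoc)
  qed
  finally show "nn_integral MM (%w. ennreal (abs (LINT x|X t w. h x) powr p)) <= ennreal ((K * exp (G * t)) powr p)" .
 qed
qed

text \<open>Decomposition according to the first exceedance time i. On \<open>A i\<close> the sign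
  of Y i splits the event into P and Q, both in \<open>FF (tau i)\<close>, so the martingale
  property replaces Y i by Y N on each of them; the disjoint pieces are then added up.\<close>

lemma doob_finite:
 fixes tau :: "nat => real" and Y :: "nat => 'w => real"
 assumes mono: "!!i j. i <= j ==> j <= N ==> tau i <= tau j"
  and ad: "!!i. i <= N ==> Y i \<in> borel_measurable (FF (tau i))" and int: "!!i. i <= N ==> integrable MM (Y i)"
  and mart: "!!i A. i <= N ==> A \<in> sets (FF (tau i)) ==> (LINT w|MM. indicator A w * Y N w) = (LINT w|MM. indicator A w * Y i w)"
  and c: "0 < c"
 shows "c * prob {w \<in> space MM. \<exists>i\<le>N. c < abs (Y i w)} <= (LINT w|MM. abs (Y N w))"
proof -
 have Ym: "Y j \<in> borel_measurable (FF (tau i))" if "j <= i" "i <= N" for i j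
  using FF_measurable_mono[OF ad mono[OF that]] that by simp
 have YM [measurable]: "Y i \<in> borel_measurable MM" if "i <= N" for i using int[OF that] by auto
 define A where "A = (%i. {w \<in> space MM. c < abs (Y i w) & (\<forall>j<i. abs (Y j w) <= c)})"
 have AF: "A i \<in> sets (FF (tau i))" if i: "i <= N" for i
 proof -
  have [measurable]: "Y j \<in> borel_measurable (FF (tau i))" if "j \<in> {..i}" for j using Ym[of j i] that i by auto
  have "{w \<in> space (FF (tau i)). c < abs (Y i w) & (\<forall>j\<in>{..<i}. abs (Y j w) <= c)} \<in> sets (FF (tau i))"
   by measurable
  then show ?thesis by (simp only: A_def Ball_def lessThan_iff space_FF)
 qed
 have AM: "A i \<in> sets MM" if "i <= N" for i by (rule FF_sub[OF AF[OF that]])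
 have disj: "i = j" if "w \<in> A i" "w \<in> A j" for i j w
  using that unfolding A_def by (cases i j rule: linorder_cases) auto
 have iN: "integrable MM (%w. abs (Y N w))" using int[of N] by simp
 have one: "c * prob (A i) <= (LINT w|MM. indicator (A i) w * abs (Y N w))" if i: "i <= N" for i
 proof -
  define P where "P = A i \<inter> {w \<in> space MM. 0 <= Y i w}"
  define Q where "Q = A i \<inter> {w \<in> space MM. Y i w < 0}"
  have [measurable]: "Y i \<in> borel_measurable (FF (tau i))" using ad[OF i] .
  have "{w \<in> space (FF (tau i)). 0 <= Y i w} \<in> sets (FF (tau i))" "{w \<in> space (FF (tau i)). Y i w < 0} \<in> sets (FF (tau i))" by measurable
  then have PF: "P \<in> sets (FF (tau i))" "Q \<in> sets (FF (tau i))" unfolding P_def Q_def using AF[OF i] by auto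
  have PM [measurable]: "P \<in> sets MM" "Q \<in> sets MM" using FF_sub[OF PF(1)] FF_sub[OF PF(2)] by auto
  have ii: "integrable MM (%w. indicator S w * Y k w)" if "S \<in> sets MM" "k <= N" for S k
   using integrable_mult_indicator[OF that(1) int[OF that(2)]] by simp
  have "c * prob (A i) = (LINT w|MM. indicator (A i) w * c)" using AM[OF i] by simp
  also have "... <= (LINT w|MM. indicator P w * Y i w - indicator Q w * Y i w)"
  proof (rule integral_mono)
   show "integrable MM (%w. indicator (A i) w * c)" using AM[OF i] by (intro integrable_mult_left integrable_real_indicator) (auto simp: less_top[symmetric])
   show "integrable MM (%w. indicator P w * Y i w - indicator Q w * Y i w)" using ii PM i by (intro Bochner_Integration.integrable_diff) auto
   show "indicator (A i) w * c <= indicator P w * Y i w - indicator Q w * Y i w" for w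
    by (auto simp: P_def Q_def A_def split: split_indicator)
  qed
  also have "... = (LINT w|MM. indicator P w * Y N w) - (LINT w|MM. indicator Q w * Y N w)"
   using ii PM i by (simp add: mart[OF i PF(1)] mart[OF i PF(2)])
  also have "... = (LINT w|MM. indicator P w * Y N w - indicator Q w * Y N w)" using ii PM by simp
  also have "... <= (LINT w|MM. indicator (A i) w * abs (Y N w))"
  proof (rule integral_mono)
   show "integrable MM (%w. indicator P w * Y N w - indicator Q w * Y N w)" using ii PM by (intro Bochner_Integration.integrable_diff) auto
   show "integrable MM (%w. indicator (A i) w * abs (Y N w))" using integrable_mult_indicator[OF AM[OF i] iN] by simp
   show "indicator P w * Y N w - indicator Q w * Y N w <= indicator (A i) w * abs (Y N w)" for w
    by (auto simp: P_def Q_def split: split_indicator)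
  qed
  finally show ?thesis .
 qed
 have "{w \<in> space MM. \<exists>i\<le>N. c < abs (Y i w)} \<subseteq> (\<Union>i\<in>{..N}. A i)"
 proof
  fix w assume "w \<in> {w \<in> space MM. \<exists>i\<le>N. c < abs (Y i w)}"
  then obtain i where i: "w \<in> space MM" "i <= N" "c < abs (Y i w)" by auto
  define k where "k = (LEAST k. c < abs (Y k w))"
  have "c < abs (Y k w)" "k <= i" unfolding k_def using i(3) by (auto intro: LeastI Least_le)
  moreover have "abs (Y j w) <= c" if "j < k" for j using not_less_Least[OF that[unfolded k_def]] by simp
  ultimately show "w \<in> (\<Union>i\<in>{..N}. A i)" using i by (auto simp: A_def intro!: bexI[of _ k])
 qed
 then have "prob {w \<in> space MM. \<exists>i\<le>N. c < abs (Y i w)} <= prob (\<Union>i\<in>{..N}. A i)"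
  using AM by (intro finite_measure_mono) auto
 also have "... <= (\<Sum>i\<in>{..N}. prob (A i))" using AM by (intro finite_measure_subadditive_finite) auto
 finally have "c * prob {w \<in> space MM. \<exists>i\<le>N. c < abs (Y i w)} <= (\<Sum>i\<in>{..N}. c * prob (A i))"
  using c by (simp add: sum_distrib_left[symmetric])
 also have "... <= (\<Sum>i\<in>{..N}. (LINT w|MM. indicator (A i) w * abs (Y N w)))" by (intro sum_mono one) auto
 also have "... = (LINT w|MM. (\<Sum>i\<in>{..N}. indicator (A i) w * abs (Y N w)))"
  using integrable_mult_indicator[OF AM iN] by (intro Bochner_Integration.integral_sum[symmetric]) auto
 also have "... <= (LINT w|MM. abs (Y N w))"
 proof (rule integral_mono[OF _ iN])
  show "integrable MM (%w. \<Sum>i\<in>{..N}. indicator (A i) w * abs (Y N w))"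
   using integrable_mult_indicator[OF AM iN] by (intro Bochner_Integration.integrable_sum) auto
  fix w
  have "(\<Sum>i\<in>{..N}. indicator (A i) w :: real) <= 1"
  proof (cases "\<exists>i\<in>{..N}. w \<in> A i")
   case True
   then obtain i where i: "i \<in> {..N}" "w \<in> A i" by auto
   have "(\<Sum>j\<in>{..N}. indicator (A j) w :: real) = (\<Sum>j\<in>{..N}. if j = i then 1 else 0)"
    using i disj by (intro sum.cong) (auto simp: indicator_def)
   then show ?thesis using i by simp
  qed (simp add: indicator_def)
  then show "(\<Sum>i\<in>{..N}. indicator (A i) w * abs (Y N w)) <= abs (Y N w)"
   unfolding sum_distrib_right[symmetric] by (simp add: mult_left_le_one_le sum_nonneg)
 qed
 finally show ?thesis .
qed

text \<open>Dyadic subdivisions of [u, v] with both end points. They are nested in k, so the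
  finite-level exceedance events increase to the event over all dyadic times.\<close>

definition dyad :: "real => real => real set" where
 "dyad u v = {u + (v - u) * (real i / 2 ^ k) | i k. i <= 2 ^ k}"

lemma countable_dyad: "countable (dyad u v)"
proof -
 have "dyad u v \<subseteq> range (%(i, k). u + (v - u) * (real i / 2 ^ k))" by (auto simp: dyad_def)
 then show ?thesis by (rule countable_subset) auto
qed

lemma dyad_bounds:
 assumes "u <= v" "s \<in> dyad u v" shows "u <= s" "s <= v"
proof -
 obtain i :: nat and k where ik: "s = u + (v - u) * (real i / 2 ^ k)" "i <= 2 ^ k" using assms(2) by (auto simp: dyad_def)
 have "real i <= 2 ^ k" using ik(2) by (metis of_nat_le_iff of_nat_numeral of_nat_power)
 then have "0 <= real i / 2 ^ k" "real i / 2 ^ k <= 1" by auto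
 then show "u <= s" "s <= v" using assms(1) mult_left_le[of "real i / 2 ^ k" "v - u"] unfolding ik(1) by auto
qed

text \<open>The points (floor(x 2^k) + 1)/2^k lie strictly to the right of x, as a right limit
  requires, and do not exceed 1 because x < 1.\<close>

lemma dyad_right_limit:
 fixes f :: "real => real"
 assumes s: "u <= s" "s < v" and f: "continuous (at_right s) f" and le: "!!d. d \<in> dyad u v ==> f d <= c"
 shows "f s <= c"
proof -
 define x where "x = (s - u) / (v - u)"
 have x: "0 <= x" "x < 1" using s by (auto simp: x_def)
 have sx: "s = u + (v - u) * x" using s by (simp add: x_def)
 define y where "y = (%k::nat. (real (nat \<lfloor>x * 2 ^ k\<rfloor>) + 1) / 2 ^ k)"
 have y: "x < y k" "y k <= x + inverse (2 ^ k)" "nat \<lfloor>x * 2 ^ k\<rfloor> + 1 <= 2 ^ k" for k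
 proof -
  have x2: "0 <= x * 2 ^ k" using x by simp
  then have fl: "real (nat \<lfloor>x * 2 ^ k\<rfloor>) <= x * 2 ^ k" "x * 2 ^ k < real (nat \<lfloor>x * 2 ^ k\<rfloor>) + 1" by linarith+
  then show "x < y k" "y k <= x + inverse (2 ^ k)" by (auto simp: y_def field_simps)
  have "x * 2 ^ k < 2 ^ k" using x by simp
  then have "real (nat \<lfloor>x * 2 ^ k\<rfloor>) < real (2 ^ k)" using fl(1) unfolding of_nat_power of_nat_numeral by (rule order.strict_trans1[rotated])
  then show "nat \<lfloor>x * 2 ^ k\<rfloor> + 1 <= 2 ^ k" by linarith
 qed
 define d where "d = (%k. u + (v - u) * y k)"
 have dD: "d k \<in> dyad u v" for k
  unfolding dyad_def d_def y_def using y(3)[of k] by (intro CollectI exI[of _ "nat \<lfloor>x * 2 ^ k\<rfloor> + 1"] exI[of _ k]) auto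
 have "(%k. inverse (2 ^ k :: real)) \<longlonglongrightarrow> 0" by (rule LIMSEQ_inverse_realpow_zero) simp
 from tendsto_add[OF tendsto_const this, of x] have lx: "(%k. x + inverse (2 ^ k)) \<longlonglongrightarrow> x" by simp
 have "y \<longlonglongrightarrow> x"
  by (rule tendsto_sandwich[OF always_eventually always_eventually tendsto_const lx]) (simp_all add: y less_imp_le)
 then have "d \<longlonglongrightarrow> u + (v - u) * x" unfolding d_def by (intro tendsto_intros)
 moreover have ds: "s < d k" for k
 proof -
  have "(v - u) * x < (v - u) * y k" using y(1)[of k] s by (intro mult_strict_left_mono) auto
  then show ?thesis using sx unfolding d_def by linarith
 qed
 ultimately have "filterlim d (at_right s) sequentially"
  unfolding filterlim_at sx[symmetric] using ds by (auto intro!: always_eventually)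
 then have "(%k. f (d k)) \<longlonglongrightarrow> f s"
  using f unfolding continuous_within by (rule filterlim_compose[rotated])
 then show ?thesis by (rule LIMSEQ_le_const2) (use le dD in auto)
qed

text \<open>On each dyadic level the drift terms are summed to \<open>Q\<close>, and
  \<open>L\<close> = Y - Q is a martingale. If |Y| exceeds c, then |L| exceeds c/2 or the sum of the
  |D| reaches c/2; the drift enters once through the final value of L and once through Markov's
  inequality, hence 2e(v - u).\<close>

lemma doob_dyadic:
 assumes uv: "0 <= u" "u < v"
  and ad: "!!s. u <= s ==> s <= v ==> Y s \<in> borel_measurable (FF s)" and int: "!!s. u <= s ==> s <= v ==> integrable MM (Y s)"
  and drift: "!!s r. u <= s ==> 0 < r ==> s + r <= v ==> \<exists>D. D \<in> borel_measurable (FF s) & integrable MM D & (LINT w|MM. abs (D w)) <= e * r &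
   (\<forall>A\<in>sets (FF s). (LINT w|MM. indicator A w * Y (s + r) w) = (LINT w|MM. indicator A w * (Y s w + D w)))"
  and c: "0 < c"
 shows "{w \<in> space MM. \<exists>s\<in>dyad u v. c < abs (Y s w)} \<in> sets MM"
  "c / 2 * prob {w \<in> space MM. \<exists>s\<in>dyad u v. c < abs (Y s w)} <= (LINT w|MM. abs (Y v w)) + 2 * e * (v - u)"
proof -
 have uv': "u <= v" using uv by simp
 have YM [measurable]: "Y s \<in> borel_measurable MM" if "s \<in> dyad u v" for s
  using int[OF dyad_bounds[OF uv' that]] by auto
 show meas: "{w \<in> space MM. \<exists>s\<in>dyad u v. c < abs (Y s w)} \<in> sets MM"
  using countable_dyad[of u v] YM by measurable
 define tau where "tau = (%k i. u + (v - u) * (real i / 2 ^ k))"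
 have tauD: "tau k i \<in> dyad u v" if "i <= 2 ^ k" for k i using that by (auto simp: tau_def dyad_def)
 note taub = dyad_bounds[OF uv' tauD]
 have taum: "tau k i <= tau k j" if "i <= j" for k i j using that uv by (auto simp: tau_def intro!: mult_left_mono divide_right_mono)
 define S where "S = (%k. {w \<in> space MM. \<exists>i\<le>2 ^ k. c < abs (Y (tau k i) w)})"
 have Sm: "S k \<in> sets MM" for k
 proof -
  have "{w \<in> space MM. \<exists>i\<in>{..2 ^ k}. c < abs (Y (tau k i) w)} \<in> sets MM"
   using YM[OF tauD] by (intro sets.sets_Collect_finite_Ex) auto
  then show ?thesis by (simp only: S_def Bex_def atMost_iff)
 qed
 have Sk: "c / 2 * prob (S k) <= (LINT w|MM. abs (Y v w)) + 2 * e * (v - u)" for k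
 proof -
  define N :: nat where "N = 2 ^ k"
  define r where "r = (v - u) / 2 ^ k"
  have r: "0 < r" "real N * r = v - u" using uv by (auto simp: r_def N_def)
  have tauv: "tau k N = v" by (simp add: tau_def N_def)
  have tauS: "tau k i + r = tau k (Suc i)" for i by (simp add: tau_def r_def field_simps)
  have b: "u <= tau k i" "tau k i <= v" if "i <= N" for i using taub that unfolding N_def by auto
  have "\<forall>i. \<exists>D. i < N --> D \<in> borel_measurable (FF (tau k i)) & integrable MM D & (LINT w|MM. abs (D w)) <= e * r &
   (\<forall>A\<in>sets (FF (tau k i)). (LINT w|MM. indicator A w * Y (tau k (Suc i)) w) = (LINT w|MM. indicator A w * (Y (tau k i) w + D w)))"
  proof
   fix i show "\<exists>D. i < N --> D \<in> borel_measurable (FF (tau k i)) & integrable MM D & (LINT w|MM. abs (D w)) <= e * r &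
    (\<forall>A\<in>sets (FF (tau k i)). (LINT w|MM. indicator A w * Y (tau k (Suc i)) w) = (LINT w|MM. indicator A w * (Y (tau k i) w + D w)))"
   proof (cases "i < N")
    case True
    then show ?thesis using drift[of "tau k i" r] b[of i] b[of "Suc i"] r by (auto simp: tauS)
   qed simp
  qed
  from choice[OF this] obtain D where D: "!!i. i < N ==> D i \<in> borel_measurable (FF (tau k i))" "!!i. i < N ==> integrable MM (D i)"
   "!!i. i < N ==> (LINT w|MM. abs (D i w)) <= e * r"
   "!!i A. i < N ==> A \<in> sets (FF (tau k i)) ==> (LINT w|MM. indicator A w * Y (tau k (Suc i)) w) = (LINT w|MM. indicator A w * (Y (tau k i) w + D i w))"
   by blast
  define Q where "Q = (%i w. \<Sum>j<i. D j w)"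
  define L where "L = (%i w. Y (tau k i) w - Q i w)"
  have Qi: "integrable MM (Q i)" if "i <= N" for i unfolding Q_def using that D(2) by (intro Bochner_Integration.integrable_sum) auto
  have Yi: "integrable MM (Y (tau k i))" if "i <= N" for i by (rule int[OF b[OF that]])
  have Li: "integrable MM (L i)" if "i <= N" for i unfolding L_def using Qi[OF that] Yi[OF that] by simp
  have ii: "integrable MM (%w. indicator A w * Z w)" if "A \<in> sets MM" "integrable MM Z" for A and Z :: "'w => real"
   using integrable_mult_indicator[OF that] by simp
  have mart: "(LINT w|MM. indicator A w * L n w) = (LINT w|MM. indicator A w * L i w)"
   if "i <= n" "n <= N" "A \<in> sets (FF (tau k i))" for i n A
   using that(1,2)
  proof (induction n rule: dec_induct)
   case (step n)
   have A: "A \<in> sets (FF (tau k n))" using FF_mono[OF taum[OF step(1), of k]] that(3) by auto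
   note AM = FF_sub[OF A]
   have nN: "n < N" "n <= N" using step by auto
   have "(LINT w|MM. indicator A w * L (Suc n) w) = (LINT w|MM. indicator A w * Y (tau k (Suc n)) w - indicator A w * Q (Suc n) w)"
    by (simp add: L_def right_diff_distrib)
   also have "... = (LINT w|MM. indicator A w * Y (tau k (Suc n)) w) - (LINT w|MM. indicator A w * Q (Suc n) w)"
    using step(4) by (intro Bochner_Integration.integral_diff ii AM Yi Qi)
   also have "... = (LINT w|MM. indicator A w * (Y (tau k n) w + D n w)) - (LINT w|MM. indicator A w * Q (Suc n) w)"
    by (simp only: D(4)[OF nN(1) A])
   also have "... = (LINT w|MM. indicator A w * (Y (tau k n) w + D n w) - indicator A w * Q (Suc n) w)"
    using step(4) nN by (intro Bochner_Integration.integral_diff[symmetric] ii AM Bochner_Integration.integrable_add Yi Qi D(2))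
   also have "... = (LINT w|MM. indicator A w * L n w)" by (simp add: L_def Q_def algebra_simps)
   finally show ?case using step by simp
  qed simp
  define P1 where "P1 = {w \<in> space MM. \<exists>i\<le>N. c / 2 < abs (L i w)}"
  define P2 where "P2 = {w \<in> space MM. c / 2 <= (\<Sum>j<N. abs (D j w))}"
  have si: "integrable MM (%w. \<Sum>j<N. abs (D j w))" using D(2) by (intro Bochner_Integration.integrable_sum) auto
  have sb: "(LINT w|MM. (\<Sum>j<N. abs (D j w))) <= e * (v - u)"
  proof -
   have "(LINT w|MM. (\<Sum>j<N. abs (D j w))) = (\<Sum>j<N. (LINT w|MM. abs (D j w)))" using D(2) by (intro Bochner_Integration.integral_sum) auto
   also have "... <= (\<Sum>j<N. e * r)" by (intro sum_mono D(3)) auto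
   also have "... = e * (v - u)" using r(2) by simp
   finally show ?thesis .
  qed
  have "c / 2 * prob P1 <= (LINT w|MM. abs (L N w))" unfolding P1_def
  proof (rule doob_finite[where tau = "tau k"])
   show "L i \<in> borel_measurable (FF (tau k i))" if "i <= N" for i
   proof -
    have "D j \<in> borel_measurable (FF (tau k i))" if "j < i" for j
     using FF_measurable_mono[OF D(1) taum[of j i]] that \<open>i <= N\<close> by auto
    then show ?thesis unfolding L_def Q_def using ad[OF b[OF that]] by (intro borel_measurable_diff borel_measurable_sum) auto
   qed
  qed (use Li mart taum c in auto)
  also have "... <= (LINT w|MM. abs (Y v w) + (\<Sum>j<N. abs (D j w)))"
  proof (rule integral_mono)
   show "integrable MM (%w. abs (L N w))" using Li[of N] by simp
   show "integrable MM (%w. abs (Y v w) + (\<Sum>j<N. abs (D j w)))" using si Yi[of N] by (simp add: tauv)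
   show "abs (L N w) <= abs (Y v w) + (\<Sum>j<N. abs (D j w))" for w
    using abs_triangle_ineq4[of "Y v w" "Q N w"] sum_abs[of "%j. D j w" "{..<N}"] unfolding L_def Q_def tauv by linarith
  qed
  also have "... = (LINT w|MM. abs (Y v w)) + (LINT w|MM. (\<Sum>j<N. abs (D j w)))"
   using Yi[of N] by (intro Bochner_Integration.integral_add si) (simp add: tauv)
  finally have 1: "c / 2 * prob P1 <= (LINT w|MM. abs (Y v w)) + e * (v - u)" using sb by linarith
  have "prob P2 <= (LINT w|MM. (\<Sum>j<N. abs (D j w))) / (c / 2)" unfolding P2_def
   by (rule integral_Markov_inequality_measure[where A="space MM", simplified]) (use si c in \<open>auto intro!: AE_I2 sum_nonneg\<close>)
  then have 2: "c / 2 * prob P2 <= e * (v - u)" using sb c by (simp add: field_simps)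
  have Lm: "L i \<in> borel_measurable MM" if "i <= N" for i using Li[OF that] by auto
  have "{w \<in> space MM. \<exists>i\<in>{..N}. c / 2 < abs (L i w)} \<in> sets MM" using Lm by (intro sets.sets_Collect_finite_Ex) auto
  then have m1: "P1 \<in> sets MM" by (simp only: P1_def Bex_def atMost_iff)
  have m2: "P2 \<in> sets MM" unfolding P2_def using borel_measurable_integrable[OF si] by measurable
  have "S k \<subseteq> P1 \<union> P2"
  proof
   fix w assume "w \<in> S k"
   then obtain i where i: "w \<in> space MM" "i <= N" "c < abs (Y (tau k i) w)" by (auto simp: S_def N_def)
   have "abs (Q i w) <= (\<Sum>j<i. abs (D j w))" unfolding Q_def by (rule sum_abs)
   also have "... <= (\<Sum>j<N. abs (D j w))" using i by (intro sum_mono2) auto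
   finally have "c / 2 < abs (L i w) \<or> c / 2 <= (\<Sum>j<N. abs (D j w))" using i(3) unfolding L_def by linarith
   then show "w \<in> P1 \<union> P2" unfolding P1_def P2_def using i by auto
  qed
  then have "prob (S k) <= prob P1 + prob P2"
   using finite_measure_mono[of "S k" "P1 \<union> P2"] m1 m2 measure_Un_le[OF m1 m2] by auto
  then have "c / 2 * prob (S k) <= c / 2 * (prob P1 + prob P2)" using c by (intro mult_left_mono) auto
  then show ?thesis using 1 2 by (simp add: distrib_left)
 qed
 have inc: "incseq S"
 proof (rule incseq_SucI, rule subsetI)
  fix k w assume "w \<in> S k"
  then obtain i where i: "w \<in> space MM" "i <= 2 ^ k" "c < abs (Y (tau k i) w)" by (auto simp: S_def)
  have "tau k i = tau (Suc k) (2 * i)" by (simp add: tau_def)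
  then show "w \<in> S (Suc k)" using i by (auto simp: S_def intro!: exI[of _ "2 * i"])
 qed
 have un: "(\<Union>k. S k) = {w \<in> space MM. \<exists>s\<in>dyad u v. c < abs (Y s w)}"
  unfolding S_def dyad_def tau_def by blast
 have "(%k. prob (S k)) \<longlonglongrightarrow> prob (\<Union>k. S k)" using Sm inc by (intro finite_Lim_measure_incseq) auto
 then have "(%k. c / 2 * prob (S k)) \<longlonglongrightarrow> c / 2 * prob (\<Union>k. S k)" by (intro tendsto_intros)
 then show "c / 2 * prob {w \<in> space MM. \<exists>s\<in>dyad u v. c < abs (Y s w)} <= (LINT w|MM. abs (Y v w)) + 2 * e * (v - u)"
  unfolding un by (rule LIMSEQ_le_const2) (use Sk in auto)
qed

text \<open>Below the level L one has |y|^r <= L^r, above it |y|^r <= L^(r-p)|y|^p; both contribute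
  at most L^r.\<close>

lemma moment_lower:
 fixes y :: "'w => real" and p r L :: real
 assumes [measurable]: "y \<in> borel_measurable MM" and r: "0 < r" "r <= p" and L: "0 < L"
  and b: "nn_integral MM (%w. ennreal (abs (y w) powr p)) <= ennreal (L powr p)"
 shows "nn_integral MM (%w. ennreal (abs (y w) powr r)) <= ennreal (2 * L powr r)"
proof -
 have pt: "abs (y w) powr r <= L powr r + L powr (r - p) * abs (y w) powr p" for w
 proof (cases "abs (y w) <= L")
  case True
  then have "abs (y w) powr r <= L powr r" using r by (intro powr_mono2) auto
  then show ?thesis by (smt (verit) mult_nonneg_nonneg powr_ge_zero)
 next
  case False
  then have "abs (y w) powr (r - p) <= L powr (r - p)" using r L by (intro powr_mono2') auto
  then have "abs (y w) powr (r - p) * abs (y w) powr p <= L powr (r - p) * abs (y w) powr p" by (rule mult_right_mono) simp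
  moreover have "abs (y w) powr (r - p) * abs (y w) powr p = abs (y w) powr r" by (simp add: powr_add[symmetric])
  ultimately show ?thesis by (smt (verit) powr_ge_zero)
 qed
 have "nn_integral MM (%w. ennreal (abs (y w) powr r)) <= nn_integral MM (%w. ennreal (L powr r) + ennreal (L powr (r - p)) * ennreal (abs (y w) powr p))"
  using pt by (intro nn_integral_mono) (simp add: ennreal_mult[symmetric] ennreal_plus[symmetric] del: ennreal_plus)
 also have "... = ennreal (L powr r) + ennreal (L powr (r - p)) * nn_integral MM (%w. ennreal (abs (y w) powr p))"
  by (subst nn_integral_add) (auto simp: nn_integral_cmult emeasure_space_1)
 also have "... <= ennreal (L powr r) + ennreal (L powr (r - p)) * ennreal (L powr p)" using b by (intro add_left_mono mult_left_mono) auto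
 also have "... = ennreal (2 * L powr r)"
  by (simp add: ennreal_mult[symmetric] ennreal_plus[symmetric] powr_add[symmetric] del: ennreal_plus)
 finally show ?thesis .
qed

lemma L1_le_moment:
 fixes y :: "'w => real" and p L :: real
 assumes y: "integrable MM y" and p: "1 <= p" and L: "0 < L"
  and b: "nn_integral MM (%w. ennreal (abs (y w) powr p)) <= ennreal (L powr p)"
 shows "(LINT w|MM. abs (y w)) <= 2 * L"
proof -
 have "nn_integral MM (%w. ennreal (abs (y w))) = ennreal (LINT w|MM. abs (y w))" using y by (intro nn_integral_eq_integral) auto
 moreover have "nn_integral MM (%w. ennreal (abs (y w) powr 1)) <= ennreal (2 * L powr 1)"
  using y by (intro moment_lower[OF _ _ p L b]) auto
 ultimately show ?thesis using L by (simp add: ennreal_le_iff)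
qed

text \<open>Local boundedness in time of all polynomial moments along a path. It makes truncation
  errors uniform in time, so that right continuity passes from bounded to polynomially growing
  functions.\<close>

definition good :: "'w => bool" where
 "good w \<longleftrightarrow> (\<forall>n N. \<exists>B. \<forall>t. 0 <= t & t < real N --> (nn_integral (X t w) (%x. ennreal (wt n x))) <= ennreal B)"

lemma good_integrable:
 assumes "good w" "polyP h" "0 <= t" shows "integrable (X t w) h"
proof -
 obtain C n where C: "C > 0" "!!x. abs (h x) <= C * wt n x" using assms(2) by (rule polyPE) blast
 obtain N :: nat where "t < real N" using reals_Archimedean2 by blast
 then obtain B where "nn_integral (X t w) (%x. ennreal (wt n x)) <= ennreal B" using assms unfolding good_def by blast
 then have "nn_integral (X t w) (%x. ennreal (wt n x)) < \<infinity>" by (auto intro: order.strict_trans1)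
 then show ?thesis by (rule X_int_le(2)[OF polyP_measurable[OF assms(2)] C(2) less_imp_le[OF C(1)]])
qed

text \<open>The conditional expectation of X_T(W) at time s, exp(\<alpha>(T-s))X_s(P_{T-s}W), is a
  martingale; the maximal inequality bounds it over dyadic times, and \<open>ou_lower\<close>
  recovers X_s(W). Other times are reached by right continuity for the truncations min(W, j),
  followed by monotone convergence in j.\<close>

lemma AE_good: "AE w in MM. good w"
proof -
 have "AE w in MM. \<exists>B. \<forall>t. 0 <= t & t < real N --> (nn_integral (X t w) (%x. ennreal (wt n x))) <= ennreal B" for n N :: nat
 proof -
  \<comment> \<open>The extra unit ensures that every t < N has dyadic times to its right.\<close>
  define T where "T = real N + 1"
  have T: "0 < T" by (simp add: T_def)
  define W where "W = (%x::real^'d. wt n x)"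
  have W: "polyP W" unfolding W_def by (rule polyP_norm_power)
  note Wm [measurable] = polyP_measurable[OF W]
  define Y where "Y = (%s w. exp (\<alpha> * (T - s)) * (LINT x|X s w. ou (T - s) W x))"
  have Yi: "integrable MM (Y s)" if "0 <= s" "s <= T" for s unfolding Y_def using that by (intro integrable_mult_right X_integrable polyP_ou W) auto
  define S where "S = (%k::nat. {w \<in> space MM. \<exists>s\<in>dyad 0 T. real (Suc k) < abs (Y s w)})"
  define E where "E = (LINT w|MM. abs (Y T w))"
  have S: "S k \<in> sets MM & real (Suc k) / 2 * prob (S k) <= E" for k
  proof -
   have dr: "\<exists>D. D \<in> borel_measurable (FF s) & integrable MM D & (LINT w|MM. abs (D w)) <= 0 * r &
    (\<forall>A\<in>sets (FF s). (LINT w|MM. indicator A w * Y (s + r) w) = (LINT w|MM. indicator A w * (Y s w + D w)))"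
    if s: "0 <= s" "0 < r" "s + r <= T" for s r
   proof (intro exI[of _ "%_. 0"] conjI ballI)
    fix A assume A: "A \<in> sets (FF s)"
    have h: "polyP (ou (T - (s + r)) W)" using s by (intro polyP_ou W) auto
    have e: "ou r (ou (T - (s + r)) W) = ou (T - s) W"
    proof
     fix x show "ou r (ou (T - (s + r)) W) x = ou (T - s) W x" using ou_add_time[OF W, of r "T - (s + r)" x] s by simp
    qed
    have "(LINT w|MM. indicator A w * Y (s + r) w) = exp (\<alpha> * (T - (s + r))) * (LINT w|MM. indicator A w * (LINT x|X (s + r) w. ou (T - (s + r)) W x))"
     unfolding Y_def by (subst integral_mult_right_zero[symmetric]) (simp only: mult_ac)
    also have "... = exp (\<alpha> * (T - (s + r))) * exp (\<alpha> * r) * (LINT w|MM. indicator A w * (LINT x|X s w. ou (T - s) W x))"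
     using mean_signed[OF h s(1) less_imp_le[OF s(2)] A] unfolding e by simp
    also have "exp (\<alpha> * (T - (s + r))) * exp (\<alpha> * r) = exp (\<alpha> * (T - s))" unfolding exp_add[symmetric] by (simp add: algebra_simps)
    also have "exp (\<alpha> * (T - s)) * (LINT w|MM. indicator A w * (LINT x|X s w. ou (T - s) W x)) = (LINT w|MM. indicator A w * (Y s w + 0))"
     unfolding Y_def by (subst integral_mult_right_zero[symmetric]) (simp only: mult_ac add_0_right)
    finally show "(LINT w|MM. indicator A w * Y (s + r) w) = (LINT w|MM. indicator A w * (Y s w + 0))" .
   qed auto
   have ad: "Y s \<in> borel_measurable (FF s)" if "0 <= s" "s <= T" for s
    unfolding Y_def using that by (intro borel_measurable_times borel_measurable_const X_adapted ou_measurable Wm) auto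
   show ?thesis using doob_dyadic[of 0 T Y 0 "real (Suc k)", OF order_refl T ad Yi dr] unfolding S_def E_def by auto
  qed
  have "prob (\<Inter>k. S k) <= 2 * E * (1 / real (Suc k))" for k
  proof -
   have "prob (\<Inter>k. S k) <= prob (S k)" using S by (intro finite_measure_mono) auto
   also have "... <= 2 * E * (1 / real (Suc k))" using S[of k] by (simp add: field_simps)
   finally show ?thesis .
  qed
  then have "prob (\<Inter>k. S k) <= 2 * E * 0"
   by (intro LIMSEQ_le_const[OF tendsto_mult_left[OF lim_1_over_n[THEN LIMSEQ_Suc]]]) auto
  then have "prob (\<Inter>k. S k) = 0" by (simp add: measure_le_0_iff)
  then have A1: "AE w in MM. w \<notin> (\<Inter>k. S k)" using S by (subst prob_eq_0[symmetric]) auto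
  have A2: "AE w in MM. \<forall>s\<in>dyad 0 T. (nn_integral (X s w) (%x. ennreal (W x))) < \<infinity>"
   unfolding W_def by (subst AE_ball_countable[OF countable_dyad], intro ballI X_W_AE) (use dyad_bounds[of 0 T] T in auto)
  obtain K where K: "K >= 1" "!!f C t x. f \<in> borel_measurable borel ==> (!!x. abs (f x) <= C * wt n x) ==> 0 <= C ==> t >= 0
    ==> abs (ou t f (x::real^'d)) <= C * K * wt n x" by (rule ou_bound[of n]) blast
  show ?thesis
   using A1 A2 AE_space
  proof eventually_elim
   case (elim w)
   then obtain k where k: "!!s. s \<in> dyad 0 T ==> abs (Y s w) <= real (Suc k)" by (auto simp: S_def not_less)
   \<comment> \<open>The factor 2 exp(bT)^n undoes the loss in \<open>ou_lower\<close>, as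
     exp(-b(T-s)) >= exp(-bT).\<close>
   define B where "B = 2 * exp (b * T) ^ n * real (Suc k)"
   have dB: "integrable (X s w) W" "(LINT x|X s w. W x) <= B" if s: "s \<in> dyad 0 T" for s
   proof -
    have s0: "0 <= s" "s <= T" using dyad_bounds[OF _ s] T by auto
    have fin: "nn_integral (X s w) (%x. ennreal (wt n x)) < \<infinity>" using elim(2) s by (simp add: W_def)
    show iW: "integrable (X s w) W" by (rule X_int_le(2)[OF Wm _ _ fin, of 1]) (auto simp: W_def)
    have iO: "integrable (X s w) (ou (T - s) W)"
     by (rule X_int_le(2)[OF ou_measurable[OF Wm] K(2)[OF Wm, of 1] _ fin]) (use K(1) s0 in \<open>auto simp: W_def\<close>)
    have lo: "W x <= 2 * exp (b * T) ^ n * ou (T - s) W x" for x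
    proof -
     have "1 * W x <= exp (b * s) ^ n * W x" using s0 b_pos by (intro mult_right_mono one_le_power) (auto simp: W_def)
     also have "exp (b * s) ^ n = exp (- b * (T - s)) ^ n * exp (b * T) ^ n"
      unfolding power_mult_distrib[symmetric] exp_add[symmetric] by (simp add: algebra_simps)
     also have "exp (- b * (T - s)) ^ n * exp (b * T) ^ n * W x = 2 * exp (b * T) ^ n * (1/2 * exp (- b * (T - s)) ^ n * W x)" by (simp only: mult_ac)
     also have "... <= 2 * exp (b * T) ^ n * ou (T - s) W x"
      unfolding W_def using s0 by (intro mult_left_mono ou_lower) auto
     finally show ?thesis by simp
    qed
    have o0: "0 <= (LINT x|X s w. ou (T - s) W x)"
     unfolding W_def by (intro integral_nonneg_AE AE_I2, rule order_trans[OF _ ou_lower]) (use s0 in auto)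
    have "(LINT x|X s w. W x) <= 2 * exp (b * T) ^ n * (LINT x|X s w. ou (T - s) W x)"
     unfolding integral_mult_right_zero[symmetric] by (rule integral_mono) (use lo iW iO in auto)
    also have "... <= 2 * exp (b * T) ^ n * abs (Y s w)"
    proof -
     have "1 * (LINT x|X s w. ou (T - s) W x) <= exp (\<alpha> * (T - s)) * (LINT x|X s w. ou (T - s) W x)"
      using o0 s0 \<alpha>_pos by (intro mult_right_mono) auto
     then show ?thesis unfolding Y_def abs_mult using o0 by (intro mult_left_mono) auto
    qed
    also have "... <= B" unfolding B_def using k[OF s] by (intro mult_left_mono) auto
    finally show "(LINT x|X s w. W x) <= B" .
   qed
   have B0: "0 <= B" by (simp add: B_def)
   show ?case
   proof (intro exI[of _ B] allI impI)
    fix t :: real assume t: "0 <= t & t < real N"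
    define g where "g = (%j::nat. %x. min (W x) (real j))"
    have g0: "0 <= g j x" "g j x <= real j" "g j x <= W x" for j x by (auto simp: g_def W_def)
    have gm [measurable]: "g j \<in> borel_measurable borel" for j unfolding g_def by measurable
    have gi: "integrable (X s w) (g j)" for s j
    proof -
     interpret finite_measure "X s w" by (rule X_finite)
     show ?thesis by (rule integrable_const_bound[of _ "real j"]) (use g0 in auto)
    qed
    have gB: "(LINT x|X t w. g j x) <= B" for j
    proof (rule dyad_right_limit[of 0 t T])
     show "continuous (at_right t) (%s. (LINT x|X s w. g j x))"
     proof (rule X_right_cont)
      show "bounded (range (g j))" unfolding bounded_iff using g0 by (intro exI[of _ "real j"]) auto
      show "continuous_on UNIV (g j)" unfolding g_def W_def by (intro continuous_intros)
     qed (use t in auto)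
     show "(LINT x|X d w. g j x) <= B" if "d \<in> dyad 0 T" for d
      using integral_mono[OF gi dB(1)[OF that] g0(3), of j] dB(2)[OF that] by simp
    qed (use t T_def in auto)
    have "nn_integral (X t w) (%x. ennreal (W x)) = nn_integral (X t w) (%x. (SUP j. ennreal (g j x)))"
    proof (intro nn_integral_cong antisym)
     fix x
     obtain j where "W x <= real j" using real_arch_simple by blast
     then have "W x = g j x" by (simp add: g_def)
     then show "ennreal (W x) <= (SUP j. ennreal (g j x))" by (auto intro!: SUP_upper2[of j])
    qed (auto intro!: SUP_least ennreal_leI g0)
    also have "... = (SUP j. nn_integral (X t w) (%x. ennreal (g j x)))"
     by (rule nn_integral_monotone_convergence_SUP) (auto simp: incseq_def le_fun_def g_def intro!: ennreal_leI)
    also have "... <= ennreal B"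
    proof (rule SUP_least)
     fix j
     have "nn_integral (X t w) (%x. ennreal (g j x)) = ennreal (LINT x|X t w. g j x)" using gi g0 by (intro nn_integral_eq_integral) auto
     then show "nn_integral (X t w) (%x. ennreal (g j x)) <= ennreal B" using gB[of j] by (simp add: ennreal_leI)
    qed
    finally show "nn_integral (X t w) (%x. ennreal (wt n x)) <= ennreal B" by (simp add: W_def)
   qed
  qed
 qed
 then show ?thesis unfolding good_def by (simp add: AE_all_countable)
qed

text \<open>f and its truncation \<open>h k\<close> differ only where |f| > k+1, so |f - h_k| <=
  f^2/(k+1). The error is at most C^2 X_s(W_{2n})/(k+1), uniformly in s near t by
  \<open>good\<close>, and the bounded \<open>h k\<close> are covered by the path assumption on
  X.\<close>

lemma good_right_cont:
 fixes f :: "real^'d => real"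
 assumes g: "good w" and f: "polyP f" "continuous_on UNIV f" and t: "0 <= t"
 shows "continuous (at_right t) (%s. (LINT x|X s w. f x))"
proof -
 obtain C n where C: "C > 0" "!!x. abs (f x) <= C * wt n x" using f(1) by (rule polyPE) blast
 obtain N :: nat where N: "t + 1 < real N" using reals_Archimedean2 by blast
 obtain B0 where B0: "!!s. 0 <= s ==> s < real N ==> (nn_integral (X s w) (%x. ennreal (wt (2 * n) x))) <= ennreal B0"
  using g unfolding good_def by blast
 define B where "B = abs B0"
 have B: "0 <= B" "!!s. 0 <= s ==> s < real N ==> (nn_integral (X s w) (%x. ennreal (wt (2 * n) x))) <= ennreal B"
  using order_trans[OF B0 ennreal_leI[of B0 B]] by (auto simp: B_def)
 define h where "h = (%k::nat. %x. max (- real (Suc k)) (min (f x) (real (Suc k))))"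
 have hc: "continuous_on UNIV (h k)" for k unfolding h_def using f(2) by (intro continuous_intros)
 have hm: "h k \<in> borel_measurable borel" for k by (rule borel_measurable_continuous_onI[OF hc])
 have hf: "abs (h k x) <= real (Suc k)" "abs (h k x) <= abs (f x)" for k x by (auto simp: h_def)
 have hp: "polyP (h k)" for k by (rule polyP_bound[OF polyP_abs[OF f(1)] hm hf(2)])
 have dif: "abs (f x - h k x) <= C\<^sup>2 / real (Suc k) * wt (2 * n) x" for k x
 proof -
  have "abs (f x - h k x) * real (Suc k) <= abs (f x) * abs (f x)"
  proof (cases "abs (f x) <= real (Suc k)")
   case True then have "f x - h k x = 0" by (auto simp: h_def)
   then show ?thesis by simp
  next
   case False then show ?thesis by (intro mult_mono) (auto simp: h_def)
  qed
  also have "... <= (C * wt n x) * (C * wt n x)" using C by (intro mult_mono) auto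
  also have "... = C\<^sup>2 * wt (2 * n) x" by (simp only: mult.commute[of 2 n] power_mult power2_eq_square mult_ac)
  finally show ?thesis by (simp add: field_simps)
 qed
 have ap: "abs ((LINT x|X s w. f x) - (LINT x|X s w. h k x)) <= C\<^sup>2 / real (Suc k) * B" if s: "0 <= s" "s < real N" for s k
 proof -
  have "ennreal (abs (LINT x|X s w. f x - h k x)) <= ennreal (C\<^sup>2 / real (Suc k)) * nn_integral (X s w) (%x. ennreal (wt (2 * n) x))"
   using polyP_measurable[OF f(1)] hm by (intro X_int_le(1) dif borel_measurable_diff) auto
  also have "... <= ennreal (C\<^sup>2 / real (Suc k)) * ennreal B" using B(2)[OF s] by (intro mult_left_mono) auto
  also have "... = ennreal (C\<^sup>2 / real (Suc k) * B)" using B(1) by (intro ennreal_mult[symmetric]) auto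
  finally have "abs (LINT x|X s w. f x - h k x) <= C\<^sup>2 / real (Suc k) * B" using B(1) by (subst (asm) ennreal_le_iff) auto
  then show ?thesis using good_integrable[OF g f(1) s(1)] good_integrable[OF g hp s(1)] by simp
 qed
 show ?thesis unfolding continuous_within
 proof (rule tendstoI)
  fix e :: real assume e: "0 < e"
  obtain k :: nat where "C\<^sup>2 * B * 3 / e < real k" using reals_Archimedean2 by blast
  then have k: "C\<^sup>2 / real (Suc k) * B < e / 3" using e by (simp add: field_simps)
  have "bounded (range (h k))" unfolding bounded_iff using hf(1)[of k] by (intro exI[of _ "real (Suc k)"]) auto
  from X_right_cont[OF this hc t, of w] have "((%s. (LINT x|X s w. h k x)) \<longlongrightarrow> (LINT x|X t w. h k x)) (at_right t)"
   unfolding continuous_within .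
  then have "eventually (%s. dist (LINT x|X s w. h k x) (LINT x|X t w. h k x) < e / 3) (at_right t)" using e by (intro tendstoD) auto
  moreover have "eventually (%s. s \<in> {t<..<t+1}) (at_right t)" by (rule eventually_at_right_real) simp
  ultimately show "eventually (%s. dist (LINT x|X s w. f x) (LINT x|X t w. f x) < e) (at_right t)"
  proof eventually_elim
   case (elim s)
   then have "0 <= s" "s < real N" "t < real N" using t N by auto
   then show ?case using ap[of s k] ap[of t k] t k elim(1) unfolding dist_real_def by linarith
  qed
 qed
qed

text \<open>On the n-th unit block the maximal inequality at level exp(-gn) gives a probability of
  order exp((g-h)n); this is summable, and Borel-Cantelli applies.\<close>

lemma dyad_eventually:
 fixes Y :: "nat => real => 'w => real" and e :: "nat => real"
 assumes ad: "!!n s. real n <= s ==> s <= real n + 1 ==> Y n s \<in> borel_measurable (FF s)"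
  and int: "!!n s. real n <= s ==> s <= real n + 1 ==> integrable MM (Y n s)"
  and drift: "!!n s r. real n <= s ==> 0 < r ==> s + r <= real n + 1 ==> \<exists>D. D \<in> borel_measurable (FF s) & integrable MM D & (LINT w|MM. abs (D w)) <= e n * r &
   (\<forall>A\<in>sets (FF s). (LINT w|MM. indicator A w * Y n (s + r) w) = (LINT w|MM. indicator A w * (Y n s w + D w)))"
  and le: "!!n. (LINT w|MM. abs (Y n (real n + 1) w)) + 2 * e n <= K * exp (- (h * real n))" and gh: "g < h"
 shows "AE w in MM. eventually (%n. \<forall>s\<in>dyad (real n) (real n + 1). abs (Y n s w) <= exp (- (g * real n))) sequentially"
proof -
 define S where "S = (%n. {w \<in> space MM. \<exists>s\<in>dyad (real n) (real n + 1). exp (- (g * real n)) < abs (Y n s w)})"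
 have S: "S n \<in> sets MM & exp (- (g * real n)) / 2 * prob (S n) <= K * exp (- (h * real n))" for n
  using doob_dyadic[of "real n" "real n + 1" "Y n" "e n" "exp (- (g * real n))", OF _ _ ad int drift] le[of n] unfolding S_def by auto
 have pb: "prob (S n) <= 2 * K * exp (g - h) ^ n" for n
 proof -
  have "prob (S n) = 2 * exp (g * real n) * (exp (- (g * real n)) / 2 * prob (S n))" by (simp add: exp_minus field_simps)
  also have "... <= 2 * exp (g * real n) * (K * exp (- (h * real n)))" using S[of n] by (intro mult_left_mono) auto
  also have "... = 2 * K * (exp (g * real n) * exp (- (h * real n)))" by (simp only: mult_ac)
  also have "exp (g * real n) * exp (- (h * real n)) = exp (g - h) ^ n" unfolding exp_add[symmetric] exp_of_nat_mult[symmetric] by (simp add: algebra_simps)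
  finally show ?thesis .
 qed
 have sg: "summable (%n. 2 * K * exp (g - h) ^ n)" using gh by (intro summable_mult summable_geometric) auto
 have sm: "summable (%n. prob (S n))"
  by (rule summable_comparison_test'[OF sg, of 0]) (unfold real_norm_def abs_of_nonneg[OF measure_nonneg], rule pb)
 have "AE w in MM. eventually (%n. w \<in> space MM - S n) sequentially"
 proof (rule borel_cantelli_AE1[OF _ _ sm])
  show "S n \<in> sets MM" "emeasure MM (S n) < \<infinity>" for n using S[of n] by (simp_all add: emeasure_eq_measure)
 qed
 then show ?thesis
 proof eventually_elim
  case (elim w)
  then show ?case by eventually_elim (simp add: S_def not_less)
 qed
qed

end

subsection \<open>The limit martingales\<close>

lemma sum_geometric_le: "0 <= (x::real) ==> x < 1 ==> (\<Sum>j<N. x ^ j) <= 1 / (1 - x)"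
 using sum_le_suminf[OF summable_geometric, of x "{..<N}"] suminf_geometric[of x] by auto

lemma filterlim_nat_floor: "filterlim (%t::real. nat \<lfloor>t\<rfloor>) sequentially at_top"
 by (rule filterlim_compose[OF filterlim_nat_sequentially filterlim_floor_sequentially])

lemma exp_decay_nat_floor: "0 < g ==> ((%t::real. exp (- (g * real (nat \<lfloor>t\<rfloor>)))) \<longlongrightarrow> 0) at_top"
proof (rule filterlim_compose[OF _ filterlim_nat_floor])
 assume "0 < g"
 then have "(%n. exp (- g) ^ n) \<longlonglongrightarrow> 0" by (intro LIMSEQ_realpow_zero) auto
 moreover have "exp (- g) ^ n = exp (- (g * real n))" for n unfolding exp_of_nat_mult[symmetric] by (simp add: mult.commute)
 ultimately show "(%n. exp (- (g * real n))) \<longlonglongrightarrow> 0" by simp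
qed

lemma nat_floor_bounds: "0 <= (t::real) ==> real (nat \<lfloor>t\<rfloor>) <= t & t < real (nat \<lfloor>t\<rfloor>) + 1"
 by linarith

lemma convergent_of_increments:
 fixes F :: "real => real"
 assumes g: "0 < g" and ev: "eventually (%n. \<forall>s\<in>{real n..real n + 1}. abs (F s - F (real n)) <= exp (- (g * real n))) sequentially"
 shows "\<exists>L. (F \<longlongrightarrow> L) at_top"
proof -
 obtain n0 where n0: "!!n s. n0 <= n ==> s \<in> {real n..real n + 1} ==> abs (F s - F (real n)) <= exp (- (g * real n))"
  using ev unfolding eventually_sequentially by blast
 have "summable (%n. exp (- g) ^ n)" using g by (intro summable_geometric) auto
 then have "summable (%n. F (real (Suc n)) - F (real n))"
 proof (rule summable_comparison_test'[where N=n0])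
  fix n assume "n0 <= n"
  then have "abs (F (real n + 1) - F (real n)) <= exp (- (g * real n))" by (intro n0) auto
  moreover have "exp (- g) ^ n = exp (- (g * real n))" unfolding exp_of_nat_mult[symmetric] by (simp add: mult.commute)
  ultimately show "norm (F (real (Suc n)) - F (real n)) <= exp (- g) ^ n" by (simp add: add.commute)
 qed
 from summable_LIMSEQ[OF this] obtain S where "(%n. F (real n) - F 0) \<longlonglongrightarrow> S"
  unfolding sum_lessThan_telescope[of "%n. F (real n)"] by auto
 from tendsto_add[OF this tendsto_const, of "F 0"] have "(%n. F (real n)) \<longlonglongrightarrow> S + F 0" by simp
 from filterlim_compose[OF this filterlim_nat_floor] have 1: "((%t::real. F (real (nat \<lfloor>t\<rfloor>))) \<longlongrightarrow> S + F 0) at_top" .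
 have "((%t. F t - F (real (nat \<lfloor>t\<rfloor>))) \<longlongrightarrow> 0) at_top"
 proof (rule Lim_null_comparison[OF _ exp_decay_nat_floor[OF g]])
  show "eventually (%t. norm (F t - F (real (nat \<lfloor>t\<rfloor>))) <= exp (- (g * real (nat \<lfloor>t\<rfloor>)))) at_top"
   using eventually_ge_at_top[of "real n0"]
  proof eventually_elim
   case (elim t)
   then have "n0 <= nat \<lfloor>t\<rfloor>" "0 <= t" by linarith+
   then show ?case using n0[of "nat \<lfloor>t\<rfloor>" t] nat_floor_bounds[of t] by auto
  qed
 qed
 from tendsto_add[OF this 1] show ?thesis by auto
qed

context super
begin

lemma phi_p_continuous:
 fixes i :: "'d => nat" shows "continuous_on UNIV (ph i)"
proof -
 have "continuous_on UNIV (herm n)" for n by (intro continuous_at_imp_continuous_on ballI DERIV_isCont[OF herm_DERIV])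
 then have "continuous_on UNIV (%x::real^'d. herm (i k) (((sqrt b / \<sigma>) *\<^sub>R x) $ k))" for k
  by (rule continuous_on_compose2) (use \<sigma>_pos in \<open>auto intro!: continuous_intros\<close>)
 then show ?thesis unfolding phi_p_def[abs_def] hermite_def hermite1_eq by (intro continuous_intros)
qed

abbreviation "HH \<equiv> Hmart \<sigma> b \<alpha> X"

lemma H_increment:
 assumes "0 <= t" "0 <= r"
 shows "HH i (t + r) w - HH i t w = exp (- (\<alpha> - real (mi_abs i) * b) * (t + r)) * Dm t r (ph i) w"
proof -
 have o: "ou r (ph i) = (%x. exp (- (real (mi_abs i) * b * r)) * ph i x)" using ou_phi_p[OF assms(2)] by blast
 have "exp (- (\<alpha> - real (mi_abs i) * b) * (t + r)) * (exp (\<alpha> * r) * exp (- (real (mi_abs i) * b * r))) = exp (- (\<alpha> - real (mi_abs i) * b) * t)"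
  unfolding exp_add[symmetric] by (simp add: algebra_simps)
 then show ?thesis unfolding Dm_def o Hmart_def integral_mult_right_zero right_diff_distrib by (simp only: mult.assoc[symmetric])
qed

text \<open>The normalisation multiplies the p-th moment, of order exp(\<alpha>t), by
  exp(-p(\<alpha> - |i|b)t). \<open>E\<close> absorbs the change of the normalisation over a step of
  length at most 1.\<close>

lemma H_moment:
 fixes p :: real
 assumes p: "0 < p" "p < q"
 obtains K where "0 < K" "!!t r. 0 <= t ==> 0 <= r ==> r <= 1 ==>
  (nn_integral MM (%w. ennreal (abs (HH i (t + r) w - HH i t w) powr p))) <= ennreal ((K * exp (- ((\<alpha> - real (mi_abs i) * b - \<alpha> / p) * t))) powr p)"
proof -
 define k where "k = real (mi_abs i) * b"
 obtain c n where c: "c > 0" "!!x. abs (ph i x) <= c * (1 + norm (x::real^'d)) ^ n" using polyP_phi_p by (rule polyPE) blast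
 obtain C where C: "0 <= C" "!!s t h c. 0 <= s ==> 0 <= t ==> t <= 1 ==> h \<in> borel_measurable borel ==> 0 < c ==>
  (!!x. abs (h x) <= c * wt n x) ==>
  (nn_integral MM (%w. ennreal (abs (Dm s t h w) powr p))) <= ennreal (C * c powr p * exp (\<alpha> * s))"
  by (rule moment_poly[OF p, of n]) blast
 define E where "E = exp (abs (\<alpha> - k))"
 define Q where "Q = E powr p * (C * c powr p) + 1"
 have Q: "0 < Q" unfolding Q_def using C(1) by (intro add_nonneg_pos) auto
 show ?thesis
 proof (rule that[of "Q powr (1 / p)"])
  show "0 < Q powr (1 / p)" using Q by simp
  fix t r :: real assume t: "0 <= t" "0 <= r" "r <= 1"
  note m [measurable] = Dm_measurable[OF polyP_measurable[OF polyP_phi_p] t(1,2), of i]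
  have e: "exp (- (\<alpha> - k) * (t + r)) <= E * exp (- (\<alpha> - k) * t)"
  proof -
   have "- (\<alpha> - k) * r <= abs (\<alpha> - k) * 1" using t by (intro order_trans[OF mult_right_mono[OF abs_ge_minus_self] mult_left_mono]) auto
   then show ?thesis unfolding E_def exp_add[symmetric] by (simp add: algebra_simps)
  qed
  have "nn_integral MM (%w. ennreal (abs (HH i (t + r) w - HH i t w) powr p))
   <= nn_integral MM (%w. ennreal ((E * exp (- (\<alpha> - k) * t)) powr p) * ennreal (abs (Dm t r (ph i) w) powr p))"
  proof (rule nn_integral_mono)
   fix w
   have "abs (HH i (t + r) w - HH i t w) powr p = (exp (- (\<alpha> - k) * (t + r)) * abs (Dm t r (ph i) w)) powr p"
    unfolding H_increment[OF t(1,2)] abs_mult k_def by simp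
   also have "... <= (E * exp (- (\<alpha> - k) * t) * abs (Dm t r (ph i) w)) powr p" using e p by (intro powr_mono2 mult_right_mono) auto
   also have "... = (E * exp (- (\<alpha> - k) * t)) powr p * abs (Dm t r (ph i) w) powr p" by (rule powr_mult)
   finally show "ennreal (abs (HH i (t + r) w - HH i t w) powr p) <= ennreal ((E * exp (- (\<alpha> - k) * t)) powr p) * ennreal (abs (Dm t r (ph i) w) powr p)"
    unfolding ennreal_mult[OF powr_ge_zero powr_ge_zero, symmetric] by (rule ennreal_leI)
  qed
  also have "... = ennreal ((E * exp (- (\<alpha> - k) * t)) powr p) * nn_integral MM (%w. ennreal (abs (Dm t r (ph i) w) powr p))"
   by (rule nn_integral_cmult) measurable
  also have "... <= ennreal ((E * exp (- (\<alpha> - k) * t)) powr p) * ennreal (C * c powr p * exp (\<alpha> * t))"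
   using c by (intro mult_left_mono C t polyP_measurable[OF polyP_phi_p]) auto
  also have "... = ennreal ((E * exp (- (\<alpha> - k) * t)) powr p * (C * c powr p * exp (\<alpha> * t)))"
   using C(1) by (intro ennreal_mult[symmetric]) auto
  also have "(E * exp (- (\<alpha> - k) * t)) powr p * (C * c powr p * exp (\<alpha> * t)) = E powr p * (C * c powr p) * exp (- ((\<alpha> - k - \<alpha> / p) * t) * p)"
  proof -
   have "exp (- (\<alpha> - k) * t) powr p * exp (\<alpha> * t) = exp (- ((\<alpha> - k - \<alpha> / p) * t) * p)"
    unfolding exp_powr_real exp_add[symmetric] using p by (simp add: field_simps)
   moreover have "(E * exp (- (\<alpha> - k) * t)) powr p = E powr p * exp (- (\<alpha> - k) * t) powr p" by (rule powr_mult)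
   ultimately show ?thesis by (simp only: mult_ac)
  qed
  also have "... <= Q * exp (- ((\<alpha> - k - \<alpha> / p) * t) * p)" unfolding Q_def by (intro mult_right_mono) auto
  also have "... = (Q powr (1 / p) * exp (- ((\<alpha> - k - \<alpha> / p) * t))) powr p"
   using Q p by (simp add: powr_mult powr_powr exp_powr_real)
  finally show "nn_integral MM (%w. ennreal (abs (HH i (t + r) w - HH i t w) powr p)) \<le>
   ennreal ((Q powr (1 / p) * exp (- ((\<alpha> - real (mi_abs i) * b - \<alpha> / p) * t))) powr p)" by (simp add: k_def ennreal_leI)
 qed
qed

lemma H_adapted: "0 <= r ==> r <= s ==> HH i r \<in> borel_measurable (FF s)"
 unfolding Hmart_def[abs_def] by (intro borel_measurable_times borel_measurable_const X_adapted polyP_measurable[OF polyP_phi_p])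

lemma H_integrable: "0 <= s ==> integrable MM (HH i s)"
 unfolding Hmart_def[abs_def] by (intro integrable_mult_right X_integrable polyP_phi_p)

lemma H_martingale:
 assumes "0 <= s" "0 <= r" "A \<in> sets (FF s)"
 shows "(LINT w|MM. indicator A w * HH i (s + r) w) = (LINT w|MM. indicator A w * HH i s w)"
proof -
 have o: "ou r (ph i) = (%x. exp (- (real (mi_abs i) * b * r)) * ph i x)" using ou_phi_p[OF assms(2)] by blast
 have e: "exp (- (\<alpha> - real (mi_abs i) * b) * (s + r)) * (exp (\<alpha> * r) * exp (- (real (mi_abs i) * b * r))) = exp (- (\<alpha> - real (mi_abs i) * b) * s)"
  unfolding exp_add[symmetric] by (simp add: algebra_simps)
 have H: "(LINT w|MM. indicator A w * HH i u w) = exp (- (\<alpha> - real (mi_abs i) * b) * u) * (LINT w|MM. indicator A w * (LINT x|X u w. ph i x))" for u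
  unfolding Hmart_def by (subst integral_mult_right_zero[symmetric]) (simp only: mult_ac)
 have "(LINT w|MM. indicator A w * (LINT x|X (s + r) w. ph i x))
  = exp (\<alpha> * r) * exp (- (real (mi_abs i) * b * r)) * (LINT w|MM. indicator A w * (LINT x|X s w. ph i x))"
  unfolding mean_signed[OF polyP_phi_p assms] o integral_mult_right_zero mult.left_commute[of "indicator A _"] by (simp only: mult.assoc integral_mult_right_zero)
 then show ?thesis unfolding H by (simp only: e[symmetric] mult.assoc)
qed

text \<open>L^1 bounds on the increments over unit blocks enter \<open>dyad_eventually\<close> with
  zero drift, right continuity fills in the remaining times, and summable oscillations force
  convergence. \<open>Hinf\<close> is defined through \<open>Lim\<close>, so only existence has to
  be shown.\<close>

lemma H_tendsto:
 fixes p :: real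
 assumes p: "1 <= p" "p < q" and a: "0 < \<alpha> - real (mi_abs i) * b - \<alpha> / p"
 shows "AE w in MM. (((%t. HH i t w) \<longlongrightarrow> Hinf \<sigma> b \<alpha> X i w) at_top)"
proof -
 define a where "a = \<alpha> - real (mi_abs i) * b - \<alpha> / p"
 have a0: "0 < a" using a by (simp add: a_def)
 have p0: "0 < p" using p by simp
 obtain K where K: "0 < K" "!!t r. 0 <= t ==> 0 <= r ==> r <= 1 ==>
  (nn_integral MM (%w. ennreal (abs (HH i (t + r) w - HH i t w) powr p))) <= ennreal ((K * exp (- (a * t))) powr p)"
  unfolding a_def by (rule H_moment[OF p0 p(2), of i]) blast
 have "AE w in MM. eventually (%n. \<forall>s\<in>dyad (real n) (real n + 1). abs (HH i s w - HH i (real n) w) <= exp (- (a / 2 * real n))) sequentially"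
 proof (rule dyad_eventually[where K = "2 * K" and h = a and e = "%_. 0"])
  fix n :: nat and s r :: real
  assume s: "real n <= s"
  show "(%w. HH i s w - HH i (real n) w) \<in> borel_measurable (FF s)" using s by (intro borel_measurable_diff H_adapted) auto
  show "integrable MM (%w. HH i s w - HH i (real n) w)" using s by (intro Bochner_Integration.integrable_diff H_integrable) auto
  assume r: "0 < r"
  show "\<exists>D. D \<in> borel_measurable (FF s) & integrable MM D & (LINT w|MM. abs (D w)) <= 0 * r &
   (\<forall>A\<in>sets (FF s). (LINT w|MM. indicator A w * (HH i (s + r) w - HH i (real n) w)) = (LINT w|MM. indicator A w * (HH i s w - HH i (real n) w + D w)))"
  proof (intro exI[of _ "%_. 0"] conjI ballI)
   fix A assume A: "A \<in> sets (FF s)"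
   have ii: "integrable MM (%w. indicator A w * HH i u w)" if "0 <= u" for u
    using integrable_mult_indicator[OF FF_sub[OF A] H_integrable[OF that]] by simp
   have "0 <= s" using s by (rule order_trans[rotated]) simp
   then show "(LINT w|MM. indicator A w * (HH i (s + r) w - HH i (real n) w)) = (LINT w|MM. indicator A w * (HH i s w - HH i (real n) w + 0))"
    using H_martingale[OF _ _ A, of r i] r ii by (simp add: right_diff_distrib)
  qed auto
 next
  fix n :: nat
  show "(LINT w|MM. abs (HH i (real n + 1) w - HH i (real n) w)) + 2 * 0 <= 2 * K * exp (- (a * real n))"
   using L1_le_moment[OF _ p(1) _ K(2)[of "real n" 1]] K(1) H_integrable[of "real n + 1" i] H_integrable[of "real n" i] by simp
 qed (use a0 in auto)
 with AE_good show ?thesis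
 proof eventually_elim
  case (elim w)
  have "\<exists>L. ((%t. HH i t w) \<longlongrightarrow> L) at_top"
  proof (rule convergent_of_increments[of "a / 2"])
   show "eventually (%n. \<forall>s\<in>{real n..real n + 1}. abs (HH i s w - HH i (real n) w) <= exp (- (a / 2 * real n))) sequentially"
    using elim(2)
   proof (rule eventually_mono, intro ballI)
    fix n s assume d: "\<forall>s\<in>dyad (real n) (real n + 1). abs (HH i s w - HH i (real n) w) <= exp (- (a / 2 * real n))" and s: "s \<in> {real n..real n + 1}"
    show "abs (HH i s w - HH i (real n) w) <= exp (- (a / 2 * real n))"
    proof (cases "s = real n + 1")
     \<comment> \<open>The right end of the block has no dyadic points of the block to its right,
       but it is itself one of them.\<close>
     case True
     have "real n + 1 \<in> dyad (real n) (real n + 1)" unfolding dyad_def by (intro CollectI exI[of _ 1] exI[of _ 0]) simp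
     then show ?thesis using d True by blast
    next
     case False
     show ?thesis
     proof (rule dyad_right_limit[where f="%s. abs (HH i s w - HH i (real n) w)" and u="real n" and v="real n + 1"])
      show "continuous (at_right s) (%s. abs (HH i s w - HH i (real n) w))" unfolding Hmart_def using s
       by (intro continuous_intros good_right_cont elim(1) polyP_phi_p phi_p_continuous) auto
     qed (use False s d in auto)
    qed
   qed
  qed (use a0 in auto)
  then obtain L where L: "((%t. HH i t w) \<longlongrightarrow> L) at_top" ..
  then have "Hinf \<sigma> b \<alpha> X i w = L" unfolding Hinf_def by (intro tendsto_Lim) auto
  then show ?case using L by simp
 qed
qed

text \<open>The partial sums of the unit increments after time t are bounded in L^p uniformly in N;
  Fatou's lemma along t + N passes the bound to the limit.\<close>

lemma H_Lp:
 fixes p :: real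
 assumes p: "1 <= p" "p < q" and a: "0 < \<alpha> - real (mi_abs i) * b - \<alpha> / p"
 obtains K where "0 < K" "!!t. 0 <= t ==> (nn_integral MM (%w. ennreal (abs (Hinf \<sigma> b \<alpha> X i w - HH i t w) powr p)))
  <= ennreal ((K * exp (- ((\<alpha> - real (mi_abs i) * b - \<alpha> / p) * t))) powr p)"
proof -
 define a where "a = \<alpha> - real (mi_abs i) * b - \<alpha> / p"
 have a0: "0 < a" using a by (simp add: a_def)
 have p0: "0 < p" using p by simp
 obtain K where K: "0 < K" "!!t r. 0 <= t ==> 0 <= r ==> r <= 1 ==>
  (nn_integral MM (%w. ennreal (abs (HH i (t + r) w - HH i t w) powr p))) <= ennreal ((K * exp (- (a * t))) powr p)"
  unfolding a_def by (rule H_moment[OF p0 p(2), of i]) blast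
 \<comment> \<open>Half of the decay exp(-a) per step is spent on the weights x^j; the other half
   leaves the summable series of x^(pj).\<close>
 define x where "x = exp (- a / 2)"
 have x: "0 < x" "x < 1" using a0 by (auto simp: x_def)
 have xp: "0 <= x powr p" "x powr p < 1" using x p0 powr_less_mono2[of p x 1] by auto
 define G1 G2 where "G1 = 1 / (1 - x)" and "G2 = 1 / (1 - x powr p)"
 have G: "0 < G1" "0 < G2" using x xp by (auto simp: G1_def G2_def)
 show ?thesis
 proof (rule that[of "G1 * K * G2 powr (1 / p)"])
  show "0 < G1 * K * G2 powr (1 / p)" using G K by simp
  fix t :: real assume t: "0 <= t"
  define d where "d = (%j w. HH i (t + real j + 1) w - HH i (t + real j) w)"
  have dm [measurable]: "d j \<in> borel_measurable MM" for j
   unfolding d_def using t by (intro borel_measurable_diff borel_measurable_integrable[OF H_integrable]) auto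
  have tel: "HH i (t + real N) w - HH i t w = (\<Sum>j<N. d j w)" for N w
   unfolding d_def using sum_lessThan_telescope[of "%j. HH i (t + real j) w" N] by (simp add: ac_simps)
  have db: "nn_integral MM (%w. ennreal ((abs (d j w) / x ^ j) powr p)) <= ennreal ((K * exp (- (a * t))) powr p * (x powr p) ^ j)" for j
  proof -
   have "nn_integral MM (%w. ennreal ((abs (d j w) / x ^ j) powr p)) = nn_integral MM (%w. ennreal ((1 / x ^ j) powr p) * ennreal (abs (d j w) powr p))"
    using x by (intro nn_integral_cong) (simp add: ennreal_mult[symmetric] powr_mult[symmetric])
   also have "... = ennreal ((1 / x ^ j) powr p) * nn_integral MM (%w. ennreal (abs (d j w) powr p))" by (rule nn_integral_cmult) measurable
   also have "... <= ennreal ((1 / x ^ j) powr p) * ennreal ((K * exp (- (a * (t + real j)))) powr p)"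
    unfolding d_def using t by (intro mult_left_mono K(2)) auto
   also have "... = ennreal ((1 / x ^ j * (K * exp (- (a * (t + real j))))) powr p)"
    unfolding powr_mult[of "1 / x ^ j"] by (rule ennreal_mult[symmetric]) auto
   also have "1 / x ^ j * (K * exp (- (a * (t + real j)))) = K * exp (- (a * t)) * x ^ j"
   proof -
    have xx: "x ^ j = exp (- (a / 2 * real j))" unfolding x_def exp_of_nat_mult[symmetric] by (simp add: mult.commute)
    have "exp (- (a * (t + real j))) = exp (- (a * t)) * x ^ j * x ^ j" unfolding xx exp_add[symmetric] by (simp add: algebra_simps)
    then show ?thesis using x by simp
   qed
   also have "(K * exp (- (a * t)) * x ^ j) powr p = (K * exp (- (a * t))) powr p * (x powr p) ^ j"
   proof -
    have "(x ^ j) powr p = (x powr p) ^ j" by (induction j) (use x in \<open>auto simp: powr_mult\<close>)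
    then show ?thesis using x K(1) by (subst powr_mult) auto
   qed
   finally show ?thesis .
  qed
  have "nn_integral MM (%w. ennreal (abs (Hinf \<sigma> b \<alpha> X i w - HH i t w) powr p)) <= ennreal (G1 powr p * ((K * exp (- (a * t))) powr p * G2))"
  proof (rule nn_integral_Fatou_powr[where f = "%N w. HH i (t + real N) w - HH i t w", OF _ _ p0])
   show "(%w. HH i (t + real N) w - HH i t w) \<in> borel_measurable MM" for N unfolding tel by measurable
   show "AE w in MM. (%N. HH i (t + real N) w - HH i t w) \<longlonglongrightarrow> Hinf \<sigma> b \<alpha> X i w - HH i t w"
    using H_tendsto[OF p a]
   proof eventually_elim
    case (elim w)
    have "filterlim (%N::nat. t + real N) at_top sequentially" by (rule filterlim_tendsto_add_at_top[OF tendsto_const filterlim_real_sequentially])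
    from filterlim_compose[OF elim this] show ?case by (intro tendsto_intros)
   qed
   fix N
   have "nn_integral MM (%w. ennreal (abs (HH i (t + real N) w - HH i t w) powr p)) <= nn_integral MM (%w. ennreal (G1 powr p) * (\<Sum>j<N. ennreal ((abs (d j w) / x ^ j) powr p)))"
   proof (rule nn_integral_mono)
    fix w
    have "abs (\<Sum>j<N. d j w) powr p <= (\<Sum>j<N. x ^ j) powr p * (\<Sum>j<N. (abs (d j w) / x ^ j) powr p)"
     using x p0 by (intro powr_sum_le) auto
    also have "... <= G1 powr p * (\<Sum>j<N. (abs (d j w) / x ^ j) powr p)"
     unfolding G1_def using x p0 by (intro mult_right_mono powr_mono2 sum_geometric_le sum_nonneg) auto
    finally show "ennreal (abs (HH i (t + real N) w - HH i t w) powr p) <= ennreal (G1 powr p) * (\<Sum>j<N. ennreal ((abs (d j w) / x ^ j) powr p))"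
     unfolding tel by (subst sum_ennreal, simp, subst ennreal_mult[symmetric]) (auto intro!: sum_nonneg ennreal_leI)
   qed
   also have "... = ennreal (G1 powr p) * (\<Sum>j<N. nn_integral MM (%w. ennreal ((abs (d j w) / x ^ j) powr p)))"
    by (subst nn_integral_cmult, measurable, subst nn_integral_sum) auto
   also have "... <= ennreal (G1 powr p) * (\<Sum>j<N. ennreal ((K * exp (- (a * t))) powr p * (x powr p) ^ j))"
    by (intro mult_left_mono sum_mono db) auto
   also have "... = ennreal (G1 powr p * ((K * exp (- (a * t))) powr p * (\<Sum>j<N. (x powr p) ^ j)))"
    by (subst sum_ennreal, simp, subst ennreal_mult[symmetric]) (auto intro!: sum_nonneg simp: sum_distrib_left)
   also have "... <= ennreal (G1 powr p * ((K * exp (- (a * t))) powr p * G2))"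
    unfolding G2_def using xp by (intro ennreal_leI mult_left_mono sum_geometric_le) auto
   finally show "nn_integral MM (%w. ennreal (abs (HH i (t + real N) w - HH i t w) powr p)) <= ennreal (G1 powr p * ((K * exp (- (a * t))) powr p * G2))" .
  qed
  also have "G1 powr p * ((K * exp (- (a * t))) powr p * G2) = (G1 * K * G2 powr (1 / p) * exp (- (a * t))) powr p"
   using G K(1) p0 by (simp add: powr_mult powr_powr)
  finally show "nn_integral MM (%w. ennreal (abs (Hinf \<sigma> b \<alpha> X i w - HH i t w) powr p))
  <= ennreal ((G1 * K * G2 powr (1 / p) * exp (- ((\<alpha> - real (mi_abs i) * b - \<alpha> / p) * t))) powr p)" by (simp only: a_def)
 qed
qed

end

subsection \<open>Spectral projections\<close>

lemma finite_mi_le: "finite {i :: 'd::finite => nat. mi_abs i <= k}"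
proof (rule finite_subset)
 show "{i :: 'd => nat. mi_abs i <= k} \<subseteq> PiE UNIV (%_. {..k})"
 proof
  fix i :: "'d => nat" assume "i \<in> {i. mi_abs i <= k}"
  moreover have "i j <= mi_abs i" for j unfolding mi_abs_def by (rule member_le_sum) auto
  ultimately have "i j <= k" for j using order_trans by blast
  then show "i \<in> PiE UNIV (%_. {..k})" by (intro PiE_I) auto
 qed
qed (auto intro!: finite_PiE)

context ou_params
begin

definition proj :: "('d::finite => nat) set => (real^'d => real) => real^'d => real" where
 "proj I f x = (\<Sum>i\<in>I. inner_phi \<sigma> b f (ph i) * ph i x)"

lemma polyP_phi_sum: "polyP (%x. \<Sum>i\<in>I. c i * ph i x)"
 by (intro polyP_sum polyP_mult polyP_const polyP_phi_p)

lemma polyP_resid: "polyP f ==> polyP (%x. f x - proj I f x)"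
 unfolding proj_def by (intro polyP_diff polyP_phi_sum)

lemma ou_diff: "polyP f ==> polyP g ==> ou t (%x. f x - g x) x = ou t f x - ou t g x"
 using gop_diff[of f g] polyP_measurable[of f] polyP_measurable[of g] polyP_measurable[OF polyP_diff[of f g]]
 by (simp add: ou_sg_eq_gop)

lemma ou_phi_sum:
 assumes t: "0 <= t"
 shows "ou t (%x. \<Sum>i\<in>I. c i * ph i x) x = (\<Sum>i\<in>I. c i * exp (- (real (mi_abs i) * b * t)) * ph i x)"
proof -
 have "ou t (%x. \<Sum>i\<in>I. c i * ph i x) x = (\<Sum>i\<in>I. gop (exp (- b * t)) (ou_sd \<sigma> b t) (%x. c i * ph i x) x)"
  unfolding ou_sg_eq_gop[OF polyP_measurable[OF polyP_phi_sum]] by (intro gop_sum polyP_mult polyP_const polyP_phi_p)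
 also have "... = (\<Sum>i\<in>I. c i * ou t (ph i) x)"
  unfolding gop_cmult ou_sg_eq_gop[OF polyP_measurable[OF polyP_phi_p]] ..
 finally show ?thesis unfolding ou_phi_p[OF t] by (simp only: mult.assoc)
qed

lemma inner_phi_resid:
 assumes "polyP f" "finite I"
 shows "inner_phi \<sigma> b (%x. f x - (\<Sum>i\<in>I. c i * ph i x)) (ph j) = inner_phi \<sigma> b f (ph j) - (if j \<in> I then c j else 0)"
proof -
 have "(\<Sum>i\<in>I. c i * (if i = j then 1 else 0)) = (if j \<in> I then c j else 0)" using assms(2) by (simp add: if_distrib sum.delta cong: if_cong)
 then show ?thesis unfolding inner_phi_diff[OF assms(1) polyP_phi_sum] inner_phi_sum[OF polyP_phi_p] inner_phi_orthonormal by simp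
qed

lemma inner_phi_le:
 fixes f :: "real^'d::finite => real"
 assumes f: "polyP f" "!!x. abs (f x) <= c * wt m x"
 shows "abs (inner_phi \<sigma> b f (ph j)) <= c * inner_phi \<sigma> b (%x. wt m x) (%x. abs (ph j x))"
proof -
 let ?w = "%x::real^'d. wt m x" and ?p = "%x::real^'d. abs (ph j x)"
 have pp: "polyP ?p" by (intro polyP_abs polyP_phi_p)
 have pw: "polyP ?w" by (rule polyP_norm_power)
 have i: "integrable stdN (%z. ?w (scl *\<^sub>R z) * ?p (scl *\<^sub>R z))"
  using integrable_polyP[OF polyP_affine[OF polyP_mult[OF pw pp], of 0 scl]] by simp
 have "abs (LINT z|stdN. f (scl *\<^sub>R z) * ph j (scl *\<^sub>R z)) <= (LINT z|stdN. c * (?w (scl *\<^sub>R z) * ?p (scl *\<^sub>R z)))"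
 proof (intro abs_integral_le integrable_mult_right i AE_I2)
  show "abs (f (scl *\<^sub>R z) * ph j (scl *\<^sub>R z)) <= c * (?w (scl *\<^sub>R z) * ?p (scl *\<^sub>R z))" for z
   unfolding abs_mult mult.assoc[symmetric] by (intro mult_right_mono f(2)) simp
 qed
 then show ?thesis
  unfolding inner_phi_eq[OF polyP_measurable[OF f(1)] polyP_measurable[OF polyP_phi_p]] inner_phi_eq[OF polyP_measurable[OF pw] polyP_measurable[OF pp]]
  by simp
qed

lemma dynkin_between:
 assumes f: "twice_diff_P f" "polyP f" and t: "0 <= t1" "t1 <= t2"
 shows "ou t2 f x - ou t1 f x = (LINT s|lborel. indicator {t1..t2} s * ou s (ou_gen \<sigma> b f) x)"
 using dynkin_pos[OF f _ t(2), of x] dynkin[OF f, of t2 x] t ou_0[OF polyP_measurable[OF f(2)]] by (cases "t1 = 0") auto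

text \<open>The projection of the generator part need not be computed: it is recovered from the orthogonality of the increment to all low modes.\<close>

lemma resid_increment_decay:
 fixes f :: "real^'d::finite => real" and k :: nat
 assumes f: "twice_diff_P f" "polyP f"
 defines "I \<equiv> {i :: 'd => nat. mi_abs i <= k}"
 defines "F \<equiv> %x. f x - proj I f x"
 obtains C m where "0 <= C" "!!r t x. 0 < r ==> 0 <= t ==>
  abs (ou t (%x. (1 / r) * (ou r F x - F x)) x) <= C * exp (- (real (Suc k) * b * t)) * wt m x"
proof -
 have fin: "finite I" unfolding I_def by (rule finite_mi_le)
 define g where "g = ou_gen \<sigma> b f"
 have g: "polyP g" unfolding g_def by (rule twice_diff_polyP(3)[OF f(1)])
 define g1 where "g1 = (%x. g x - proj I g x)"
 have g1: "polyP g1" unfolding g1_def by (rule polyP_resid[OF g])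
 have F: "polyP F" unfolding F_def by (rule polyP_resid[OF f(2)])
 have F0: "inner_phi \<sigma> b F (ph j) = 0" if "j \<in> I" for j unfolding F_def proj_def using that fin f(2) by (simp add: inner_phi_resid)
 have "inner_phi \<sigma> b g1 (ph j) = 0" if "mi_abs j < Suc k" for j
  unfolding g1_def proj_def using that fin g by (simp add: inner_phi_resid I_def)
 from ou_decay[OF g1 this, of "Suc k"] obtain C m where C: "0 <= C"
  "!!t x. t >= 0 ==> abs (ou t g1 x) <= C * exp (- (real (Suc k) * b * t)) * wt m x" by blast
 define N where "N = (%j::'d => nat. inner_phi \<sigma> b (%x. wt m x) (%x. abs (ph j x)))"
 have "polyP (%x::real^'d. wt m x + (\<Sum>j\<in>I. N j * abs (ph j x)))"
  by (intro polyP_add polyP_norm_power polyP_sum polyP_mult polyP_const polyP_abs polyP_phi_p)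
 then obtain C2 m2 where C2: "C2 > 0" "!!x::real^'d. abs (wt m x + (\<Sum>j\<in>I. N j * abs (ph j x))) <= C2 * wt m2 x"
  by (rule polyPE) blast
 show ?thesis
 proof (rule that[of "C * C2" m2])
  show "0 <= C * C2" using C C2 by simp
  fix r t :: real and x :: "real^'d" assume rt: "0 < r" "0 <= t"
  define e where "e = C * exp (- (real (Suc k) * b * t))"
  have e0: "0 <= e" unfolding e_def using C by simp
  define h where "h = (%x. (1 / r) * (ou r F x - F x))"
  have pF: "polyP (%x. ou r F x - F x)" using rt F by (intro polyP_diff polyP_ou) auto
  have h: "polyP h" unfolding h_def by (intro polyP_mult polyP_const pF)
  have oF: "ou u F y = ou u f y - (\<Sum>i\<in>I. inner_phi \<sigma> b f (ph i) * exp (- (real (mi_abs i) * b * u)) * ph i y)" if "0 <= u" for u y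
   unfolding F_def proj_def ou_diff[OF f(2) polyP_phi_sum] ou_phi_sum[OF that] ..
  have og: "ou u g y = ou u g1 y + (\<Sum>i\<in>I. inner_phi \<sigma> b g (ph i) * exp (- (real (mi_abs i) * b * u)) * ph i y)" if "0 <= u" for u y
   unfolding g1_def proj_def ou_diff[OF g polyP_phi_sum] ou_phi_sum[OF that] by simp
  have U: "ou t h y = (1 / r) * (ou (t + r) F y - ou t F y)" for y
  proof -
   have "ou t h y = (1 / r) * ou t (%x. ou r F x - F x) y"
    unfolding h_def ou_sg_eq_gop[OF polyP_measurable[OF polyP_mult[OF polyP_const pF]]] ou_sg_eq_gop[OF polyP_measurable[OF pF]] by (rule gop_cmult)
   then show ?thesis using rt F by (simp add: ou_diff polyP_ou ou_add_time)
  qed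
  define G where "G = (%y. (LINT s|lborel. indicator {t..t+r} s * ou s g1 y))"
  define J where "J = (%j::'d => nat. (LINT s|lborel. indicator {t..t+r} s * exp (- (real (mi_abs j) * b * s))))"
  have ib: "integrable lborel (%s. indicator {t..t+r} s * B)" for B :: real
   by (intro integrable_mult_left integrable_real_indicator) (auto simp: emeasure_lborel_Icc_eq)
  have Jint: "integrable lborel (%s. indicator {t..t+r} s * exp (- (real (mi_abs j) * b * s)))" for j :: "'d => nat"
   by (rule Bochner_Integration.integrable_bound[OF ib[of 1]]) (use rt b_pos in \<open>auto split: split_indicator\<close>)
  have Gb: "abs (indicator {t..t+r} s * ou s g1 y) <= indicator {t..t+r} s * (e * wt m y)" for s y
  proof (cases "s \<in> {t..t+r}")
   case True
   have "abs (ou s g1 y) <= C * exp (- (real (Suc k) * b * s)) * wt m y" using True rt by (intro C(2)) auto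
   also have "... <= e * wt m y" unfolding e_def using True b_pos C(1) by (intro mult_right_mono mult_left_mono) auto
   finally show ?thesis using True by simp
  qed simp
  have Gm: "(%s. ou s g1 y) \<in> borel_measurable lborel" for y
   by (rule ou_measurable_pair[where F="%_. g1"]) (use polyP_measurable[OF g1] in measurable)
  have Gint: "integrable lborel (%s. indicator {t..t+r} s * ou s g1 y)" for y
   by (rule Bochner_Integration.integrable_bound[OF ib[of "e * wt m y"]])
    (use Gm[of y] Gb[of _ y] e0 in \<open>auto intro!: AE_I2 borel_measurable_times simp: abs_mult\<close>)
  have GG: "abs ((1 / r) * G y) <= e * wt m y" for y
  proof -
   have "abs (G y) <= (LINT s|lborel. indicator {t..t+r} s * (e * wt m y))" unfolding G_def by (rule abs_integral_le[OF ib]) (use Gb in auto)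
   also have "... = r * (e * wt m y)" using rt by simp
   finally show ?thesis using rt by (simp add: abs_mult field_simps)
  qed
  \<comment> \<open>The coefficients of the low modes that remain in the increment once the
    generator part has been replaced by its residual \<open>g1\<close>.\<close>
  define ka where "ka = (%j. (1 / r) * (inner_phi \<sigma> b g (ph j) * J j
   - inner_phi \<sigma> b f (ph j) * (exp (- (real (mi_abs j) * b * (t + r))) - exp (- (real (mi_abs j) * b * t)))))"
  have dec: "ou t h y = (1 / r) * G y + (\<Sum>j\<in>I. ka j * ph j y)" for y
  proof -
   have "ou (t + r) f y - ou t f y = (LINT s|lborel. indicator {t..t+r} s * ou s g y)"
    unfolding g_def using rt by (intro dynkin_between f) auto
   also have "... = (LINT s|lborel. indicator {t..t+r} s * ou s g1 y + (\<Sum>j\<in>I. inner_phi \<sigma> b g (ph j) * ph j y * (indicator {t..t+r} s * exp (- (real (mi_abs j) * b * s)))))"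
    using rt by (intro Bochner_Integration.integral_cong) (auto simp: og sum_distrib_left mult_ac split: split_indicator)
   also have "... = G y + (\<Sum>j\<in>I. inner_phi \<sigma> b g (ph j) * ph j y * J j)"
    unfolding G_def J_def
    by (subst Bochner_Integration.integral_add, rule Gint, intro Bochner_Integration.integrable_sum integrable_mult_right Jint,
      subst Bochner_Integration.integral_sum, intro integrable_mult_right Jint) simp
   finally have d: "ou (t + r) f y - ou t f y = G y + (\<Sum>j\<in>I. inner_phi \<sigma> b g (ph j) * ph j y * J j)" .
   have "ou (t + r) F y - ou t F y = (ou (t + r) f y - ou t f y) -
    (\<Sum>i\<in>I. inner_phi \<sigma> b f (ph i) * (exp (- (real (mi_abs i) * b * (t + r))) - exp (- (real (mi_abs i) * b * t))) * ph i y)"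
    using rt oF[of "t + r" y] oF[of t y] by (simp add: sum_subtractf algebra_simps)
   moreover have "(\<Sum>j\<in>I. ka j * ph j y) = (1 / r) * ((\<Sum>j\<in>I. inner_phi \<sigma> b g (ph j) * ph j y * J j) -
    (\<Sum>i\<in>I. inner_phi \<sigma> b f (ph i) * (exp (- (real (mi_abs i) * b * (t + r))) - exp (- (real (mi_abs i) * b * t))) * ph i y))"
    unfolding ka_def sum_subtractf[symmetric] sum_distrib_left by (intro sum.cong refl) (simp only: left_diff_distrib right_diff_distrib mult_ac)
   ultimately show ?thesis unfolding U d by (simp only: right_diff_distrib distrib_left)
  qed
  have R: "(%y. (1 / r) * G y) = (%y. ou t h y - (\<Sum>j\<in>I. ka j * ph j y))" using dec by (simp add: fun_eq_iff)
  have pR: "polyP (%y. (1 / r) * G y)" unfolding R using h rt by (intro polyP_diff polyP_ou polyP_phi_sum) auto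
  \<comment> \<open>F, hence h and P_t h, is orthogonal to the modes in \<open>I\<close>, so
    \<open>ka j\<close> is minus the j-th coefficient of (1/r)G and inherits the bound
    \<open>GG\<close>.\<close>
  have kb: "abs (ka j) <= e * N j" if j: "j \<in> I" for j
  proof -
   have "inner_phi \<sigma> b (ou r F) (ph j) = 0" unfolding inner_phi_symmetric_ou[OF F rt(1)] F0[OF j] by simp
   then have "inner_phi \<sigma> b (%x. ou r F x - F x) (ph j) = 0" using rt F0[OF j] by (subst inner_phi_diff) (auto intro!: polyP_ou F)
   moreover have "inner_phi \<sigma> b h (ph j) = (1 / r) * inner_phi \<sigma> b (%x. ou r F x - F x) (ph j)"
    unfolding h_def inner_phi_def integral_mult_right_zero[symmetric] by (simp only: mult.assoc)
   ultimately have h0: "inner_phi \<sigma> b h (ph j) = 0" by simp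
   have "inner_phi \<sigma> b (ou t h) (ph j) = 0"
   proof (cases "t = 0")
    case True
    have "ou 0 h = h" using ou_0[OF polyP_measurable[OF h]] by blast
    then show ?thesis using True h0 by simp
   next
    case False then show ?thesis using inner_phi_symmetric_ou[OF h, of t j] rt h0 by simp
   qed
   then have "inner_phi \<sigma> b (%y. (1 / r) * G y) (ph j) = - ka j"
    unfolding R using inner_phi_resid[OF polyP_ou[OF h rt(2)] fin, of ka j] j by simp
   then show ?thesis using inner_phi_le[OF pR GG, of j] unfolding N_def by simp
  qed
  have "abs (ou t h x) <= abs ((1 / r) * G x) + abs (\<Sum>j\<in>I. ka j * ph j x)" unfolding dec by (rule abs_triangle_ineq)
  also have "... <= e * wt m x + (\<Sum>j\<in>I. e * N j * abs (ph j x))"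
   by (intro add_mono GG order_trans[OF sum_abs] sum_mono) (auto simp: abs_mult intro!: mult_right_mono kb)
  also have "... = e * (wt m x + (\<Sum>j\<in>I. N j * abs (ph j x)))" by (simp add: distrib_left sum_distrib_left mult.assoc)
  also have "... <= e * (C2 * wt m2 x)" using order_trans[OF abs_ge_self C2(2)] e0 by (intro mult_left_mono) auto
  finally show "abs (ou t (%x. (1 / r) * (ou r F x - F x)) x) <= C * C2 * exp (- (real (Suc k) * b * t)) * wt m2 x"
   unfolding e_def h_def by (simp only: mult_ac)
 qed
qed

end

subsection \<open>Convergence\<close>

locale super_mode = super \<sigma> b \<alpha> \<rho> Lev q cpsi Pm X \<mu>
 for \<sigma> b \<alpha> \<rho> Lev q cpsi and Pm :: "(real^'d::finite) measure => 'w measure" and X :: "real => 'w => (real^'d) measure" and \<mu> +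
 fixes f :: "real^'d => real" and k :: nat and p :: real
 assumes f_poly: "polyP f" and f_orth: "!!i. mi_abs i < k ==> inner_phi \<sigma> b f (ph i) = 0"
  and p_range: "1 <= p" "p < q" and gap: "0 < \<alpha> - real k * b - \<alpha> / p"
begin

abbreviation "fc i \<equiv> inner_phi \<sigma> b f (ph i)"
abbreviation "F \<equiv> %x. f x - proj {i. mi_abs i <= k} f x"
abbreviation "modes \<equiv> {i :: 'd => nat. mi_abs i = k}"

text \<open>Half the smaller of the moment gap at level k and the spectral gap b to level k+1;
  halving provides the strict inequalities asked for by \<open>moment_decay\<close>.\<close>

definition rate :: real where "rate = min (\<alpha> - real k * b - \<alpha> / p) b / 2"

lemma rate: "0 < rate" "rate < \<alpha> - real k * b - \<alpha> / p" "rate < b"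
proof -
 have "0 < min x y / 2 & min x y / 2 < x & min x y / 2 < y" if "0 < x" "0 < y" for x y :: real using that by (auto simp: min_def)
 from this[OF gap b_pos] show "0 < rate" "rate < \<alpha> - real k * b - \<alpha> / p" "rate < b" unfolding rate_def by blast+
qed

lemma p_pos: "0 < p" using p_range by simp

lemma finite_modes: "finite modes"
 by (rule finite_subset[OF _ finite_mi_le[of k]]) auto

lemma proj_modes: "proj {i. mi_abs i <= k} f x = (\<Sum>i\<in>modes. fc i * ph i x)"
 unfolding proj_def using finite_mi_le[of k] f_orth by (intro sum.mono_neutral_right) (auto simp: le_less)

lemma F_poly: "polyP F" by (rule polyP_resid[OF f_poly])

lemma F_decay:
 obtains C m where "0 <= C" "!!t x. t >= 0 ==> abs (ou t F x) <= C * exp (- (real (Suc k) * b * t)) * wt m x"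
proof (rule ou_decay[OF F_poly, of "Suc k"])
 show "inner_phi \<sigma> b F (ph i) = 0" if "mi_abs i < Suc k" for i
  unfolding proj_def using that by (simp add: inner_phi_resid[OF f_poly finite_mi_le])
qed blast

lemma moment_resid:
 fixes C :: real and m :: nat
 assumes "0 <= C"
 obtains K where "0 < K" "!!h t. polyP h ==> (!!t x. 0 <= t ==> abs (ou t h x) <= C * exp (- (real (Suc k) * b * t)) * wt m x) ==> 0 <= t ==>
  (nn_integral MM (%w. ennreal (abs (LINT x|X t w. h x) powr p))) <= ennreal ((K * exp ((\<alpha> - real k * b - rate) * t)) powr p)"
proof -
 have "\<alpha> / p < \<alpha> - real k * b - rate" "\<alpha> - real (Suc k) * b < \<alpha> - real k * b - rate" using rate by (auto simp: algebra_simps)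
 from moment_decay[OF p_pos p_range(2) assms this] that show ?thesis by blast
qed

lemma X_split:
 assumes "integrable (X t w) f" "!!i. i \<in> modes ==> integrable (X t w) (ph i)"
 shows "exp (- (\<alpha> - real k * b) * t) * (LINT x|X t w. f x) = exp (- (\<alpha> - real k * b) * t) * (LINT x|X t w. F x) + (\<Sum>i\<in>modes. fc i * HH i t w)"
proof -
 have "(LINT x|X t w. F x) = (LINT x|X t w. f x) - (\<Sum>i\<in>modes. fc i * (LINT x|X t w. ph i x))"
  unfolding proj_modes using assms by (subst Bochner_Integration.integral_diff) (auto intro!: Bochner_Integration.integral_sum)
 moreover have "(\<Sum>i\<in>modes. fc i * HH i t w) = exp (- (\<alpha> - real k * b) * t) * (\<Sum>i\<in>modes. fc i * (LINT x|X t w. ph i x))"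
  unfolding Hmart_def sum_distrib_left by (intro sum.cong refl) auto
 ultimately show ?thesis by (simp only: right_diff_distrib)
qed

lemma mode_tendsto: "i \<in> modes ==> AE w in MM. (((%t. HH i t w) \<longlongrightarrow> Hinf \<sigma> b \<alpha> X i w) at_top)"
 using H_tendsto[OF p_range, of i] gap by simp

lemma exp_decay: "0 < g ==> ((%t::real. exp (- (g * t))) \<longlongrightarrow> 0) at_top"
 by (rule filterlim_compose[OF exp_at_bot]) (simp add: filterlim_uminus_at_bot_at_top filterlim_tendsto_pos_mult_at_top[OF tendsto_const _ filterlim_ident] filterlim_uminus_at_bot)

lemma moment_vanish:
 fixes y :: "real => 'w => real" and r g K :: real
 assumes m: "!!t. 0 <= t ==> y t \<in> borel_measurable MM" and r: "0 < r" "r <= p" and K: "0 < K" and g: "0 < g"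
  and b: "!!t. 0 <= t ==> (nn_integral MM (%w. ennreal (abs (y t w) powr p))) <= ennreal ((K * exp (- (g * t))) powr p)"
 shows "((%t. nn_integral MM (%w. ennreal (abs (y t w) powr r))) \<longlongrightarrow> 0) at_top"
proof (rule tendsto_sandwich[OF always_eventually _ tendsto_const])
 show "eventually (%t. (nn_integral MM (%w. ennreal (abs (y t w) powr r))) <= ennreal (2 * (K * exp (- (g * t))) powr r)) at_top"
  using eventually_ge_at_top[of 0] by eventually_elim (use K in \<open>auto intro!: moment_lower[OF m r _ b]\<close>)
 have "((%t. 2 * (K * exp (- (g * t))) powr r) \<longlongrightarrow> 2 * (K * 0) powr r) at_top"
  using r K by (intro tendsto_mult tendsto_powr' tendsto_const exp_decay[OF g]) (auto intro!: always_eventually)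
 from tendsto_ennrealI[OF this] show "((%t. ennreal (2 * (K * exp (- (g * t))) powr r)) \<longlongrightarrow> 0) at_top" by simp
qed simp

theorem Lp_convergence:
 fixes r :: real
 assumes r: "0 < r" "r <= p"
 shows "((%t. nn_integral MM (%w. ennreal (abs (exp (- (\<alpha> - real k * b) * t) * (LINT x|X t w. f x) - (\<Sum>i\<in>modes. fc i * Hinf \<sigma> b \<alpha> X i w)) powr r))) \<longlongrightarrow> 0) at_top"
proof -
 \<comment> \<open>\<open>Hinf\<close> is a limit along real times and comes without measurability.
   The limit along integers is measurable and agrees with it almost everywhere.\<close>
 define L where "L = (%i w. lim (%n. HH i (real n) w))"
 have Hm [measurable]: "HH i t \<in> borel_measurable MM" if "0 <= t" for i t using H_integrable[OF that, of i] by auto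
 have Lm [measurable]: "L i \<in> borel_measurable MM" for i unfolding L_def by (rule borel_measurable_lim_metric) simp
 have HL: "AE w in MM. Hinf \<sigma> b \<alpha> X i w = L i w" if "i \<in> modes" for i
  using mode_tendsto[OF that]
 proof eventually_elim
  case (elim w)
  from filterlim_compose[OF elim filterlim_real_sequentially] show ?case unfolding L_def by (rule limI[symmetric])
 qed
 \<comment> \<open>\<open>None\<close> stands for the residual F and \<open>Some i\<close> for the
   error of mode i, so that one use of \<open>powr_sum_le\<close> treats all terms.\<close>
 define y where "y = (%j t w. case j of None => exp (- (\<alpha> - real k * b) * t) * (LINT x|X t w. F x) | Some i => HH i t w - L i w)"
 define c where "c = (%j. case j of None => 1 | Some i => fc i)"
 define J where "J = insert None (Some ` modes)"
 have J: "finite J" unfolding J_def using finite_modes by simp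
 have ym: "y j t \<in> borel_measurable MM" if "0 <= t" for j t
  unfolding y_def using that by (cases j) (auto intro!: borel_measurable_times X_int_measurable polyP_measurable[OF F_poly])
 have lim: "((%t. nn_integral MM (%w. ennreal (abs (y j t w) powr r))) \<longlongrightarrow> 0) at_top" if j: "j \<in> J" for j
 proof (cases j)
  case None
  obtain C m where C: "0 <= C" "!!t x. t >= 0 ==> abs (ou t F x) <= C * exp (- (real (Suc k) * b * t)) * wt m x" by (rule F_decay) blast
  obtain K where K: "0 < K" "!!h t. polyP h ==> (!!t x. 0 <= t ==> abs (ou t h x) <= C * exp (- (real (Suc k) * b * t)) * wt m x) ==> 0 <= t ==>
  (nn_integral MM (%w. ennreal (abs (LINT x|X t w. h x) powr p))) <= ennreal ((K * exp ((\<alpha> - real k * b - rate) * t)) powr p)"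
   by (rule moment_resid[OF C(1), of m]) blast
  show ?thesis
  proof (rule moment_vanish[OF ym r K(1) rate(1)])
   fix t :: real assume t: "0 <= t"
   have "nn_integral MM (%w. ennreal (abs (y j t w) powr p)) = nn_integral MM (%w. ennreal (exp (- (\<alpha> - real k * b) * t) powr p) * ennreal (abs (LINT x|X t w. F x) powr p))"
    unfolding None y_def by (intro nn_integral_cong) (simp add: abs_mult powr_mult ennreal_mult)
   also have "... = ennreal (exp (- (\<alpha> - real k * b) * t) powr p) * nn_integral MM (%w. ennreal (abs (LINT x|X t w. F x) powr p))"
    using X_int_measurable[OF polyP_measurable[OF F_poly] t] by (intro nn_integral_cmult) simp
   also have "... <= ennreal (exp (- (\<alpha> - real k * b) * t) powr p) * ennreal ((K * exp ((\<alpha> - real k * b - rate) * t)) powr p)"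
    by (intro mult_left_mono K(2)[OF F_poly C(2) t]) auto
   also have "... = ennreal ((exp (- (\<alpha> - real k * b) * t) * (K * exp ((\<alpha> - real k * b - rate) * t))) powr p)"
    unfolding powr_mult[of "exp _" "_ * _"] by (rule ennreal_mult[symmetric]) auto
   also have "exp (- (\<alpha> - real k * b) * t) * (K * exp ((\<alpha> - real k * b - rate) * t)) = K * exp (- (rate * t))"
    unfolding mult.left_commute[of "exp _" K] exp_add[symmetric] by (simp add: algebra_simps)
   finally show "nn_integral MM (%w. ennreal (abs (y j t w) powr p)) <= ennreal ((K * exp (- (rate * t))) powr p)" .
  qed
 next
  case (Some i)
  then have i: "i \<in> modes" using j by (auto simp: J_def)
  then have ga: "0 < \<alpha> - real (mi_abs i) * b - \<alpha> / p" using gap by simp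
  obtain K where K: "0 < K" "!!t. 0 <= t ==> (nn_integral MM (%w. ennreal (abs (Hinf \<sigma> b \<alpha> X i w - HH i t w) powr p)))
  <= ennreal ((K * exp (- ((\<alpha> - real (mi_abs i) * b - \<alpha> / p) * t))) powr p)" by (rule H_Lp[OF p_range ga]) blast
  show ?thesis
  proof (rule moment_vanish[OF ym r K(1) ga])
   fix t :: real assume t: "0 <= t"
   have "nn_integral MM (%w. ennreal (abs (y j t w) powr p)) = nn_integral MM (%w. ennreal (abs (Hinf \<sigma> b \<alpha> X i w - HH i t w) powr p))"
    by (intro nn_integral_cong_AE, use HL[OF i] in eventually_elim) (simp add: y_def Some abs_minus_commute)
   then show "nn_integral MM (%w. ennreal (abs (y j t w) powr p)) <= ennreal ((K * exp (- ((\<alpha> - real (mi_abs i) * b - \<alpha> / p) * t))) powr p)" using K(2)[OF t] by simp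
  qed
 qed
 define U where "U = (%t. ennreal (real (card J) powr r) * (\<Sum>j\<in>J. ennreal (abs (c j) powr r) * nn_integral MM (%w. ennreal (abs (y j t w) powr r))))"
 have U0: "(U \<longlongrightarrow> 0) at_top"
 proof -
  have "((%t. \<Sum>j\<in>J. ennreal (abs (c j) powr r) * nn_integral MM (%w. ennreal (abs (y j t w) powr r))) \<longlongrightarrow> (\<Sum>j\<in>J. ennreal (abs (c j) powr r) * 0)) at_top"
   by (intro tendsto_sum ennreal_tendsto_cmult lim) auto
  from ennreal_tendsto_cmult[OF _ this, of "ennreal (real (card J) powr r)"] show ?thesis unfolding U_def by simp
 qed
 show ?thesis
 proof (rule tendsto_sandwich[OF always_eventually _ tendsto_const U0])
  show "eventually (%t. (nn_integral MM (%w. ennreal (abs (exp (- (\<alpha> - real k * b) * t) * (LINT x|X t w. f x) - (\<Sum>i\<in>modes. fc i * Hinf \<sigma> b \<alpha> X i w)) powr r))) <= U t) at_top"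
   using eventually_ge_at_top[of 0]
  proof eventually_elim
   fix t :: real assume t: "0 <= t"
   have A1: "AE w in MM. \<forall>i\<in>modes. Hinf \<sigma> b \<alpha> X i w = L i w" by (rule AE_finite_allI[OF finite_modes HL])
   have "nn_integral MM (%w. ennreal (abs (exp (- (\<alpha> - real k * b) * t) * (LINT x|X t w. f x) - (\<Sum>i\<in>modes. fc i * Hinf \<sigma> b \<alpha> X i w)) powr r))
    <= nn_integral MM (%w. ennreal (real (card J) powr r) * (\<Sum>j\<in>J. ennreal (abs (c j) powr r) * ennreal (abs (y j t w) powr r)))"
   proof (rule nn_integral_mono_AE, use A1 AE_good in eventually_elim)
    case (elim w)
    have sp: "exp (- (\<alpha> - real k * b) * t) * (LINT x|X t w. f x) - (\<Sum>i\<in>modes. fc i * Hinf \<sigma> b \<alpha> X i w) = (\<Sum>j\<in>J. c j * y j t w)"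
    proof -
     have "(\<Sum>j\<in>J. c j * y j t w) = exp (- (\<alpha> - real k * b) * t) * (LINT x|X t w. F x) + (\<Sum>i\<in>modes. fc i * (HH i t w - L i w))"
      unfolding J_def using finite_modes by (subst sum.insert) (auto simp: c_def y_def sum.reindex)
     also have "(\<Sum>i\<in>modes. fc i * (HH i t w - L i w)) = (\<Sum>i\<in>modes. fc i * HH i t w) - (\<Sum>i\<in>modes. fc i * Hinf \<sigma> b \<alpha> X i w)"
      unfolding sum_subtractf[symmetric] using elim(1) by (intro sum.cong) (auto simp: right_diff_distrib)
     finally show ?thesis
      using X_split[OF good_integrable[OF elim(2) f_poly t] good_integrable[OF elim(2) polyP_phi_p t]] by simp
    qed
    have "abs (\<Sum>j\<in>J. c j * y j t w) powr r <= (\<Sum>j\<in>J. 1) powr r * (\<Sum>j\<in>J. (abs (c j * y j t w) / 1) powr r)"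
     using r J by (intro powr_sum_le) auto
    then have "ennreal (abs (\<Sum>j\<in>J. c j * y j t w) powr r) <= ennreal (real (card J) powr r * (\<Sum>j\<in>J. abs (c j) powr r * abs (y j t w) powr r))"
     by (intro ennreal_leI) (simp add: abs_mult powr_mult)
    also have "... = ennreal (real (card J) powr r) * (\<Sum>j\<in>J. ennreal (abs (c j) powr r) * ennreal (abs (y j t w) powr r))"
     by (simp add: ennreal_mult[symmetric] sum_nonneg)
    finally show "ennreal (abs (exp (- (\<alpha> - real k * b) * t) * (LINT x|X t w. f x) - (\<Sum>i\<in>modes. fc i * Hinf \<sigma> b \<alpha> X i w)) powr r)
     <= ennreal (real (card J) powr r) * (\<Sum>j\<in>J. ennreal (abs (c j) powr r) * ennreal (abs (y j t w) powr r))" unfolding sp .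
   qed
   also have "... = U t"
   proof -
    have m: "(%w. ennreal (abs (y j t w) powr r)) \<in> borel_measurable MM" for j using ym[OF t, of j] by simp
    have m': "(%w. ennreal (abs (c j) powr r) * ennreal (abs (y j t w) powr r)) \<in> borel_measurable MM" for j by (intro borel_measurable_times_ennreal borel_measurable_const m)
    show ?thesis unfolding U_def by (simp only: nn_integral_cmult[OF borel_measurable_sum[OF m']] nn_integral_sum[OF m'] nn_integral_cmult[OF m])
   qed
   finally show "nn_integral MM (%w. ennreal (abs (exp (- (\<alpha> - real k * b) * t) * (LINT x|X t w. f x) - (\<Sum>i\<in>modes. fc i * Hinf \<sigma> b \<alpha> X i w)) powr r)) <= U t" .
  qed
 qed simp
qed

text \<open>exp(-\<alpha>s)X_s(F) is not a martingale: over a step r its conditional mean moves by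
  exp(-\<alpha>s)X_s(P_r F - F). Smoothness of f makes this O(r) with the decay of level k+1, so the
  dyadic maximal inequality with drift applies.\<close>

theorem AE_convergence:
 assumes f2: "twice_diff_P f"
 shows "AE w in MM. ((%t. exp (- (\<alpha> - real k * b) * t) * (LINT x|X t w. f x)) \<longlongrightarrow> (\<Sum>i\<in>modes. fc i * Hinf \<sigma> b \<alpha> X i w)) at_top"
proof -
 obtain C1 m1 where C1: "0 <= C1" "!!t x. t >= 0 ==> abs (ou t F x) <= C1 * exp (- (real (Suc k) * b * t)) * wt m1 x" by (rule F_decay) blast
 obtain K1 where K1: "0 < K1" "!!h t. polyP h ==> (!!t x. 0 <= t ==> abs (ou t h x) <= C1 * exp (- (real (Suc k) * b * t)) * wt m1 x) ==> 0 <= t ==>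
  (nn_integral MM (%w. ennreal (abs (LINT x|X t w. h x) powr p))) <= ennreal ((K1 * exp ((\<alpha> - real k * b - rate) * t)) powr p)"
  by (rule moment_resid[OF C1(1), of m1]) blast
 obtain C2 m2 where C2: "0 <= C2" "!!r t x. 0 < r ==> 0 <= t ==>
  abs (ou t (%x. (1 / r) * (ou r F x - F x)) x) <= C2 * exp (- (real (Suc k) * b * t)) * wt m2 x"
  by (rule resid_increment_decay[OF f2 f_poly, of k]) blast
 obtain K2 where K2: "0 < K2" "!!h t. polyP h ==> (!!t x. 0 <= t ==> abs (ou t h x) <= C2 * exp (- (real (Suc k) * b * t)) * wt m2 x) ==> 0 <= t ==>
  (nn_integral MM (%w. ennreal (abs (LINT x|X t w. h x) powr p))) <= ennreal ((K2 * exp ((\<alpha> - real k * b - rate) * t)) powr p)"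
  by (rule moment_resid[OF C2(1), of m2]) blast
 \<comment> \<open>By \<open>moment_resid\<close> the L^1 size of exp(-\<alpha>s)X_s(F) is of order
   exp(-hs). The pathwise level with exponent kb + rate/2 used below stays under h and still beats
   the normalisation exp(kbs).\<close>
 define h where "h = real k * b + rate"
 have h0: "0 < h" unfolding h_def using rate b_pos by (intro add_nonneg_pos) auto
 have L1: "exp (- (\<alpha> * s)) * (LINT w|MM. abs (LINT x|X s w. u x)) <= 2 * K * exp (- (h * real n))"
  if "polyP u" "0 < K" "real n <= s" and B: "nn_integral MM (%w. ennreal (abs (LINT x|X s w. u x) powr p)) <= ennreal ((K * exp ((\<alpha> - real k * b - rate) * s)) powr p)" for s K u n
 proof -
  have s: "0 <= s" using that(3) by (rule order_trans[rotated]) simp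
  have "exp (- (\<alpha> * s)) * (LINT w|MM. abs (LINT x|X s w. u x)) <= exp (- (\<alpha> * s)) * (2 * (K * exp ((\<alpha> - real k * b - rate) * s)))"
   using L1_le_moment[OF X_integrable[OF that(1) s] p_range(1) _ B] that(2) by (intro mult_left_mono) auto
  also have "... = 2 * K * (exp (- (\<alpha> * s)) * exp ((\<alpha> - real k * b - rate) * s))" by (simp only: mult_ac)
  also have "exp (- (\<alpha> * s)) * exp ((\<alpha> - real k * b - rate) * s) = exp (- (h * s))"
   unfolding h_def exp_add[symmetric] by (simp add: algebra_simps)
  also have "2 * K * exp (- (h * s)) <= 2 * K * exp (- (h * real n))" using that(2,3) h0 by (intro mult_left_mono) auto
  finally show ?thesis .
 qed
 have Fm: "F \<in> borel_measurable borel" by (rule polyP_measurable[OF F_poly])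
 have "AE w in MM. eventually (%n. \<forall>s\<in>dyad (real n) (real n + 1). abs (exp (- (\<alpha> * s)) * (LINT x|X s w. F x)) <= exp (- ((real k * b + rate / 2) * real n))) sequentially"
 proof (rule dyad_eventually[where K = "2 * K1 + 4 * K2" and h = h and e = "%n. 2 * K2 * exp (- (h * real n))"])
  fix n :: nat and s r :: real
  assume s: "real n <= s"
  have s0: "0 <= s" using s by (rule order_trans[rotated]) simp
  show "(%w. exp (- (\<alpha> * s)) * (LINT x|X s w. F x)) \<in> borel_measurable (FF s)"
   using s0 by (intro borel_measurable_times borel_measurable_const X_adapted Fm) auto
  show "integrable MM (%w. exp (- (\<alpha> * s)) * (LINT x|X s w. F x))" by (intro integrable_mult_right X_integrable F_poly s0)
  assume r: "0 < r"
  \<comment> \<open>Dividing by r gives a function bounded uniformly in r by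
    \<open>resid_increment_decay\<close>; the drift D is r times its contribution and so has an L^1
    norm linear in r.\<close>
  define u where "u = (%x. (1 / r) * (ou r F x - F x))"
  have oF: "polyP (ou r F)" using r by (intro polyP_ou F_poly) auto
  have u: "polyP u" unfolding u_def by (intro polyP_mult polyP_const polyP_diff oF F_poly)
  define D where "D = (%w. r * (exp (- (\<alpha> * s)) * (LINT x|X s w. u x)))"
  show "\<exists>D. D \<in> borel_measurable (FF s) & integrable MM D & (LINT w|MM. abs (D w)) <= 2 * K2 * exp (- (h * real n)) * r &
   (\<forall>A\<in>sets (FF s). (LINT w|MM. indicator A w * (exp (- (\<alpha> * (s + r))) * (LINT x|X (s + r) w. F x)))
    = (LINT w|MM. indicator A w * (exp (- (\<alpha> * s)) * (LINT x|X s w. F x) + D w)))"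
  proof (intro exI[of _ D] conjI ballI)
   show "D \<in> borel_measurable (FF s)" unfolding D_def using s0 by (intro borel_measurable_times borel_measurable_const X_adapted polyP_measurable[OF u]) auto
   show "integrable MM D" unfolding D_def by (intro integrable_mult_right X_integrable u s0)
   have "exp (- (\<alpha> * s)) * (LINT w|MM. abs (LINT x|X s w. u x)) <= 2 * K2 * exp (- (h * real n))"
    by (rule L1[OF u K2(1) s K2(2)[OF u _ s0]]) (unfold u_def, rule C2(2)[OF r])
   from mult_left_mono[OF this, of r] r show "(LINT w|MM. abs (D w)) <= 2 * K2 * exp (- (h * real n)) * r"
    unfolding D_def abs_mult by (simp add: mult_ac)
   fix A assume A: "A \<in> sets (FF s)"
   have "(LINT w|MM. indicator A w * (exp (- (\<alpha> * (s + r))) * (LINT x|X (s + r) w. F x))) = exp (- (\<alpha> * (s + r))) * (LINT w|MM. indicator A w * (LINT x|X (s + r) w. F x))"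
    by (subst integral_mult_right_zero[symmetric]) (simp only: mult_ac)
   also have "... = exp (- (\<alpha> * (s + r))) * exp (\<alpha> * r) * (LINT w|MM. indicator A w * (LINT x|X s w. ou r F x))"
    using mean_signed[OF F_poly s0 less_imp_le[OF r] A] by simp
   also have "exp (- (\<alpha> * (s + r))) * exp (\<alpha> * r) = exp (- (\<alpha> * s))" unfolding exp_add[symmetric] by (simp add: algebra_simps)
   also have "exp (- (\<alpha> * s)) * (LINT w|MM. indicator A w * (LINT x|X s w. ou r F x)) = (LINT w|MM. indicator A w * (exp (- (\<alpha> * s)) * (LINT x|X s w. ou r F x)))"
    by (subst integral_mult_right_zero[symmetric]) (simp only: mult_ac)
   also have "... = (LINT w|MM. indicator A w * (exp (- (\<alpha> * s)) * (LINT x|X s w. F x) + D w))"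
   proof (rule integral_cong_AE)
    note AM [measurable] = FF_sub[OF A]
    note [measurable] = X_int_measurable[OF polyP_measurable[OF oF] s0] X_int_measurable[OF Fm s0] X_int_measurable[OF polyP_measurable[OF u] s0]
    show "(%w. indicator A w * (exp (- (\<alpha> * s)) * (LINT x|X s w. ou r F x))) \<in> borel_measurable MM" by measurable
    show "(%w. indicator A w * (exp (- (\<alpha> * s)) * (LINT x|X s w. F x) + D w)) \<in> borel_measurable MM" unfolding D_def by measurable
    show "AE w in MM. indicator A w * (exp (- (\<alpha> * s)) * (LINT x|X s w. ou r F x)) = indicator A w * (exp (- (\<alpha> * s)) * (LINT x|X s w. F x) + D w)"
     using AE_good
    proof eventually_elim
     case (elim w)
     have "(LINT x|X s w. u x) = (1 / r) * ((LINT x|X s w. ou r F x) - (LINT x|X s w. F x))"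
      unfolding u_def integral_mult_right_zero Bochner_Integration.integral_diff[OF good_integrable[OF elim oF s0] good_integrable[OF elim F_poly s0]] ..
     then have "D w = exp (- (\<alpha> * s)) * ((LINT x|X s w. ou r F x) - (LINT x|X s w. F x))" unfolding D_def using r by simp
     then show ?case by (simp only: right_diff_distrib) simp
    qed
   qed
   finally show "(LINT w|MM. indicator A w * (exp (- (\<alpha> * (s + r))) * (LINT x|X (s + r) w. F x)))
    = (LINT w|MM. indicator A w * (exp (- (\<alpha> * s)) * (LINT x|X s w. F x) + D w))" .
  qed
 next
  fix n :: nat
  have "exp (- (\<alpha> * (real n + 1))) * (LINT w|MM. abs (LINT x|X (real n + 1) w. F x)) <= 2 * K1 * exp (- (h * real n))"
   by (rule L1[OF F_poly K1(1) _ K1(2)[OF F_poly C1(2)]]) auto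
  then show "(LINT w|MM. abs (exp (- (\<alpha> * (real n + 1))) * (LINT x|X (real n + 1) w. F x))) + 2 * (2 * K2 * exp (- (h * real n))) <= (2 * K1 + 4 * K2) * exp (- (h * real n))"
   unfolding abs_mult distrib_right by simp
 next
  show "real k * b + rate / 2 < h" unfolding h_def using rate by simp
 qed
 moreover have "AE w in MM. \<forall>i\<in>modes. ((%t. HH i t w) \<longlongrightarrow> Hinf \<sigma> b \<alpha> X i w) at_top"
  by (rule AE_finite_allI[OF finite_modes mode_tendsto])
 ultimately show ?thesis using AE_good
 proof eventually_elim
  case (elim w)
  have Fc: "continuous_on UNIV F"
  proof -
   have "continuous_on UNIV f" using f2 unfolding twice_diff_P_def
    by (intro continuous_at_imp_continuous_on ballI differentiable_imp_continuous_within) auto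
   then show ?thesis unfolding proj_modes by (intro continuous_intros phi_p_continuous)
  qed
  obtain n0 where n0: "!!n s. n0 <= n ==> s \<in> dyad (real n) (real n + 1) ==> abs (exp (- (\<alpha> * s)) * (LINT x|X s w. F x)) <= exp (- ((real k * b + rate / 2) * real n))"
   using elim(1) unfolding eventually_sequentially by blast
  have "((%t. exp (- (\<alpha> - real k * b) * t) * (LINT x|X t w. F x)) \<longlongrightarrow> 0) at_top"
  proof (rule Lim_null_comparison)
   show "((%t::real. exp (real k * b) * exp (- (rate / 2 * real (nat \<lfloor>t\<rfloor>)))) \<longlongrightarrow> 0) at_top"
    using tendsto_mult[OF tendsto_const exp_decay_nat_floor[of "rate / 2"]] rate by force
   show "eventually (%t. norm (exp (- (\<alpha> - real k * b) * t) * (LINT x|X t w. F x)) <= exp (real k * b) * exp (- (rate / 2 * real (nat \<lfloor>t\<rfloor>)))) at_top"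
    using eventually_ge_at_top[of "real n0"]
   proof eventually_elim
    fix t assume t: "real n0 <= t"
    define n where "n = nat \<lfloor>t\<rfloor>"
    have nn: "n0 <= n" "0 <= t" unfolding n_def using t by linarith+
    have nt: "real n <= t" "t < real n + 1" unfolding n_def using nat_floor_bounds[OF nn(2)] by auto
    have "abs (exp (- (\<alpha> * t)) * (LINT x|X t w. F x)) <= exp (- ((real k * b + rate / 2) * real n))"
    proof (rule dyad_right_limit[where f="%s. abs (exp (- (\<alpha> * s)) * (LINT x|X s w. F x))", OF nt])
     show "continuous (at_right t) (%s. abs (exp (- (\<alpha> * s)) * (LINT x|X s w. F x)))"
      by (intro continuous_intros good_right_cont[OF elim(3) F_poly Fc nn(2)])
    qed (rule n0[OF nn(1)])
    from mult_left_mono[OF this, of "exp (real k * b * t)"]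
    have "exp (real k * b * t) * abs (exp (- (\<alpha> * t)) * (LINT x|X t w. F x)) <= exp (real k * b * t) * exp (- ((real k * b + rate / 2) * real n))" by simp
    \<comment> \<open>As t < n + 1, replacing t by n in the normalisation costs at most the constant
      exp(kb).\<close>
    also have "... <= exp (real k * b * (real n + 1)) * exp (- ((real k * b + rate / 2) * real n))"
     using nt b_pos by (intro mult_right_mono) (auto intro!: mult_left_mono)
    also have "... = exp (real k * b) * exp (- (rate / 2 * real n))" unfolding exp_add[symmetric] by (simp add: algebra_simps)
    finally have le: "exp (real k * b * t) * abs (exp (- (\<alpha> * t)) * (LINT x|X t w. F x)) <= exp (real k * b) * exp (- (rate / 2 * real n))" .
    have "exp (- (\<alpha> - real k * b) * t) = exp (real k * b * t) * exp (- (\<alpha> * t))" unfolding exp_add[symmetric] by (simp add: algebra_simps)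
    then show "norm (exp (- (\<alpha> - real k * b) * t) * (LINT x|X t w. F x)) <= exp (real k * b) * exp (- (rate / 2 * real (nat \<lfloor>t\<rfloor>)))"
     using le unfolding n_def real_norm_def abs_mult by (simp add: mult.assoc)
   qed
  qed
  then have "((%t. exp (- (\<alpha> - real k * b) * t) * (LINT x|X t w. F x) + (\<Sum>i\<in>modes. fc i * HH i t w)) \<longlongrightarrow> 0 + (\<Sum>i\<in>modes. fc i * Hinf \<sigma> b \<alpha> X i w)) at_top"
   using elim(2) by (intro tendsto_add tendsto_sum tendsto_mult tendsto_const) auto
  then show ?case unfolding add_0_left
  proof (rule Lim_transform_eventually)
   show "eventually (%t. exp (- (\<alpha> - real k * b) * t) * (LINT x|X t w. F x) + (\<Sum>i\<in>modes. fc i * HH i t w) = exp (- (\<alpha> - real k * b) * t) * (LINT x|X t w. f x)) at_top"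
    using eventually_ge_at_top[of 0]
    by eventually_elim (rule X_split[OF good_integrable[OF elim(3) f_poly] good_integrable[OF elim(3) polyP_phi_p], symmetric])
  qed
 qed
qed

end

theorem theorem1p3:
  fixes \<sigma> b \<alpha> \<rho> \<eta> \<beta> \<delta> :: real
    and Lev :: "real measure"
    and Pm :: "(real^'d::finite) measure \<Rightarrow> 'w measure"
    and X :: "real \<Rightarrow> 'w \<Rightarrow> (real^'d) measure"
    and \<mu> :: "(real^'d) measure"
    and f :: "real^'d \<Rightarrow> real"
    and k :: nat
  assumes \<sigma>: "\<sigma> > 0" and b: "b > 0" and \<alpha>: "\<alpha> > 0" and \<rho>: "\<rho> \<ge> 0"
    and Pi_sets: "sets Lev = sets borel"
    and Pi_int: "(\<integral>\<^sup>+ y. ennreal (min y (y\<^sup>2)) * indicator {0<..} y \<partial>Lev) < \<infinity>"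
    and Grey: "\<exists>z'>0. (\<forall>z>z'. psi \<alpha> \<rho> Lev z > 0) \<and>
                 (\<integral>\<^sup>+ z. ennreal (1 / psi \<alpha> \<rho> Lev z) * indicator {z'<..} z \<partial>lborel) < \<infinity>"
    and \<eta>: "\<eta> > 0" and \<beta>: "0 < \<beta>" "\<beta> < 1" and \<delta>: "\<delta> > 0"
    and stable: "tv_wint (\<lambda>y. y powr (1 + \<beta> + \<delta>)) Lev
                   (density lborel (\<lambda>y. ennreal (\<eta> / (Gamma (-1 - \<beta>) * y powr (2 + \<beta>))))) {1<..} < \<infinity>"
    and X: "superOU \<sigma> b \<alpha> \<rho> Lev Pm X"
    and \<mu>: "fin_borel_measure \<mu>" "\<exists>K. compact K \<and> emeasure \<mu> (- K) = 0"
    and f: "polyP f"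
    and kf: "kappa \<sigma> b f = enat k"
    and cond: "\<alpha> * (\<beta> / (1 + \<beta>)) > real k * b"
  shows "(\<forall>\<gamma>. 0 < \<gamma> \<and> \<gamma> < \<beta> \<longrightarrow>
           ((\<lambda>t. \<integral>\<^sup>+ \<omega>. ennreal (\<bar>exp (- (\<alpha> - real k * b) * t) * (\<integral>x. f x \<partial>(X t \<omega>))
                 - (\<Sum>p\<in>{p::'d \<Rightarrow> nat. mi_abs p = k}. inner_phi \<sigma> b f (phi_p \<sigma> b p) * Hinf \<sigma> b \<alpha> X p \<omega>)\<bar>
                 powr (1 + \<gamma>)) \<partial>(Pm \<mu>)) \<longlongrightarrow> 0) at_top)
       \<and> (twice_diff_P f \<longrightarrow>
           (AE \<omega> in Pm \<mu>. ((\<lambda>t. exp (- (\<alpha> - real k * b) * t) * (\<integral>x. f x \<partial>(X t \<omega>)))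
              \<longlongrightarrow> (\<Sum>p\<in>{p::'d \<Rightarrow> nat. mi_abs p = k}. inner_phi \<sigma> b f (phi_p \<sigma> b p) * Hinf \<sigma> b \<alpha> X p \<omega>)) at_top))"
proof -
 have main: "((%t. nn_integral (Pm \<mu>) (%w. ennreal (\<bar>exp (- (\<alpha> - real k * b) * t) * (LINT x|(X t w). f x)
        - (\<Sum>p\<in>{p::'d => nat. mi_abs p = k}. inner_phi \<sigma> b f (phi_p \<sigma> b p) * Hinf \<sigma> b \<alpha> X p w)\<bar>
        powr (1 + \<gamma>)))) \<longlongrightarrow> 0) at_top
   & (twice_diff_P f -->
     (AE w in Pm \<mu>. ((%t. exp (- (\<alpha> - real k * b) * t) * (LINT x|(X t w). f x))
       \<longlongrightarrow> (\<Sum>p\<in>{p::'d => nat. mi_abs p = k}. inner_phi \<sigma> b f (phi_p \<sigma> b p) * Hinf \<sigma> b \<alpha> X p w)) at_top))"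
  if \<gamma>: "0 < \<gamma>" "\<gamma> < \<beta>" for \<gamma>
 proof -
  interpret br: branching \<sigma> b \<alpha> \<rho> Lev by unfold_locales fact+
  \<comment> \<open>The hypothesis rearranged: \<alpha>/(\<alpha> - kb) < 1+\<beta>, which is the
    room for p.\<close>
  have c1: "\<alpha> < (1 + \<beta>) * (\<alpha> - real k * b)" using cond \<beta> by (simp add: field_simps)
  then have c2: "0 < \<alpha> - real k * b" using \<alpha> \<beta> by (smt (verit) zero_less_mult_iff)
  \<comment> \<open>p has to exceed \<alpha>/(\<alpha> - kb) for the gap and to be at least
    1+\<gamma> for the required norm; p and q are then successive midpoints towards
    1+\<beta>.\<close>
  define p0 where "p0 = max (1 + \<gamma>) (\<alpha> / (\<alpha> - real k * b))"
  have p0: "p0 < 1 + \<beta>" "1 + \<gamma> <= p0" "\<alpha> / (\<alpha> - real k * b) <= p0"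
   unfolding p0_def using c1 c2 \<gamma> by (auto simp: field_simps)
  define p where "p = (p0 + (1 + \<beta>)) / 2"
  define q where "q = (p + (1 + \<beta>)) / 2"
  have pq: "p0 < p" "p < q" "q < 1 + \<beta>" unfolding q_def p_def using p0(1) by simp_all
  have p1: "1 <= p" "1 + \<gamma> <= p" "1 < q" "q <= 2" using pq p0 \<gamma> \<beta> by auto
  have "\<alpha> / (\<alpha> - real k * b) < p" using pq p0 by linarith
  then have gap: "0 < \<alpha> - real k * b - \<alpha> / p" using c2 p1 by (simp add: field_simps)
  have mom: "(nn_integral Lev (%y. ennreal (y powr q) * indicator {1<..} y)) < \<infinity>"
   by (rule tv_wint_imp_moment[OF Pi_sets br.Lev_gt1_finite _ pq(3) \<beta>(1) \<delta> stable]) (use p1 in simp)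
  obtain A where A: "A >= 0" "!!z. 0 <= z ==> br.\<psi>0 z <= A * (z powr q + z\<^sup>2)"
   by (rule br.\<psi>0_upper[OF _ p1(4) mom]) (use p1 in auto)
  \<comment> \<open>Grey's condition supplies the constants M with psi(M) >= 0 that bound the
    monotone iteration.\<close>
  have big: "\<exists>z'. \<forall>z>z'. 0 <= psi \<alpha> \<rho> Lev z" using Grey by (auto intro: less_imp_le)
  obtain K where K: "compact K" "emeasure \<mu> (- K) = 0" using \<mu>(2) by blast
  obtain R where R: "!!x. x \<in> K ==> norm x <= R" using compact_imp_bounded[OF K(1)] unfolding bounded_iff by blast
  have \<mu>s: "sets \<mu> = sets borel" and \<mu>f: "finite_measure \<mu>" using \<mu>(1) by (auto simp: fin_borel_measure_def)
  have "- K \<in> sets \<mu>" unfolding \<mu>s using compact_imp_closed[OF K(1)] by (simp add: borel_comp)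
  then have inK: "AE x in \<mu>. x \<in> K" using K(2) by (intro AE_I[of _ _ "- K"]) auto
  have mm: "(nn_integral \<mu> (%x. ennreal ((1 + norm x) ^ n))) < \<infinity>" for n
  proof -
   have "(nn_integral \<mu> (%x. ennreal ((1 + norm x) ^ n))) <= (nn_integral \<mu> (%x. ennreal ((1 + R) ^ n)))"
    by (rule nn_integral_mono_AE, use inK in eventually_elim) (auto intro!: ennreal_leI power_mono R)
   also have "... < \<infinity>" using finite_measure.emeasure_finite[OF \<mu>f, of "space \<mu>"] by (auto simp: ennreal_mult_less_top less_top)
   finally show ?thesis .
  qed
  have orth: "inner_phi \<sigma> b f (phi_p \<sigma> b i) = 0" if i: "mi_abs i < k" for i
  proof (rule ccontr)
   assume "inner_phi \<sigma> b f (phi_p \<sigma> b i) ~= 0"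
   then have "kappa \<sigma> b f <= enat (mi_abs i)" unfolding kappa_def by (intro Inf_lower) auto
   then show False using i kf by simp
  qed
  interpret super_mode \<sigma> b \<alpha> \<rho> Lev q A Pm X \<mu> f k p
   by unfold_locales (use p1 pq A big X \<mu>(1) mm f orth gap in auto)
  show ?thesis using Lp_convergence[of "1 + \<gamma>"] AE_convergence p1(2) \<gamma> by auto
 qed
 \<comment> \<open>The almost sure statement does not mention \<gamma>; it is read off from
   \<open>main\<close> at \<gamma> = \<beta>/2.\<close>
 have "0 < \<beta> / 2" "\<beta> / 2 < \<beta>" using \<beta> by auto
 then show ?thesis using main by blast
qed

end
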